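(* Let $\alpha,\beta\in\mathbb{R}$ with $\alpha\beta\neq0$, and let $b=\tfrac53$. There is a constant $C>0$, independent of $N$, such that for every sufficiently large $N\in\mathbb{N}^+$ (with $N>10$) there exists $u_0\in\mathcal{C}^\infty(\mathbb{R})$ such that the following hold: (i) $\|u_0\|_{B^1_{\infty,1}}\le CN^{-\frac1{10}}$; (ii) there exists a unique solution $u\in\mathcal{C}([0,T];\mathcal{C}^\infty(\mathbb{R}))$ to the Cauchy problem $$u_t+uu_x+F(u)=0,\qquad u|_{t=0}=u_0,$$ with a time $T\le 2N^{-\frac12}$; (iii) there exists a time $t_0\in[0,T]$ such that $\|u(t_0)\|_{B^1_{\infty,1}}\ge\ln N$.
   Context: All functions are real-valued on $\mathbb{R}$ (in $x$). $B^s_{p,r}=B^s_{p,r}(\mathbb{R})$ denotes the nonhomogeneous Besov space. $P(D)=(1-\alpha^2\partial_{xx})^{-1}(1-\beta^2\partial_{xx})^{-1}$ (convolution operator with Fourier symbol $(1+\alpha^2\xi^2)^{-1}(1+\beta^2\xi^2)^{-1}$), and, for general $b$, $F(u)=F_1(u)+F_2(u)+F_3(u)+F_4(u)$ with $$F_1(u)=\tfrac b2\partial_xP(D)(u^2),\qquad F_2(u)=\tfrac{3-b}{2}(\alpha^2+\beta^2)\partial_xP(D)(u_x^2),$$ $$F_3(u)=\tfrac{5-3b}{2}\alpha^2\beta^2\partial_xP(D)(u_{xx}^2),\qquad F_4(u)=\tfrac{b-5}{2}\alpha^2\beta^2\partial_x^3P(D)(u_x^2).$$ Here $b=\tfrac53$,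 so $F_3\equiv0$.
   Formalization: Since P(D) is undefined on all of C^∞(R) (e.g. for u = exp(x^2)), a solution in C([0,T];C^∞(R)) is also required to have u and u_x bounded uniformly on [0,T]; existence is shown with this bound and uniqueness holds among such solutions. *)

theory Defs
  imports "HOL-Analysis.Analysis"
begin

definition smooth :: "(real \<Rightarrow> real) \<Rightarrow> bool" where
  "smooth f \<longleftrightarrow> (\<forall>k x. ((deriv ^^ k) f) field_differentiable (at x))"

section \<open>Fourier multipliers\<close>

definition inv_fourier :: "(real \<Rightarrow> real) \<Rightarrow> real \<Rightarrow> complex" where
  "inv_fourier m x = (1 / (2 * pi)) * (LINT \<xi>|lborel. cis (x * \<xi>) * complex_of_real (m \<xi>))"

text \<open>
  The operator \<open>m(D)\<close> with symbol \<open>m\<close>, as convolution with the inverse Fourier transform of \<open>m\<close>.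
  It is only used for even, integrable, real symbols, whose inverse Fourier transform is a
  real-valued function; the real part merely changes the type.
\<close>
definition multiplier :: "(real \<Rightarrow> real) \<Rightarrow> (real \<Rightarrow> real) \<Rightarrow> real \<Rightarrow> real" where
  "multiplier m f x = (LINT y|lborel. Re (inv_fourier m (x - y)) * f y)"

section \<open>Besov norms\<close>

text \<open>
  A dyadic partition of unity \<open>(\<chi>, \<phi>)\<close> on the frequency line. The homogeneous identity
  \<open>\<Sum>\<^sub>j\<^sub>\<in>\<^sub>\<int> \<phi> (\<xi> / 2\<^sup>j) = 1\<close> for \<open>\<xi> \<noteq> 0\<close> and the disjointness of the supports of non-adjacent
  pieces follow from these conditions.
\<close>
definition dyadic_partition :: "(real \<Rightarrow> real) \<Rightarrow> (real \<Rightarrow> real) \<Rightarrow> bool" where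
  "dyadic_partition chi phi \<longleftrightarrow>
     smooth chi \<and> smooth phi \<and>
     (\<forall>\<xi>. chi (- \<xi>) = chi \<xi>) \<and> (\<forall>\<xi>. phi (- \<xi>) = phi \<xi>) \<and>
     (\<forall>\<xi>. chi \<xi> \<in> {0..1}) \<and> (\<forall>\<xi>. phi \<xi> \<in> {0..1}) \<and>
     (\<forall>\<xi>. chi \<xi> \<noteq> 0 \<longrightarrow> \<bar>\<xi>\<bar> \<le> 4 / 3) \<and>
     (\<forall>\<xi>. phi \<xi> \<noteq> 0 \<longrightarrow> 3 / 4 \<le> \<bar>\<xi>\<bar> \<and> \<bar>\<xi>\<bar> \<le> 8 / 3) \<and>
     (\<forall>\<xi>. (\<lambda>j. phi (\<xi> / 2 ^ j)) sums (1 - chi \<xi>))"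

text \<open>Used for continuous functions only, where it agrees with the essential supremum.\<close>
definition sup_norm :: "(real \<Rightarrow> real) \<Rightarrow> ennreal" where
  "sup_norm f = (SUP x. ennreal \<bar>f x\<bar>)"

definition slowly_increasing :: "(real \<Rightarrow> real) \<Rightarrow> bool" where
  "slowly_increasing f \<longleftrightarrow>
     f \<in> borel_measurable borel \<and> (\<exists>C m. \<forall>x. \<bar>f x\<bar> \<le> C * (1 + \<bar>x\<bar>) ^ m)"

text \<open>
  The norm of the nonhomogeneous space \<open>B\<^sup>s\<^bsub>\<infinity>,1\<^esub>\<close> for \<open>s > 0\<close>. The block of index \<open>-1\<close> is \<open>chi(D) f\<close>,
  the block of index \<open>j \<ge> 0\<close> is \<open>phi(2\<^bsup>-j\<^esup> D) f\<close>. The convolution integrals converge for slowly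
  increasing \<open>f\<close>; all other functions get norm \<open>\<infinity>\<close>, in accordance with the fact that for \<open>s > 0\<close>
  the elements of \<open>B\<^sup>s\<^bsub>\<infinity>,1\<^esub>\<close> are bounded.
\<close>
definition besov_norm ::
  "(real \<Rightarrow> real) \<Rightarrow> (real \<Rightarrow> real) \<Rightarrow> real \<Rightarrow> (real \<Rightarrow> real) \<Rightarrow> ennreal" where
  "besov_norm chi phi s f =
     (if slowly_increasing f then
        ennreal (2 powr (- s)) * sup_norm (multiplier chi f)
        + (\<Sum>j. ennreal (2 powr (real j * s)) * sup_norm (multiplier (\<lambda>\<xi>. phi (\<xi> / 2 ^ j)) f))
      else \<infinity>)"

section \<open>The Cauchy problem\<close>

definition PD :: "real \<Rightarrow> real \<Rightarrow> (real \<Rightarrow> real) \<Rightarrow> real \<Rightarrow> real" where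
  "PD \<alpha> \<beta> = multiplier (\<lambda>\<xi>. 1 / ((1 + \<alpha>\<^sup>2 * \<xi>\<^sup>2) * (1 + \<beta>\<^sup>2 * \<xi>\<^sup>2)))"

definition F1 :: "real \<Rightarrow> real \<Rightarrow> real \<Rightarrow> (real \<Rightarrow> real) \<Rightarrow> real \<Rightarrow> real" where
  "F1 \<alpha> \<beta> b u x = b / 2 * deriv (PD \<alpha> \<beta> (\<lambda>y. (u y)\<^sup>2)) x"

definition F2 :: "real \<Rightarrow> real \<Rightarrow> real \<Rightarrow> (real \<Rightarrow> real) \<Rightarrow> real \<Rightarrow> real" where
  "F2 \<alpha> \<beta> b u x = (3 - b) / 2 * (\<alpha>\<^sup>2 + \<beta>\<^sup>2) * deriv (PD \<alpha> \<beta> (\<lambda>y. (deriv u y)\<^sup>2)) x"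

definition F3 :: "real \<Rightarrow> real \<Rightarrow> real \<Rightarrow> (real \<Rightarrow> real) \<Rightarrow> real \<Rightarrow> real" where
  "F3 \<alpha> \<beta> b u x =
     (5 - 3 * b) / 2 * \<alpha>\<^sup>2 * \<beta>\<^sup>2 * deriv (PD \<alpha> \<beta> (\<lambda>y. ((deriv ^^ 2) u y)\<^sup>2)) x"

definition F4 :: "real \<Rightarrow> real \<Rightarrow> real \<Rightarrow> (real \<Rightarrow> real) \<Rightarrow> real \<Rightarrow> real" where
  "F4 \<alpha> \<beta> b u x =
     (b - 5) / 2 * \<alpha>\<^sup>2 * \<beta>\<^sup>2 * (deriv ^^ 3) (PD \<alpha> \<beta> (\<lambda>y. (deriv u y)\<^sup>2)) x"

definition F :: "real \<Rightarrow> real \<Rightarrow> real \<Rightarrow> (real \<Rightarrow> real) \<Rightarrow> real \<Rightarrow> real" where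
  "F \<alpha> \<beta> b u x = F1 \<alpha> \<beta> b u x + F2 \<alpha> \<beta> b u x + F3 \<alpha> \<beta> b u x + F4 \<alpha> \<beta> b u x"

text \<open>
  Continuity of \<open>u : [0,T] \<rightarrow> C\<^sup>\<infinity>(\<real>)\<close> for the usual Frechet topology of \<open>C\<^sup>\<infinity>(\<real>)\<close>: uniform
  convergence of every derivative on compact sets. The function \<open>u\<close> takes the time first.
\<close>
definition continuous_into_smooth :: "real \<Rightarrow> (real \<Rightarrow> real \<Rightarrow> real) \<Rightarrow> bool" where
  "continuous_into_smooth T u \<longleftrightarrow>
     (\<forall>t\<in>{0..T}. smooth (u t)) \<and>
     (\<forall>t\<in>{0..T}. \<forall>k R.
        uniform_limit {-R..R} (\<lambda>s. (deriv ^^ k) (u s)) ((deriv ^^ k) (u t)) (at t within {0..T}))"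

text \<open>
  The topology of \<open>C\<^sup>\<infinity>(\<real>)\<close> does not restrict the growth at infinity, and \<open>P(D)\<close> makes no sense on
  all of \<open>C\<^sup>\<infinity>(\<real>)\<close>. Solutions are therefore required to be bounded together with \<open>u\<^sub>x\<close> (as is
  every function in \<open>B\<^sup>1\<^bsub>\<infinity>,1\<^esub>\<close>), uniformly in time.
\<close>
definition bounded_with_deriv :: "real \<Rightarrow> (real \<Rightarrow> real \<Rightarrow> real) \<Rightarrow> bool" where
  "bounded_with_deriv T u \<longleftrightarrow> (\<exists>M. \<forall>t\<in>{0..T}. \<forall>x. \<bar>u t x\<bar> \<le> M \<and> \<bar>deriv (u t) x\<bar> \<le> M)"

definition solution ::
  "real \<Rightarrow> real \<Rightarrow> real \<Rightarrow> (real \<Rightarrow> real) \<Rightarrow> real \<Rightarrow> (real \<Rightarrow> real \<Rightarrow> real) \<Rightarrow> bool" where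
  "solution \<alpha> \<beta> b u0 T u \<longleftrightarrow>
     continuous_into_smooth T u \<and> bounded_with_deriv T u \<and>
     u 0 = u0 \<and>
     (\<forall>t\<in>{0..T}. \<forall>x. \<exists>ut.
        ((\<lambda>s. u s x) has_real_derivative ut) (at t within {0..T}) \<and>
        ut + u t x * deriv (u t) x + F \<alpha> \<beta> b (u t) x = 0)"

end

theory Submission
  imports Defs "HOL-Probability.Probability"
begin

text \<open>
  Along the flow \<open>q\<close> of \<open>u\<close>, the triple \<open>U = u \<circ> q\<close>, \<open>W = u\<^sub>x \<circ> q\<close>, \<open>R = q\<^sub>x\<close> solves an ordinary
  differential equation in a space of bounded continuous functions, because the kernels of \<open>F\<close>
  have at most a jump at \<open>0\<close>. Hence the existence time depends only on the bounds of \<open>u\<^sub>0\<close> and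
  \<open>u\<^sub>0'\<close>, and the equation \<open>W\<^sub>t = 2/3 W\<^sup>2 - G\<close> with \<open>G\<close> smoother than \<open>W\<close> propagates smoothness.

  Take \<open>u\<^sub>0 = A 4\<^sup>-\<^sup>n sin (4\<^sup>n x) \<sigma> (2\<^sup>n x)\<close> with a smoothed step \<open>\<sigma>\<close>. It lives at frequency \<open>4\<^sup>n\<close>, so
  its norm in \<open>B\<^sup>1\<^bsub>\<infinity>,1\<^esub>\<close> is \<open>O(A)\<close>. But \<open>(u\<^sub>0')\<^sup>2\<close> has the mean \<open>A\<^sup>2 \<sigma>\<^sup>2 / 2\<close>, which jumps at \<open>0\<close>, and to
  first order in \<open>t\<close> this produces a corner \<open>5/6 t A\<^sup>2 max 0 x\<close> in \<open>u(t)\<close>. A corner contributes the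
  same amount to every dyadic block, so \<open>L\<close> blocks give \<open>c L t A\<^sup>2\<close>; the errors are \<open>O(t\<^sup>2)\<close> per block
  or summable in the block index. First \<open>t\<close>, then \<open>L\<close>, then \<open>n\<close> is chosen.
\<close>

section \<open>Fourier inversion\<close>

text \<open>At b = 5/3 the force contains only u^2 and u_x^2, and the part of its x-derivative that
  is local in u_x is - 5/3 u_x^2. Along the flow this leaves W_t = 2/3 W^2 - G and (W R)_t = R (5/3
  W^2 - G). The second identity is the source of the corner: W R is the z-derivative of U, so after
  a short time t it has gained 5/3 t (u_0')^2, and cos^2 has mean 1/2, whence 5/6. The difficulty is
  the order of the choices. The time is fixed before the frequency 4^n, although u_0'' has size A
  4^n. So every constant in the existence time and in the expansion of u(t) must come from bounds of
  u_0 and u_0' alone; u_0'' may enter only uniqueness and the finiteness of the norm. This is why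
  the expansion is carried out in Lagrangian variables: transporting the oscillation in Eulerian
  ones would cost a second derivative. The blocks of index j >= 0 annihilate affine functions. The
  value and the mean slope of u(t) at the corner can therefore be discarded, and only deviations
  from them have to be estimated.\<close>

lemma gaussian_fourier:
  fixes n t :: real
  assumes n: "n > 0"
  shows "integrable lborel (\<lambda>\<xi>. exp (- (\<xi> / n)\<^sup>2 / 2))"
    and "(LINT \<xi>|lborel. cis (t * \<xi>) * complex_of_real (exp (- (\<xi> / n)\<^sup>2 / 2))) =
      complex_of_real (n * sqrt (2 * pi) * exp (- (n * t)\<^sup>2 / 2))"
proof -
  have d: "std_normal_density x = exp (- x\<^sup>2 / 2) / sqrt (2 * pi)" for x
    by (simp add: std_normal_density_def)
  have i0: "integrable lborel (\<lambda>x::real. exp (- x\<^sup>2 / 2))"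
  proof -
    have "integrable lborel (\<lambda>x. sqrt (2 * pi) * std_normal_density x)"
      by (intro integrable_mult_right) (simp add: integrable_normal_density)
    thus ?thesis by (simp add: d)
  qed
  have "integrable lborel (\<lambda>x::real. exp (- (0 + (1 / n) * x)\<^sup>2 / 2))"
    by (rule lborel_integrable_real_affine[OF i0]) (use n in simp)
  thus "integrable lborel (\<lambda>\<xi>. exp (- (\<xi> / n)\<^sup>2 / 2))" by simp
  have c: "(LINT s|lborel. std_normal_density s *\<^sub>R cis (u * s)) = exp (- u\<^sup>2 / 2)" for u
  proof -
    have "char std_normal_distribution u = (LINT s|lborel. std_normal_density s *\<^sub>R cis (u * s))"
      unfolding char_def
      by (subst integral_density) (auto simp: cis_conv_exp intro!: Bochner_Integration.integral_cong)
    thus ?thesis by (simp add: char_std_normal_distribution)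
  qed
  have "(LINT \<xi>|lborel. cis (t * \<xi>) * complex_of_real (exp (- (\<xi> / n)\<^sup>2 / 2)))
    = n *\<^sub>R (LINT s|lborel. cis (t * (0 + n * s)) * complex_of_real (exp (- ((0 + n * s) / n)\<^sup>2 / 2)))"
    using n by (subst lborel_integral_real_affine[of n _ 0]) auto
  also have "(LINT s|lborel. cis (t * (0 + n * s)) * complex_of_real (exp (- ((0 + n * s) / n)\<^sup>2 / 2)))
    = (LINT s|lborel. complex_of_real (sqrt (2 * pi)) * (std_normal_density s *\<^sub>R cis ((n * t) * s)))"
    using n by (intro Bochner_Integration.integral_cong) (auto simp: d scaleR_conv_of_real mult_ac)
  also have "\<dots> = complex_of_real (sqrt (2 * pi)) * exp (- (n * t)\<^sup>2 / 2)"
    by (subst integral_mult_right_zero, subst c, rule refl)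
  finally show "(LINT \<xi>|lborel. cis (t * \<xi>) * complex_of_real (exp (- (\<xi> / n)\<^sup>2 / 2))) =
      complex_of_real (n * sqrt (2 * pi) * exp (- (n * t)\<^sup>2 / 2))"
    by (simp add: scaleR_conv_of_real mult_ac)
qed

theorem fourier_inversion:
  fixes f :: "real \<Rightarrow> real" and g :: "real \<Rightarrow> complex"
  assumes fi: "integrable lborel f" and fc: "continuous_on UNIV f" and fb: "\<And>x. \<bar>f x\<bar> \<le> B"
    and g: "\<And>\<xi>. g \<xi> = (LINT y|lborel. cis (- (y * \<xi>)) * complex_of_real (f y))"
    and gi: "integrable lborel g"
  shows "(LINT \<xi>|lborel. cis (x * \<xi>) * g \<xi>) = complex_of_real (2 * pi * f x)"
proof -
  define E where "E n \<xi> = exp (- (\<xi> / n)\<^sup>2 / 2)" for n \<xi> :: real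
  have [measurable]: "f \<in> borel_measurable borel" "g \<in> borel_measurable borel"
    using fi gi by (auto dest: borel_measurable_integrable)
  have [measurable]: "E n \<in> borel_measurable borel" for n
    unfolding E_def by measurable
  have [measurable]: "cis \<in> borel_measurable borel"
    by (intro borel_measurable_continuous_onI continuous_intros)
  have Ei: "integrable lborel (E n)" if "n > 0" for n
    using gaussian_fourier(1)[OF that] unfolding E_def .
  define S where "S n = (LINT \<xi>|lborel. cis (x * \<xi>) * g \<xi> * complex_of_real (E n \<xi>))" for n
  \<comment> \<open>Fubini, the transform of the Gaussian and the substitution y = x - s /
    n.\<close>
  have S_eq: "S n = complex_of_real (sqrt (2 * pi) * (LINT s|lborel. f (x - s / n) * exp (- s\<^sup>2 / 2)))"
    if n: "n > 0" for n
  proof -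
    let ?h = "\<lambda>y \<xi>. cis ((x - y) * \<xi>) * complex_of_real (f y * E n \<xi>)"
    have "S n = (LINT \<xi>|lborel. (LINT y|lborel. ?h y \<xi>))"
      unfolding S_def
    proof (intro Bochner_Integration.integral_cong refl)
      fix \<xi>
      have "(LINT y|lborel. ?h y \<xi>) = (LINT y|lborel. (cis (x * \<xi>) * complex_of_real (E n \<xi>)) *
          (cis (- (y * \<xi>)) * complex_of_real (f y)))"
        by (intro Bochner_Integration.integral_cong refl)
          (simp add: left_diff_distrib cis_divide[symmetric] divide_inverse cis_inverse)
      thus "cis (x * \<xi>) * g \<xi> * complex_of_real (E n \<xi>) = (LINT y|lborel. ?h y \<xi>)"
        by (simp add: g)
    qed
    also have "\<dots> = (LINT y|lborel. (LINT \<xi>|lborel. ?h y \<xi>))"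
    proof (rule lborel_pair.Fubini_integral)
      show "integrable (lborel \<Otimes>\<^sub>M lborel) (\<lambda>(y, \<xi>). ?h y \<xi>)"
      proof (rule lborel_pair.Fubini_integrable)
        show "(\<lambda>(y, \<xi>). ?h y \<xi>) \<in> borel_measurable (lborel \<Otimes>\<^sub>M lborel)"
          by measurable
        have "integrable lborel (\<lambda>y. \<bar>f y\<bar> * (LINT \<xi>|lborel. \<bar>E n \<xi>\<bar>))"
          using fi by (intro integrable_mult_left) auto
        thus "integrable lborel (\<lambda>y. LINT \<xi>|lborel. norm (case (y, \<xi>) of (y, \<xi>) \<Rightarrow> ?h y \<xi>))"
          by (simp add: norm_mult abs_mult)
        have "integrable lborel (\<lambda>\<xi>. ?h y \<xi>)" for y
        proof (rule Bochner_Integration.integrable_bound)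
          show "integrable lborel (\<lambda>\<xi>. f y * E n \<xi>)" using Ei[OF n] by simp
        qed (auto simp: norm_mult)
        thus "AE y in lborel. integrable lborel (\<lambda>\<xi>. case (y, \<xi>) of (y, \<xi>) \<Rightarrow> ?h y \<xi>)"
          by simp
      qed
    qed
    also have "\<dots> = (LINT y|lborel. complex_of_real (n * sqrt (2 * pi) * (f y * exp (- (n * (x - y))\<^sup>2 / 2))))"
    proof (intro Bochner_Integration.integral_cong refl)
      fix y
      have "(LINT \<xi>|lborel. ?h y \<xi>) = (LINT \<xi>|lborel. complex_of_real (f y) *
         (cis ((x - y) * \<xi>) * complex_of_real (E n \<xi>)))"
        by (intro Bochner_Integration.integral_cong refl) simp
      also have "\<dots> = complex_of_real (f y) * complex_of_real (n * sqrt (2 * pi) * exp (- (n * (x - y))\<^sup>2 / 2))"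
        using gaussian_fourier(2)[OF n, of "x - y"] by (simp add: E_def)
      finally show "(LINT \<xi>|lborel. ?h y \<xi>) =
         complex_of_real (n * sqrt (2 * pi) * (f y * exp (- (n * (x - y))\<^sup>2 / 2)))" by simp
    qed
    also have "\<dots> = complex_of_real (n * sqrt (2 * pi) * (LINT y|lborel. f y * exp (- (n * (x - y))\<^sup>2 / 2)))"
      by (subst integral_complex_of_real, subst integral_mult_right_zero, rule refl)
    also have "(LINT y|lborel. f y * exp (- (n * (x - y))\<^sup>2 / 2)) =
       (1 / n) * (LINT s|lborel. f (x - s / n) * exp (- s\<^sup>2 / 2))"
      using n by (subst lborel_integral_real_affine[of "- 1 / n" _ x]) (auto simp: field_simps)
    finally show ?thesis using n by simp
  qed
  have l1: "(\<lambda>k. S (real (Suc k))) \<longlonglongrightarrow> (LINT \<xi>|lborel. cis (x * \<xi>) * g \<xi>)"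
    unfolding S_def
  proof (rule integral_dominated_convergence[where w="\<lambda>\<xi>. norm (g \<xi>)"])
    show "AE \<xi> in lborel. (\<lambda>k. cis (x * \<xi>) * g \<xi> * complex_of_real (E (real (Suc k)) \<xi>))
        \<longlonglongrightarrow> cis (x * \<xi>) * g \<xi>"
    proof (rule AE_I2)
      fix \<xi>
      have "(\<lambda>k. \<xi> / real (Suc k)) \<longlonglongrightarrow> 0" by real_asymp
      hence "(\<lambda>k. E (real (Suc k)) \<xi>) \<longlonglongrightarrow> exp (- 0\<^sup>2 / 2)"
        unfolding E_def by (intro tendsto_intros) auto
      hence "(\<lambda>k. cis (x * \<xi>) * g \<xi> * complex_of_real (E (real (Suc k)) \<xi>))
        \<longlonglongrightarrow> cis (x * \<xi>) * g \<xi> * complex_of_real (exp (- 0\<^sup>2 / 2))"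
        by (intro tendsto_intros)
      thus "(\<lambda>k. cis (x * \<xi>) * g \<xi> * complex_of_real (E (real (Suc k)) \<xi>)) \<longlonglongrightarrow> cis (x * \<xi>) * g \<xi>"
        by simp
    qed
    show "AE \<xi> in lborel. norm (cis (x * \<xi>) * g \<xi> * complex_of_real (E (real (Suc k)) \<xi>)) \<le> norm (g \<xi>)" for k
      by (auto simp: norm_mult E_def intro!: mult_left_le)
  qed (use gi in auto)
  have gn: "integrable lborel (\<lambda>s::real. exp (- s\<^sup>2 / 2))"
    using gaussian_fourier(1)[of 1] by simp
  have gv: "(LINT s|lborel. exp (- s\<^sup>2 / 2)) = sqrt (2 * pi)"
  proof -
    have "complex_of_real (LINT s|lborel. exp (- s\<^sup>2 / 2)) = complex_of_real (sqrt (2 * pi))"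
      using gaussian_fourier(2)[of 1 0] by (simp del: of_real_exp flip: of_real_exp)
    thus ?thesis using of_real_eq_iff by blast
  qed
  have "(\<lambda>k. LINT s|lborel. f (x - s / real (Suc k)) * exp (- s\<^sup>2 / 2)) \<longlonglongrightarrow>
     (LINT s|lborel. f x * exp (- s\<^sup>2 / 2))"
  proof (rule integral_dominated_convergence[where w="\<lambda>s. B * exp (- s\<^sup>2 / 2)"])
    show "AE s in lborel. (\<lambda>k. f (x - s / real (Suc k)) * exp (- s\<^sup>2 / 2)) \<longlonglongrightarrow> f x * exp (- s\<^sup>2 / 2)"
    proof (rule AE_I2)
      fix s
      have a: "(\<lambda>k. x - s / real (Suc k)) \<longlonglongrightarrow> x" by real_asymp
      have "(\<lambda>k. f (x - s / real (Suc k))) \<longlonglongrightarrow> f x"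
        using continuous_on_tendsto_compose[OF fc a] by simp
      thus "(\<lambda>k. f (x - s / real (Suc k)) * exp (- s\<^sup>2 / 2)) \<longlonglongrightarrow> f x * exp (- s\<^sup>2 / 2)"
        by (intro tendsto_intros)
    qed
    show "integrable lborel (\<lambda>s. B * exp (- s\<^sup>2 / 2))" using gn by simp
  qed (use fb in \<open>auto simp: abs_mult intro!: mult_right_mono\<close>)
  hence "(\<lambda>k. complex_of_real (sqrt (2 * pi) * (LINT s|lborel. f (x - s / real (Suc k)) * exp (- s\<^sup>2 / 2)))) \<longlonglongrightarrow>
     complex_of_real (sqrt (2 * pi) * (f x * sqrt (2 * pi)))"
    using gv by (intro tendsto_intros) simp
  hence "(\<lambda>k. S (real (Suc k))) \<longlonglongrightarrow> complex_of_real (sqrt (2 * pi) * (f x * sqrt (2 * pi)))"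
    by (subst S_eq) auto
  hence "(LINT \<xi>|lborel. cis (x * \<xi>) * g \<xi>) = complex_of_real (sqrt (2 * pi) * (f x * sqrt (2 * pi)))"
    by (rule LIMSEQ_unique[OF l1])
  also have "sqrt (2 * pi) * (f x * sqrt (2 * pi)) = 2 * pi * f x" by simp
  finally show ?thesis .
qed

section \<open>Resolvents of the Laplacian in Lagrangian coordinates\<close>

lemma abs_le_1_plus_square: "\<bar>y\<bar> \<le> 1 + (y :: real)\<^sup>2"
proof -
  have "0 \<le> (\<bar>y\<bar> - 1)\<^sup>2 + y\<^sup>2 + 1" by simp
  thus ?thesis by (simp add: power2_eq_square algebra_simps abs_mult_self_eq)
qed

lemma abs_square_le: "\<bar>x\<bar> \<le> M \<Longrightarrow> \<bar>x\<^sup>2\<bar> \<le> (M :: real)\<^sup>2"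
  by (metis abs_power2 power2_abs power_mono abs_ge_zero)

text \<open>Applied with m = 0 for the mass of the kernels and with m = 1 for the factor |z - y|
  that appears when \<open>R\<close> is varied.\<close>

lemma has_bochner_integral_power_exp_abs:
  fixes k :: real
  assumes k: "k > 0"
  shows "has_bochner_integral lborel (\<lambda>y. \<bar>y\<bar> ^ m * exp (- k * \<bar>y\<bar>)) (2 * fact m / k ^ Suc m)"
proof -
  let ?f = "\<lambda>x. x ^ m * exp (- x) * indicator {0 <..} x :: real"
  note f = has_bochner_integral_I0i_power_exp_m[of m]
  have "has_bochner_integral lborel (\<lambda>x. ?f (0 + (- 1) * x)) (fact m /\<^sub>R \<bar>- 1\<bar>)"
    using f by (subst lborel_has_bochner_integral_real_affine_iff[symmetric]) auto
  from has_bochner_integral_add[OF f this]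
  have "has_bochner_integral lborel (\<lambda>x. ?f x + ?f (0 + (- 1) * x)) (2 * fact m)" by simp
  hence "has_bochner_integral lborel (\<lambda>y::real. \<bar>y\<bar> ^ m * exp (- \<bar>y\<bar>)) (2 * fact m)"
    by (rule has_bochner_integral_cong_AE[THEN iffD1, rotated 3])
      (use AE_lborel_singleton[of 0] in \<open>auto simp: indicator_def\<close>)
  hence "has_bochner_integral lborel (\<lambda>y. \<bar>0 + k * y\<bar> ^ m * exp (- \<bar>0 + k * y\<bar>)) ((2 * fact m) /\<^sub>R \<bar>k\<bar>)"
    using k by (subst lborel_has_bochner_integral_real_affine_iff[symmetric]) auto
  hence "has_bochner_integral lborel (\<lambda>y. (1 / k ^ m) * (\<bar>0 + k * y\<bar> ^ m * exp (- \<bar>0 + k * y\<bar>)))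
     ((1 / k ^ m) * ((2 * fact m) /\<^sub>R \<bar>k\<bar>))"
    by (rule has_bochner_integral_mult_right)
  thus ?thesis using k by (simp add: abs_mult power_mult_distrib field_simps)
qed

lemma has_bochner_integral_power_exp_abs_diff:
  fixes k :: real
  assumes k: "k > 0"
  shows "has_bochner_integral lborel (\<lambda>y. \<bar>z - y\<bar> ^ m * exp (- k * \<bar>z - y\<bar>)) (2 * fact m / k ^ Suc m)"
  using has_bochner_integral_power_exp_abs[OF k, of m]
    lborel_has_bochner_integral_real_affine_iff[of "- 1" "\<lambda>y. \<bar>y\<bar> ^ m * exp (- k * \<bar>y\<bar>)" _ z] by simp

lemma ex_antiderivative:
  fixes f :: "real \<Rightarrow> real"
  assumes "continuous_on UNIV f"
  obtains Q where "\<And>x. (Q has_real_derivative f x) (at x)"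
proof -
  have "((\<lambda>u. LBINT y=0..u. f y) has_real_derivative f x) (at x)" for x
  proof -
    have "((\<lambda>u. LBINT y=0..u. f y) has_vector_derivative f x) (at x within {- \<bar>x\<bar> - 1..\<bar>x\<bar> + 1})"
      unfolding zero_ereal_def
      by (rule interval_integral_FTC2) (auto intro: continuous_on_subset[OF assms])
    moreover have "at x within {- \<bar>x\<bar> - 1..\<bar>x\<bar> + 1} = at x"
      by (rule at_within_interior) auto
    ultimately show ?thesis by (simp add: has_real_derivative_iff_has_vector_derivative)
  qed
  thus thesis by (rule that)
qed

text \<open>Only the moving end matters: near z each half-line integral is a fixed one ending or
  starting at z - 1, corrected by an integral over a bounded interval.\<close>

lemma half_line_integral_deriv:
  fixes f :: "real \<Rightarrow> real"
  assumes c: "continuous_on UNIV f"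
  shows "(\<And>m. set_integrable lborel {..m} f) \<Longrightarrow>
      ((\<lambda>z. LINT y:{..z}|lborel. f y) has_real_derivative f z) (at z)"
    and "(\<And>m. set_integrable lborel {m<..} f) \<Longrightarrow>
      ((\<lambda>z. LINT y:{z<..}|lborel. f y) has_real_derivative - f z) (at z)"
proof -
  have fin: "set_integrable lborel {a..b} f" for a b
    by (rule borel_integrable_atLeastAtMost') (rule continuous_on_subset[OF c], simp)
  have d: "((\<lambda>u. LBINT y=(z - 1)..u. f y) has_real_derivative f z) (at z)"
  proof -
    have "((\<lambda>u. LBINT y=(z - 1)..u. f y) has_vector_derivative f z) (at z within {z - 1..z + 1})"
      by (rule interval_integral_FTC2) (auto intro: continuous_on_subset[OF c])
    moreover have "at z within {z - 1..z + 1} = at z"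
      by (rule at_within_interior) auto
    ultimately show ?thesis by (simp add: has_real_derivative_iff_has_vector_derivative)
  qed
  have ev: "\<forall>\<^sub>F u in nhds z. u \<in> {z - 1<..}"
    by (intro eventually_nhds_in_open) auto
  have oc: "set_integrable lborel {a<..b} f" for a b
    by (rule set_integrable_subset[OF fin[of a b]]) auto
  {
    assume i: "\<And>m. set_integrable lborel {..m} f"
    have eq: "(LINT y:{..u}|lborel. f y) = (LINT y:{..z - 1}|lborel. f y) + (LBINT y=(z - 1)..u. f y)"
      if "u \<in> {z - 1<..}" for u
    proof -
      have "{..u} = {..z - 1} \<union> {z - 1<..u}" using that by auto
      hence "(LINT y:{..u}|lborel. f y) = (LINT y:{..z - 1}|lborel. f y) + (LINT y:{z - 1<..u}|lborel. f y)"
        using i oc by (simp only:) (intro set_integral_Un, auto)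
      thus ?thesis using that by (subst interval_integral_Ioc) auto
    qed
    have "((\<lambda>u. (LINT y:{..z - 1}|lborel. f y) + (LBINT y=(z - 1)..u. f y)) has_real_derivative 0 + f z) (at z)"
      by (intro DERIV_add d DERIV_const)
    thus "((\<lambda>z. LINT y:{..z}|lborel. f y) has_real_derivative f z) (at z)"
      by (subst DERIV_cong_ev[OF refl _ refl]) (use ev eq in \<open>auto elim!: eventually_mono\<close>)
  }
  {
    assume i: "\<And>m. set_integrable lborel {m<..} f"
    have eq: "(LINT y:{u<..}|lborel. f y) = (LINT y:{z - 1<..}|lborel. f y) - (LBINT y=(z - 1)..u. f y)"
      if "u \<in> {z - 1<..}" for u
    proof -
      have "{z - 1<..} = {z - 1<..u} \<union> {u<..}" using that by auto
      hence "(LINT y:{z - 1<..}|lborel. f y) = (LINT y:{z - 1<..u}|lborel. f y) + (LINT y:{u<..}|lborel. f y)"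
        using i oc by (simp only:) (intro set_integral_Un, auto)
      thus ?thesis using that by (subst interval_integral_Ioc) auto
    qed
    have "((\<lambda>u. (LINT y:{z - 1<..}|lborel. f y) - (LBINT y=(z - 1)..u. f y)) has_real_derivative 0 - f z) (at z)"
      by (intro DERIV_diff d DERIV_const)
    thus "((\<lambda>z. LINT y:{z<..}|lborel. f y) has_real_derivative - f z) (at z)"
      by (subst DERIV_cong_ev[OF refl _ refl]) (use ev eq in \<open>auto elim!: eventually_mono\<close>)
  }
qed

text \<open>\<open>R\<close> is the space derivative of the flow map. The two-sided bound makes the
  change of coordinate bi-Lipschitz, so exponential decay in x becomes decay in z at no less than
  half the rate.\<close>

definition admissible :: "(real \<Rightarrow> real) \<Rightarrow> bool" where
  "admissible R \<longleftrightarrow> continuous_on UNIV R \<and> (\<forall>x. 1 / 2 \<le> R x \<and> R x \<le> 2)"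

text \<open>
  With \<open>Q\<close> a primitive of \<open>R\<close>, the kernel is \<open>exp (- c \<bar>Q z - Q y\<bar>)\<close>. So \<open>resolvent c R f\<close> is
  \<open>(1 - c\<^sup>-\<^sup>2 \<partial>\<^sub>x\<^sub>x)\<^sup>-\<^sup>1\<close> applied to \<open>f\<close>, written in a coordinate \<open>z\<close> with \<open>x = Q z\<close>, and
  \<open>resolvent_deriv c R f\<close> is its \<open>x\<close>-derivative.
\<close>

definition exp_kernel :: "real \<Rightarrow> (real \<Rightarrow> real) \<Rightarrow> real \<Rightarrow> real \<Rightarrow> real" where
  "exp_kernel c R z y = exp (- c * integral {min y z..max y z} R)"

definition weighted_integral :: "(real \<Rightarrow> real) \<Rightarrow> real \<Rightarrow> (real \<Rightarrow> real) \<Rightarrow> (real \<Rightarrow> real) \<Rightarrow> real \<Rightarrow> real" where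
  "weighted_integral \<sigma> c R h z = (LINT y|lborel. \<sigma> y * (exp_kernel c R z y * h y))"

definition resolvent :: "real \<Rightarrow> (real \<Rightarrow> real) \<Rightarrow> (real \<Rightarrow> real) \<Rightarrow> real \<Rightarrow> real" where
  "resolvent c R f z = c / 2 * weighted_integral (\<lambda>_. 1) c R (\<lambda>y. f y * R y) z"

definition resolvent_deriv :: "real \<Rightarrow> (real \<Rightarrow> real) \<Rightarrow> (real \<Rightarrow> real) \<Rightarrow> real \<Rightarrow> real" where
  "resolvent_deriv c R f z = c\<^sup>2 / 2 * weighted_integral (\<lambda>y. sgn (y - z)) c R (\<lambda>y. f y * R y) z"

lemma admissible_1 [simp]: "admissible (\<lambda>_. 1)"
  by (simp add: admissible_def)

lemma admissible_continuous_on: "admissible R \<Longrightarrow> continuous_on S R"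
  unfolding admissible_def using continuous_on_subset by blast

lemma admissible_integral_bounds:
  assumes "admissible R" "a \<le> b"
  shows "(b - a) / 2 \<le> integral {a..b} R" "integral {a..b} R \<le> 2 * (b - a)" "R integrable_on {a..b}"
proof -
  show i: "R integrable_on {a..b}"
    using assms by (intro integrable_continuous_real admissible_continuous_on)
  have "integral {a..b} (\<lambda>_. 1 / 2) \<le> integral {a..b} R" "integral {a..b} R \<le> integral {a..b} (\<lambda>_. 2)"
    by (intro integral_le i; use assms in \<open>auto simp: admissible_def intro!: integrable_const_ivl\<close>)+
  thus "(b - a) / 2 \<le> integral {a..b} R" "integral {a..b} R \<le> 2 * (b - a)"
    using assms by auto
qed

lemma exp_kernel_eq:
  assumes R: "admissible R" and Q: "\<And>x. (Q has_real_derivative R x) (at x)"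
  shows "exp_kernel c R z y = exp (- c * \<bar>Q z - Q y\<bar>)"
proof -
  have *: "integral {a..b} R = Q b - Q a" if "a \<le> b" for a b
    using that Q by (intro integral_unique fundamental_theorem_of_calculus)
      (auto simp: has_real_derivative_iff_has_vector_derivative intro: has_vector_derivative_at_within)
  have "Q a \<le> Q b" if "a \<le> b" for a b
    using *[OF that] admissible_integral_bounds(1)[OF R that] that by simp
  thus ?thesis unfolding exp_kernel_def using *[of "min y z" "max y z"] by (cases "y \<le> z") (auto simp: min_def max_def)
qed

lemma exp_kernel_bounds:
  assumes "admissible R" "c > 0"
  shows "0 < exp_kernel c R z y" "exp_kernel c R z y \<le> exp (- (c / 2) * \<bar>z - y\<bar>)"
  using admissible_integral_bounds(1)[OF assms(1), of "min y z" "max y z"] assms(2)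
  by (auto simp: exp_kernel_def min_def max_def abs_if split: if_splits)

lemma exp_kernel_measurable [measurable]:
  assumes "admissible R" shows "exp_kernel c R z \<in> borel_measurable borel"
proof -
  obtain Q where Q: "\<And>x. (Q has_real_derivative R x) (at x)"
    using ex_antiderivative assms admissible_def by metis
  have "continuous_on UNIV Q" using Q by (meson DERIV_isCont continuous_at_imp_continuous_on)
  hence "continuous_on UNIV (\<lambda>y. exp (- c * \<bar>Q z - Q y\<bar>))" by (intro continuous_intros)
  thus ?thesis using exp_kernel_eq[OF assms Q] by (simp add: borel_measurable_continuous_onI)
qed

text \<open>Both exponents are at least c |z - y| / 2 and they differ by at most c d |z - y|. The
  decay absorbs the factor |z - y|, so the dependence on \<open>R\<close> is Lipschitz in the sup
  norm although primitives of \<open>R1\<close> and \<open>R2\<close> may drift apart without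
  bound.\<close>

lemma exp_kernel_diff:
  assumes R: "admissible R1" "admissible R2" and c: "c > 0" and d: "\<And>x. \<bar>R1 x - R2 x\<bar> \<le> d"
  shows "\<bar>exp_kernel c R1 z y - exp_kernel c R2 z y\<bar> \<le> c * d * (\<bar>z - y\<bar> * exp (- (c / 2) * \<bar>z - y\<bar>))"
proof -
  define a b where "a = min y z" and "b = max y z"
  have ab: "a \<le> b" "b - a = \<bar>z - y\<bar>" by (auto simp: a_def b_def)
  define I1 I2 where "I1 = integral {a..b} R1" and "I2 = integral {a..b} R2"
  have l: "\<bar>z - y\<bar> / 2 \<le> I1" "\<bar>z - y\<bar> / 2 \<le> I2"
    using admissible_integral_bounds(1)[OF _ ab(1)] R ab(2) by (auto simp: I1_def I2_def)
  have "I1 - I2 = integral {a..b} (\<lambda>x. R1 x - R2 x)"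
    unfolding I1_def I2_def using admissible_integral_bounds(3)[OF _ ab(1)] R by (simp add: Henstock_Kurzweil_Integration.integral_diff)
  also have "norm \<dots> \<le> d * (b - a)"
    by (rule integral_bound[OF ab(1) continuous_on_diff]) (use ab d R in \<open>auto intro!: admissible_continuous_on\<close>)
  finally have dI: "\<bar>I1 - I2\<bar> \<le> d * \<bar>z - y\<bar>" using ab by simp
  have e: "\<bar>exp (- s) - exp (- t)\<bar> \<le> exp (- m) * \<bar>s - t\<bar>" if "m \<le> s" "m \<le> t" for m s t :: real
  proof -
    have *: "exp (- s) - exp (- t) \<le> exp (- m) * (t - s)" "0 \<le> exp (- s) - exp (- t)" if "m \<le> s" "s \<le> t" for s t
    proof -
      have "1 + (s - t) \<le> exp (s - t)" by (rule exp_ge_add_one_self)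
      hence "1 - exp (s - t) \<le> t - s" by linarith
      hence "exp (- s) * (1 - exp (s - t)) \<le> exp (- s) * (t - s)" by (rule mult_left_mono) simp
      also have "\<dots> \<le> exp (- m) * (t - s)" using that by (intro mult_right_mono) auto
      also have "exp (- s) * (1 - exp (s - t)) = exp (- s) - exp (- t)"
        by (simp add: right_diff_distrib flip: exp_add)
      finally show "exp (- s) - exp (- t) \<le> exp (- m) * (t - s)" .
    qed (use that in auto)
    show ?thesis using *[of s t] *[of t s] that by (cases "s \<le> t") auto
  qed
  have "\<bar>exp (- (c * I1)) - exp (- (c * I2))\<bar> \<le> exp (- (c * (\<bar>z - y\<bar> / 2))) * \<bar>c * I1 - c * I2\<bar>"
    by (rule e) (use l c in \<open>auto intro!: mult_left_mono\<close>)
  also have "\<bar>c * I1 - c * I2\<bar> = c * \<bar>I1 - I2\<bar>" using c by (simp add: abs_mult flip: right_diff_distrib)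
  also have "\<dots> \<le> c * (d * \<bar>z - y\<bar>)" using dI c by (intro mult_left_mono) auto
  finally show ?thesis by (simp add: exp_kernel_def I1_def I2_def a_def b_def mult_ac)
qed

text \<open>The weight is 1 for the resolvent and a sign for its derivative, so both share the
  estimates. The constant is the mass 2 / (c / 2) of the majorant.\<close>

lemma weighted_integral_integrand:
  assumes R: "admissible R" and c: "c > 0" and h[measurable]: "h \<in> borel_measurable borel" and hB: "\<And>y. \<bar>h y\<bar> \<le> B"
    and s[measurable]: "\<sigma> \<in> borel_measurable borel" and sB: "\<And>y. \<bar>\<sigma> y\<bar> \<le> 1"
  shows "integrable lborel (\<lambda>y. \<sigma> y * (exp_kernel c R z y * h y))"
    and "\<bar>weighted_integral \<sigma> c R h z\<bar> \<le> 4 * B / c"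
proof -
  note [measurable] = exp_kernel_measurable[OF R]
  have hb: "has_bochner_integral lborel (\<lambda>y. B * exp (- (c / 2) * \<bar>z - y\<bar>)) (B * (2 / (c / 2)))"
    using has_bochner_integral_power_exp_abs_diff[of "c / 2" z 0] c
    by (intro has_bochner_integral_mult_right) auto
  have B0: "0 \<le> B" using hB[of 0] by linarith
  have le: "\<bar>\<sigma> y * (exp_kernel c R z y * h y)\<bar> \<le> B * exp (- (c / 2) * \<bar>z - y\<bar>)" for y
  proof -
    have "\<bar>\<sigma> y * (exp_kernel c R z y * h y)\<bar> = \<bar>\<sigma> y\<bar> * (exp_kernel c R z y * \<bar>h y\<bar>)"
      using exp_kernel_bounds(1)[OF R c, of z y] by (simp add: abs_mult)
    also have "\<dots> \<le> 1 * (exp (- (c / 2) * \<bar>z - y\<bar>) * B)"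
      using exp_kernel_bounds[OF R c, of z y] hB[of y] sB[of y] B0 by (intro mult_mono) (auto intro: less_imp_le)
    finally show ?thesis by (simp add: mult_ac)
  qed
  show i: "integrable lborel (\<lambda>y. \<sigma> y * (exp_kernel c R z y * h y))"
  proof (rule Bochner_Integration.integrable_bound[OF integrable.intros[OF hb]])
    show "AE y in lborel. norm (\<sigma> y * (exp_kernel c R z y * h y)) \<le> norm (B * exp (- (c / 2) * \<bar>z - y\<bar>))"
      using order_trans[OF le abs_ge_self] by (intro AE_I2) (simp only: real_norm_def)
  qed auto
  have "\<bar>weighted_integral \<sigma> c R h z\<bar> \<le> (LINT y|lborel. \<bar>\<sigma> y * (exp_kernel c R z y * h y)\<bar>)"
    unfolding weighted_integral_def by (rule integral_abs_bound)
  also have "\<dots> \<le> (LINT y|lborel. B * exp (- (c / 2) * \<bar>z - y\<bar>))"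
    by (intro integral_mono integrable_abs i le integrable.intros[OF hb])
  also have "\<dots> = 4 * B / c" using has_bochner_integral_integral_eq[OF hb] by simp
  finally show "\<bar>weighted_integral \<sigma> c R h z\<bar> \<le> 4 * B / c" .
qed

text \<open>First the kernel is changed with \<open>h1\<close> kept, which costs c d B times the
  first moment 2 / (c / 2)^2 of the majorant; then the function is changed.\<close>

lemma weighted_integral_diff:
  assumes R: "admissible R1" "admissible R2" and c: "c > 0" and d: "\<And>x. \<bar>R1 x - R2 x\<bar> \<le> d"
    and h[measurable]: "h1 \<in> borel_measurable borel" "h2 \<in> borel_measurable borel"
    and hB: "\<And>y. \<bar>h1 y\<bar> \<le> B" and hd: "\<And>y. \<bar>h1 y - h2 y\<bar> \<le> e"
    and s[measurable]: "\<sigma> \<in> borel_measurable borel" and sB: "\<And>y. \<bar>\<sigma> y\<bar> \<le> 1"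
  shows "\<bar>weighted_integral \<sigma> c R1 h1 z - weighted_integral \<sigma> c R2 h2 z\<bar> \<le> 4 * e / c + 8 * B * d / c"
proof -
  note [measurable] = exp_kernel_measurable[OF R(1)] exp_kernel_measurable[OF R(2)]
  have h2B: "\<bar>h2 y\<bar> \<le> B + e" for y using hB[of y] hd[of y] by linarith
  have B0: "0 \<le> B" using hB[of 0] by linarith
  have d0: "0 \<le> d" using d[of 0] by linarith
  note i1 = weighted_integral_integrand(1)[OF R(1) c h(1) hB s sB, of z]
  note i2 = weighted_integral_integrand(1)[OF R(2) c h(2) h2B s sB, of z]
  note i12 = weighted_integral_integrand(1)[OF R(2) c h(1) hB s sB, of z]
  have "\<bar>weighted_integral \<sigma> c R1 h1 z - weighted_integral \<sigma> c R2 h1 z\<bar> \<le> 8 * B * d / c"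
  proof -
    have hb: "has_bochner_integral lborel (\<lambda>y. c * d * B * (\<bar>z - y\<bar> ^ 1 * exp (- (c / 2) * \<bar>z - y\<bar>)))
       (c * d * B * (2 * fact 1 / (c / 2) ^ Suc 1))"
      using c by (intro has_bochner_integral_mult_right has_bochner_integral_power_exp_abs_diff) auto
    have le: "\<bar>\<sigma> y * (exp_kernel c R1 z y * h1 y) - \<sigma> y * (exp_kernel c R2 z y * h1 y)\<bar>
        \<le> c * d * B * (\<bar>z - y\<bar> ^ 1 * exp (- (c / 2) * \<bar>z - y\<bar>))" for y
    proof -
      have "\<bar>\<sigma> y * (exp_kernel c R1 z y * h1 y) - \<sigma> y * (exp_kernel c R2 z y * h1 y)\<bar> =
         \<bar>\<sigma> y\<bar> * (\<bar>exp_kernel c R1 z y - exp_kernel c R2 z y\<bar> * \<bar>h1 y\<bar>)"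
        by (simp add: algebra_simps flip: abs_mult)
      also have "\<dots> \<le> 1 * ((c * d * (\<bar>z - y\<bar> * exp (- (c / 2) * \<bar>z - y\<bar>))) * B)"
        using exp_kernel_diff[OF R c d, of z y] hB[of y] sB[of y] c d0 by (intro mult_mono) auto
      finally show ?thesis by (simp add: mult_ac)
    qed
    have "\<bar>weighted_integral \<sigma> c R1 h1 z - weighted_integral \<sigma> c R2 h1 z\<bar> =
       \<bar>LINT y|lborel. \<sigma> y * (exp_kernel c R1 z y * h1 y) - \<sigma> y * (exp_kernel c R2 z y * h1 y)\<bar>"
      unfolding weighted_integral_def using i1 i12 by simp
    also have "\<dots> \<le> (LINT y|lborel. \<bar>\<sigma> y * (exp_kernel c R1 z y * h1 y) - \<sigma> y * (exp_kernel c R2 z y * h1 y)\<bar>)"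
      by (rule integral_abs_bound)
    also have "\<dots> \<le> (LINT y|lborel. c * d * B * (\<bar>z - y\<bar> ^ 1 * exp (- (c / 2) * \<bar>z - y\<bar>)))"
      using i1 i12 integrable.intros[OF hb]
      by (intro integral_mono le integrable_abs Bochner_Integration.integrable_diff) auto
    also have "\<dots> = 8 * B * d / c"
      using c by (subst has_bochner_integral_integral_eq[OF hb]) (simp add: field_simps)
    finally show ?thesis .
  qed
  moreover have "\<bar>weighted_integral \<sigma> c R2 h1 z - weighted_integral \<sigma> c R2 h2 z\<bar> \<le> 4 * e / c"
  proof -
    have "weighted_integral \<sigma> c R2 h1 z - weighted_integral \<sigma> c R2 h2 z = weighted_integral \<sigma> c R2 (\<lambda>y. h1 y - h2 y) z"
      unfolding weighted_integral_def using i12 i2 by (simp add: right_diff_distrib)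
    thus ?thesis using weighted_integral_integrand(2)[where h="\<lambda>y. h1 y - h2 y", OF R(2) c _ hd s sB, of z] by simp
  qed
  ultimately show ?thesis by linarith
qed

text \<open>On each half-line the absolute value in the kernel disappears and the exponential
  factors into a function of z and one of y. The left and right parts \<open>P\<close> and
  \<open>N\<close> therefore solve scalar first-order equations, which needs no more than continuity
  of \<open>R\<close> and \<open>f\<close>.\<close>

lemma resolvents_deriv:
  assumes R: "admissible R" and c: "c > 0" and f: "continuous_on UNIV f" and fB: "\<And>y. \<bar>f y\<bar> \<le> B"
  shows "(resolvent c R f has_real_derivative R z * resolvent_deriv c R f z) (at z)"
    and "(resolvent_deriv c R f has_real_derivative c\<^sup>2 * R z * (resolvent c R f z - f z)) (at z)"
proof -
  have Rc: "continuous_on UNIV R" and Rb: "\<And>x. 1 / 2 \<le> R x" "\<And>x. R x \<le> 2" using R by (auto simp: admissible_def)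
  obtain Q where Q: "\<And>x. (Q has_real_derivative R x) (at x)"
    using ex_antiderivative Rc by metis
  have Qc: "continuous_on UNIV Q" using Q by (meson DERIV_isCont continuous_at_imp_continuous_on)
  have Qm: "Q a \<le> Q b" if "a \<le> b" for a b
    by (rule DERIV_nonneg_imp_nondecreasing[OF that]) (use Q Rb in \<open>force intro: order_trans[of 0 "1/2"]\<close>)
  define h where "h y = f y * R y" for y
  have hc: "continuous_on UNIV h" unfolding h_def using f Rc by (intro continuous_intros)
  have [measurable]: "h \<in> borel_measurable borel" using hc by (rule borel_measurable_continuous_onI)
  have hB: "\<bar>h y\<bar> \<le> B * 2" for y
  proof -
    have "\<bar>R y\<bar> \<le> 2" using Rb[of y] by linarith
    thus ?thesis unfolding h_def abs_mult using fB[of y] by (intro mult_mono) auto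
  qed
  note kq = exp_kernel_eq[OF R Q]
  have ee: "exp p * (exp q * w) = exp (p + q) * w" for p q w :: real by (simp add: exp_add)
  have ki: "integrable lborel (\<lambda>y. exp_kernel c R z y * h y)" for z
    using weighted_integral_integrand(1)[where h=h and \<sigma>="\<lambda>_. 1" and z=z, OF R c _ hB] by simp
  have sk: "set_integrable lborel X (\<lambda>y. exp_kernel c R z y * h y)" if "X \<in> sets lborel" for X z
    using ki[of z] that unfolding set_integrable_def by (intro integrable_mult_indicator)
  define A B' where "A z = (LINT y:{..z}|lborel. exp (c * Q y) * h y)"
    and "B' z = (LINT y:{z<..}|lborel. exp (- c * Q y) * h y)" for z
  have iA: "set_integrable lborel {..m} (\<lambda>y. exp (c * Q y) * h y)" for m
  proof -
    have "set_integrable lborel {..m} (\<lambda>y. exp (c * Q m) * (exp_kernel c R m y * h y))"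
      by (intro set_integrable_mult_right) (auto intro: sk)
    thus ?thesis
      by (rule set_integrable_cong[THEN iffD1, rotated 3])
        (auto simp: kq Qm ee abs_of_nonneg right_diff_distrib)
  qed
  have iB: "set_integrable lborel {m<..} (\<lambda>y. exp (- c * Q y) * h y)" for m
  proof -
    have "set_integrable lborel {m<..} (\<lambda>y. exp (- c * Q m) * (exp_kernel c R m y * h y))"
      by (intro set_integrable_mult_right) (auto intro: sk)
    thus ?thesis
    proof (rule set_integrable_cong[THEN iffD1, rotated 3])
      fix y assume "y \<in> {m<..}"
      hence "Q m \<le> Q y" using Qm[of m y] by auto
      thus "exp (- c * Q m) * (exp_kernel c R m y * h y) = exp (- c * Q y) * h y"
        by (auto simp: kq ee abs_of_nonpos right_diff_distrib)
    qed auto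
  qed
  \<comment> \<open>All z-dependence of \<open>A\<close> and \<open>B'\<close> sits in the end point
    of the half-line; the exponential in z is multiplied back in \<open>P\<close> and
    \<open>N\<close>.\<close>
  have A': "(A has_real_derivative exp (c * Q z) * h z) (at z)" for z
    unfolding A_def by (rule half_line_integral_deriv) (intro iA continuous_intros Qc hc)+
  have B'': "(B' has_real_derivative - (exp (- c * Q z) * h z)) (at z)" for z
    unfolding B'_def by (rule half_line_integral_deriv) (intro iB continuous_intros Qc hc)+
  define P N where "P z = exp (- c * Q z) * A z" and "N z = exp (c * Q z) * B' z" for z
  have P': "(P has_real_derivative - c * R z * P z + h z) (at z)" for z
    unfolding P_def by (auto intro!: derivative_eq_intros Q A' simp: exp_minus field_simps)
  have N': "(N has_real_derivative c * R z * N z - h z) (at z)" for z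
    unfolding N_def by (auto intro!: derivative_eq_intros Q B'' simp: exp_minus field_simps)
  have Pk: "P z = (LINT y:{..z}|lborel. exp_kernel c R z y * h y)" for z
  proof -
    have "P z = (LINT y:{..z}|lborel. exp (- c * Q z) * (exp (c * Q y) * h y))"
      unfolding P_def A_def by simp
    also have "\<dots> = (LINT y:{..z}|lborel. exp_kernel c R z y * h y)"
      by (rule set_lebesgue_integral_cong) (auto simp: kq Qm ee abs_of_nonneg right_diff_distrib)
    finally show ?thesis .
  qed
  have Nk: "N z = (LINT y:{z<..}|lborel. exp_kernel c R z y * h y)" for z
  proof -
    have "N z = (LINT y:{z<..}|lborel. exp (c * Q z) * (exp (- c * Q y) * h y))"
      unfolding N_def B'_def by simp
    also have "\<dots> = (LINT y:{z<..}|lborel. exp_kernel c R z y * h y)"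
    proof (rule set_lebesgue_integral_cong)
      show "\<forall>y. y \<in> {z<..} \<longrightarrow> exp (c * Q z) * (exp (- c * Q y) * h y) = exp_kernel c R z y * h y"
      proof safe
        fix y assume "z < y"
        hence "Q z \<le> Q y" using Qm[of z y] by auto
        thus "exp (c * Q z) * (exp (- c * Q y) * h y) = exp_kernel c R z y * h y"
          by (auto simp: kq ee abs_of_nonpos right_diff_distrib)
      qed
    qed auto
    finally show ?thesis .
  qed
  have v: "resolvent c R f z = c / 2 * (P z + N z)" for z
  proof -
    have "(LINT y|lborel. exp_kernel c R z y * h y) = (LINT y:{..z} \<union> {z<..}|lborel. exp_kernel c R z y * h y)"
    proof -
      have "{..z} \<union> {z<..} = (UNIV :: real set)" by auto
      thus ?thesis by (simp add: set_lebesgue_integral_def)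
    qed
    also have "\<dots> = P z + N z" unfolding Pk Nk by (intro set_integral_Un sk) auto
    finally show ?thesis by (simp add: resolvent_def weighted_integral_def h_def)
  qed
  have dd: "resolvent_deriv c R f z = c\<^sup>2 / 2 * (N z - P z)" for z
  proof -
    \<comment> \<open>The sign vanishes at y = z, where the two indicators give - 1; this single
      point is a null set.\<close>
    have "(LINT y|lborel. sgn (y - z) * (exp_kernel c R z y * h y)) =
      (LINT y|lborel. indicator {z<..} y *\<^sub>R (exp_kernel c R z y * h y) - indicator {..z} y *\<^sub>R (exp_kernel c R z y * h y))"
    proof (rule integral_cong_AE)
      show "AE y in lborel. sgn (y - z) * (exp_kernel c R z y * h y) =
          indicator {z<..} y *\<^sub>R (exp_kernel c R z y * h y) - indicator {..z} y *\<^sub>R (exp_kernel c R z y * h y)"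
        using AE_lborel_singleton[of z] by eventually_elim (auto simp: indicator_def sgn_if)
    qed (use exp_kernel_measurable[OF R] in measurable)
    also have "\<dots> = N z - P z"
      using sk[of "{..z}" z] sk[of "{z<..}" z] unfolding Pk Nk set_lebesgue_integral_def set_integrable_def
      by (intro Bochner_Integration.integral_diff) auto
    finally show ?thesis by (simp add: resolvent_deriv_def weighted_integral_def h_def)
  qed
  have vE: "resolvent c R f = (\<lambda>z. c / 2 * (P z + N z))" and dE: "resolvent_deriv c R f = (\<lambda>z. c\<^sup>2 / 2 * (N z - P z))"
    using v dd by auto
  show "(resolvent c R f has_real_derivative R z * resolvent_deriv c R f z) (at z)"
    unfolding vE by (rule DERIV_cong[OF DERIV_cmult[OF DERIV_add[OF P' N']]])
      (simp add: dd power2_eq_square field_simps)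
  show "(resolvent_deriv c R f has_real_derivative c\<^sup>2 * R z * (resolvent c R f z - f z)) (at z)"
    unfolding dE by (rule DERIV_cong[OF DERIV_cmult[OF DERIV_diff[OF N' P']]])
      (simp add: v h_def power2_eq_square field_simps)
qed

lemma resolvents_bound:
  assumes R: "admissible R" and c: "c > 0" and [measurable]: "f \<in> borel_measurable borel" and fB: "\<And>y. \<bar>f y\<bar> \<le> B"
  shows "\<bar>resolvent c R f z\<bar> \<le> 4 * B" "\<bar>resolvent_deriv c R f z\<bar> \<le> 4 * c * B"
proof -
  have [measurable]: "R \<in> borel_measurable borel" using R by (auto simp: admissible_def intro: borel_measurable_continuous_onI)
  have hB: "\<bar>f y * R y\<bar> \<le> B * 2" for y
  proof -
    have "1 / 2 \<le> R y" "R y \<le> 2" using R by (auto simp: admissible_def)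
    hence "\<bar>R y\<bar> \<le> 2" by linarith
    thus ?thesis unfolding abs_mult using fB[of y] by (intro mult_mono) auto
  qed
  show "\<bar>resolvent c R f z\<bar> \<le> 4 * B"
    using mult_left_mono[OF weighted_integral_integrand(2)[where h="\<lambda>y. f y * R y" and \<sigma>="\<lambda>_. 1" and z=z, OF R c _ hB], of "c / 2"] c
    by (simp add: resolvent_def abs_mult)
  have "\<bar>sgn (y - z)\<bar> \<le> 1" for y by (simp add: sgn_if)
  thus "\<bar>resolvent_deriv c R f z\<bar> \<le> 4 * c * B"
    using mult_left_mono[OF weighted_integral_integrand(2)[where h="\<lambda>y. f y * R y" and \<sigma>="\<lambda>y. sgn (y - z)" and z=z, OF R c _ hB], of "c\<^sup>2 / 2"] c
    by (simp add: resolvent_deriv_def abs_mult power2_eq_square)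
qed

text \<open>The 10 is 2 + 8: 2 from changing \<open>R\<close> in the factor \<open>f * R\<close>, 8
  from changing it in the kernel.\<close>

lemma resolvents_lipschitz:
  assumes R: "admissible R1" "admissible R2" and c: "c > 0"
    and f[measurable]: "f1 \<in> borel_measurable borel" "f2 \<in> borel_measurable borel"
    and B: "\<And>y. \<bar>f1 y\<bar> \<le> B"
    and d: "\<And>x. \<bar>R1 x - R2 x\<bar> \<le> d" and e: "\<And>x. \<bar>f1 x - f2 x\<bar> \<le> e"
  shows "\<bar>resolvent c R1 f1 z - resolvent c R2 f2 z\<bar> \<le> 4 * e + 10 * B * d"
    and "\<bar>resolvent_deriv c R1 f1 z - resolvent_deriv c R2 f2 z\<bar> \<le> c * (4 * e + 10 * B * d)"
proof -
  have [measurable]: "R1 \<in> borel_measurable borel" "R2 \<in> borel_measurable borel"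
    using R by (auto simp: admissible_def intro: borel_measurable_continuous_onI)
  have Rb: "\<bar>R1 y\<bar> \<le> 2" "\<bar>R2 y\<bar> \<le> 2" for y
  proof -
    have "1 / 2 \<le> R1 y" "R1 y \<le> 2" "1 / 2 \<le> R2 y" "R2 y \<le> 2" using R by (auto simp: admissible_def)
    thus "\<bar>R1 y\<bar> \<le> 2" "\<bar>R2 y\<bar> \<le> 2" by linarith+
  qed
  have B0: "0 \<le> B" using B[of 0] by linarith
  have hB: "\<bar>f1 y * R1 y\<bar> \<le> B * 2" for y
    unfolding abs_mult using Rb[of y] B[of y] B0 by (intro mult_mono) auto
  have hd: "\<bar>f1 y * R1 y - f2 y * R2 y\<bar> \<le> B * d + e * 2" for y
  proof -
    have "\<bar>f1 y * R1 y - f2 y * R2 y\<bar> = \<bar>f1 y * (R1 y - R2 y) + (f1 y - f2 y) * R2 y\<bar>"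
      by (simp add: algebra_simps)
    also have "\<dots> \<le> \<bar>f1 y\<bar> * \<bar>R1 y - R2 y\<bar> + \<bar>f1 y - f2 y\<bar> * \<bar>R2 y\<bar>"
      by (metis abs_mult abs_triangle_ineq)
    also have "\<dots> \<le> B * d + e * 2"
      using Rb[of y] B[of y] B0 d[of y] e[of y] by (intro add_mono mult_mono) auto
    finally show ?thesis .
  qed
  have "\<bar>weighted_integral (\<lambda>_. 1) c R1 (\<lambda>y. f1 y * R1 y) z - weighted_integral (\<lambda>_. 1) c R2 (\<lambda>y. f2 y * R2 y) z\<bar>
    \<le> 4 * (B * d + e * 2) / c + 8 * (B * 2) * d / c"
    by (rule weighted_integral_diff[OF R c d _ _ hB hd]) auto
  from mult_left_mono[OF this, of "c / 2"]
  have "\<bar>c / 2 * (weighted_integral (\<lambda>_. 1) c R1 (\<lambda>y. f1 y * R1 y) z - weighted_integral (\<lambda>_. 1) c R2 (\<lambda>y. f2 y * R2 y) z)\<bar>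
    \<le> c / 2 * (4 * (B * d + e * 2) / c + 8 * (B * 2) * d / c)"
    using c by (simp add: abs_mult)
  also have "\<dots> = 4 * e + 10 * B * d" using c by (simp add: field_simps)
  finally show "\<bar>resolvent c R1 f1 z - resolvent c R2 f2 z\<bar> \<le> 4 * e + 10 * B * d"
    by (simp add: resolvent_def right_diff_distrib)
  have "\<bar>weighted_integral (\<lambda>y. sgn (y - z)) c R1 (\<lambda>y. f1 y * R1 y) z - weighted_integral (\<lambda>y. sgn (y - z)) c R2 (\<lambda>y. f2 y * R2 y) z\<bar>
    \<le> 4 * (B * d + e * 2) / c + 8 * (B * 2) * d / c"
    by (rule weighted_integral_diff[OF R c d _ _ hB hd]) (auto simp: sgn_if)
  from mult_left_mono[OF this, of "c\<^sup>2 / 2"]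
  have "\<bar>c\<^sup>2 / 2 * (weighted_integral (\<lambda>y. sgn (y - z)) c R1 (\<lambda>y. f1 y * R1 y) z - weighted_integral (\<lambda>y. sgn (y - z)) c R2 (\<lambda>y. f2 y * R2 y) z)\<bar>
    \<le> c\<^sup>2 / 2 * (4 * (B * d + e * 2) / c + 8 * (B * 2) * d / c)"
    by (simp add: abs_mult)
  also have "\<dots> = c * (4 * e + 10 * B * d)" using c by (simp add: field_simps power2_eq_square)
  finally show "\<bar>resolvent_deriv c R1 f1 z - resolvent_deriv c R2 f2 z\<bar> \<le> c * (4 * e + 10 * B * d)"
    by (simp add: resolvent_deriv_def right_diff_distrib)
qed

section \<open>Bounded solutions of the resolvent equation\<close>

lemma bounded_growth_zero:
  assumes R: "admissible R" and c: "c > 0" and s: "\<And>z. (s has_real_derivative c * R z * s z) (at z)"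
    and sB: "\<And>z. \<bar>s z\<bar> \<le> B"
  shows "s z = 0"
proof -
  obtain Q where Q: "\<And>x. (Q has_real_derivative R x) (at x)"
    using ex_antiderivative R admissible_def by metis
  \<comment> \<open>The solution is a multiple of exp (c Q), and Q has slope at least 1 / 2;
    comparison with the bounded value at z + n forces the multiple to be 0.\<close>
  have "((\<lambda>z. s z * exp (- c * Q z)) has_real_derivative 0) (at z)" for z
    by (auto intro!: derivative_eq_intros s Q simp: algebra_simps)
  hence const: "s x * exp (- c * Q x) = s z * exp (- c * Q z)" for x
    using DERIV_isconst_all[of "\<lambda>z. s z * exp (- c * Q z)"] by blast
  have le: "\<bar>s z\<bar> \<le> B * exp (- (c / 2) * real n)" for n
  proof -
    define x where "x = z + real n"
    have "exp_kernel c R z x = exp (- c * \<bar>Q z - Q x\<bar>)" by (rule exp_kernel_eq[OF R Q])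
    moreover have "Q z \<le> Q x"
      by (rule DERIV_nonneg_imp_nondecreasing) (use Q R in \<open>force simp: x_def admissible_def intro: order_trans[of 0 "1/2"]\<close>)+
    ultimately have k: "exp (c * Q z - c * Q x) = exp_kernel c R z x" by (simp add: algebra_simps)
    have "s z = s x * exp (c * Q z - c * Q x)" using const[of x] by (simp add: exp_diff exp_minus field_simps)
    hence "\<bar>s z\<bar> = \<bar>s x\<bar> * exp_kernel c R z x" by (simp add: k abs_mult exp_kernel_def)
    also have "\<dots> \<le> B * exp (- (c / 2) * \<bar>z - x\<bar>)"
      using sB[of x] exp_kernel_bounds[OF R c, of z x] by (intro mult_mono) (auto intro: less_imp_le)
    finally show ?thesis by (simp add: x_def)
  qed
  have "(\<lambda>n. B * exp (- (c / 2) * real n)) \<longlonglongrightarrow> B * 0"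
    using c by (intro tendsto_intros) real_asymp
  from LIMSEQ_le_const[OF this, of "\<bar>s z\<bar>"] le show ?thesis by auto
qed

lemma bounded_decay_zero:
  assumes R: "admissible R" and c: "c > 0" and s: "\<And>z. (s has_real_derivative - c * R z * s z) (at z)"
    and sB: "\<And>z. \<bar>s z\<bar> \<le> B"
  shows "s z = 0"
proof -
  have "s (- (- z)) = 0"
  proof (rule bounded_growth_zero[of "\<lambda>x. R (- x)" c "\<lambda>x. s (- x)" B])
    show "admissible (\<lambda>x. R (- x))"
      using R by (auto simp: admissible_def intro!: continuous_on_compose2[of UNIV R UNIV] continuous_intros)
    fix z show "((\<lambda>x. s (- x)) has_real_derivative c * R (- z) * s (- z)) (at z)"
      by (rule DERIV_cong[OF DERIV_chain2[OF s]]) (auto intro!: derivative_eq_intros)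
  qed (use c sB in auto)
  thus ?thesis by simp
qed

text \<open>The combinations d + c v and d - c v diagonalise the first-order system with rates c and
  - c, so the difference of two bounded solutions vanishes. This identifies explicit functions as
  resolvents without evaluating an integral.\<close>

lemma resolvents_unique:
  assumes R: "admissible R" and c: "c > 0" and f: "continuous_on UNIV f" and fB: "\<And>y. \<bar>f y\<bar> \<le> B"
    and v: "\<And>z. (v has_real_derivative R z * d z) (at z)" and vB: "\<And>z. \<bar>v z\<bar> \<le> Bv"
    and d: "\<And>z. (d has_real_derivative c\<^sup>2 * R z * (v z - f z)) (at z)" and dB: "\<And>z. \<bar>d z\<bar> \<le> Bd"
  shows "v z = resolvent c R f z" "d z = resolvent_deriv c R f z"
proof -
  note V = resolvents_deriv[OF R c f fB]
  have [measurable]: "f \<in> borel_measurable borel" using f by (rule borel_measurable_continuous_onI)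
  note b = resolvents_bound[where f=f, OF R c _ fB]
  define p m where "p z = (d z - resolvent_deriv c R f z) + c * (v z - resolvent c R f z)"
    and "m z = (d z - resolvent_deriv c R f z) - c * (v z - resolvent c R f z)" for z
  have 0: "\<bar>d z - resolvent_deriv c R f z\<bar> \<le> Bd + 4 * c * B" "\<bar>c * (v z - resolvent c R f z)\<bar> \<le> c * (Bv + 4 * B)" for z
  proof -
    show "\<bar>d z - resolvent_deriv c R f z\<bar> \<le> Bd + 4 * c * B" using b(2)[of z] dB[of z] by simp
    have "\<bar>v z - resolvent c R f z\<bar> \<le> Bv + 4 * B" using b(1)[of z] vB[of z] by simp
    thus "\<bar>c * (v z - resolvent c R f z)\<bar> \<le> c * (Bv + 4 * B)" using c by (simp add: abs_mult)
  qed
  have "p z = 0"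
  proof (rule bounded_growth_zero[where s=p, OF R c])
    show "(p has_real_derivative c * R z * p z) (at z)" for z
      unfolding p_def by (auto intro!: derivative_eq_intros v d V simp: algebra_simps power2_eq_square)
    show "\<bar>p z\<bar> \<le> (Bd + 4 * c * B) + c * (Bv + 4 * B)" for z
      using 0[of z] unfolding p_def by linarith
  qed
  moreover have "m z = 0"
  proof (rule bounded_decay_zero[where s=m, OF R c])
    show "(m has_real_derivative - c * R z * m z) (at z)" for z
      unfolding m_def by (auto intro!: derivative_eq_intros v d V simp: algebra_simps power2_eq_square)
    show "\<bar>m z\<bar> \<le> (Bd + 4 * c * B) + c * (Bv + 4 * B)" for z
      using 0[of z] unfolding m_def by linarith
  qed
  ultimately have "d z - resolvent_deriv c R f z = 0" "c * (v z - resolvent c R f z) = 0" unfolding p_def m_def by linarith+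
  thus "v z = resolvent c R f z" "d z = resolvent_deriv c R f z" using c by auto
qed

section \<open>The operator P(D)\<close>

lemma integrable_inverse_1_plus_square_UNIV: "integrable lborel (\<lambda>x::real. 1 / (1 + x\<^sup>2))"
  using integrable_inverse_1_plus_square by (simp add: set_integrable_def einterval_def inverse_eq_divide)

lemma exp_kernel_1: "exp_kernel c (\<lambda>_. 1) z y = exp (- c * \<bar>z - y\<bar>)"
  using exp_kernel_eq[of "\<lambda>_. 1" "\<lambda>x. x" c z y] by simp

abbreviation "resolvent1 c \<equiv> resolvent c (\<lambda>_. 1)"
abbreviation "resolvent_deriv1 c \<equiv> resolvent_deriv c (\<lambda>_. 1)"

definition exp_decay :: "real \<Rightarrow> real \<Rightarrow> real" where
  "exp_decay c x = c / 2 * exp (- c * \<bar>x\<bar>)"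

lemma resolvent1_eq: "resolvent1 c f x = (LINT y|lborel. exp_decay c (x - y) * f y)"
  by (simp add: resolvent_def weighted_integral_def exp_kernel_1 exp_decay_def mult.assoc)

lemma exp_decay_measurable [measurable]: "exp_decay c \<in> borel_measurable borel"
  unfolding exp_decay_def[abs_def] by measurable

lemma exp_decay_bounds: "c > 0 \<Longrightarrow> 0 < exp_decay c x" "c > 0 \<Longrightarrow> \<bar>exp_decay c x\<bar> \<le> c / 2"
  by (auto simp: exp_decay_def)

lemma exp_decay_integrable:
  assumes "c > 0" shows "integrable lborel (\<lambda>y. exp_decay c (x - y))"
  using integrable.intros[OF has_bochner_integral_power_exp_abs_diff[of c x 0]] assms
  by (simp add: exp_decay_def)

text \<open>The right-hand side is bounded and solves the resolvent equation, hence uniqueness. This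
  is how the symbol of the exponential kernel is found.\<close>

lemma resolvent1_cos: assumes "c > 0" shows "resolvent1 c (\<lambda>y. cos (\<xi> * y)) x = c\<^sup>2 / (c\<^sup>2 + \<xi>\<^sup>2) * cos (\<xi> * x)"
proof (rule resolvents_unique(1)[symmetric, where B=1 and d="\<lambda>z. - (c\<^sup>2 / (c\<^sup>2 + \<xi>\<^sup>2) * \<xi> * sin (\<xi> * z))"
    and Bv="\<bar>c\<^sup>2 / (c\<^sup>2 + \<xi>\<^sup>2)\<bar>" and Bd="\<bar>c\<^sup>2 / (c\<^sup>2 + \<xi>\<^sup>2) * \<xi>\<bar>" and R="\<lambda>_. 1" and c=c
      and v="\<lambda>x. c\<^sup>2 / (c\<^sup>2 + \<xi>\<^sup>2) * cos (\<xi> * x)"])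
  have dK: "((\<lambda>z. - (K * \<xi> * sin (\<xi> * z))) has_real_derivative - (K * \<xi> * \<xi>) * cos (\<xi> * z)) (at z)"
    "((\<lambda>z. K * cos (\<xi> * z)) has_real_derivative 1 * - (K * \<xi> * sin (\<xi> * z))) (at z)" for K z
    by (auto intro!: derivative_eq_intros)
  have "c\<^sup>2 + \<xi>\<^sup>2 > 0" using assms by (simp add: add_pos_nonneg)
  hence "c\<^sup>2 / (c\<^sup>2 + \<xi>\<^sup>2) + \<xi>\<^sup>2 / (c\<^sup>2 + \<xi>\<^sup>2) = 1"
    using assms by (simp add: add_divide_distrib[symmetric])
  hence "c\<^sup>2 / (c\<^sup>2 + \<xi>\<^sup>2) - 1 = - (\<xi>\<^sup>2 / (c\<^sup>2 + \<xi>\<^sup>2))"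
    by linarith
  hence k: "c\<^sup>2 * (c\<^sup>2 / (c\<^sup>2 + \<xi>\<^sup>2) - 1) = - (c\<^sup>2 / (c\<^sup>2 + \<xi>\<^sup>2) * \<xi> * \<xi>)"
    by (simp add: power2_eq_square)
  show "((\<lambda>z. - (c\<^sup>2 / (c\<^sup>2 + \<xi>\<^sup>2) * \<xi> * sin (\<xi> * z))) has_real_derivative
      c\<^sup>2 * 1 * (c\<^sup>2 / (c\<^sup>2 + \<xi>\<^sup>2) * cos (\<xi> * z) - cos (\<xi> * z))) (at z)" for z
  proof (rule DERIV_cong)
    show "((\<lambda>z. - (c\<^sup>2 / (c\<^sup>2 + \<xi>\<^sup>2) * \<xi> * sin (\<xi> * z))) has_real_derivative
       - (c\<^sup>2 / (c\<^sup>2 + \<xi>\<^sup>2) * \<xi> * \<xi>) * cos (\<xi> * z)) (at z)"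
      by (rule dK)
    show "- (c\<^sup>2 / (c\<^sup>2 + \<xi>\<^sup>2) * \<xi> * \<xi>) * cos (\<xi> * z) =
       c\<^sup>2 * 1 * (c\<^sup>2 / (c\<^sup>2 + \<xi>\<^sup>2) * cos (\<xi> * z) - cos (\<xi> * z))"
      unfolding k[symmetric] by (simp add: algebra_simps)
  qed
  show "((\<lambda>x. c\<^sup>2 / (c\<^sup>2 + \<xi>\<^sup>2) * cos (\<xi> * x)) has_real_derivative
     1 * - (c\<^sup>2 / (c\<^sup>2 + \<xi>\<^sup>2) * \<xi> * sin (\<xi> * z))) (at z)" for z
    by (rule dK)
  show "\<bar>c\<^sup>2 / (c\<^sup>2 + \<xi>\<^sup>2) * cos (\<xi> * z)\<bar> \<le> \<bar>c\<^sup>2 / (c\<^sup>2 + \<xi>\<^sup>2)\<bar>" for z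
    unfolding abs_mult by (rule mult_left_le) auto
  show "\<bar>- (c\<^sup>2 / (c\<^sup>2 + \<xi>\<^sup>2) * \<xi> * sin (\<xi> * z))\<bar> \<le> \<bar>c\<^sup>2 / (c\<^sup>2 + \<xi>\<^sup>2) * \<xi>\<bar>" for z
    unfolding abs_mult abs_minus_cancel by (rule mult_left_le) auto
qed (use assms in \<open>auto intro!: continuous_intros\<close>)

text \<open>The convolution of the two exponential kernels, which will be the kernel of
  P(D).\<close>

definition PD_kernel :: "real \<Rightarrow> real \<Rightarrow> real \<Rightarrow> real" where
  "PD_kernel a b = resolvent1 a (exp_decay b)"

lemma PD_kernel_conv:
  assumes ab: "a > 0" "b > 0" and f[measurable]: "f \<in> borel_measurable borel" and fB: "\<And>y. \<bar>f y\<bar> \<le> B"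
  shows "integrable lborel (\<lambda>s. PD_kernel a b (x - s) * f s)"
    and "resolvent1 a (resolvent1 b f) x = (LINT s|lborel. PD_kernel a b (x - s) * f s)"
proof -
  let ?h = "\<lambda>s y. exp_decay a (x - y) * (exp_decay b (y - s) * f s)"
  have B0: "0 \<le> B" using fB[of 0] by linarith
  have s: "(LINT s|lborel. exp_decay b (y - s)) = 1" for y
    using has_bochner_integral_integral_eq[OF has_bochner_integral_power_exp_abs_diff[of b y 0]] ab
    by (simp add: exp_decay_def)
  have i: "integrable (lborel \<Otimes>\<^sub>M lborel) (\<lambda>(y, s). ?h s y)"
  proof (rule Bochner_Integration.integrable_bound)
    show "integrable (lborel \<Otimes>\<^sub>M lborel) (\<lambda>(y, s). B * (exp_decay a (x - y) * exp_decay b (y - s)))"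
    proof (rule lborel_pair.Fubini_integrable)
      have "integrable lborel (\<lambda>y. B * exp_decay a (x - y))"
        using exp_decay_integrable[OF ab(1)] by simp
      moreover have "(LINT s|lborel. norm (B * (exp_decay a (x - y) * exp_decay b (y - s)))) = B * exp_decay a (x - y)" for y
      proof -
        have "norm (B * (exp_decay a (x - y) * exp_decay b (y - s))) = B * (exp_decay a (x - y) * exp_decay b (y - s))" for s
          using B0 exp_decay_bounds(1)[OF ab(1), of "x - y"] exp_decay_bounds(1)[OF ab(2), of "y - s"]
          by (simp add: abs_mult)
        thus ?thesis using s[of y] by simp
      qed
      ultimately show "integrable lborel (\<lambda>y. LINT s|lborel. norm (case (y, s) of (y, s) \<Rightarrow> B * (exp_decay a (x - y) * exp_decay b (y - s))))"
        by simp
      show "AE y in lborel. integrable lborel (\<lambda>s. case (y, s) of (y, s) \<Rightarrow> B * (exp_decay a (x - y) * exp_decay b (y - s)))"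
        using exp_decay_integrable[OF ab(2)] by simp
    qed measurable
    show "AE p in lborel \<Otimes>\<^sub>M lborel. norm (case p of (y, s) \<Rightarrow> ?h s y)
        \<le> norm (case p of (y, s) \<Rightarrow> B * (exp_decay a (x - y) * exp_decay b (y - s)))"
    proof (rule AE_I2, clarify)
      fix y s
      have "norm (?h s y) = \<bar>f s\<bar> * (exp_decay a (x - y) * exp_decay b (y - s))"
        using exp_decay_bounds(1)[OF ab(1), of "x - y"] exp_decay_bounds(1)[OF ab(2), of "y - s"]
        by (simp add: abs_mult)
      also have "\<dots> \<le> B * (exp_decay a (x - y) * exp_decay b (y - s))"
        using exp_decay_bounds(1)[OF ab(1), of "x - y"] exp_decay_bounds(1)[OF ab(2), of "y - s"] fB[of s]
        by (intro mult_right_mono) auto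
      finally show "norm (?h s y) \<le> norm (B * (exp_decay a (x - y) * exp_decay b (y - s)))" by simp
    qed
  qed measurable
  have eq: "(LINT y|lborel. ?h s y) = PD_kernel a b (x - s) * f s" for s
  proof -
    have "PD_kernel a b (x - s) = (LINT y|lborel. exp_decay a (x - s - y) * exp_decay b y)"
      by (simp add: PD_kernel_def resolvent1_eq)
    also have "\<dots> = (LINT y|lborel. exp_decay a (x - y) * exp_decay b (y - s))"
      by (subst lborel_integral_real_affine[of 1 _ "- s"]) (auto simp: algebra_simps)
    finally have "PD_kernel a b (x - s) * f s = (LINT y|lborel. exp_decay a (x - y) * exp_decay b (y - s) * f s)" by simp
    thus ?thesis by (simp add: mult.assoc)
  qed
  show "integrable lborel (\<lambda>s. PD_kernel a b (x - s) * f s)"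
    using lborel_pair.integrable_snd[OF i] by (simp add: eq)
  have "resolvent1 a (resolvent1 b f) x = (LINT y|lborel. (LINT s|lborel. ?h s y))"
    by (simp add: resolvent1_eq)
  also have "\<dots> = (LINT s|lborel. (LINT y|lborel. ?h s y))"
    by (rule lborel_pair.Fubini_integral[symmetric]) (rule i)
  finally show "resolvent1 a (resolvent1 b f) x = (LINT s|lborel. PD_kernel a b (x - s) * f s)" by (simp add: eq)
qed

lemma exp_decay_continuous: "continuous_on UNIV (exp_decay c)"
  unfolding exp_decay_def[abs_def] by (intro continuous_intros)

lemma PD_kernel_facts:
  assumes ab: "a > 0" "b > 0"
  shows "continuous_on UNIV (PD_kernel a b)" "\<bar>PD_kernel a b x\<bar> \<le> 2 * b" "integrable lborel (PD_kernel a b)" "PD_kernel a b (- x) = PD_kernel a b x"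
proof -
  note e = exp_decay_bounds(2)[OF ab(2)]
  show "continuous_on UNIV (PD_kernel a b)"
    unfolding PD_kernel_def using resolvents_deriv(1)[OF admissible_1 ab(1) exp_decay_continuous e]
    by (meson DERIV_isCont continuous_at_imp_continuous_on)
  show "\<bar>PD_kernel a b x\<bar> \<le> 2 * b"
    unfolding PD_kernel_def using resolvents_bound(1)[where f="exp_decay b", OF admissible_1 ab(1) _ e, of x] by simp
  \<comment> \<open>Testing against the constant 1 yields integrability.\<close>
  have "integrable lborel (\<lambda>s. PD_kernel a b (0 - s))"
    using PD_kernel_conv(1)[OF ab, of "\<lambda>_. 1" 1 0] by simp
  thus "integrable lborel (PD_kernel a b)"
    using lborel_integrable_real_affine_iff[of "- 1" "PD_kernel a b" 0] by simp
  show "PD_kernel a b (- x) = PD_kernel a b x"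
    unfolding PD_kernel_def resolvent1_eq
    by (subst lborel_integral_real_affine[of "- 1" _ 0]) (auto simp: exp_decay_def abs_minus_commute add.commute)
qed

text \<open>The transform of the kernel is computed by applying both resolvents to cosines at 0, and
  then inverted. Partial fractions would require a separate case a = b.\<close>

lemma inv_fourier_PD:
  assumes ab: "a > 0" "b > 0"
  shows "inv_fourier (\<lambda>\<xi>. a\<^sup>2 / (a\<^sup>2 + \<xi>\<^sup>2) * (b\<^sup>2 / (b\<^sup>2 + \<xi>\<^sup>2))) x = complex_of_real (PD_kernel a b x)"
proof -
  define m where "m \<xi> = a\<^sup>2 / (a\<^sup>2 + \<xi>\<^sup>2) * (b\<^sup>2 / (b\<^sup>2 + \<xi>\<^sup>2))" for \<xi> :: real
  note p = PD_kernel_facts[OF ab]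
  have [measurable]: "PD_kernel a b \<in> borel_measurable borel" using p(1) by (rule borel_measurable_continuous_onI)
  have c: "(LINT s|lborel. PD_kernel a b s * cos (\<xi> * s)) = m \<xi>" for \<xi>
  proof -
    have "(LINT s|lborel. PD_kernel a b (0 - s) * cos (\<xi> * s)) = resolvent1 a (resolvent1 b (\<lambda>y. cos (\<xi> * y))) 0"
      by (rule PD_kernel_conv(2)[OF ab, symmetric, where B=1]) auto
    also have "resolvent1 b (\<lambda>y. cos (\<xi> * y)) = (\<lambda>x. b\<^sup>2 / (b\<^sup>2 + \<xi>\<^sup>2) * cos (\<xi> * x))"
      using resolvent1_cos[OF ab(2)] by auto
    also have "resolvent1 a \<dots> 0 = b\<^sup>2 / (b\<^sup>2 + \<xi>\<^sup>2) * resolvent1 a (\<lambda>x. cos (\<xi> * x)) 0"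
      unfolding resolvent1_eq
      by (subst integral_mult_right_zero[symmetric], intro Bochner_Integration.integral_cong) auto
    also have "\<dots> = m \<xi>" unfolding resolvent1_cos[OF ab(1)] m_def by (simp add: mult.commute)
    finally show ?thesis by (simp add: p(4))
  qed
  have s: "(LINT s|lborel. PD_kernel a b s * sin (\<xi> * s)) = 0" for \<xi>
  proof -
    have "(LINT s|lborel. PD_kernel a b s * sin (\<xi> * s)) = - (LINT s|lborel. PD_kernel a b s * sin (\<xi> * s))"
      by (subst lborel_integral_real_affine[of "- 1" _ 0]) (simp_all add: p(4))
    thus ?thesis by simp
  qed
  have ic: "integrable lborel (\<lambda>s. PD_kernel a b s * cos (\<xi> * s))" "integrable lborel (\<lambda>s. PD_kernel a b s * sin (\<xi> * s))" for \<xi>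
    by (rule Bochner_Integration.integrable_bound[OF p(3)]; simp add: abs_mult mult_left_le)+
  have g: "complex_of_real (m \<xi>) = (LINT y|lborel. cis (- (y * \<xi>)) * complex_of_real (PD_kernel a b y))" for \<xi>
  proof -
    have "(LINT y|lborel. cis (- (y * \<xi>)) * complex_of_real (PD_kernel a b y)) =
      (LINT y|lborel. complex_of_real (PD_kernel a b y * cos (\<xi> * y)) - \<i> * complex_of_real (PD_kernel a b y * sin (\<xi> * y)))"
      by (intro Bochner_Integration.integral_cong refl) (simp add: complex_eq_iff mult_ac)
    also have "\<dots> = complex_of_real (m \<xi>)"
      using ic[of \<xi>] by (subst Bochner_Integration.integral_diff) 
        (simp_all only: integrable_mult_right integrable_of_real integral_complex_of_real integral_mult_right_zero c s, simp_all)
    finally show ?thesis ..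
  qed
  \<comment> \<open>One of the two factors already decays integrably.\<close>
  have mb: "\<bar>m \<xi>\<bar> \<le> a\<^sup>2 / (a\<^sup>2 + \<xi>\<^sup>2)" for \<xi>
  proof -
    have "0 \<le> a\<^sup>2 / (a\<^sup>2 + \<xi>\<^sup>2)" "0 \<le> b\<^sup>2 / (b\<^sup>2 + \<xi>\<^sup>2)" by auto
    moreover have "b\<^sup>2 / (b\<^sup>2 + \<xi>\<^sup>2) \<le> 1" using ab by (simp add: add_pos_nonneg)
    ultimately show ?thesis unfolding m_def by (simp only: abs_of_nonneg mult_nonneg_nonneg mult_left_le)
  qed
  have "integrable lborel (\<lambda>\<xi>. 1 / (1 + (0 + (1 / a) * \<xi>)\<^sup>2))"
    by (rule lborel_integrable_real_affine[OF integrable_inverse_1_plus_square_UNIV]) (use ab in auto)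
  hence "integrable lborel (\<lambda>\<xi>. a\<^sup>2 / (a\<^sup>2 + \<xi>\<^sup>2))"
    using ab by (simp add: field_simps)
  hence "integrable lborel m"
    by (rule Bochner_Integration.integrable_bound) (use mb in \<open>auto simp: m_def[abs_def]\<close>)
  hence "(LINT \<xi>|lborel. cis (x * \<xi>) * complex_of_real (m \<xi>)) = complex_of_real (2 * pi * PD_kernel a b x)"
    by (intro fourier_inversion[OF p(3,1) p(2) g]) auto
  thus ?thesis by (simp add: inv_fourier_def m_def)
qed

lemma PD_eq:
  assumes "\<alpha> \<noteq> 0" "\<beta> \<noteq> 0" and f: "f \<in> borel_measurable borel" "\<And>y. \<bar>f y\<bar> \<le> B"
  shows "PD \<alpha> \<beta> f x = resolvent1 (1 / \<bar>\<alpha>\<bar>) (resolvent1 (1 / \<bar>\<beta>\<bar>) f) x"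
proof -
  have *: "1 / (1 + \<gamma>\<^sup>2 * \<xi>\<^sup>2) = (1 / \<bar>\<gamma>\<bar>)\<^sup>2 / ((1 / \<bar>\<gamma>\<bar>)\<^sup>2 + \<xi>\<^sup>2)" if "\<gamma> \<noteq> 0" for \<gamma> \<xi> :: real
    using that by (simp add: power_divide divide_simps) (simp add: algebra_simps)
  have "(\<lambda>\<xi>. 1 / ((1 + \<alpha>\<^sup>2 * \<xi>\<^sup>2) * (1 + \<beta>\<^sup>2 * \<xi>\<^sup>2))) =
     (\<lambda>\<xi>. (1 / \<bar>\<alpha>\<bar>)\<^sup>2 / ((1 / \<bar>\<alpha>\<bar>)\<^sup>2 + \<xi>\<^sup>2) * ((1 / \<bar>\<beta>\<bar>)\<^sup>2 / ((1 / \<bar>\<beta>\<bar>)\<^sup>2 + \<xi>\<^sup>2)))"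
    by (intro ext) (simp only: *[OF assms(1), symmetric] *[OF assms(2), symmetric] times_divide_times_eq mult_1_left)
  thus ?thesis
    unfolding PD_def multiplier_def using assms
    by (simp only: inv_fourier_PD zero_less_divide_1_iff zero_less_abs_iff Re_complex_of_real not_False_eq_True)
      (rule PD_kernel_conv(2)[symmetric], auto)
qed

lemma resolvent1_continuous:
  assumes "c > 0" "continuous_on UNIV f" "\<And>y. \<bar>f y\<bar> \<le> B"
  shows "continuous_on UNIV (resolvent1 c f)" "continuous_on UNIV (resolvent_deriv1 c f)"
  using resolvents_deriv[OF admissible_1 assms] by (meson DERIV_isCont continuous_at_imp_continuous_on)+

text \<open>The resolvent equation trades every second derivative for a difference of resolvents, so
  three derivatives ask for nothing beyond continuity of \<open>f\<close>.\<close>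

lemma deriv_PD:
  assumes \<alpha>: "\<alpha> \<noteq> 0" and \<beta>: "\<beta> \<noteq> 0" and f: "continuous_on UNIV f" "\<And>y. \<bar>f y\<bar> \<le> B"
  defines "a \<equiv> 1 / \<bar>\<alpha>\<bar>" and "b \<equiv> 1 / \<bar>\<beta>\<bar>"
  shows "deriv (PD \<alpha> \<beta> f) = resolvent_deriv1 a (resolvent1 b f)"
    and "(deriv ^^ 3) (PD \<alpha> \<beta> f) = (\<lambda>x. a\<^sup>2 * (resolvent_deriv1 a (resolvent1 b f) x - resolvent_deriv1 b f x))"
proof -
  have ab: "a > 0" "b > 0" using \<alpha> \<beta> by (auto simp: a_def b_def)
  have m: "f \<in> borel_measurable borel" using f(1) by (rule borel_measurable_continuous_onI)
  have e: "PD \<alpha> \<beta> f = resolvent1 a (resolvent1 b f)"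
    using PD_eq[OF \<alpha> \<beta> m f(2)] by (auto simp: a_def b_def)
  note vc = resolvent1_continuous(1)[OF ab(2) f]
  note vB = resolvents_bound(1)[where f=f, OF admissible_1 ab(2) m f(2)]
  note D1 = resolvents_deriv[OF admissible_1 ab(1) vc vB]
  note D2 = resolvents_deriv[OF admissible_1 ab(2) f]
  show 1: "deriv (PD \<alpha> \<beta> f) = resolvent_deriv1 a (resolvent1 b f)"
    unfolding e using D1(1) by (auto intro!: DERIV_imp_deriv)
  have 2: "deriv (resolvent_deriv1 a (resolvent1 b f)) = (\<lambda>x. a\<^sup>2 * (resolvent1 a (resolvent1 b f) x - resolvent1 b f x))"
    using D1(2) by (auto intro!: DERIV_imp_deriv)
  have 3: "deriv (\<lambda>x. a\<^sup>2 * (resolvent1 a (resolvent1 b f) x - resolvent1 b f x)) = (\<lambda>x. a\<^sup>2 * (resolvent_deriv1 a (resolvent1 b f) x - resolvent_deriv1 b f x))"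
    by (intro ext DERIV_imp_deriv DERIV_cmult DERIV_diff) (use D1(1) D2(1) in auto)
  show "(deriv ^^ 3) (PD \<alpha> \<beta> f) = (\<lambda>x. a\<^sup>2 * (resolvent_deriv1 a (resolvent1 b f) x - resolvent_deriv1 b f x))"
    by (simp add: numeral_3_eq_3 1 2 3)
qed

section \<open>Functions smooth in space and continuous in time\<close>

text \<open>The time comes first; \<open>space_diff T k f\<close> asks for \<open>k\<close> space derivatives, all jointly continuous.\<close>

definition jointly_cont :: "real \<Rightarrow> (real \<Rightarrow> real \<Rightarrow> real) \<Rightarrow> bool" where
  "jointly_cont T f \<longleftrightarrow> continuous_on ({0..T} \<times> UNIV) (\<lambda>(t, z). f t z)"

primrec space_diff :: "real \<Rightarrow> nat \<Rightarrow> (real \<Rightarrow> real \<Rightarrow> real) \<Rightarrow> bool" where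
  "space_diff T 0 f = jointly_cont T f"
| "space_diff T (Suc k) f \<longleftrightarrow> jointly_cont T f \<and>
     (\<exists>g. space_diff T k g \<and> (\<forall>t\<in>{0..T}. \<forall>z. (f t has_real_derivative g t z) (at z)))"

lemma jointly_cont_compose:
  assumes "jointly_cont T f" "continuous_on S \<tau>" "continuous_on S \<zeta>" "\<And>x. x \<in> S \<Longrightarrow> \<tau> x \<in> {0..T}"
  shows "continuous_on S (\<lambda>x. f (\<tau> x) (\<zeta> x))"
proof -
  have "(\<lambda>x. (\<tau> x, \<zeta> x)) ` S \<subseteq> {0..T} \<times> UNIV" using assms(4) by (simp add: image_subset_iff)
  from continuous_on_compose2[OF assms(1)[unfolded jointly_cont_def] continuous_on_Pair[OF assms(2,3)] this]
  show ?thesis by simp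
qed

lemma jointly_cont_slices:
  assumes "jointly_cont T f"
  shows "z \<in> UNIV \<Longrightarrow> continuous_on {0..T} (\<lambda>t. f t z)" "t \<in> {0..T} \<Longrightarrow> continuous_on A (f t)"
  using jointly_cont_compose[OF assms, of "{0..T}" "\<lambda>t. t" "\<lambda>_. z"] jointly_cont_compose[OF assms, of A "\<lambda>_. t" "\<lambda>z. z"]
  by auto

lemma space_diff_jointly_cont: "space_diff T k f \<Longrightarrow> jointly_cont T f"
  by (cases k) auto

lemma jointly_cont_cong: "(\<And>t z. t \<in> {0..T} \<Longrightarrow> f t z = g t z) \<Longrightarrow> jointly_cont T f \<longleftrightarrow> jointly_cont T g"
  unfolding jointly_cont_def by (intro continuous_on_cong) auto

lemma space_diff_cong:
  assumes "\<And>t z. t \<in> {0..T} \<Longrightarrow> f t z = g t z" shows "space_diff T k f \<longleftrightarrow> space_diff T k g"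
proof -
  have e: "f t = g t" if "t \<in> {0..T}" for t using assms[OF that] by auto
  show ?thesis by (cases k) (use e jointly_cont_cong[OF assms] in auto)
qed

lemma space_diff_SucI:
  assumes "jointly_cont T f" "space_diff T k g" "\<And>t z. t \<in> {0..T} \<Longrightarrow> (f t has_real_derivative g t z) (at z)"
  shows "space_diff T (Suc k) f"
  using assms by auto

lemma space_diff_SucE:
  assumes "space_diff T (Suc k) f"
  obtains g where "space_diff T k g" "\<And>t z. t \<in> {0..T} \<Longrightarrow> (f t has_real_derivative g t z) (at z)"
  using assms by auto

lemma space_diff_Suc_imp: "space_diff T (Suc k) f \<Longrightarrow> space_diff T k f"
proof (induction k arbitrary: f)
  case (Suc k)
  then obtain g where "space_diff T (Suc k) g" "\<And>t z. t \<in> {0..T} \<Longrightarrow> (f t has_real_derivative g t z) (at z)"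
    using space_diff_SucE by metis
  thus ?case using Suc by (intro space_diff_SucI[of _ _ _ g]) auto
qed auto

lemma jointly_cont_arith:
  assumes "jointly_cont T f" "jointly_cont T g"
  shows "jointly_cont T (\<lambda>t z. f t z + g t z)" "jointly_cont T (\<lambda>t z. f t z * g t z)"
  using assms unfolding jointly_cont_def by (auto simp: case_prod_unfold intro!: continuous_intros)

lemma space_diff_const [intro]: "space_diff T k (\<lambda>t z. c)"
proof (induction k arbitrary: c)
  have c: "jointly_cont T (\<lambda>t z. c)" for c by (simp add: jointly_cont_def case_prod_unfold)
  case 0 show ?case using c by simp
  case (Suc k) show ?case by (rule space_diff_SucI[OF c Suc[of 0]]) simp
qed

lemma space_diff_add [intro]: "space_diff T k f \<Longrightarrow> space_diff T k g \<Longrightarrow> space_diff T k (\<lambda>t z. f t z + g t z)"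
proof (induction k arbitrary: f g)
  case (Suc k)
  obtain f' g' where "space_diff T k f'" "\<And>t z. t \<in> {0..T} \<Longrightarrow> (f t has_real_derivative f' t z) (at z)"
    "space_diff T k g'" "\<And>t z. t \<in> {0..T} \<Longrightarrow> (g t has_real_derivative g' t z) (at z)"
    using Suc.prems by auto
  thus ?case using Suc.prems
    by (intro space_diff_SucI[where g="\<lambda>t z. f' t z + g' t z"] Suc.IH DERIV_add jointly_cont_arith) auto
qed (simp add: jointly_cont_arith)

lemma space_diff_mult [intro]: "space_diff T k f \<Longrightarrow> space_diff T k g \<Longrightarrow> space_diff T k (\<lambda>t z. f t z * g t z)"
proof (induction k arbitrary: f g)
  case (Suc k)
  obtain f' g' where d: "space_diff T k f'" "\<And>t z. t \<in> {0..T} \<Longrightarrow> (f t has_real_derivative f' t z) (at z)"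
    "space_diff T k g'" "\<And>t z. t \<in> {0..T} \<Longrightarrow> (g t has_real_derivative g' t z) (at z)"
    using Suc.prems by auto
  note k = Suc.prems[THEN space_diff_Suc_imp]
  show ?case
  proof (rule space_diff_SucI[where g="\<lambda>t z. f' t z * g t z + g' t z * f t z"])
    show "space_diff T k (\<lambda>t z. f' t z * g t z + g' t z * f t z)"
      by (intro space_diff_add Suc.IH d k)
    show "((\<lambda>z. f t z * g t z) has_real_derivative f' t z * g t z + g' t z * f t z) (at z)" if "t \<in> {0..T}" for t z
      using d that by (intro DERIV_mult) auto
  qed (use Suc.prems in \<open>auto intro: jointly_cont_arith\<close>)
qed (simp add: jointly_cont_arith)

lemma space_diff_cmult [intro]: "space_diff T k f \<Longrightarrow> space_diff T k (\<lambda>t z. c * f t z)"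
  by (intro space_diff_mult space_diff_const)

lemma space_diff_minus [intro]: "space_diff T k f \<Longrightarrow> space_diff T k (\<lambda>t z. - f t z)"
  using space_diff_cmult[of T k f "- 1"] by simp

lemma space_diff_diff [intro]: "space_diff T k f \<Longrightarrow> space_diff T k g \<Longrightarrow> space_diff T k (\<lambda>t z. f t z - g t z)"
  using space_diff_add[of T k f "\<lambda>t z. - g t z"] by auto

lemma space_diff_power2 [intro]: "space_diff T k f \<Longrightarrow> space_diff T k (\<lambda>t z. (f t z)\<^sup>2)"
  unfolding power2_eq_square by (intro space_diff_mult)

text \<open>\<open>step\<close> says that the derivative of the outer function is built from that
  function itself: it is \<open>exp\<close> for \<open>exp\<close>, and minus the square for
  \<open>inverse\<close>. The induction on k then closes.\<close>

lemma space_diff_compose_deriv: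
  fixes \<phi> :: "real \<Rightarrow> real"
  assumes d: "\<And>x. x \<in> D \<Longrightarrow> (\<phi> has_real_derivative \<phi>' x) (at x)"
    and step: "\<And>k f. space_diff T k f \<Longrightarrow> (\<And>t z. t \<in> {0..T} \<Longrightarrow> f t z \<in> D) \<Longrightarrow>
      space_diff T k (\<lambda>t z. \<phi> (f t z)) \<Longrightarrow> space_diff T k (\<lambda>t z. \<phi>' (f t z))"
    and f: "space_diff T k f" "\<And>t z. t \<in> {0..T} \<Longrightarrow> f t z \<in> D"
  shows "space_diff T k (\<lambda>t z. \<phi> (f t z))"
  using f
proof (induction k arbitrary: f)
  have \<phi>c: "continuous_on D \<phi>"
    using d by (meson DERIV_isCont continuous_at_imp_continuous_on)
  have jc0: "jointly_cont T (\<lambda>t z. \<phi> (f t z))" if "jointly_cont T f" "\<And>t z. t \<in> {0..T} \<Longrightarrow> f t z \<in> D" for f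
  proof -
    have "(\<lambda>(t, z). f t z) ` ({0..T} \<times> UNIV) \<subseteq> D" using that(2) by (simp add: image_subset_iff)
    from continuous_on_compose2[OF \<phi>c that(1)[unfolded jointly_cont_def] this]
    show ?thesis by (simp add: jointly_cont_def case_prod_unfold)
  qed
  {
    case 0 thus ?case using jc0 by simp
  next
    case (Suc k)
    obtain f' where f': "space_diff T k f'" "\<And>t z. t \<in> {0..T} \<Longrightarrow> (f t has_real_derivative f' t z) (at z)"
      using Suc.prems by auto
    note k = Suc.prems(1)[THEN space_diff_Suc_imp]
    show ?case
    proof (rule space_diff_SucI[where g="\<lambda>t z. \<phi>' (f t z) * f' t z"])
      show "jointly_cont T (\<lambda>t z. \<phi> (f t z))" using Suc.prems jc0 by auto
      show "space_diff T k (\<lambda>t z. \<phi>' (f t z) * f' t z)"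
        by (intro space_diff_mult f' step k Suc.prems(2) Suc.IH)
      show "((\<lambda>z. \<phi> (f t z)) has_real_derivative \<phi>' (f t z) * f' t z) (at z)" if "t \<in> {0..T}" for t z
        using d Suc.prems(2) f'(2) that by (intro DERIV_chain2[of \<phi>]) auto
    qed
  }
qed

lemma space_diff_exp [intro]: "space_diff T k f \<Longrightarrow> space_diff T k (\<lambda>t z. exp (f t z))"
  by (rule space_diff_compose_deriv[where D=UNIV and \<phi>=exp and \<phi>'=exp]) auto

lemma space_diff_inverse:
  assumes "space_diff T k f" "\<And>t z. t \<in> {0..T} \<Longrightarrow> f t z \<noteq> 0"
  shows "space_diff T k (\<lambda>t z. inverse (f t z))"
proof (rule space_diff_compose_deriv[where D="- {0}" and \<phi>=inverse and \<phi>'="\<lambda>x. - (inverse x)\<^sup>2"])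
  show "(inverse has_real_derivative - (inverse x)\<^sup>2) (at x)" if "x \<in> - {0}" for x :: real
    using DERIV_inverse[of x] that by (simp add: power2_eq_square)
qed (use assms in auto)

lemma space_diff_divide:
  assumes "space_diff T k f" "space_diff T k g" "\<And>t z. t \<in> {0..T} \<Longrightarrow> g t z \<noteq> 0"
  shows "space_diff T k (\<lambda>t z. f t z / g t z)"
  using space_diff_mult[OF assms(1) space_diff_inverse[OF assms(2,3)]] by (simp add: divide_inverse)

lemma space_diff_sin_cos: "space_diff T k (\<lambda>t z. sin (m * z))" "space_diff T k (\<lambda>t z. cos (m * z))"
proof (induction k)
  case 0 show "space_diff T 0 (\<lambda>t z. sin (m * z))" "space_diff T 0 (\<lambda>t z. cos (m * z))"
    by (auto simp: jointly_cont_def case_prod_unfold intro!: continuous_intros)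
next
  case (Suc k)
  have c: "jointly_cont T (\<lambda>t z. sin (m * z))" "jointly_cont T (\<lambda>t z. cos (m * z))"
    by (auto simp: jointly_cont_def case_prod_unfold intro!: continuous_intros)
  show "space_diff T (Suc k) (\<lambda>t z. sin (m * z))"
    by (rule space_diff_SucI[OF c(1) space_diff_cmult[OF Suc(2), of m]]) (auto intro!: derivative_eq_intros)
  show "space_diff T (Suc k) (\<lambda>t z. cos (m * z))"
    by (rule space_diff_SucI[OF c(2) space_diff_cmult[OF Suc(1), of "- m"]]) (auto intro!: derivative_eq_intros)
qed

lemma space_diff_linear: "space_diff T k (\<lambda>t z. m * z)"
proof -
  have c: "jointly_cont T (\<lambda>t z. m * z)" by (auto simp: jointly_cont_def case_prod_unfold intro!: continuous_intros)
  have "space_diff T (Suc k) (\<lambda>t z. m * z)"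
    by (rule space_diff_SucI[OF c space_diff_const[of _ _ m]]) (auto intro!: derivative_eq_intros)
  thus ?thesis by (rule space_diff_Suc_imp)
qed

section \<open>Integration over time\<close>

definition time_int :: "(real \<Rightarrow> real \<Rightarrow> real) \<Rightarrow> real \<Rightarrow> real \<Rightarrow> real" where
  "time_int f t z = integral {0..t} (\<lambda>s. f s z)"

lemma time_int_0 [simp]: "time_int f 0 z = 0" by (simp add: time_int_def)

lemma jointly_cont_time_int:
  assumes f: "jointly_cont T f" shows "jointly_cont T (time_int f)"
proof -
  \<comment> \<open>Rescaling to the fixed interval [0, 1] moves t into the integrand, where
    continuity in a parameter applies.\<close>
  have sc: "time_int f t z = t * integral (cbox 0 1) (\<lambda>\<theta>. f (t * \<theta>) z)" if t: "t \<in> {0..T}" for t z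
  proof (cases "t = 0")
    case False
    hence im: "(\<lambda>x. x / t) ` {0..t} = {0..1}"
      using t by (auto simp: image_iff intro!: bexI[of _ "t * x" for x])
    show ?thesis using integral_stretch_real[of t 0 t "\<lambda>s. f s z"] False t im by (simp add: time_int_def)
  qed (simp add: time_int_def)
  have "continuous_on ({0..T} \<times> (UNIV::real set)) (\<lambda>p. integral (cbox 0 1) ((\<lambda>p \<theta>. f (fst p * \<theta>) (snd p)) p))"
  proof (rule integral_continuous_on_param)
    have "continuous_on (({0..T} \<times> (UNIV::real set)) \<times> cbox 0 1) (\<lambda>x. f (fst (fst x) * snd x) (snd (fst x)))"
      by (rule jointly_cont_compose[OF f]) (auto intro!: continuous_intros mult_nonneg_nonneg intro: order_trans[OF mult_left_le])
    thus "continuous_on (({0..T} \<times> (UNIV::real set)) \<times> cbox 0 1) (\<lambda>(p, \<theta>). f (fst p * \<theta>) (snd p))"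
      by (simp add: case_prod_unfold)
  qed
  hence "continuous_on ({0..T} \<times> UNIV) (\<lambda>p. fst p * integral (cbox 0 1) (\<lambda>\<theta>. f (fst p * \<theta>) (snd p)))"
    by (intro continuous_intros)
  moreover have "continuous_on ({0..T} \<times> UNIV) (\<lambda>p. fst p * integral (cbox 0 1) (\<lambda>\<theta>. f (fst p * \<theta>) (snd p)))
     = continuous_on ({0..T} \<times> UNIV) (\<lambda>(t, z). time_int f t z)"
    by (rule continuous_on_cong) (auto simp: sc)
  ultimately show ?thesis by (simp add: jointly_cont_def)
qed

lemma time_int_deriv_z:
  assumes f: "jointly_cont T f" and g: "jointly_cont T g" and d: "\<And>t z. t \<in> {0..T} \<Longrightarrow> (f t has_real_derivative g t z) (at z)"
    and t: "t \<in> {0..T}"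
  shows "(time_int f t has_real_derivative time_int g t z) (at z)"
proof -
  have "((\<lambda>x. integral (cbox 0 t) ((\<lambda>x s. f s x) x)) has_field_derivative integral (cbox 0 t) ((\<lambda>x s. g s x) z)) (at z within UNIV)"
  proof (rule leibniz_rule_field_derivative)
    show "((\<lambda>x. f s x) has_real_derivative g s x) (at x within UNIV)" if "s \<in> cbox 0 t" for x s
      using d t that by auto
    show "(\<lambda>s. f s x) integrable_on cbox 0 t" for x
      using t by (intro integrable_continuous) (rule jointly_cont_compose[OF f], auto)
    have "continuous_on (UNIV \<times> cbox 0 t) (\<lambda>p. g (snd p) (fst p))"
      by (rule jointly_cont_compose[OF g]) (use t in \<open>auto intro!: continuous_intros\<close>)
    thus "continuous_on (UNIV \<times> cbox 0 t) (\<lambda>(x, s). g s x)"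
      by (simp add: case_prod_unfold)
  qed auto
  thus ?thesis by (simp add: time_int_def[abs_def])
qed

lemma time_int_deriv_t:
  assumes "jointly_cont T f" "t \<in> {0..T}"
  shows "((\<lambda>s. time_int f s z) has_real_derivative f t z) (at t within {0..T})"
  unfolding time_int_def using assms by (intro integral_has_real_derivative jointly_cont_slices) auto

lemma space_diff_time_int: "space_diff T k f \<Longrightarrow> space_diff T k (time_int f)"
proof (induction k arbitrary: f)
  case (Suc k)
  obtain f' where f': "space_diff T k f'" "\<And>t z. t \<in> {0..T} \<Longrightarrow> (f t has_real_derivative f' t z) (at z)"
    using Suc.prems by auto
  show ?case
    by (rule space_diff_SucI[OF _ Suc.IH[OF f'(1)]])
      (use Suc.prems f' in \<open>auto intro: jointly_cont_time_int space_diff_jointly_cont time_int_deriv_z\<close>)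
qed (simp add: jointly_cont_time_int)

lemma time_int_eqI:
  assumes T: "t \<in> {0..T}" and d: "\<And>s. s \<in> {0..T} \<Longrightarrow> ((\<lambda>s. f s z) has_real_derivative g s z) (at s within {0..T})"
  shows "f t z - f 0 z = time_int g t z"
  unfolding time_int_def using T
  by (intro integral_unique[symmetric] fundamental_theorem_of_calculus)
     (auto simp: has_real_derivative_iff_has_vector_derivative[symmetric] intro!: DERIV_subset[OF d])

lemma time_int_bound:
  assumes "jointly_cont T f" "t \<in> {0..T}" "\<And>s. s \<in> {0..t} \<Longrightarrow> \<bar>f s z\<bar> \<le> B"
  shows "\<bar>time_int f t z\<bar> \<le> B * t"
proof -
  have "continuous_on {0..t} (\<lambda>s. f s z)" by (rule jointly_cont_compose[OF assms(1)]) (use assms in auto)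
  from integral_bound[OF _ this, of B] show ?thesis using assms by (auto simp: time_int_def)
qed

section \<open>Relation to smooth functions and their topology\<close>

lemma space_diff_deriv:
  assumes "\<And>k. space_diff T k f" shows "space_diff T k (\<lambda>t. deriv (f t))"
proof -
  obtain g where g: "space_diff T k g" "\<And>t z. t \<in> {0..T} \<Longrightarrow> (f t has_real_derivative g t z) (at z)"
    using space_diff_SucE[OF assms[of "Suc k"]] by metis
  have "space_diff T k g = space_diff T k (\<lambda>t. deriv (f t))"
    by (rule space_diff_cong) (use g(2) DERIV_imp_deriv in metis)
  thus ?thesis using g by simp
qed

lemma space_diff_deriv_iter:
  assumes "\<And>k. space_diff T k f" shows "space_diff T k (\<lambda>t. (deriv ^^ n) (f t))"
  using assms
proof (induction n arbitrary: k)
  case (Suc n)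
  have "space_diff T k (\<lambda>t. deriv ((deriv ^^ n) (f t)))" by (rule space_diff_deriv) (rule Suc.IH[OF Suc.prems])
  thus ?case by simp
qed simp

lemma space_diff_smooth:
  assumes "\<And>k. space_diff T k f" "t \<in> {0..T}" shows "smooth (f t)"
  unfolding smooth_def
proof (intro allI)
  fix n x
  obtain g where "(((deriv ^^ n) (f t)) has_real_derivative g t x) (at x)"
    using space_diff_SucE[OF space_diff_deriv_iter[OF assms(1), of "Suc 0" n]] assms(2) by metis
  thus "((deriv ^^ n) (f t)) field_differentiable (at x)" by (auto simp: field_differentiable_def)
qed

lemma jointly_cont_uniform_limit:
  assumes f: "jointly_cont T f" and t: "t \<in> {0..T}"
  shows "uniform_limit {- R..R} f (f t) (at t within {0..T})"
proof (rule uniform_limitI)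
  fix e :: real assume e: "e > 0"
  have "uniformly_continuous_on ({0..T} \<times> {- R..R}) (\<lambda>(t, z). f t z)"
    by (rule compact_uniformly_continuous)
      (use f in \<open>auto simp: jointly_cont_def intro!: compact_Times elim: continuous_on_subset\<close>)
  then obtain d where d: "d > 0" "\<And>p q. p \<in> {0..T} \<times> {- R..R} \<Longrightarrow> q \<in> {0..T} \<times> {- R..R} \<Longrightarrow>
      dist q p < d \<Longrightarrow> dist (case q of (t, z) \<Rightarrow> f t z) (case p of (t, z) \<Rightarrow> f t z) < e"
    using e unfolding uniformly_continuous_on_def by metis
  have "dist (f s x) (f t x) < e" if "s \<in> {0..T}" "dist s t < d" "x \<in> {- R..R}" for s x
    using d(2)[of "(t, x)" "(s, x)"] that t by (simp add: dist_Pair_Pair)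
  thus "\<forall>\<^sub>F s in at t within {0..T}. \<forall>x\<in>{- R..R}. dist (f s x) (f t x) < e"
    using d(1) unfolding eventually_at by blast
qed

lemma space_diff_continuous_into_smooth:
  assumes "\<And>k. space_diff T k f" shows "continuous_into_smooth T f"
  unfolding continuous_into_smooth_def
  using space_diff_smooth[OF assms] jointly_cont_uniform_limit[OF space_diff_jointly_cont[OF space_diff_deriv_iter[OF assms]]] by blast

lemma smooth_deriv: "smooth f \<Longrightarrow> (((deriv ^^ n) f) has_real_derivative (deriv ^^ Suc n) f x) (at x)"
  unfolding smooth_def using DERIV_deriv_iff_field_differentiable by auto

text \<open>Uniform convergence in time near z combines with the continuity of one slice. An
  arbitrary competitor in the uniqueness proof is known only through
  \<open>continuous_into_smooth\<close>, so this direction is needed as well.\<close>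

lemma continuous_into_smooth_jointly_cont:
  assumes c: "continuous_into_smooth T f" shows "jointly_cont T (\<lambda>t. (deriv ^^ n) (f t))"
proof -
  let ?g = "\<lambda>t. (deriv ^^ n) (f t)"
  have "\<exists>d>0. \<forall>p\<in>{0..T} \<times> UNIV. dist p (t, z) < d \<longrightarrow> dist (?g (fst p) (snd p)) (?g t z) < e"
    if t: "t \<in> {0..T}" and e: "0 < e" for t z e :: real
  proof -
  have "uniform_limit {- (\<bar>z\<bar> + 1)..\<bar>z\<bar> + 1} ?g (?g t) (at t within {0..T})"
    using c t unfolding continuous_into_smooth_def by blast
  hence "\<forall>\<^sub>F s in at t within {0..T}. \<forall>x\<in>{- (\<bar>z\<bar> + 1)..\<bar>z\<bar> + 1}. dist (?g s x) (?g t x) < e / 2"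
    using e by (intro uniform_limitD) auto
  then obtain d1 where d1: "d1 > 0" "\<And>s x. s \<in> {0..T} \<Longrightarrow> s \<noteq> t \<Longrightarrow> dist s t < d1 \<Longrightarrow>
      x \<in> {- (\<bar>z\<bar> + 1)..\<bar>z\<bar> + 1} \<Longrightarrow> dist (?g s x) (?g t x) < e / 2"
    unfolding eventually_at by blast
  have "isCont (?g t) z"
    using smooth_deriv[of "f t" n z] c t unfolding continuous_into_smooth_def by (blast intro: DERIV_isCont)
  then obtain d2 where d2: "d2 > 0" "\<And>y. dist y z < d2 \<Longrightarrow> dist (?g t y) (?g t z) < e / 2"
    using e unfolding continuous_at_eps_delta dist_real_def by (metis half_gt_zero)
  show ?thesis
  proof (intro exI[of _ "min 1 (min d1 d2)"] conjI ballI impI)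
    fix p assume p: "p \<in> {0..T} \<times> UNIV" "dist p (t, z) < min 1 (min d1 d2)"
    obtain s y where sy: "p = (s, y)" by (cases p)
    have 1: "dist s t \<le> dist p (t, z)" "dist y z \<le> dist p (t, z)"
      using dist_fst_le[of p "(t, z)"] dist_snd_le[of p "(t, z)"] by (auto simp: sy)
    have "y \<in> {- (\<bar>z\<bar> + 1)..\<bar>z\<bar> + 1}" using 1(2) p(2) by (auto simp: dist_real_def)
    \<comment> \<open>The limit s to t says nothing about s = t; there the distance is 0.\<close>
    hence "dist (?g s y) (?g t y) < e / 2"
      using d1(2)[of s y] 1 p e by (cases "s = t") (auto simp: sy)
    moreover have "dist (?g t y) (?g t z) < e / 2" using d2(2) 1 p by auto
    ultimately have "dist (?g s y) (?g t z) < e" 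
      using dist_triangle[of "?g s y" "?g t z" "?g t y"] by linarith
    thus "dist (?g (fst p) (snd p)) (?g t z) < e" by (simp add: sy)
  qed (use d1 d2 in auto)
  qed
  thus ?thesis unfolding jointly_cont_def continuous_on_iff case_prod_unfold by fastforce
qed

lemma smooth_space_diff:
  assumes "smooth f" shows "space_diff T k (\<lambda>_. f)"
proof -
  have "space_diff T k (\<lambda>_. (deriv ^^ n) f)" for n
  proof (induction k arbitrary: n)
    have c: "jointly_cont T (\<lambda>_. (deriv ^^ n) f)" for n
    proof -
      have "continuous_on UNIV ((deriv ^^ n) f)"
        using smooth_deriv[OF assms] by (meson DERIV_isCont continuous_at_imp_continuous_on)
      from continuous_on_compose2[OF this, of "{0..T} \<times> UNIV" snd]
      show ?thesis by (simp add: jointly_cont_def case_prod_unfold continuous_on_snd[OF continuous_on_id])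
    qed
    case 0 show ?case using c by simp
    case (Suc k) show ?case
      by (rule space_diff_SucI[OF c Suc[of "Suc n"]]) (rule smooth_deriv[OF assms])
  qed
  from this[of 0] show ?thesis by simp
qed

text \<open>
  The difference of \<open>W\<close> at two points solves a linear equation in time, so it is explicit, and
  dividing it by the distance leaves a continuous function (Caratheodory's form of the derivative).
\<close>

lemma riccati_deriv:
  assumes W: "jointly_cont T W" and G: "jointly_cont T G" and H: "jointly_cont T H"
    and Wt: "\<And>t z. t \<in> {0..T} \<Longrightarrow> ((\<lambda>s. W s z) has_real_derivative 2 / 3 * (W t z)\<^sup>2 - G t z) (at t within {0..T})"
    and Gz: "\<And>t z. t \<in> {0..T} \<Longrightarrow> (G t has_real_derivative H t z) (at z)"
    and w1: "\<And>z. (W 0 has_real_derivative w1 z) (at z)"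
    and t: "t \<in> {0..T}"
  shows "(W t has_real_derivative exp (4 / 3 * time_int W t z) *
     (w1 z - time_int (\<lambda>s z. exp (- (4 / 3 * time_int W s z)) * H s z) t z)) (at z)"
proof -
  note tw = jointly_cont_time_int[OF W]
  \<comment> \<open>The squares differ by (W y - W z) (W y + W z), so \<open>E\<close> is the
    integrating factor of the equation for W y - W z.\<close>
  define E where "E s y = exp (2 / 3 * (time_int W s y + time_int W s z))" for s y
  \<comment> \<open>The difference quotient of \<open>G\<close> in integral form, which stays
    continuous at y = z with value \<open>H\<close>.\<close>
  define q where "q s y = integral (cbox 0 1) (\<lambda>\<theta>. H s (z + \<theta> * (y - z)))" for s y
  have Ep: "E s y > 0" for s y by (simp add: E_def)
  have Ec: "continuous_on S (\<lambda>x. E (\<tau> x) (\<zeta> x))"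
    if "continuous_on S \<tau>" "continuous_on S \<zeta>" "\<And>x. x \<in> S \<Longrightarrow> \<tau> x \<in> {0..T}" for S :: "'a::topological_space set" and \<tau> \<zeta>
    unfolding E_def by (intro continuous_intros jointly_cont_compose[OF tw] that)
  have qG: "G s y - G s z = (y - z) * q s y" if s: "s \<in> {0..T}" for s y
  proof -
    have "((\<lambda>\<theta>. H s (z + \<theta> * (y - z)) * (y - z)) has_integral
       G s (z + 1 * (y - z)) - G s (z + 0 * (y - z))) {0..1}"
    proof (rule fundamental_theorem_of_calculus)
      fix \<theta> :: real
      have "((\<lambda>\<theta>. G s (z + \<theta> * (y - z))) has_real_derivative H s (z + \<theta> * (y - z)) * (y - z)) (at \<theta>)"
        by (rule DERIV_chain2[OF Gz[OF s]]) (auto intro!: derivative_eq_intros)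
      thus "((\<lambda>\<theta>. G s (z + \<theta> * (y - z))) has_vector_derivative H s (z + \<theta> * (y - z)) * (y - z)) (at \<theta> within {0..1})"
        by (auto simp: has_real_derivative_iff_has_vector_derivative intro: has_vector_derivative_at_within)
    qed simp
    from integral_unique[OF this] show ?thesis by (simp add: q_def mult.commute)
  qed
  have qc: "continuous_on ({0..T} \<times> UNIV) (\<lambda>p. q (fst p) (snd p))"
  proof -
    have "continuous_on ({0..T} \<times> (UNIV::real set)) (\<lambda>p. integral (cbox 0 1) ((\<lambda>p \<theta>. H (fst p) (z + \<theta> * (snd p - z))) p))"
    proof (rule integral_continuous_on_param)
      have "continuous_on (({0..T} \<times> (UNIV::real set)) \<times> cbox 0 1) (\<lambda>x. H (fst (fst x)) (z + snd x * (snd (fst x) - z)))"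
        by (rule jointly_cont_compose[OF H]) (auto intro!: continuous_intros)
      thus "continuous_on (({0..T} \<times> (UNIV::real set)) \<times> cbox 0 1) (\<lambda>(p, \<theta>). H (fst p) (z + \<theta> * (snd p - z)))"
        by (simp add: case_prod_unfold)
    qed
    thus ?thesis by (simp add: q_def)
  qed
  hence qj: "jointly_cont T q" by (simp add: jointly_cont_def case_prod_unfold)
  obtain g where g: "\<And>y. W 0 y - W 0 z = g y * (y - z)" "isCont g z" "g z = w1 z"
    using w1[of z] unfolding CARAT_DERIV by metis
  \<comment> \<open>The quotient (W y - W z) / (y - z) at time t, extended continuously to y =
    z.\<close>
  define r where "r y = E t y * (g y - integral (cbox 0 t) ((\<lambda>y s. q s y / E s y) y))" for y
  have main: "W t y - W t z = r y * (y - z)" for y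
  proof -
    have "((\<lambda>s. (W s y - W s z) / E s y) has_real_derivative - ((y - z) * (q s y / E s y))) (at s within {0..T})"
      if s: "s \<in> {0..T}" for s
    proof -
      have dE: "((\<lambda>s. E s y) has_real_derivative E s y * (2 / 3 * (W s y + W s z))) (at s within {0..T})"
        unfolding E_def using s by (auto intro!: derivative_eq_intros time_int_deriv_t[OF W])
      have "((\<lambda>s. (W s y - W s z) / E s y) has_real_derivative
         ((((2 / 3 * (W s y)\<^sup>2 - G s y) - (2 / 3 * (W s z)\<^sup>2 - G s z)) * E s y - (W s y - W s z) * (E s y * (2 / 3 * (W s y + W s z))))
         / (E s y * E s y))) (at s within {0..T})"
        by (intro DERIV_divide DERIV_diff Wt dE s) (use Ep[of s y] in simp)
      also have "(((2 / 3 * (W s y)\<^sup>2 - G s y) - (2 / 3 * (W s z)\<^sup>2 - G s z)) * E s y - (W s y - W s z) * (E s y * (2 / 3 * (W s y + W s z))))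
         = - (G s y - G s z) * E s y"
        by (simp add: field_simps power2_eq_square)
      also have "\<dots> / (E s y * E s y) = - ((y - z) * (q s y / E s y))"
        using Ep[of s y] by (simp add: qG[OF s])
      finally show ?thesis .
    qed
    from time_int_eqI[where f="\<lambda>s y. (W s y - W s z) / E s y" and z=y and g="\<lambda>s y. - ((y - z) * (q s y / E s y))", OF t this]
    have "(W t y - W t z) / E t y - (W 0 y - W 0 z) / E 0 y = integral {0..t} (\<lambda>s. - ((y - z) * (q s y / E s y)))"
      by (simp add: time_int_def)
    also have "\<dots> = - (y - z) * integral {0..t} (\<lambda>s. q s y / E s y)"
      by (simp only: integral_neg integral_mult_right mult_minus_left)
    also have "E 0 y = 1" by (simp add: E_def)
    finally have "(W t y - W t z) / E t y = (y - z) * (g y - integral {0..t} (\<lambda>s. q s y / E s y))"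
      unfolding g(1) by (simp add: algebra_simps)
    thus ?thesis using Ep[of t y] by (simp add: r_def field_simps)
  qed
  have "continuous_on UNIV (\<lambda>y. integral (cbox 0 t) ((\<lambda>y s. q s y / E s y) y))"
  proof (rule integral_continuous_on_param)
    have "continuous_on (UNIV \<times> cbox 0 t) (\<lambda>p. q (snd p) (fst p) / E (snd p) (fst p))"
      by (intro continuous_intros jointly_cont_compose[OF qj] Ec) (use t Ep in \<open>auto simp: less_imp_neq[symmetric]\<close>)
    thus "continuous_on (UNIV \<times> cbox 0 t) (\<lambda>(y, s). q s y / E s y)" by (simp add: case_prod_unfold)
  qed
  hence c1: "isCont (\<lambda>y. integral (cbox 0 t) ((\<lambda>y s. q s y / E s y) y)) z"
    by (simp add: continuous_on_eq_continuous_at)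
  have "continuous_on UNIV (\<lambda>y. E t y)" by (intro Ec) (use t in auto)
  hence c2: "isCont (\<lambda>y. E t y) z" by (simp add: continuous_on_eq_continuous_at)
  have "isCont r z" unfolding r_def[abs_def] by (intro continuous_intros c1 c2 g)
  moreover have "r z = exp (4 / 3 * time_int W t z) * (w1 z - time_int (\<lambda>s z. exp (- (4 / 3 * time_int W s z)) * H s z) t z)"
  proof -
    have Ez: "E s z = exp (4 / 3 * time_int W s z)" for s by (simp add: E_def)
    have "(\<lambda>s. q s z / E s z) = (\<lambda>s. exp (- (4 / 3 * time_int W s z)) * H s z)"
      by (intro ext) (simp add: q_def Ez exp_minus field_simps)
    thus ?thesis unfolding r_def time_int_def[of "\<lambda>s z. exp (- (4 / 3 * time_int W s z)) * H s z" t z]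
      by (simp only: Ez g(3) cbox_interval)
  qed
  ultimately show ?thesis using main unfolding CARAT_DERIV by (intro exI[of _ r] conjI allI) auto
qed

section \<open>The Lagrangian system\<close>

lemma picard_lindeloef:
  fixes \<Phi> :: "'a::banach \<Rightarrow> 'a"
  assumes L: "\<And>x y. x \<in> cball X0 \<rho> \<Longrightarrow> y \<in> cball X0 \<rho> \<Longrightarrow> dist (\<Phi> x) (\<Phi> y) \<le> L * dist x y"
    and B: "\<And>x. x \<in> cball X0 \<rho> \<Longrightarrow> norm (\<Phi> x) \<le> B"
    and T: "0 \<le> T" "T * B \<le> \<rho>" "T * L < 1" and L0: "0 \<le> L" and \<rho>: "0 \<le> \<rho>"
  obtains X where "X 0 = X0" "\<And>t. X t \<in> cball X0 \<rho>" "continuous_on {0..T} X"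
    "\<And>t. t \<in> {0..T} \<Longrightarrow> (X has_vector_derivative \<Phi> (X t)) (at t within {0..T})"
proof -
  \<comment> \<open>Time is clamped to [0, T] because the fixed point is sought among bounded
    continuous functions on the whole line, a complete space; this also keeps \<open>X t\<close> in
    the ball for every real t.\<close>
  define cl where "cl t = max 0 (min t T)" for t
  have cl: "cl t \<in> {0..T}" "t \<in> {0..T} \<Longrightarrow> cl t = t" for t using T by (auto simp: cl_def)
  have clc: "continuous_on UNIV cl" unfolding cl_def by (intro continuous_intros)
  have \<Phi>c: "continuous_on (cball X0 \<rho>) \<Phi>"
  proof (rule lipschitz_on_continuous_on)
    show "L-lipschitz_on (cball X0 \<rho>) \<Phi>" using L L0 by (intro lipschitz_onI) auto
  qed
  define S :: "(real \<Rightarrow>\<^sub>C 'a) set" where "S = PiC UNIV (\<lambda>_. cball X0 \<rho>)"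
  have SD: "x t \<in> cball X0 \<rho>" if "x \<in> S" for x t using that by (auto simp: S_def mem_PiC_iff)
  define P where "P x t = X0 + integral {0..cl t} (\<lambda>s. \<Phi> (x s))" for x t
  have ci: "continuous_on A (\<lambda>s. \<Phi> (apply_bcontfun x s))" if "x \<in> S" for x :: "real \<Rightarrow>\<^sub>C 'a" and A
    using SD[OF that] by (intro continuous_on_compose2[OF \<Phi>c]) auto
  have ic: "(\<lambda>s. \<Phi> (apply_bcontfun x s)) integrable_on {0..t}" if "x \<in> S" for x :: "real \<Rightarrow>\<^sub>C 'a" and t
    by (intro integrable_continuous_real ci that)
  have B0: "0 \<le> B" using order_trans[OF norm_ge_zero B[of X0]] \<rho> by simp
  have Pball: "P (apply_bcontfun x) t \<in> cball X0 \<rho>" if "x \<in> S" for x :: "real \<Rightarrow>\<^sub>C 'a" and t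
  proof -
    have "norm (integral {0..cl t} (\<lambda>s. \<Phi> (apply_bcontfun x s))) \<le> B * (cl t - 0)"
      using cl(1)[of t] B SD[OF that] by (intro integral_bound ci that) auto
    also have "\<dots> \<le> T * B" using cl(1)[of t] B0 by (simp add: mult.commute mult_left_mono)
    finally show ?thesis using T by (simp add: P_def dist_norm)
  qed
  have Pc: "continuous_on UNIV (P (apply_bcontfun x))" if "x \<in> S" for x :: "real \<Rightarrow>\<^sub>C 'a"
  proof -
    have "continuous_on {0..T} (\<lambda>t. integral {0..t} (\<lambda>s. \<Phi> (apply_bcontfun x s)))"
      by (rule indefinite_integral_continuous_1) (rule ic[OF that])
    moreover have "range cl \<subseteq> {0..T}" using cl(1) by blast
    ultimately have "continuous_on UNIV (\<lambda>t. integral {0..cl t} (\<lambda>s. \<Phi> (apply_bcontfun x s)))"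
      by (rule continuous_on_compose2[OF _ clc])
    thus ?thesis unfolding P_def by (intro continuous_intros)
  qed
  have Pb: "P (apply_bcontfun x) \<in> bcontfun" if "x \<in> S" for x :: "real \<Rightarrow>\<^sub>C 'a"
  proof -
    have "range (P (apply_bcontfun x)) \<subseteq> cball X0 \<rho>" using Pball[OF that] by blast
    thus ?thesis using Pc[OF that] bounded_subset[OF bounded_cball] by (auto simp: bcontfun_def)
  qed
  define Q where "Q x = Bcontfun (P (apply_bcontfun x))" for x :: "real \<Rightarrow>\<^sub>C 'a"
  have Q: "apply_bcontfun (Q x) = P (apply_bcontfun x)" if "x \<in> S" for x
    unfolding Q_def using Bcontfun_inverse[OF Pb[OF that]] .
  have "closed S" unfolding S_def by (intro closed_PiC) auto
  hence "\<exists>!x\<in>S. Q x = x"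
  proof (rule Banach_fix[where c="T * L", OF complete_eq_closed[THEN iffD2]])
    have "const_bcontfun X0 \<in> S" using \<rho> by (auto simp: S_def mem_PiC_iff const_bcontfun.rep_eq)
    thus "S \<noteq> {}" by auto
    show "Q ` S \<subseteq> S" using Pball Q by (auto simp: S_def mem_PiC_iff)
    fix x y assume xy: "x \<in> S" "y \<in> S"
    show "dist (Q x) (Q y) \<le> T * L * dist x y"
    proof (rule dist_bound)
      fix t
      have "dist (Q x t) (Q y t) = norm (integral {0..cl t} (\<lambda>s. \<Phi> (x s) - \<Phi> (y s)))"
        using xy by (simp add: Q P_def dist_norm Henstock_Kurzweil_Integration.integral_diff ic)
      also have "\<dots> \<le> (L * dist x y) * (cl t - 0)"
      proof (rule integral_bound)
        show "norm (\<Phi> (x s) - \<Phi> (y s)) \<le> L * dist x y" for s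
          using L[OF SD[OF xy(1)] SD[OF xy(2)], of s s] mult_left_mono[OF dist_bounded[of x s y] L0]
          by (simp add: dist_norm)
      qed (use cl(1)[of t] xy in \<open>auto intro!: continuous_intros ci\<close>)
      also have "\<dots> \<le> (L * dist x y) * T" using cl(1)[of t] L0 by (intro mult_left_mono) auto
      finally show "dist (Q x t) (Q y t) \<le> T * L * dist x y" by (simp add: mult_ac)
    qed
  qed (use T L0 in auto)
  then obtain x where x: "x \<in> S" "Q x = x" by blast
  have eq: "x t = X0 + integral {0..cl t} (\<lambda>s. \<Phi> (x s))" for t
    using fun_cong[OF Q[OF x(1)], of t] x(2) by (simp add: P_def)
  have eqT: "x t = X0 + integral {0..t} (\<lambda>s. \<Phi> (x s))" if "t \<in> {0..T}" for t
    using eq[of t] unfolding cl(2)[OF that] .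
  show thesis
  proof (rule that[of "apply_bcontfun x"])
    show "x 0 = X0" using eq[of 0] T by (simp add: cl_def)
    show "x t \<in> cball X0 \<rho>" for t by (rule SD[OF x(1)])
    fix t assume t: "t \<in> {0..T}"
    have "((\<lambda>t. X0 + integral {0..t} (\<lambda>s. \<Phi> (x s))) has_vector_derivative 0 + \<Phi> (x t)) (at t within {0..T})"
      by (intro has_vector_derivative_add has_vector_derivative_const integral_has_vector_derivative ci x t)
    hence "((\<lambda>t. X0 + integral {0..t} (\<lambda>s. \<Phi> (x s))) has_vector_derivative \<Phi> (x t)) (at t within {0..T})"
      by simp
    thus "(apply_bcontfun x has_vector_derivative \<Phi> (x t)) (at t within {0..T})"
      by (rule has_vector_derivative_transform[OF t, rotated]) (rule eqT)
  qed simp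
qed

instance bcontfun :: (metric_space, banach) banach ..

type_synonym bcf = "real \<Rightarrow>\<^sub>C real"
type_synonym lstate = "bcf \<times> bcf \<times> bcf"

abbreviation cU :: "lstate \<Rightarrow> real \<Rightarrow> real" where "cU X \<equiv> apply_bcontfun (fst X)"
abbreviation cW :: "lstate \<Rightarrow> real \<Rightarrow> real" where "cW X \<equiv> apply_bcontfun (fst (snd X))"
abbreviation cR :: "lstate \<Rightarrow> real \<Rightarrow> real" where "cR X \<equiv> apply_bcontfun (snd (snd X))"

text \<open>Contains the ball of radius 1 / 2 around any start with |U|, |W| at most 1 and R = 1,
  and makes every \<open>cR X\<close> admissible.\<close>

definition states :: "lstate set" where
  "states = {X. \<forall>z. \<bar>cU X z\<bar> \<le> 2 \<and> \<bar>cW X z\<bar> \<le> 2 \<and> 1 / 2 \<le> cR X z \<and> cR X z \<le> 2}"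

text \<open>Closure properties of \<open>tame\<close> replace a product on bounded continuous functions, which the library lacks.\<close>

definition tame :: "(lstate \<Rightarrow> real \<Rightarrow> real) \<Rightarrow> bool" where
  "tame \<Psi> \<longleftrightarrow> (\<forall>X\<in>states. continuous_on UNIV (\<Psi> X)) \<and> (\<exists>B. \<forall>X\<in>states. \<forall>z. \<bar>\<Psi> X z\<bar> \<le> B) \<and>
     (\<exists>L. 0 \<le> L \<and> (\<forall>X\<in>states. \<forall>Y\<in>states. \<forall>z. \<bar>\<Psi> X z - \<Psi> Y z\<bar> \<le> L * dist X Y))"

lemma tameI:
  assumes "\<And>X. X \<in> states \<Longrightarrow> continuous_on UNIV (\<Psi> X)" "\<And>X z. X \<in> states \<Longrightarrow> \<bar>\<Psi> X z\<bar> \<le> B" "0 \<le> L"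
    "\<And>X Y z. X \<in> states \<Longrightarrow> Y \<in> states \<Longrightarrow> \<bar>\<Psi> X z - \<Psi> Y z\<bar> \<le> L * dist X Y"
  shows "tame \<Psi>"
  using assms unfolding tame_def by blast

lemma tameE:
  assumes "tame \<Psi>"
  obtains B L where "\<And>X. X \<in> states \<Longrightarrow> continuous_on UNIV (\<Psi> X)" "0 \<le> B" "\<And>X z. X \<in> states \<Longrightarrow> \<bar>\<Psi> X z\<bar> \<le> B" "0 \<le> L"
    "\<And>X Y z. X \<in> states \<Longrightarrow> Y \<in> states \<Longrightarrow> \<bar>\<Psi> X z - \<Psi> Y z\<bar> \<le> L * dist X Y"
proof -
  obtain B L where BL: "\<And>X. X \<in> states \<Longrightarrow> continuous_on UNIV (\<Psi> X)" "\<And>X z. X \<in> states \<Longrightarrow> \<bar>\<Psi> X z\<bar> \<le> B" "0 \<le> L"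
    "\<And>X Y z. X \<in> states \<Longrightarrow> Y \<in> states \<Longrightarrow> \<bar>\<Psi> X z - \<Psi> Y z\<bar> \<le> L * dist X Y"
    using assms unfolding tame_def by blast
  have "\<bar>\<Psi> X z\<bar> \<le> \<bar>B\<bar>" if "X \<in> states" for X z using BL(2)[OF that, of z] by linarith
  thus thesis using BL that[of "\<bar>B\<bar>" L] by auto
qed

lemma comp_dist:
  "\<bar>cU X z - cU Y z\<bar> \<le> dist X Y" "\<bar>cW X z - cW Y z\<bar> \<le> dist X Y" "\<bar>cR X z - cR Y z\<bar> \<le> dist X Y"
proof -
  show "\<bar>cU X z - cU Y z\<bar> \<le> dist X Y"
    using dist_bounded[of "fst X" z "fst Y"] dist_fst_le[of X Y] by (simp add: dist_real_def)
  have 2: "dist (snd X) (snd Y) \<le> dist X Y" by (rule dist_snd_le)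
  show "\<bar>cW X z - cW Y z\<bar> \<le> dist X Y"
    using dist_bounded[of "fst (snd X)" z "fst (snd Y)"] dist_fst_le[of "snd X" "snd Y"] 2 by (simp add: dist_real_def)
  show "\<bar>cR X z - cR Y z\<bar> \<le> dist X Y"
    using dist_bounded[of "snd (snd X)" z "snd (snd Y)"] dist_snd_le[of "snd X" "snd Y"] 2 by (simp add: dist_real_def)
qed

lemma states_D:
  assumes "X \<in> states" shows "\<bar>cU X z\<bar> \<le> 2" "\<bar>cW X z\<bar> \<le> 2" "1 / 2 \<le> cR X z" "cR X z \<le> 2" "admissible (cR X)"
  using assms by (auto simp: states_def admissible_def)

lemma tame_comp: "tame cU" "tame cW" "tame cR"
proof -
  have r: "\<bar>cR X z\<bar> \<le> 2" if "X \<in> states" for X z using states_D(3,4)[OF that, of z] by linarith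
  show "tame cU" "tame cW" "tame cR"
    by (rule tameI[where B=2 and L=1]; use comp_dist states_D r in simp)+
qed

lemma tame_const: "tame (\<lambda>X z. c)"
  by (rule tameI[where B="\<bar>c\<bar>" and L=0]) auto

lemma tame_add: assumes "tame f" "tame g" shows "tame (\<lambda>X z. f X z + g X z)"
proof -
  obtain B1 L1 where 1: "\<And>X. X \<in> states \<Longrightarrow> continuous_on UNIV (f X)" "0 \<le> B1" "\<And>X z. X \<in> states \<Longrightarrow> \<bar>f X z\<bar> \<le> B1" "0 \<le> L1"
    "\<And>X Y z. X \<in> states \<Longrightarrow> Y \<in> states \<Longrightarrow> \<bar>f X z - f Y z\<bar> \<le> L1 * dist X Y" using tameE[OF assms(1)] by metis
  obtain B2 L2 where 2: "\<And>X. X \<in> states \<Longrightarrow> continuous_on UNIV (g X)" "0 \<le> B2" "\<And>X z. X \<in> states \<Longrightarrow> \<bar>g X z\<bar> \<le> B2" "0 \<le> L2"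
    "\<And>X Y z. X \<in> states \<Longrightarrow> Y \<in> states \<Longrightarrow> \<bar>g X z - g Y z\<bar> \<le> L2 * dist X Y" using tameE[OF assms(2)] by metis
  show ?thesis
  proof (rule tameI[where B="B1 + B2" and L="L1 + L2"])
    fix X Y z assume XY: "X \<in> states" "Y \<in> states"
    show "\<bar>f X z + g X z\<bar> \<le> B1 + B2" using 1(3)[OF XY(1), of z] 2(3)[OF XY(1), of z] by linarith
    show "\<bar>f X z + g X z - (f Y z + g Y z)\<bar> \<le> (L1 + L2) * dist X Y"
      using 1(5)[OF XY, of z] 2(5)[OF XY, of z] by (simp add: distrib_right)
  qed (use 1 2 in \<open>auto intro!: continuous_intros\<close>)
qed

lemma tame_mult: assumes "tame f" "tame g" shows "tame (\<lambda>X z. f X z * g X z)"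
proof -
  obtain B1 L1 where 1: "\<And>X. X \<in> states \<Longrightarrow> continuous_on UNIV (f X)" "0 \<le> B1" "\<And>X z. X \<in> states \<Longrightarrow> \<bar>f X z\<bar> \<le> B1" "0 \<le> L1"
    "\<And>X Y z. X \<in> states \<Longrightarrow> Y \<in> states \<Longrightarrow> \<bar>f X z - f Y z\<bar> \<le> L1 * dist X Y" using tameE[OF assms(1)] by metis
  obtain B2 L2 where 2: "\<And>X. X \<in> states \<Longrightarrow> continuous_on UNIV (g X)" "0 \<le> B2" "\<And>X z. X \<in> states \<Longrightarrow> \<bar>g X z\<bar> \<le> B2" "0 \<le> L2"
    "\<And>X Y z. X \<in> states \<Longrightarrow> Y \<in> states \<Longrightarrow> \<bar>g X z - g Y z\<bar> \<le> L2 * dist X Y" using tameE[OF assms(2)] by metis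
  show ?thesis
  proof (rule tameI[where B="B1 * B2" and L="B1 * L2 + L1 * B2"])
    fix X Y z assume XY: "X \<in> states" "Y \<in> states"
    show "\<bar>f X z * g X z\<bar> \<le> B1 * B2"
      unfolding abs_mult using 1 2 XY by (intro mult_mono) auto
    have "\<bar>f X z * g X z - f Y z * g Y z\<bar> = \<bar>f X z * (g X z - g Y z) + (f X z - f Y z) * g Y z\<bar>"
      by (simp add: algebra_simps)
    also have "\<dots> \<le> \<bar>f X z\<bar> * \<bar>g X z - g Y z\<bar> + \<bar>f X z - f Y z\<bar> * \<bar>g Y z\<bar>"
      by (metis abs_mult abs_triangle_ineq)
    also have "\<dots> \<le> B1 * (L2 * dist X Y) + (L1 * dist X Y) * B2"
      using 1 2 XY by (intro add_mono mult_mono) auto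
    finally show "\<bar>f X z * g X z - f Y z * g Y z\<bar> \<le> (B1 * L2 + L1 * B2) * dist X Y"
      by (simp add: algebra_simps)
  qed (use 1 2 in \<open>auto intro!: continuous_intros\<close>)
qed

lemma tame_cmult: "tame f \<Longrightarrow> tame (\<lambda>X z. c * f X z)"
  using tame_mult[OF tame_const] .

lemma tame_diff: "tame f \<Longrightarrow> tame g \<Longrightarrow> tame (\<lambda>X z. f X z - g X z)"
  using tame_add[OF _ tame_cmult[of g "- 1"], of f] by simp

lemma tame_power2: "tame f \<Longrightarrow> tame (\<lambda>X z. (f X z)\<^sup>2)"
  unfolding power2_eq_square by (rule tame_mult)

text \<open>This is what makes the system an ordinary differential equation: varying
  \<open>R\<close> inside the kernel costs no derivative.\<close>

lemma tame_resolvents: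
  assumes "tame f" and c: "c > 0"
  shows "tame (\<lambda>X. resolvent c (cR X) (f X))" "tame (\<lambda>X. resolvent_deriv c (cR X) (f X))"
proof -
  obtain B L where 1: "\<And>X. X \<in> states \<Longrightarrow> continuous_on UNIV (f X)" "0 \<le> B" "\<And>X z. X \<in> states \<Longrightarrow> \<bar>f X z\<bar> \<le> B" "0 \<le> L"
    "\<And>X Y z. X \<in> states \<Longrightarrow> Y \<in> states \<Longrightarrow> \<bar>f X z - f Y z\<bar> \<le> L * dist X Y" using tameE[OF assms(1)] by metis
  have m: "f X \<in> borel_measurable borel" if "X \<in> states" for X
    using 1(1)[OF that] by (rule borel_measurable_continuous_onI)
  note cont = resolvents_deriv[OF states_D(5) c 1(1) 1(3)]
  note bd = resolvents_bound[OF states_D(5) c m 1(3)]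
  note lip = resolvents_lipschitz[OF states_D(5) states_D(5) c m m 1(3) comp_dist(3) 1(5)]
  show "tame (\<lambda>X. resolvent c (cR X) (f X))"
  proof (rule tameI[where B="4 * B" and L="4 * L + 10 * B"])
    fix X Y z assume XY: "X \<in> states" "Y \<in> states"
    show "continuous_on UNIV (resolvent c (cR X) (f X))"
      using cont(1)[OF XY(1) XY(1) XY(1)] by (meson DERIV_isCont continuous_at_imp_continuous_on)
    show "\<bar>resolvent c (cR X) (f X) z\<bar> \<le> 4 * B" using bd(1)[OF XY(1) XY(1) XY(1)] .
    show "\<bar>resolvent c (cR X) (f X) z - resolvent c (cR Y) (f Y) z\<bar> \<le> (4 * L + 10 * B) * dist X Y"
      using lip(1)[OF XY(1) XY(2) XY(1) XY(2) XY(1) XY(1) XY(2), of z] by (simp add: algebra_simps)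
  qed (use 1 in auto)
  show "tame (\<lambda>X. resolvent_deriv c (cR X) (f X))"
  proof (rule tameI[where B="4 * c * B" and L="c * (4 * L + 10 * B)"])
    fix X Y z assume XY: "X \<in> states" "Y \<in> states"
    show "continuous_on UNIV (resolvent_deriv c (cR X) (f X))"
      using cont(2)[OF XY(1) XY(1) XY(1)] by (meson DERIV_isCont continuous_at_imp_continuous_on)
    show "\<bar>resolvent_deriv c (cR X) (f X) z\<bar> \<le> 4 * c * B" using bd(2)[OF XY(1) XY(1) XY(1)] .
    show "\<bar>resolvent_deriv c (cR X) (f X) z - resolvent_deriv c (cR Y) (f Y) z\<bar> \<le> (c * (4 * L + 10 * B)) * dist X Y"
      using lip(2)[OF XY(1) XY(2) XY(1) XY(2) XY(1) XY(1) XY(2), of z] by (simp add: algebra_simps)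
  qed (use 1 c in auto)
qed

text \<open>The Lipschitz bound controls a change of time uniformly in z, which leaves continuity in
  z at a fixed time.\<close>

lemma tame_jointly_cont:
  assumes \<Psi>: "tame \<Psi>" and X: "continuous_on {0..T} X" "\<And>t. X t \<in> states"
  shows "jointly_cont T (\<lambda>t. \<Psi> (X t))"
proof -
  obtain B L where 1: "\<And>X. X \<in> states \<Longrightarrow> continuous_on UNIV (\<Psi> X)" "0 \<le> L"
    "\<And>X Y z. X \<in> states \<Longrightarrow> Y \<in> states \<Longrightarrow> \<bar>\<Psi> X z - \<Psi> Y z\<bar> \<le> L * dist X Y" using tameE[OF \<Psi>] by metis
  have "((\<lambda>p. \<Psi> (X (fst p)) (snd p)) \<longlongrightarrow> \<Psi> (X t) z) (at (t, z) within {0..T} \<times> UNIV)" if t: "t \<in> {0..T}" for t z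
  proof -
    let ?net = "at (t, z) within {0..T} \<times> (UNIV :: real set)"
    have s: "((\<lambda>p. snd p) \<longlongrightarrow> z) ?net"
      using tendsto_snd[of "\<lambda>p. p" "(t, z)" ?net] tendsto_ident_at[of "(t, z)"] by simp
    have a: "((\<lambda>p. \<Psi> (X t) (snd p)) \<longlongrightarrow> \<Psi> (X t) z) ?net"
      using continuous_on_tendsto_compose[OF 1(1)[OF X(2)[of t]] s] by simp
    have "continuous_on ({0..T} \<times> (UNIV :: real set)) (\<lambda>p. X (fst p))"
      by (rule continuous_on_compose2[OF X(1)]) (auto intro: continuous_on_fst)
    hence "((\<lambda>p. X (fst p)) \<longlongrightarrow> X t) ?net"
      using t unfolding continuous_on_def by fastforce
    hence "((\<lambda>p. L * dist (X (fst p)) (X t)) \<longlongrightarrow> L * 0) ?net"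
      by (intro tendsto_mult tendsto_const) (simp flip: tendsto_dist_iff)
    hence l0: "((\<lambda>p. L * dist (X (fst p)) (X t)) \<longlongrightarrow> 0) ?net" by simp
    have "\<forall>\<^sub>F p in ?net. norm (\<Psi> (X (fst p)) (snd p) - \<Psi> (X t) (snd p)) \<le> L * dist (X (fst p)) (X t)"
      using 1(3)[OF X(2) X(2)] by (intro always_eventually) simp
    hence "((\<lambda>p. \<Psi> (X (fst p)) (snd p) - \<Psi> (X t) (snd p)) \<longlongrightarrow> 0) ?net"
      using l0 by (rule Lim_null_comparison)
    from tendsto_add[OF this a] show ?thesis by simp
  qed
  thus ?thesis unfolding jointly_cont_def continuous_on_def by (auto simp: case_prod_unfold)
qed

section \<open>The force and its derivatives in Lagrangian coordinates\<close>

text \<open>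
  With \<open>a = 1/\<bar>\<alpha>\<bar>\<close>, \<open>b = 1/\<bar>\<beta>\<bar>\<close> and the constants \<open>p1, p2, p3\<close> of lemma \<open>F_eq_nonlocal_force\<close>, this is
  \<open>F(u) \<circ> q\<close>. The derivatives of order three in \<open>F\<^sub>4\<close> are removed by
  \<open>\<partial>\<^sub>x\<^sub>x (1 - a\<^sup>-\<^sup>2 \<partial>\<^sub>x\<^sub>x)\<^sup>-\<^sup>1 = a\<^sup>2 ((1 - a\<^sup>-\<^sup>2 \<partial>\<^sub>x\<^sub>x)\<^sup>-\<^sup>1 - 1)\<close>. Likewise \<open>force_slope\<close> is
  \<open>\<partial>\<^sub>x F(u) + 5/3 u\<^sub>x\<^sup>2\<close> and \<open>force_curv\<close> its derivative.
\<close>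

definition nonlocal_force :: "real \<Rightarrow> real \<Rightarrow> real \<Rightarrow> real \<Rightarrow> real \<Rightarrow> (real \<Rightarrow> real) \<Rightarrow> (real \<Rightarrow> real) \<Rightarrow> (real \<Rightarrow> real) \<Rightarrow> real \<Rightarrow> real" where
  "nonlocal_force a b p1 p2 p3 U W R z = p1 * resolvent_deriv a R (resolvent b R (\<lambda>y. (U y)\<^sup>2)) z + p2 * resolvent_deriv a R (resolvent b R (\<lambda>y. (W y)\<^sup>2)) z
     + p3 * resolvent_deriv b R (\<lambda>y. (W y)\<^sup>2) z"

definition force_slope :: "real \<Rightarrow> real \<Rightarrow> real \<Rightarrow> real \<Rightarrow> real \<Rightarrow> (real \<Rightarrow> real) \<Rightarrow> (real \<Rightarrow> real) \<Rightarrow> (real \<Rightarrow> real) \<Rightarrow> real \<Rightarrow> real" where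
  "force_slope a b p1 p2 p3 U W R z =
     p1 * (a\<^sup>2 * (resolvent a R (resolvent b R (\<lambda>y. (U y)\<^sup>2)) z - resolvent b R (\<lambda>y. (U y)\<^sup>2) z))
     + p2 * (a\<^sup>2 * (resolvent a R (resolvent b R (\<lambda>y. (W y)\<^sup>2)) z - resolvent b R (\<lambda>y. (W y)\<^sup>2) z))
     + p3 * (b\<^sup>2 * resolvent b R (\<lambda>y. (W y)\<^sup>2) z)"

definition force_curv :: "real \<Rightarrow> real \<Rightarrow> real \<Rightarrow> real \<Rightarrow> real \<Rightarrow> (real \<Rightarrow> real) \<Rightarrow> (real \<Rightarrow> real) \<Rightarrow> (real \<Rightarrow> real) \<Rightarrow> real \<Rightarrow> real" where
  "force_curv a b p1 p2 p3 U W R z =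
     p1 * (a\<^sup>2 * (resolvent_deriv a R (resolvent b R (\<lambda>y. (U y)\<^sup>2)) z - resolvent_deriv b R (\<lambda>y. (U y)\<^sup>2) z))
     + p2 * (a\<^sup>2 * (resolvent_deriv a R (resolvent b R (\<lambda>y. (W y)\<^sup>2)) z - resolvent_deriv b R (\<lambda>y. (W y)\<^sup>2) z))
     + p3 * (b\<^sup>2 * resolvent_deriv b R (\<lambda>y. (W y)\<^sup>2) z)"

text \<open>Only the last summand of the force leaves a term local in \<open>W\<close>. With p3 b^2
  = 5/3 this term changes the - W^2 of the differentiated transport equation into + 2/3 W^2.\<close>

lemma forces_deriv:
  assumes R: "admissible R" and ab: "a > 0" "b > 0"
    and U: "continuous_on UNIV U" "\<And>y. \<bar>U y\<bar> \<le> M" and W: "continuous_on UNIV W" "\<And>y. \<bar>W y\<bar> \<le> M"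
  shows "(nonlocal_force a b p1 p2 p3 U W R has_real_derivative R z * (force_slope a b p1 p2 p3 U W R z - p3 * (b\<^sup>2 * (W z)\<^sup>2))) (at z)"
    and "(force_slope a b p1 p2 p3 U W R has_real_derivative R z * force_curv a b p1 p2 p3 U W R z) (at z)"
proof -
  have sq: "\<bar>(f y)\<^sup>2\<bar> \<le> M\<^sup>2" if "\<And>y. \<bar>f y\<bar> \<le> M" for f :: "real \<Rightarrow> real" and y
    by (rule abs_square_le[OF that])
  have U2: "continuous_on UNIV (\<lambda>y. (U y)\<^sup>2)" "\<And>y. \<bar>(U y)\<^sup>2\<bar> \<le> M\<^sup>2" using U sq[of U] by (auto intro!: continuous_intros)
  have W2: "continuous_on UNIV (\<lambda>y. (W y)\<^sup>2)" "\<And>y. \<bar>(W y)\<^sup>2\<bar> \<le> M\<^sup>2" using W sq[of W] by (auto intro!: continuous_intros)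
  note dU = resolvents_deriv[OF R ab(2) U2] and dW = resolvents_deriv[OF R ab(2) W2]
  have cont: "continuous_on UNIV (resolvent b R f)" if "continuous_on UNIV f" "\<And>y. \<bar>f y\<bar> \<le> M\<^sup>2" for f
    using resolvents_deriv(1)[OF R ab(2) that] by (meson DERIV_isCont continuous_at_imp_continuous_on)
  have bd: "\<bar>resolvent b R f y\<bar> \<le> 4 * M\<^sup>2" if "continuous_on UNIV f" "\<And>y. \<bar>f y\<bar> \<le> M\<^sup>2" for f y
    by (rule resolvents_bound(1)[OF R ab(2) borel_measurable_continuous_onI[OF that(1)] that(2)])
  note eU = resolvents_deriv[OF R ab(1) cont[OF U2] bd[OF U2]] and eW = resolvents_deriv[OF R ab(1) cont[OF W2] bd[OF W2]]
  show "(nonlocal_force a b p1 p2 p3 U W R has_real_derivative R z * (force_slope a b p1 p2 p3 U W R z - p3 * (b\<^sup>2 * (W z)\<^sup>2))) (at z)"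
    unfolding nonlocal_force_def[abs_def] force_slope_def
    by (rule DERIV_cong[OF DERIV_add[OF DERIV_add[OF DERIV_cmult[OF eU(2)] DERIV_cmult[OF eW(2)]] DERIV_cmult[OF dW(2)]]])
      (simp add: algebra_simps)
  show "(force_slope a b p1 p2 p3 U W R has_real_derivative R z * force_curv a b p1 p2 p3 U W R z) (at z)"
    unfolding force_slope_def[abs_def] force_curv_def
    by (rule DERIV_cong[OF DERIV_add[OF DERIV_add[OF DERIV_cmult[OF DERIV_cmult[OF DERIV_diff[OF eU(1) dU(1)]]]
            DERIV_cmult[OF DERIV_cmult[OF DERIV_diff[OF eW(1) dW(1)]]]] DERIV_cmult[OF DERIV_cmult[OF dW(1)]]]])
      (simp add: algebra_simps)
qed

lemma tame_nonlocal_force: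
  assumes "a > 0" "b > 0"
  shows "tame (\<lambda>X. nonlocal_force a b p1 p2 p3 (cU X) (cW X) (cR X))" "tame (\<lambda>X. force_slope a b p1 p2 p3 (cU X) (cW X) (cR X))"
    "tame (\<lambda>X. force_curv a b p1 p2 p3 (cU X) (cW X) (cR X))"
  unfolding nonlocal_force_def[abs_def] force_slope_def[abs_def] force_curv_def[abs_def]
  by (intro tame_add tame_cmult tame_diff tame_resolvents tame_power2 tame_comp assms)+

lemma bcontfun_eval_deriv:
  assumes "(X has_vector_derivative Y) net"
  shows "((\<lambda>t. cU (X t) z) has_vector_derivative cU Y z) net" "((\<lambda>t. cW (X t) z) has_vector_derivative cW Y z) net"
    "((\<lambda>t. cR (X t) z) has_vector_derivative cR Y z) net"
proof -
  have e: "bounded_linear (\<lambda>f :: bcf. f z)"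
    by (rule bounded_linear_intro[where K=1]) (use norm_bounded[where x=z, where 'b=real] in auto)
  note f = bounded_linear.has_vector_derivative[OF bounded_linear_fst] and s = bounded_linear.has_vector_derivative[OF bounded_linear_snd]
  note E = bounded_linear.has_vector_derivative[OF e]
  show "((\<lambda>t. cU (X t) z) has_vector_derivative cU Y z) net" by (rule E[OF f[OF assms]])
  show "((\<lambda>t. cW (X t) z) has_vector_derivative cW Y z) net" by (rule E[OF f[OF s[OF assms]]])
  show "((\<lambda>t. cR (X t) z) has_vector_derivative cR Y z) net" by (rule E[OF s[OF s[OF assms]]])
qed

text \<open>Bounds and Lipschitz constants are uniform on \<open>states\<close>, so
  \<open>T0\<close> is chosen before the data. Here \<open>W\<close> is an unknown of its own; that
  it is the space derivative of the velocity is shown later, in \<open>U_deriv\<close> and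
  \<open>u_deriv\<close>.\<close>

theorem lagrangian_existence:
  assumes ab: "a > 0" "b > 0"
  obtains T0 where "T0 > 0" and
    "\<And>T u0 w0. 0 < T \<Longrightarrow> T \<le> T0 \<Longrightarrow> continuous_on UNIV u0 \<Longrightarrow> continuous_on UNIV w0 \<Longrightarrow>
      (\<And>z. \<bar>u0 z\<bar> \<le> 1) \<Longrightarrow> (\<And>z. \<bar>w0 z\<bar> \<le> 1) \<Longrightarrow>
      \<exists>X. continuous_on {0..T} X \<and> (\<forall>t. X t \<in> states) \<and> (\<forall>z. cU (X 0) z = u0 z \<and> cW (X 0) z = w0 z \<and> cR (X 0) z = 1) \<and>
        (\<forall>t\<in>{0..T}. \<forall>z.
          ((\<lambda>t. cU (X t) z) has_real_derivative - nonlocal_force a b p1 p2 p3 (cU (X t)) (cW (X t)) (cR (X t)) z) (at t within {0..T}) \<and>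
          ((\<lambda>t. cW (X t) z) has_real_derivative 2 / 3 * (cW (X t) z)\<^sup>2 - force_slope a b p1 p2 p3 (cU (X t)) (cW (X t)) (cR (X t)) z) (at t within {0..T}) \<and>
          ((\<lambda>t. cR (X t) z) has_real_derivative cW (X t) z * cR (X t) z) (at t within {0..T}))"
proof -
  define P1 where "P1 X z = - 1 * nonlocal_force a b p1 p2 p3 (cU X) (cW X) (cR X) z" for X z
  define P2 where "P2 X z = 2 / 3 * (cW X z)\<^sup>2 - force_slope a b p1 p2 p3 (cU X) (cW X) (cR X) z" for X z
  define P3 where "P3 X z = cW X z * cR X z" for X z
  have t: "tame P1" "tame P2" "tame P3"
    unfolding P1_def[abs_def] P2_def[abs_def] P3_def[abs_def]
    by (intro tame_cmult tame_diff tame_mult tame_power2 tame_comp tame_nonlocal_force ab)+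
  obtain B1 L1 where 1: "\<And>X. X \<in> states \<Longrightarrow> continuous_on UNIV (P1 X)" "0 \<le> B1" "\<And>X z. X \<in> states \<Longrightarrow> \<bar>P1 X z\<bar> \<le> B1" "0 \<le> L1"
    "\<And>X Y z. X \<in> states \<Longrightarrow> Y \<in> states \<Longrightarrow> \<bar>P1 X z - P1 Y z\<bar> \<le> L1 * dist X Y" using tameE[OF t(1)] by metis
  obtain B2 L2 where 2: "\<And>X. X \<in> states \<Longrightarrow> continuous_on UNIV (P2 X)" "0 \<le> B2" "\<And>X z. X \<in> states \<Longrightarrow> \<bar>P2 X z\<bar> \<le> B2" "0 \<le> L2"
    "\<And>X Y z. X \<in> states \<Longrightarrow> Y \<in> states \<Longrightarrow> \<bar>P2 X z - P2 Y z\<bar> \<le> L2 * dist X Y" using tameE[OF t(2)] by metis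
  obtain B3 L3 where 3: "\<And>X. X \<in> states \<Longrightarrow> continuous_on UNIV (P3 X)" "0 \<le> B3" "\<And>X z. X \<in> states \<Longrightarrow> \<bar>P3 X z\<bar> \<le> B3" "0 \<le> L3"
    "\<And>X Y z. X \<in> states \<Longrightarrow> Y \<in> states \<Longrightarrow> \<bar>P3 X z - P3 Y z\<bar> \<le> L3 * dist X Y" using tameE[OF t(3)] by metis
  define \<Phi> :: "lstate \<Rightarrow> lstate" where "\<Phi> X = (Bcontfun (P1 X), Bcontfun (P2 X), Bcontfun (P3 X))" for X
  have bc: "apply_bcontfun (Bcontfun f) = f" if "continuous_on UNIV f" "\<And>z. \<bar>f z\<bar> \<le> B" for f :: "real \<Rightarrow> real" and B
    using that by (intro Bcontfun_inverse bcontfun_normI) auto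
  have \<Phi>: "cU (\<Phi> X) = P1 X" "cW (\<Phi> X) = P2 X" "cR (\<Phi> X) = P3 X" if "X \<in> states" for X
    unfolding \<Phi>_def using bc[OF 1(1,3)] bc[OF 2(1,3)] bc[OF 3(1,3)] that by auto
  define L B where "L = L1 + L2 + L3" and "B = B1 + B2 + B3"
  have LB0: "0 \<le> L" "0 \<le> B" using 1 2 3 by (auto simp: L_def B_def)
  have \<Phi>L: "dist (\<Phi> X) (\<Phi> Y) \<le> L * dist X Y" if XY: "X \<in> states" "Y \<in> states" for X Y
  proof -
    have "dist (\<Phi> X) (\<Phi> Y) \<le> dist (fst (\<Phi> X)) (fst (\<Phi> Y)) + dist (snd (\<Phi> X)) (snd (\<Phi> Y))"
      unfolding dist_prod_def by (intro sqrt_sum_squares_le_sum) auto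
    also have "dist (snd (\<Phi> X)) (snd (\<Phi> Y)) \<le> dist (fst (snd (\<Phi> X))) (fst (snd (\<Phi> Y))) + dist (snd (snd (\<Phi> X))) (snd (snd (\<Phi> Y)))"
      unfolding dist_prod_def by (intro sqrt_sum_squares_le_sum) auto
    also have "dist (fst (\<Phi> X)) (fst (\<Phi> Y)) \<le> L1 * dist X Y"
      by (rule dist_bound) (use 1(5) XY in \<open>simp add: \<Phi> dist_real_def\<close>)
    also have "dist (fst (snd (\<Phi> X))) (fst (snd (\<Phi> Y))) \<le> L2 * dist X Y"
      by (rule dist_bound) (use 2(5) XY in \<open>simp add: \<Phi> dist_real_def\<close>)
    also have "dist (snd (snd (\<Phi> X))) (snd (snd (\<Phi> Y))) \<le> L3 * dist X Y"
      by (rule dist_bound) (use 3(5) XY in \<open>simp add: \<Phi> dist_real_def\<close>)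
    finally show ?thesis by (simp add: L_def algebra_simps)
  qed
  have \<Phi>B: "norm (\<Phi> X) \<le> B" if X: "X \<in> states" for X
  proof -
    have "norm (\<Phi> X) \<le> norm (fst (\<Phi> X)) + norm (snd (\<Phi> X))"
      unfolding norm_prod_def by (intro sqrt_sum_squares_le_sum) auto
    also have "norm (snd (\<Phi> X)) \<le> norm (fst (snd (\<Phi> X))) + norm (snd (snd (\<Phi> X)))"
      unfolding norm_prod_def by (intro sqrt_sum_squares_le_sum) auto
    also have "norm (fst (\<Phi> X)) \<le> B1" by (rule norm_bound) (use 1(3) X in \<open>simp add: \<Phi>\<close>)
    also have "norm (fst (snd (\<Phi> X))) \<le> B2" by (rule norm_bound) (use 2(3) X in \<open>simp add: \<Phi>\<close>)
    also have "norm (snd (snd (\<Phi> X))) \<le> B3" by (rule norm_bound) (use 3(3) X in \<open>simp add: \<Phi>\<close>)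
    finally show ?thesis by (simp add: B_def)
  qed
  \<comment> \<open>Half the reciprocal of B + L + 1 gives T B at most 1 / 2, so the solution stays
    in the ball, and T L below 1, so the iteration contracts.\<close>
  define T0 where "T0 = 1 / (2 * (B + L + 1))"
  have T0: "T0 > 0" using LB0 by (simp add: T0_def)
  show thesis
  proof (rule that[OF T0])
    fix T and u0 w0 :: "real \<Rightarrow> real"
    assume T: "0 < T" "T \<le> T0" and u0: "continuous_on UNIV u0" "\<And>z. \<bar>u0 z\<bar> \<le> 1"
      and w0: "continuous_on UNIV w0" "\<And>z. \<bar>w0 z\<bar> \<le> 1"
    define X0 :: lstate where "X0 = (Bcontfun u0, Bcontfun w0, const_bcontfun 1)"
    have X0: "cU X0 = u0" "cW X0 = w0" "cR X0 z = 1" for z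
      unfolding X0_def using bc[OF u0] bc[OF w0] by (auto simp: const_bcontfun.rep_eq)
    have ball: "X \<in> states" if "X \<in> cball X0 (1 / 2)" for X
      unfolding states_def
    proof (safe)
      fix z
      have "dist X0 X \<le> 1 / 2" using that by simp
      hence "\<bar>u0 z - cU X z\<bar> \<le> 1 / 2" "\<bar>w0 z - cW X z\<bar> \<le> 1 / 2" "\<bar>1 - cR X z\<bar> \<le> 1 / 2"
        using comp_dist[of X0 z X] unfolding X0 by linarith+
      thus "\<bar>cU X z\<bar> \<le> 2" "\<bar>cW X z\<bar> \<le> 2" "1 / 2 \<le> cR X z" "cR X z \<le> 2"
        using u0(2)[of z] w0(2)[of z] by linarith+
    qed
    have "T * (B + L + 1) \<le> 1 / 2" using T LB0 by (simp add: T0_def field_simps)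
    moreover have "T * (B + L + 1) = T * B + T * L + T" by (simp add: algebra_simps)
    moreover have "0 \<le> T * B" "0 \<le> T * L" using T LB0 by auto
    ultimately have TB: "T * B \<le> 1 / 2" "T * L < 1" using T by linarith+
    obtain X where X: "X 0 = X0" "\<And>t. X t \<in> cball X0 (1 / 2)" "continuous_on {0..T} X"
      "\<And>t. t \<in> {0..T} \<Longrightarrow> (X has_vector_derivative \<Phi> (X t)) (at t within {0..T})"
      by (rule picard_lindeloef[of X0 "1 / 2" \<Phi> L B T]) (use \<Phi>L \<Phi>B ball T TB LB0 in auto)
    have XD: "X t \<in> states" for t using X(2) ball by blast
    show "\<exists>X. continuous_on {0..T} X \<and> (\<forall>t. X t \<in> states) \<and> (\<forall>z. cU (X 0) z = u0 z \<and> cW (X 0) z = w0 z \<and> cR (X 0) z = 1) \<and>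
        (\<forall>t\<in>{0..T}. \<forall>z.
          ((\<lambda>t. cU (X t) z) has_real_derivative - nonlocal_force a b p1 p2 p3 (cU (X t)) (cW (X t)) (cR (X t)) z) (at t within {0..T}) \<and>
          ((\<lambda>t. cW (X t) z) has_real_derivative 2 / 3 * (cW (X t) z)\<^sup>2 - force_slope a b p1 p2 p3 (cU (X t)) (cW (X t)) (cR (X t)) z) (at t within {0..T}) \<and>
          ((\<lambda>t. cR (X t) z) has_real_derivative cW (X t) z * cR (X t) z) (at t within {0..T}))"
    proof (intro exI[of _ X] conjI allI ballI)
      fix t z assume t: "t \<in> {0..T}"
      note d = bcontfun_eval_deriv[OF X(4)[OF t], of z, unfolded \<Phi>[OF XD], folded has_real_derivative_iff_has_vector_derivative]
      show "((\<lambda>t. cU (X t) z) has_real_derivative - nonlocal_force a b p1 p2 p3 (cU (X t)) (cW (X t)) (cR (X t)) z) (at t within {0..T})"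
        using d(1) by (simp add: P1_def)
      show "((\<lambda>t. cW (X t) z) has_real_derivative 2 / 3 * (cW (X t) z)\<^sup>2 - force_slope a b p1 p2 p3 (cU (X t)) (cW (X t)) (cR (X t)) z) (at t within {0..T})"
        using d(2) by (simp add: P2_def)
      show "((\<lambda>t. cR (X t) z) has_real_derivative cW (X t) z * cR (X t) z) (at t within {0..T})"
        using d(3) by (simp add: P3_def)
    qed (use X XD X0 in auto)
  qed
qed

section \<open>Return to Eulerian coordinates\<close>

text \<open>By the chain rule, composition with \<open>q\<close> turns the equations in x into those
  in z, whose bounded solutions are unique.\<close>

lemma resolvents_transport:
  assumes R: "admissible R" and c: "c > 0" and f: "continuous_on UNIV f" "\<And>y. \<bar>f y\<bar> \<le> B"
    and q: "\<And>z. (q has_real_derivative R z) (at z)"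
  shows "resolvent c R (\<lambda>z. f (q z)) z = resolvent1 c f (q z)" "resolvent_deriv c R (\<lambda>z. f (q z)) z = resolvent_deriv1 c f (q z)"
proof -
  have qc: "continuous_on UNIV q" using q by (meson DERIV_isCont continuous_at_imp_continuous_on)
  note d = resolvents_deriv[OF admissible_1 c f]
  have [measurable]: "f \<in> borel_measurable borel" using f(1) by (rule borel_measurable_continuous_onI)
  note bd = resolvents_bound[where f=f, OF admissible_1 c _ f(2)]
  have 1: "((\<lambda>z. resolvent1 c f (q z)) has_real_derivative R z * resolvent_deriv1 c f (q z)) (at z)" for z
    by (rule DERIV_cong[OF DERIV_chain2[OF d(1) q]]) simp
  have 2: "((\<lambda>z. resolvent_deriv1 c f (q z)) has_real_derivative c\<^sup>2 * R z * (resolvent1 c f (q z) - f (q z))) (at z)" for z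
    by (rule DERIV_cong[OF DERIV_chain2[OF d(2) q]]) simp
  have fc: "continuous_on UNIV (\<lambda>z. f (q z))" by (rule continuous_on_compose2[OF f(1) qc]) auto
  have b1: "\<bar>resolvent1 c f (q z)\<bar> \<le> 4 * B" and b2: "\<bar>resolvent_deriv1 c f (q z)\<bar> \<le> 4 * c * B" for z
    using bd by auto
  have fB: "\<bar>f (q z)\<bar> \<le> B" for z by (rule f(2))
  note u = resolvents_unique[where v="\<lambda>z. resolvent1 c f (q z)" and d="\<lambda>z. resolvent_deriv1 c f (q z)" and f="\<lambda>z. f (q z)", OF R c fc fB 1 b1 2 b2]
  show "resolvent c R (\<lambda>z. f (q z)) z = resolvent1 c f (q z)" "resolvent_deriv c R (\<lambda>z. f (q z)) z = resolvent_deriv1 c f (q z)"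
    using u[of z] by auto
qed

lemma nonlocal_force_transport:
  assumes R: "admissible R" and ab: "a > 0" "b > 0"
    and U: "continuous_on UNIV U" "\<And>y. \<bar>U y\<bar> \<le> M" and W: "continuous_on UNIV W" "\<And>y. \<bar>W y\<bar> \<le> M"
    and q: "\<And>z. (q has_real_derivative R z) (at z)"
  shows "nonlocal_force a b p1 p2 p3 (\<lambda>z. U (q z)) (\<lambda>z. W (q z)) R z = nonlocal_force a b p1 p2 p3 U W (\<lambda>_. 1) (q z)"
proof -
  have 1: "continuous_on UNIV (\<lambda>y. (f y)\<^sup>2)" "\<bar>(f y)\<^sup>2\<bar> \<le> M\<^sup>2" if "continuous_on UNIV f" "\<And>y. \<bar>f y\<bar> \<le> M" for f :: "real \<Rightarrow> real" and y
    by (intro continuous_intros that, rule abs_square_le[OF that(2)])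
  have 2: "resolvent_deriv a R (resolvent b R (\<lambda>y. (f (q y))\<^sup>2)) z = resolvent_deriv1 a (resolvent1 b (\<lambda>y. (f y)\<^sup>2)) (q z)"
    "resolvent_deriv b R (\<lambda>y. (f (q y))\<^sup>2) z = resolvent_deriv1 b (\<lambda>y. (f y)\<^sup>2) (q z)" if f: "continuous_on UNIV f" "\<And>y. \<bar>f y\<bar> \<le> M" for f :: "real \<Rightarrow> real"
  proof -
    note t = resolvents_transport[OF R ab(2) 1[OF f] q]
    have v: "resolvent b R (\<lambda>y. (f (q y))\<^sup>2) = (\<lambda>z. resolvent1 b (\<lambda>y. (f y)\<^sup>2) (q z))" using t(1) by auto
    have "resolvent_deriv a R (\<lambda>z. resolvent1 b (\<lambda>y. (f y)\<^sup>2) (q z)) z = resolvent_deriv1 a (resolvent1 b (\<lambda>y. (f y)\<^sup>2)) (q z)"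
    proof (rule resolvents_transport(2)[OF R ab(1) _ _ q])
      show "continuous_on UNIV (resolvent1 b (\<lambda>y. (f y)\<^sup>2))" by (rule resolvent1_continuous(1)[OF ab(2) 1[OF f]])
      show "\<bar>resolvent1 b (\<lambda>y. (f y)\<^sup>2) y\<bar> \<le> 4 * M\<^sup>2" for y
        by (rule resolvents_bound(1)[OF admissible_1 ab(2) borel_measurable_continuous_onI[OF 1(1)[OF f]] 1(2)[OF f]])
    qed
    thus "resolvent_deriv a R (resolvent b R (\<lambda>y. (f (q y))\<^sup>2)) z = resolvent_deriv1 a (resolvent1 b (\<lambda>y. (f y)\<^sup>2)) (q z)" by (simp only: v)
    show "resolvent_deriv b R (\<lambda>y. (f (q y))\<^sup>2) z = resolvent_deriv1 b (\<lambda>y. (f y)\<^sup>2) (q z)" by (rule t(2))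
  qed
  show ?thesis unfolding nonlocal_force_def using 2[OF U] 2[OF W] by simp
qed

text \<open>F1 gives 5/6 and F2 gives 2/3. The coefficient - 5/3 of F4 meets \<alpha>^2 \<beta>^2
  a^2 = \<beta>^2 when a second derivative is removed, and the resulting difference of resolvents
  contributes - 5/3 \<beta>^2 to \<open>p2\<close> and + 5/3 \<beta>^2 to \<open>p3\<close>.\<close>

lemma F_eq_nonlocal_force:
  assumes \<alpha>: "\<alpha> \<noteq> 0" and \<beta>: "\<beta> \<noteq> 0" and u: "continuous_on UNIV u" "\<And>y. \<bar>u y\<bar> \<le> M"
    and w: "continuous_on UNIV (deriv u)" "\<And>y. \<bar>deriv u y\<bar> \<le> M"
  shows "F \<alpha> \<beta> (5 / 3) u x = nonlocal_force (1 / \<bar>\<alpha>\<bar>) (1 / \<bar>\<beta>\<bar>) (5 / 6) (2 / 3 * (\<alpha>\<^sup>2 + \<beta>\<^sup>2) - 5 / 3 * \<beta>\<^sup>2) (5 / 3 * \<beta>\<^sup>2) u (deriv u) (\<lambda>_. 1) x"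
proof -
  have sq: "continuous_on UNIV (\<lambda>y. (f y)\<^sup>2)" "\<bar>(f y)\<^sup>2\<bar> \<le> M\<^sup>2" if "continuous_on UNIV f" "\<And>y. \<bar>f y\<bar> \<le> M" for f :: "real \<Rightarrow> real" and y
    by (intro continuous_intros that, rule abs_square_le[OF that(2)])
  note U = deriv_PD[OF \<alpha> \<beta> sq[OF u]] and W = deriv_PD[OF \<alpha> \<beta> sq[OF w]]
  have "\<alpha>\<^sup>2 * (1 / \<bar>\<alpha>\<bar>)\<^sup>2 = 1" using \<alpha> by (simp add: power_divide)
  moreover have "(5 / 3 - 5) / 2 * p * r * (s * y) = (p * s) * (- (5 / 3) * r * y)" for p r s y :: real
    by simp
  ultimately have e: "(5 / 3 - 5) / 2 * \<alpha>\<^sup>2 * \<beta>\<^sup>2 * ((1 / \<bar>\<alpha>\<bar>)\<^sup>2 * y) = - (5 / 3) * \<beta>\<^sup>2 * y" for y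
    by (simp only: mult_1)
  show ?thesis
    unfolding F_def F1_def F2_def F3_def F4_def nonlocal_force_def U(1) W e
    by (simp add: algebra_simps)
qed

text \<open>Each pass through the first-order system raises the regularity of v and d by one, until
  they have one derivative more than \<open>R\<close> and \<open>f\<close>.\<close>

lemma space_diff_system:
  assumes "jointly_cont T v" "jointly_cont T d" "space_diff T k R" "space_diff T k f"
    and "\<And>t z. t \<in> {0..T} \<Longrightarrow> (v t has_real_derivative R t z * d t z) (at z)"
    and "\<And>t z. t \<in> {0..T} \<Longrightarrow> (d t has_real_derivative c\<^sup>2 * R t z * (v t z - f t z)) (at z)"
  shows "space_diff T (Suc k) v \<and> space_diff T (Suc k) d"
  using assms(3,4)
proof (induction k)
  case 0
  hence 1: "space_diff T 0 (\<lambda>t z. R t z * d t z)" "space_diff T 0 (\<lambda>t z. c\<^sup>2 * R t z * (v t z - f t z))"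
    using assms(1,2) by (intro space_diff_mult space_diff_diff space_diff_const; simp)+
  show ?case using space_diff_SucI[OF assms(1) 1(1) assms(5)] space_diff_SucI[OF assms(2) 1(2) assms(6)] by blast
next
  case (Suc k)
  hence vd: "space_diff T (Suc k) v" "space_diff T (Suc k) d" using space_diff_Suc_imp by blast+
  have 1: "space_diff T (Suc k) (\<lambda>t z. R t z * d t z)" "space_diff T (Suc k) (\<lambda>t z. c\<^sup>2 * R t z * (v t z - f t z))"
    by (intro space_diff_mult space_diff_diff space_diff_const vd Suc.prems)+
  show ?case using space_diff_SucI[OF assms(1) 1(1) assms(5)] space_diff_SucI[OF assms(2) 1(2) assms(6)] by blast
qed

text \<open>One solution of the Lagrangian system. \<open>C\<close> bounds the forces on all of
  \<open>states\<close> and so is the same for all data, whereas \<open>K\<close> grows with the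
  frequency of \<open>u0\<close>; it enters only through \<open>KZ\<close>.\<close>

locale lagr =
  fixes a b p1 p2 p3 T C K :: real and u0 :: "real \<Rightarrow> real" and X :: "real \<Rightarrow> lstate"
  assumes ab: "a > 0" "b > 0" and p3: "p3 * b\<^sup>2 = 5 / 3" and T: "0 < T" "T \<le> 1"
    and u0: "smooth u0" and u0K: "\<And>z. \<bar>deriv (deriv u0) z\<bar> \<le> K"
    and Xc: "continuous_on {0..T} X" and XD: "\<And>t. X t \<in> states"
    and X0: "\<And>z. cU (X 0) z = u0 z" "\<And>z. cW (X 0) z = deriv u0 z" "\<And>z. cR (X 0) z = 1"
    and Ut: "\<And>t z. t \<in> {0..T} \<Longrightarrow> ((\<lambda>t. cU (X t) z) has_real_derivative
        - nonlocal_force a b p1 p2 p3 (cU (X t)) (cW (X t)) (cR (X t)) z) (at t within {0..T})"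
    and Wt: "\<And>t z. t \<in> {0..T} \<Longrightarrow> ((\<lambda>t. cW (X t) z) has_real_derivative
        2 / 3 * (cW (X t) z)\<^sup>2 - force_slope a b p1 p2 p3 (cU (X t)) (cW (X t)) (cR (X t)) z) (at t within {0..T})"
    and Rt: "\<And>t z. t \<in> {0..T} \<Longrightarrow> ((\<lambda>t. cR (X t) z) has_real_derivative cW (X t) z * cR (X t) z) (at t within {0..T})"
    and C: "\<And>Y z. Y \<in> states \<Longrightarrow> \<bar>nonlocal_force a b p1 p2 p3 (cU Y) (cW Y) (cR Y) z\<bar> \<le> C"
      "\<And>Y z. Y \<in> states \<Longrightarrow> \<bar>force_slope a b p1 p2 p3 (cU Y) (cW Y) (cR Y) z\<bar> \<le> C"
      "\<And>Y z. Y \<in> states \<Longrightarrow> \<bar>force_curv a b p1 p2 p3 (cU Y) (cW Y) (cR Y) z\<bar> \<le> C"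
begin

definition "U t = cU (X t)"
definition "W t = cW (X t)"
definition "R t = cR (X t)"
definition "Fl t = nonlocal_force a b p1 p2 p3 (U t) (W t) (R t)"
definition "Gl t = force_slope a b p1 p2 p3 (U t) (W t) (R t)"
definition "Hl t z = R t z * force_curv a b p1 p2 p3 (U t) (W t) (R t) z"

lemma C0: "0 \<le> C" using C(1)[OF XD[of 0], of 0] abs_ge_zero[of "nonlocal_force a b p1 p2 p3 (cU (X 0)) (cW (X 0)) (cR (X 0)) 0"] by linarith

lemma state_bounds: "\<bar>U t z\<bar> \<le> 2" "\<bar>W t z\<bar> \<le> 2" "1 / 2 \<le> R t z" "R t z \<le> 2" "admissible (R t)"
  "\<bar>Fl t z\<bar> \<le> C" "\<bar>Gl t z\<bar> \<le> C" "\<bar>Hl t z\<bar> \<le> 2 * C"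
proof -
  show 1: "\<bar>U t z\<bar> \<le> 2" "\<bar>W t z\<bar> \<le> 2" "1 / 2 \<le> R t z" "R t z \<le> 2" "admissible (R t)"
    unfolding U_def W_def R_def by (rule states_D[OF XD])+
  show "\<bar>Fl t z\<bar> \<le> C" "\<bar>Gl t z\<bar> \<le> C"
    unfolding Fl_def Gl_def U_def W_def R_def by (rule C[OF XD])+
  have "\<bar>force_curv a b p1 p2 p3 (U t) (W t) (R t) z\<bar> \<le> C" unfolding U_def W_def R_def by (rule C[OF XD])
  moreover have "\<bar>R t z\<bar> \<le> 2" using 1(3,4) by linarith
  ultimately show "\<bar>Hl t z\<bar> \<le> 2 * C" unfolding Hl_def abs_mult using C0 by (intro mult_mono) auto
qed

lemma conts: "continuous_on A (U t)" "continuous_on A (W t)" "continuous_on A (R t)"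
  unfolding U_def W_def R_def by auto

lemma jconts: "jointly_cont T U" "jointly_cont T W" "jointly_cont T R" "jointly_cont T Fl" "jointly_cont T Gl" "jointly_cont T Hl"
proof -
  note j = tame_jointly_cont[OF _ Xc XD]
  show "jointly_cont T U" "jointly_cont T W" "jointly_cont T R"
    using j[OF tame_comp(1)] j[OF tame_comp(2)] j[OF tame_comp(3)] by (simp_all add: U_def[abs_def] W_def[abs_def] R_def[abs_def])
  show "jointly_cont T Fl" "jointly_cont T Gl"
    using j[OF tame_nonlocal_force(1)[OF ab]] j[OF tame_nonlocal_force(2)[OF ab]]
    by (simp_all add: U_def[abs_def] W_def[abs_def] R_def[abs_def] Fl_def[abs_def] Gl_def[abs_def])
  show "jointly_cont T Hl"
    using j[OF tame_mult[OF tame_comp(3) tame_nonlocal_force(3)[OF ab]]]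
    by (simp add: U_def[abs_def] W_def[abs_def] R_def[abs_def] Hl_def[abs_def])
qed

lemma time_derivs:
  assumes "t \<in> {0..T}"
  shows "((\<lambda>t. U t z) has_real_derivative - Fl t z) (at t within {0..T})"
    "((\<lambda>t. W t z) has_real_derivative 2 / 3 * (W t z)\<^sup>2 - Gl t z) (at t within {0..T})"
    "((\<lambda>t. R t z) has_real_derivative W t z * R t z) (at t within {0..T})"
  using Ut[OF assms, of z] Wt[OF assms, of z] Rt[OF assms, of z] by (simp_all add: U_def W_def R_def Fl_def Gl_def)

lemma init: "U 0 = u0" "W 0 = deriv u0" "R 0 = (\<lambda>_. 1)"
  using X0 by (auto simp: U_def W_def R_def)

lemma u0_deriv: "(u0 has_real_derivative deriv u0 z) (at z)" "(deriv u0 has_real_derivative deriv (deriv u0) z) (at z)"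
  using smooth_deriv[OF u0, of 0 z] smooth_deriv[OF u0, of 1 z] by auto

lemma space_derivs:
  "(Fl t has_real_derivative R t z * (Gl t z - 5 / 3 * (W t z)\<^sup>2)) (at z)"
  "(Gl t has_real_derivative Hl t z) (at z)"
proof -
  note d = forces_deriv[OF state_bounds(5)[of t] ab conts(1)[of UNIV t] state_bounds(1)[of t] conts(2)[of UNIV t] state_bounds(2)[of t], of p1 p2 p3 z]
  have "p3 * (b\<^sup>2 * (W t z)\<^sup>2) = 5 / 3 * (W t z)\<^sup>2" using p3 by (metis mult.assoc)
  from d(1)[unfolded this] show "(Fl t has_real_derivative R t z * (Gl t z - 5 / 3 * (W t z)\<^sup>2)) (at z)"
    unfolding Fl_def Gl_def .
  show "(Gl t has_real_derivative Hl t z) (at z)"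
    using d(2) by (simp add: Gl_def[abs_def] Hl_def)
qed

text \<open>The terms 2/3 W^2 from \<open>W\<close> and W^2 from \<open>R\<close> add up to 5/3 W^2,
  so the time derivative of W R is minus the z-derivative of the force.\<close>

lemma WR: assumes t: "t \<in> {0..T}"
  shows "W t z * R t z = deriv u0 z + time_int (\<lambda>t z. R t z * (5 / 3 * (W t z)\<^sup>2 - Gl t z)) t z"
proof -
  have "((\<lambda>t. W t z * R t z) has_real_derivative R t z * (5 / 3 * (W t z)\<^sup>2 - Gl t z)) (at t within {0..T})"
    if "t \<in> {0..T}" for t
    by (rule DERIV_cong[OF DERIV_mult[OF time_derivs(2,3)]]) (use that in \<open>auto simp: algebra_simps power2_eq_square\<close>)
  from time_int_eqI[where f="\<lambda>t z. W t z * R t z" and z=z and g="\<lambda>t z. R t z * (5 / 3 * (W t z)\<^sup>2 - Gl t z)", OF t this]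
  show ?thesis by (simp add: init)
qed

lemma jointly_cont_WR: "jointly_cont T (\<lambda>t z. R t z * (5 / 3 * (W t z)\<^sup>2 - Gl t z))"
proof -
  have "space_diff T 0 (\<lambda>t z. R t z * (5 / 3 * (W t z)\<^sup>2 - Gl t z))"
    by (intro space_diff_mult space_diff_diff space_diff_const space_diff_power2) (use jconts in simp_all)
  thus ?thesis by (simp only: space_diff.simps(1))
qed

text \<open>The z-derivative of U and the product W R have the same initial value and the same time
  derivative.\<close>

lemma U_deriv:
  assumes t: "t \<in> {0..T}" shows "(U t has_real_derivative W t z * R t z) (at z)"
proof -
  let ?k = "\<lambda>t z. R t z * (5 / 3 * (W t z)\<^sup>2 - Gl t z)"
  have mF: "jointly_cont T (\<lambda>t z. - Fl t z)" using jconts(4) space_diff_minus[of T 0 Fl] by simp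
  have U: "U t z = u0 z + time_int (\<lambda>t z. - Fl t z) t z" for z
    using time_int_eqI[where f=U and z=z and g="\<lambda>t z. - Fl t z", OF t time_derivs(1)] by (simp add: init)
  have "((\<lambda>z. u0 z + time_int (\<lambda>t z. - Fl t z) t z) has_real_derivative deriv u0 z + time_int ?k t z) (at z)"
  proof (intro DERIV_add u0_deriv time_int_deriv_z[OF mF jointly_cont_WR _ t])
    show "((\<lambda>z. - Fl s z) has_real_derivative ?k s z) (at z)" for s z
      by (rule DERIV_cong[OF DERIV_minus[OF space_derivs(1)]]) (simp add: algebra_simps)
  qed
  moreover have "U t = (\<lambda>z. u0 z + time_int (\<lambda>t z. - Fl t z) t z)" using U by auto
  ultimately show ?thesis by (simp add: WR[OF t])
qed

lemma R_eq: assumes t: "t \<in> {0..T}" shows "R t z = 1 + time_int (\<lambda>t z. W t z * R t z) t z"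
proof -
  have "R t z - R 0 z = time_int (\<lambda>t z. W t z * R t z) t z" by (rule time_int_eqI[OF t time_derivs(3)])
  thus ?thesis by (simp add: init)
qed

lemma R_exp: assumes t: "t \<in> {0..T}" shows "R t z = exp (time_int W t z)"
proof -
  have "((\<lambda>t. R t z * exp (- time_int W t z)) has_real_derivative 0) (at t within {0..T})" if "t \<in> {0..T}" for t
    using that by (auto intro!: derivative_eq_intros time_derivs time_int_deriv_t[OF jconts(2)])
  from time_int_eqI[where f="\<lambda>t z. R t z * exp (- time_int W t z)" and z=z and g="\<lambda>t z. 0", OF t this]
  have "R t z * exp (- time_int W t z) = 1" by (simp add: init time_int_def)
  thus ?thesis by (simp add: exp_minus field_simps)
qed

text \<open>The value of the z-derivative of \<open>W\<close> supplied by
  \<open>riccati_deriv\<close>. Apart from the data it contains only time integrals of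
  \<open>W\<close> and \<open>Hl\<close>, so it inherits their smoothness.\<close>

definition "Z t z = exp (4 / 3 * time_int W t z) * (deriv (deriv u0) z - time_int (\<lambda>s z. exp (- (4 / 3 * time_int W s z)) * Hl s z) t z)"

lemma W_deriv:
  assumes "t \<in> {0..T}" shows "(W t has_real_derivative Z t z) (at z)"
  unfolding Z_def
  by (rule riccati_deriv[OF jconts(2,5,6) time_derivs(2) space_derivs(2) _ assms]) (use u0_deriv(2) init in auto)

lemma time_int_W_bound: "t \<in> {0..T} \<Longrightarrow> \<bar>time_int W t z\<bar> \<le> 2"
proof -
  assume t: "t \<in> {0..T}"
  have "\<bar>time_int W t z\<bar> \<le> 2 * t" by (rule time_int_bound[OF jconts(2) t]) (rule state_bounds)
  thus ?thesis using t T by auto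
qed

definition "KZ = exp 3 * (K + exp 3 * (2 * C))"

lemma Z_bound: assumes t: "t \<in> {0..T}" shows "\<bar>Z t z\<bar> \<le> KZ"
proof -
  \<comment> \<open>The time integral of \<open>W\<close> is at most 2 in modulus, and 4/3 times 2
    is below 3.\<close>
  have e: "exp (4 / 3 * time_int W t z) \<le> exp 3" "exp (- (4 / 3 * time_int W t z)) \<le> exp 3" if "t \<in> {0..T}" for t
    using time_int_W_bound[OF that, of z] by auto
  have j: "jointly_cont T (\<lambda>s z. exp (- (4 / 3 * time_int W s z)) * Hl s z)"
  proof -
    have "space_diff T 0 (\<lambda>s z. exp (- (4 / 3 * time_int W s z)) * Hl s z)"
      by (intro space_diff_mult space_diff_exp space_diff_minus space_diff_const space_diff_time_int) (use jconts in simp_all)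
    thus ?thesis by (simp only: space_diff.simps(1))
  qed
  have "\<bar>time_int (\<lambda>s z. exp (- (4 / 3 * time_int W s z)) * Hl s z) t z\<bar> \<le> exp 3 * (2 * C) * t"
  proof (rule time_int_bound[OF j t])
    fix s assume "s \<in> {0..t}"
    hence "s \<in> {0..T}" using t by auto
    thus "\<bar>exp (- (4 / 3 * time_int W s z)) * Hl s z\<bar> \<le> exp 3 * (2 * C)"
      unfolding abs_mult using e(2)[of s] state_bounds(8)[of s z] by (intro mult_mono) auto
  qed
  also have "\<dots> \<le> exp 3 * (2 * C) * 1" using t T C0 by (intro mult_left_mono) auto
  finally have "\<bar>deriv (deriv u0) z - time_int (\<lambda>s z. exp (- (4 / 3 * time_int W s z)) * Hl s z) t z\<bar> \<le> K + exp 3 * (2 * C)"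
    using u0K[of z] by linarith
  thus ?thesis unfolding Z_def KZ_def abs_mult using e(1)[OF t] by (intro mult_mono) auto
qed

text \<open>From k derivatives of U, W, R the resolvents get k + 1, hence \<open>Hl\<close> and
  \<open>Z\<close> have k, and the formula for \<open>Z\<close> returns k + 1 for \<open>W\<close>.
  Then R = exp (integral of W) and U_z = W R follow.\<close>

lemma space_diff_all: "space_diff T k U \<and> space_diff T k W \<and> space_diff T k R"
proof (induction k)
  case 0 show ?case using jconts by simp
next
  case (Suc k)
  note k = conjunct1[OF Suc] conjunct1[OF conjunct2[OF Suc]] conjunct2[OF conjunct2[OF Suc]]
  have sq: "continuous_on UNIV (\<lambda>y. (f y)\<^sup>2)" "\<bar>(f y)\<^sup>2\<bar> \<le> 2\<^sup>2" if "continuous_on UNIV f" "\<And>y. \<bar>f y\<bar> \<le> 2" for f :: "real \<Rightarrow> real" and y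
    by (intro continuous_intros that, rule abs_square_le[OF that(2)])
  have op: "space_diff T (Suc k) (\<lambda>t. resolvent b (R t) (\<lambda>y. (f t y)\<^sup>2))" "space_diff T (Suc k) (\<lambda>t. resolvent_deriv b (R t) (\<lambda>y. (f t y)\<^sup>2))"
    "space_diff T (Suc k) (\<lambda>t. resolvent a (R t) (resolvent b (R t) (\<lambda>y. (f t y)\<^sup>2)))" "space_diff T (Suc k) (\<lambda>t. resolvent_deriv a (R t) (resolvent b (R t) (\<lambda>y. (f t y)\<^sup>2)))"
    if f: "space_diff T k f" "\<And>t. continuous_on UNIV (f t)" "\<And>t y. \<bar>f t y\<bar> \<le> 2" "f = (\<lambda>t. f0 (X t))" "tame f0" for f f0
  proof -
    note j = tame_jointly_cont[OF _ Xc XD]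
    note s = sq[OF f(2,3)]
    have jv: "jointly_cont T (\<lambda>t. resolvent b (R t) (\<lambda>y. (f t y)\<^sup>2))" "jointly_cont T (\<lambda>t. resolvent_deriv b (R t) (\<lambda>y. (f t y)\<^sup>2))"
      using j[OF tame_resolvents(1)[OF tame_power2[OF f(5)] ab(2)]] j[OF tame_resolvents(2)[OF tame_power2[OF f(5)] ab(2)]]
      by (simp_all add: f(4) R_def[abs_def])
    have jy: "jointly_cont T (\<lambda>t. resolvent a (R t) (resolvent b (R t) (\<lambda>y. (f t y)\<^sup>2)))" "jointly_cont T (\<lambda>t. resolvent_deriv a (R t) (resolvent b (R t) (\<lambda>y. (f t y)\<^sup>2)))"
      using j[OF tame_resolvents(1)[OF tame_resolvents(1)[OF tame_power2[OF f(5)] ab(2)] ab(1)]]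
        j[OF tame_resolvents(2)[OF tame_resolvents(1)[OF tame_power2[OF f(5)] ab(2)] ab(1)]]
      by (simp_all add: f(4) R_def[abs_def])
    note dv = resolvents_deriv[OF state_bounds(5) ab(2) s]
    have c: "continuous_on UNIV (resolvent b (R t) (\<lambda>y. (f t y)\<^sup>2))" for t
      using dv(1) by (meson DERIV_isCont continuous_at_imp_continuous_on)
    have B: "\<bar>resolvent b (R t) (\<lambda>y. (f t y)\<^sup>2) y\<bar> \<le> 4 * 2\<^sup>2" for t y
      by (rule resolvents_bound(1)[OF state_bounds(5) ab(2) borel_measurable_continuous_onI[OF s(1)] s(2)])
    note dy = resolvents_deriv[OF state_bounds(5) ab(1) c B]
    from space_diff_system[OF jv k(3) space_diff_power2[OF f(1)] dv]
    show v: "space_diff T (Suc k) (\<lambda>t. resolvent b (R t) (\<lambda>y. (f t y)\<^sup>2))" "space_diff T (Suc k) (\<lambda>t. resolvent_deriv b (R t) (\<lambda>y. (f t y)\<^sup>2))"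
      by blast+
    from space_diff_system[OF jy k(3) space_diff_Suc_imp[OF v(1)] dy]
    show "space_diff T (Suc k) (\<lambda>t. resolvent a (R t) (resolvent b (R t) (\<lambda>y. (f t y)\<^sup>2)))" "space_diff T (Suc k) (\<lambda>t. resolvent_deriv a (R t) (resolvent b (R t) (\<lambda>y. (f t y)\<^sup>2)))"
      by blast+
  qed
  note opU = op[OF k(1) conts(1) state_bounds(1) U_def[abs_def, THEN meta_eq_to_obj_eq] tame_comp(1)]
  note opW = op[OF k(2) conts(2) state_bounds(2) W_def[abs_def, THEN meta_eq_to_obj_eq] tame_comp(2)]
  have H: "space_diff T k Hl"
    unfolding Hl_def[abs_def] force_curv_def by (intro space_diff_mult space_diff_add space_diff_diff space_diff_const k(3) opU[THEN space_diff_Suc_imp] opW[THEN space_diff_Suc_imp])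
  have "space_diff T k Z"
  proof -
    have "space_diff T k (\<lambda>_. (deriv ^^ 2) u0)"
      using space_diff_deriv_iter[OF smooth_space_diff[OF u0], where n=2] .
    hence "space_diff T k (\<lambda>_. deriv (deriv u0))" by (simp add: numeral_2_eq_2)
    thus ?thesis unfolding Z_def[abs_def]
      by (intro space_diff_mult space_diff_diff space_diff_exp space_diff_const space_diff_minus space_diff_time_int k(2) H)
  qed
  hence W: "space_diff T (Suc k) W" by (intro space_diff_SucI[OF jconts(2) _ W_deriv])
  have "space_diff T (Suc k) (\<lambda>t z. exp (time_int W t z))" by (intro space_diff_exp space_diff_time_int W)
  hence R: "space_diff T (Suc k) R" using space_diff_cong[of T R "\<lambda>t z. exp (time_int W t z)"] R_exp by blast
  have "space_diff T (Suc k) U" by (rule space_diff_SucI[OF jconts(1) space_diff_mult[OF k(2,3)] U_deriv])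
  thus ?case using W R by blast
qed

section \<open>The flow map and its inverse\<close>

definition "q t z = z + time_int U t z"

lemma q_deriv: assumes "t \<in> {0..T}" shows "(q t has_real_derivative R t z) (at z)"
proof -
  have "jointly_cont T (\<lambda>t z. W t z * R t z)" using jconts space_diff_mult[of T 0] by simp
  from DERIV_add[OF DERIV_ident time_int_deriv_z[OF jconts(1) this U_deriv assms]]
  show ?thesis unfolding q_def[abs_def] by (simp add: R_eq[OF assms])
qed

lemma q_lower: assumes t: "t \<in> {0..T}" shows "\<bar>z - y\<bar> / 2 \<le> \<bar>q t z - q t y\<bar>"
proof -
  have *: "(z - y) / 2 \<le> q t z - q t y" if "y < z" for y z
  proof -
    have "\<exists>x>y. x < z \<and> q t z - q t y = (z - y) * R t x"
      by (rule MVT2[OF that]) (rule q_deriv[OF t])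
    then obtain x where "q t z - q t y = (z - y) * R t x" by blast
    thus ?thesis using state_bounds(3)[of t x] that mult_left_mono[of "1/2" "R t x" "z - y"] by simp
  qed
  show ?thesis using *[of y z] *[of z y] by (cases y z rule: linorder_cases) auto
qed

text \<open>The flow displaces no point by more than 2, so the intermediate value theorem applies on
  [x - 2, x + 2].\<close>

lemma q_surj: assumes t: "t \<in> {0..T}" shows "\<exists>z. q t z = x"
proof -
  have b: "\<bar>time_int U t z\<bar> \<le> 2" for z
  proof -
    have "\<bar>time_int U t z\<bar> \<le> 2 * t" by (rule time_int_bound[OF jconts(1) t]) (rule state_bounds)
    thus ?thesis using t T by auto
  qed
  have "\<exists>z\<ge>x - 2. z \<le> x + 2 \<and> q t z = x"
  proof (rule IVT')
    show "q t (x - 2) \<le> x" using b[of "x - 2"] unfolding q_def by linarith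
    show "x \<le> q t (x + 2)" using b[of "x + 2"] unfolding q_def by linarith
    show "continuous_on {x - 2..x + 2} (q t)"
      using q_deriv[OF t] by (meson DERIV_isCont continuous_at_imp_continuous_on)
  qed simp
  thus ?thesis by blast
qed

definition "\<zeta> t x = (SOME z. q t z = x)"

lemma q_zeta: "t \<in> {0..T} \<Longrightarrow> q t (\<zeta> t x) = x"
  unfolding \<zeta>_def using q_surj[of t x] by (rule someI_ex)

lemma zeta_q: "t \<in> {0..T} \<Longrightarrow> \<zeta> t (q t z) = z"
  using q_zeta[of t "q t z"] q_lower[of t "\<zeta> t (q t z)" z] by simp

lemma q_time: assumes "t \<in> {0..T}" "s \<in> {0..T}" shows "\<bar>q t z - q s z\<bar> \<le> 2 * \<bar>t - s\<bar>"
proof -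
  have *: "\<bar>q t z - q s z\<bar> \<le> 2 * (t - s)" if "t \<in> {0..T}" "s \<in> {0..T}" "s \<le> t" for s t
  proof -
    have c: "continuous_on {0..T} (\<lambda>s. U s z)" by (rule jointly_cont_slices(1)[OF jconts(1)]) simp
    have "time_int U t z - time_int U s z = integral {s..t} (\<lambda>s. U s z)"
      unfolding time_int_def using that
      by (subst Henstock_Kurzweil_Integration.integral_combine[symmetric, of 0 s t])
        (auto intro!: integrable_continuous_real continuous_on_subset[OF c])
    also have "\<bar>\<dots>\<bar> \<le> 2 * (t - s)"
      using integral_bound[of s t "\<lambda>s. U s z" 2] that state_bounds(1) continuous_on_subset[OF c, of "{s..t}"] by auto
    finally show ?thesis by (simp add: q_def)
  qed
  show ?thesis using *[of t s] *[of s t] assms by (cases "s \<le> t") auto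
qed

text \<open>The map \<open>q t\<close> contracts distances at most by 1 / 2 and moves at speed at
  most 2. This yields joint continuity of the inverse flow without a time derivative of it.\<close>

lemma zeta_lipschitz:
  assumes "t \<in> {0..T}" "s \<in> {0..T}" shows "\<bar>\<zeta> t x - \<zeta> s y\<bar> \<le> 2 * \<bar>x - y\<bar> + 4 * \<bar>t - s\<bar>"
proof -
  have "\<bar>\<zeta> t x - \<zeta> s y\<bar> / 2 \<le> \<bar>q t (\<zeta> t x) - q t (\<zeta> s y)\<bar>" by (rule q_lower[OF assms(1)])
  also have "\<dots> = \<bar>(x - y) - (q t (\<zeta> s y) - q s (\<zeta> s y))\<bar>" using q_zeta assms by simp
  also have "\<dots> \<le> \<bar>x - y\<bar> + 2 * \<bar>t - s\<bar>" using q_time[OF assms, of "\<zeta> s y"] by linarith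
  finally have "\<bar>\<zeta> t x - \<zeta> s y\<bar> / 2 \<le> \<bar>x - y\<bar> + 2 * \<bar>t - s\<bar>" .
  moreover have "m / 2 \<le> k + 2 * l \<Longrightarrow> m \<le> 2 * k + 4 * l" for k l m :: real by simp
  ultimately show ?thesis by blast
qed

lemma jointly_cont_zeta: "jointly_cont T \<zeta>"
  unfolding jointly_cont_def continuous_on_iff
proof (intro ballI allI impI)
  fix p and e :: real assume p: "p \<in> {0..T} \<times> (UNIV :: real set)" and e: "0 < e"
  show "\<exists>d>0. \<forall>r\<in>{0..T} \<times> UNIV. dist r p < d \<longrightarrow> dist (case r of (t, z) \<Rightarrow> \<zeta> t z) (case p of (t, z) \<Rightarrow> \<zeta> t z) < e"
  proof (intro exI[of _ "e / 6"] conjI ballI impI)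
    fix r assume r: "r \<in> {0..T} \<times> (UNIV :: real set)" "dist r p < e / 6"
    have "\<bar>fst r - fst p\<bar> < e / 6" "\<bar>snd r - snd p\<bar> < e / 6"
      using r(2) dist_fst_le[of r p] dist_snd_le[of r p] by (auto simp: dist_real_def)
    moreover have "\<bar>\<zeta> (fst r) (snd r) - \<zeta> (fst p) (snd p)\<bar> \<le> 2 * \<bar>snd r - snd p\<bar> + 4 * \<bar>fst r - fst p\<bar>"
      by (rule zeta_lipschitz) (use r p in auto)
    ultimately show "dist (case r of (t, z) \<Rightarrow> \<zeta> t z) (case p of (t, z) \<Rightarrow> \<zeta> t z) < e"
      by (simp add: dist_real_def case_prod_unfold)
  qed (use e in auto)
qed

lemma zeta_deriv: assumes t: "t \<in> {0..T}" shows "(\<zeta> t has_real_derivative 1 / R t (\<zeta> t x)) (at x)"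
proof -
  have "(\<zeta> t has_real_derivative inverse (R t (\<zeta> t x))) (at x)"
  proof (rule DERIV_inverse_function[where f="q t" and a="x - 1" and b="x + 1"])
    show "R t (\<zeta> t x) \<noteq> 0" using state_bounds(3)[of t "\<zeta> t x"] by linarith
    show "isCont (\<zeta> t) x"
      using jointly_cont_slices(2)[OF jointly_cont_zeta t, of UNIV] by (simp add: continuous_on_eq_continuous_at)
  qed (use q_deriv[OF t] q_zeta[OF t] in auto)
  thus ?thesis by (simp add: inverse_eq_divide)
qed

text \<open>The derivative of f composed with \<open>\<zeta>\<close> is g / R composed with
  \<open>\<zeta>\<close>, again of the same form, so the induction is on f arbitrary.\<close>

lemma space_diff_comp_zeta: "space_diff T k f \<Longrightarrow> space_diff T k (\<lambda>t x. f t (\<zeta> t x))"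
proof (induction k arbitrary: f)
  case 0
  have "continuous_on ({0..T} \<times> UNIV) (\<lambda>p. f (fst p) (\<zeta> (fst p) (snd p)))"
    by (rule jointly_cont_compose) (use 0 jointly_cont_zeta in \<open>auto simp: jointly_cont_def case_prod_unfold intro: continuous_intros\<close>)
  thus ?case by (simp add: jointly_cont_def case_prod_unfold)
next
  case (Suc k)
  obtain g where g: "space_diff T k g" "\<And>t z. t \<in> {0..T} \<Longrightarrow> (f t has_real_derivative g t z) (at z)"
    using space_diff_SucE[OF Suc.prems] by metis
  have R0: "R t z \<noteq> 0" for t z using state_bounds(3)[of t z] by linarith
  have "continuous_on ({0..T} \<times> UNIV) (\<lambda>p. f (fst p) (\<zeta> (fst p) (snd p)))"
    by (rule jointly_cont_compose) (use space_diff_jointly_cont[OF Suc.prems] jointly_cont_zeta in \<open>auto simp: jointly_cont_def case_prod_unfold intro: continuous_intros\<close>)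
  hence 1: "jointly_cont T (\<lambda>t x. f t (\<zeta> t x))" by (simp add: jointly_cont_def case_prod_unfold)
  have 2: "space_diff T k (\<lambda>t x. g t (\<zeta> t x) / R t (\<zeta> t x))"
    by (rule Suc.IH[OF space_diff_divide[OF g(1), of R]]) (use space_diff_all[of k] R0 in auto)
  have 3: "((\<lambda>x. f t (\<zeta> t x)) has_real_derivative g t (\<zeta> t x) / R t (\<zeta> t x)) (at x)" if "t \<in> {0..T}" for t x
    by (rule DERIV_cong[OF DERIV_chain2[OF g(2)[OF that] zeta_deriv[OF that]]]) simp
  show ?case by (rule space_diff_SucI[OF 1 2 3])
qed

section \<open>The solution in Eulerian coordinates\<close>

definition "u t x = U t (\<zeta> t x)"

lemma u_deriv: assumes t: "t \<in> {0..T}"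
  shows "(u t has_real_derivative W t (\<zeta> t x)) (at x)"
    "((\<lambda>x. W t (\<zeta> t x)) has_real_derivative Z t (\<zeta> t x) / R t (\<zeta> t x)) (at x)"
proof -
  have R0: "R t z \<noteq> 0" for z using state_bounds(3)[of t z] by linarith
  show "(u t has_real_derivative W t (\<zeta> t x)) (at x)"
    unfolding u_def[abs_def]
    by (rule DERIV_cong[OF DERIV_chain2[OF U_deriv[OF t] zeta_deriv[OF t]]]) (use R0 in simp)
  show "((\<lambda>x. W t (\<zeta> t x)) has_real_derivative Z t (\<zeta> t x) / R t (\<zeta> t x)) (at x)"
    by (rule DERIV_cong[OF DERIV_chain2[OF W_deriv[OF t] zeta_deriv[OF t]]]) simp
qed

lemma deriv_u: "t \<in> {0..T} \<Longrightarrow> deriv (u t) = (\<lambda>x. W t (\<zeta> t x))"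
  using u_deriv(1) by (auto intro!: DERIV_imp_deriv)

lemma space_diff_u: "space_diff T k u"
  unfolding u_def[abs_def] using space_diff_comp_zeta space_diff_all by blast

lemma u_bounds: "\<bar>u t x\<bar> \<le> 2" "t \<in> {0..T} \<Longrightarrow> \<bar>deriv (u t) x\<bar> \<le> 2"
    "t \<in> {0..T} \<Longrightarrow> \<bar>deriv (deriv (u t)) x\<bar> \<le> 2 * KZ"
proof -
  show "\<bar>u t x\<bar> \<le> 2" by (simp add: u_def state_bounds)
  assume t: "t \<in> {0..T}"
  show "\<bar>deriv (u t) x\<bar> \<le> 2" by (simp add: deriv_u[OF t] state_bounds)
  have "deriv (deriv (u t)) x = Z t (\<zeta> t x) / R t (\<zeta> t x)"
    unfolding deriv_u[OF t] using u_deriv(2)[OF t] by (rule DERIV_imp_deriv)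
  also have "\<bar>\<dots>\<bar> = \<bar>Z t (\<zeta> t x)\<bar> / R t (\<zeta> t x)" using state_bounds(3)[of t "\<zeta> t x"] by simp
  also have "\<dots> \<le> KZ / (1 / 2)"
    using Z_bound[OF t, of "\<zeta> t x"] state_bounds(3)[of t "\<zeta> t x"] by (intro frac_le) auto
  finally show "\<bar>deriv (deriv (u t)) x\<bar> \<le> 2 * KZ" by simp
qed

text \<open>The inverse flow need not be differentiated in time. The particle z that is at x at time
  t is followed instead, and the gap between x and its position q s z is bridged by the mean value
  theorem at time s.\<close>

lemma u_time:
  assumes t: "t \<in> {0..T}"
  shows "((\<lambda>s. u s x) has_real_derivative - (u t x * deriv (u t) x) - Fl t (\<zeta> t x)) (at t within {0..T})"
proof -
  define z where "z = \<zeta> t x"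
  have qz: "q t z = x" using q_zeta[OF t] by (simp add: z_def)
  have w: "jointly_cont T (\<lambda>t x. W t (\<zeta> t x))" using space_diff_comp_zeta[of 0] jconts by simp
  have mv: "\<exists>\<xi>. u s x - u s y = (x - y) * W s (\<zeta> s \<xi>) \<and> \<bar>\<xi> - x\<bar> \<le> \<bar>x - y\<bar>" if s: "s \<in> {0..T}" for s y
  proof (cases x y rule: linorder_cases)
    case less
    then obtain \<xi> where "x < \<xi>" "\<xi> < y" "u s y - u s x = (y - x) * W s (\<zeta> s \<xi>)"
      using MVT2[OF less u_deriv(1)[OF s]] by blast
    thus ?thesis by (intro exI[of _ \<xi>]) (auto simp: algebra_simps)
  next
    case greater
    then obtain \<xi> where "y < \<xi>" "\<xi> < x" "u s x - u s y = (x - y) * W s (\<zeta> s \<xi>)"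
      using MVT2[OF greater u_deriv(1)[OF s]] by blast
    thus ?thesis by (intro exI[of _ \<xi>]) auto
  qed auto
  have "\<exists>\<xi>. \<forall>s\<in>{0..T}. u s x - u s (q s z) = (x - q s z) * W s (\<zeta> s (\<xi> s)) \<and> \<bar>\<xi> s - x\<bar> \<le> \<bar>x - q s z\<bar>"
    using mv by (intro bchoice ballI)
  then obtain \<xi> where \<xi>: "\<And>s. s \<in> {0..T} \<Longrightarrow> u s x - u s (q s z) = (x - q s z) * W s (\<zeta> s (\<xi> s))"
    "\<And>s. s \<in> {0..T} \<Longrightarrow> \<bar>\<xi> s - x\<bar> \<le> \<bar>x - q s z\<bar>"
    by blast
  have dq: "((\<lambda>s. q s z) has_real_derivative U t z) (at t within {0..T})"
    unfolding q_def using time_int_deriv_t[OF jconts(1) t, of z] by (auto intro!: derivative_eq_intros)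
  \<comment> \<open>No regularity of \<xi> in s is known; it lies no farther from x than q s z does,
    which forces the limit.\<close>
  have lim\<xi>: "((\<lambda>s. \<xi> s) \<longlongrightarrow> x) (at t within {0..T})"
  proof -
    have "((\<lambda>s. q s z) \<longlongrightarrow> x) (at t within {0..T})"
      using DERIV_continuous[OF dq] unfolding continuous_within qz .
    hence "((\<lambda>s. \<bar>x - q s z\<bar>) \<longlongrightarrow> \<bar>x - x\<bar>) (at t within {0..T})" by (intro tendsto_intros)
    hence l0: "((\<lambda>s. \<bar>x - q s z\<bar>) \<longlongrightarrow> 0) (at t within {0..T})" by simp
    have "((\<lambda>s. \<xi> s - x) \<longlongrightarrow> 0) (at t within {0..T})"
    proof (rule Lim_null_comparison[OF _ l0])
      show "\<forall>\<^sub>F s in at t within {0..T}. norm (\<xi> s - x) \<le> \<bar>x - q s z\<bar>"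
        unfolding eventually_at_filter by (rule always_eventually) (use \<xi>(2) in \<open>simp del: atLeastAtMost_iff\<close>)
    qed
    thus ?thesis by (simp add: LIM_zero_iff)
  qed
  have limW: "((\<lambda>s. W s (\<zeta> s (\<xi> s))) \<longlongrightarrow> W t (\<zeta> t x)) (at t within {0..T})"
  proof -
    have "((\<lambda>p. W (fst p) (\<zeta> (fst p) (snd p))) \<longlongrightarrow> W t (\<zeta> t x)) (at (t, x) within {0..T} \<times> UNIV)"
      using w[unfolded jointly_cont_def continuous_on_def, rule_format, of "(t, x)"] t by (simp add: case_prod_unfold)
    moreover have "filterlim (\<lambda>s. (s, \<xi> s)) (at (t, x) within {0..T} \<times> UNIV) (at t within {0..T})"
      unfolding filterlim_at
      by (intro conjI tendsto_Pair lim\<xi> tendsto_ident_at) (auto simp: eventually_at_filter)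
    ultimately have "((\<lambda>s. W (fst (s, \<xi> s)) (\<zeta> (fst (s, \<xi> s)) (snd (s, \<xi> s)))) \<longlongrightarrow> W t (\<zeta> t x)) (at t within {0..T})"
      by (rule filterlim_compose)
    thus ?thesis by simp
  qed
  have "((\<lambda>s. (u s x - u t x) / (s - t)) \<longlongrightarrow> - U t z * W t (\<zeta> t x) + (- Fl t z)) (at t within {0..T})"
  proof (rule Lim_transform_eventually)
    have 1: "((\<lambda>s. (q s z - q t z) / (s - t)) \<longlongrightarrow> U t z) (at t within {0..T})"
      using dq unfolding has_field_derivative_iff .
    have 2: "((\<lambda>s. (U s z - U t z) / (s - t)) \<longlongrightarrow> - Fl t z) (at t within {0..T})"
      using time_derivs(1)[OF t, of z] unfolding has_field_derivative_iff .
    show "((\<lambda>s. - ((q s z - q t z) / (s - t)) * W s (\<zeta> s (\<xi> s)) + (U s z - U t z) / (s - t)) \<longlongrightarrow>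
       - U t z * W t (\<zeta> t x) + (- Fl t z)) (at t within {0..T})"
      by (intro tendsto_intros 1 2 limW)
    show "\<forall>\<^sub>F s in at t within {0..T}. - ((q s z - q t z) / (s - t)) * W s (\<zeta> s (\<xi> s)) + (U s z - U t z) / (s - t) =
       (u s x - u t x) / (s - t)"
    proof -
      have "- ((q s z - q t z) / (s - t)) * W s (\<zeta> s (\<xi> s)) + (U s z - U t z) / (s - t) = (u s x - u t x) / (s - t)"
        if s: "s \<in> {0..T}" "s \<noteq> t" for s
      proof -
        have "u s (q s z) = U s z" "u t x = U t z" using zeta_q[OF s(1)] by (auto simp: u_def z_def)
        hence "u s x - u t x = (x - q s z) * W s (\<zeta> s (\<xi> s)) + (U s z - U t z)" using \<xi>(1)[OF s(1)] by linarith
        also have "x - q s z = - (q s z - q t z)" using qz by simp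
        finally show ?thesis by (simp only: add_divide_distrib times_divide_eq_left minus_divide_left)
      qed
      thus ?thesis by (auto simp: eventually_at_filter)
    qed
  qed
  thus ?thesis unfolding has_field_derivative_iff by (simp add: deriv_u[OF t] u_def z_def)
qed

end

section \<open>Uniqueness\<close>

text \<open>
  Subtracting \<open>\<epsilon> ((M + 1) t + sqrt (1 + x\<^sup>2))\<close> makes the maximum attained and keeps it off positive
  times.
\<close>

lemma transport_max_principle:
  assumes T: "0 \<le> T" and fc: "jointly_cont T f"
    and ft: "\<And>t x. t \<in> {0..T} \<Longrightarrow> ((\<lambda>s. f s x) has_real_derivative ft t x) (at t within {0..T})"
    and fx: "\<And>t x. t \<in> {0..T} \<Longrightarrow> (f t has_real_derivative fx t x) (at x)"
    and fB: "\<And>t x. t \<in> {0..T} \<Longrightarrow> f t x \<le> B"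
    and v: "\<And>t x. t \<in> {0..T} \<Longrightarrow> \<bar>v t x\<bar> \<le> M"
    and f0: "\<And>x. f 0 x \<le> 0"
    and H: "\<And>t. t \<in> {0..T} \<Longrightarrow> (H has_real_derivative H' t) (at t within {0..T})" "\<And>t. 0 \<le> H t"
    and le: "\<And>t x. t \<in> {0..T} \<Longrightarrow> ft t x + v t x * fx t x \<le> H' t"
    and t: "t \<in> {0..T}"
  shows "f t x \<le> H t"
proof -
  have M0: "0 \<le> M" using v[of 0 0] T abs_ge_zero[of "v 0 0"] by auto
  have key: "f t x \<le> H t + \<epsilon> * ((M + 1) * t + sqrt (1 + x\<^sup>2))" if e: "\<epsilon> > 0" for \<epsilon>
  proof (rule ccontr)
    define g where "g t x = f t x - H t - \<epsilon> * ((M + 1) * t + sqrt (1 + x\<^sup>2))" for t x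
    assume "\<not> ?thesis"
    hence pos: "g t x > 0" by (simp add: g_def)
    \<comment> \<open>Outside this radius the penalty \<epsilon> sqrt (1 + y^2) exceeds the upper
      bound of f.\<close>
    define Rr where "Rr = max \<bar>x\<bar> (\<bar>B\<bar> / \<epsilon>)"
    have Rr: "0 \<le> Rr" by (simp add: Rr_def)
    have far: "g s y \<le> 0" if "s \<in> {0..T}" "Rr \<le> \<bar>y\<bar>" for s y
    proof -
      have "\<bar>B\<bar> / \<epsilon> \<le> \<bar>y\<bar>" using that(2) by (simp add: Rr_def)
      also have "\<bar>y\<bar> \<le> sqrt (1 + y\<^sup>2)" by (rule real_le_rsqrt) simp
      finally have "\<bar>B\<bar> \<le> \<epsilon> * sqrt (1 + y\<^sup>2)" using e by (simp add: field_simps)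
      moreover have "0 \<le> \<epsilon> * ((M + 1) * s)" using e M0 that by auto
      ultimately show ?thesis using fB[OF that(1), of y] H(2)[of s] by (simp add: g_def distrib_left)
    qed
    have gc: "continuous_on ({0..T} \<times> {- Rr..Rr}) (\<lambda>p. g (fst p) (snd p))"
    proof -
      have "continuous_on {0..T} H" using H(1) by (meson DERIV_continuous continuous_on_eq_continuous_within)
      hence "continuous_on ({0..T} \<times> {- Rr..Rr}) (\<lambda>p. H (fst p))"
        by (rule continuous_on_compose2) (auto intro: continuous_on_fst)
      moreover have "continuous_on ({0..T} \<times> {- Rr..Rr}) (\<lambda>p. f (fst p) (snd p))"
        by (rule jointly_cont_compose[OF fc]) (auto intro!: continuous_intros)
      ultimately show ?thesis unfolding g_def by (intro continuous_intros)
    qed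
    have ne: "{0..T} \<times> {- Rr..Rr} \<noteq> {}" using T Rr by auto
    obtain p where p: "p \<in> {0..T} \<times> {- Rr..Rr}" "\<And>r. r \<in> {0..T} \<times> {- Rr..Rr} \<Longrightarrow> g (fst r) (snd r) \<le> g (fst p) (snd p)"
      using continuous_attains_sup[OF compact_Times[OF compact_Icc compact_Icc] ne gc] by blast
    obtain t1 x1 where tx: "p = (t1, x1)" by (cases p)
    have t1: "t1 \<in> {0..T}" and x1: "x1 \<in> {- Rr..Rr}" using p(1) tx by auto
    have mx: "g s y \<le> g t1 x1" if "s \<in> {0..T}" "y \<in> {- Rr..Rr}" for s y using p(2)[of "(s, y)"] that tx by simp
    have "x \<in> {- Rr..Rr}" by (auto simp: Rr_def)
    hence gp: "g t1 x1 > 0" using mx[OF t, of x] pos by simp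
    hence x1': "\<bar>x1\<bar> < Rr" using far[OF t1, of x1] by linarith
    have t1': "t1 \<noteq> 0"
    proof
      assume "t1 = 0"
      moreover have "\<epsilon> * sqrt (1 + x1\<^sup>2) \<ge> 0" using e by simp
      ultimately show False using gp f0[of x1] H(2)[of 0] by (simp add: g_def)
    qed
    have sx: "((\<lambda>x. sqrt (1 + x\<^sup>2)) has_real_derivative x1 / sqrt (1 + x1\<^sup>2)) (at x1)"
    proof -
      have p: "0 < 1 + x1\<^sup>2" by (rule add_pos_nonneg) simp_all
      have "((\<lambda>x. 1 + x\<^sup>2) has_real_derivative 2 * x1) (at x1)" by (auto intro!: derivative_eq_intros)
      from DERIV_chain2[OF DERIV_real_sqrt[OF p] this] show ?thesis
        by (rule DERIV_cong) (simp only: divide_inverse, simp)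
    qed
    have dx: "(g t1 has_real_derivative fx t1 x1 - \<epsilon> * (x1 / sqrt (1 + x1\<^sup>2))) (at x1)"
      unfolding g_def[abs_def]
      by (rule DERIV_cong[OF DERIV_diff[OF DERIV_diff[OF fx[OF t1] DERIV_const] DERIV_cmult[OF DERIV_add[OF DERIV_const sx]]]]) simp
    have "fx t1 x1 - \<epsilon> * (x1 / sqrt (1 + x1\<^sup>2)) = 0"
    proof (rule DERIV_local_max[OF dx])
      show "0 < Rr - \<bar>x1\<bar>" using x1' by simp
      show "\<forall>y. \<bar>x1 - y\<bar> < Rr - \<bar>x1\<bar> \<longrightarrow> g t1 y \<le> g t1 x1"
      proof (intro allI impI mx t1)
        fix y assume "\<bar>x1 - y\<bar> < Rr - \<bar>x1\<bar>" thus "y \<in> {- Rr..Rr}" by auto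
      qed
    qed
    hence fxe: "fx t1 x1 = \<epsilon> * (x1 / sqrt (1 + x1\<^sup>2))" by simp
    have "\<bar>x1\<bar> \<le> sqrt (1 + x1\<^sup>2)" by (rule real_le_rsqrt) simp
    moreover have "sqrt (1 + x1\<^sup>2) > 0" by (simp add: add_pos_nonneg)
    ultimately have "\<bar>x1 / sqrt (1 + x1\<^sup>2)\<bar> \<le> 1" by (simp add: abs_divide)
    hence "\<epsilon> * \<bar>x1 / sqrt (1 + x1\<^sup>2)\<bar> \<le> \<epsilon> * 1" using e by (intro mult_left_mono) auto
    hence fxb: "\<bar>fx t1 x1\<bar> \<le> \<epsilon>" unfolding fxe abs_mult using e by simp
    have dt: "((\<lambda>s. g s x1) has_real_derivative ft t1 x1 - H' t1 - \<epsilon> * (M + 1)) (at t1 within {0..T})"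
      unfolding g_def by (auto intro!: derivative_eq_intros ft[OF t1] H(1)[OF t1])
    \<comment> \<open>The maximum may sit at t1 = T, so it is compared with earlier times
      only.\<close>
    have "ft t1 x1 - H' t1 - \<epsilon> * (M + 1) \<ge> 0"
    proof (rule ccontr)
      assume "\<not> ?thesis"
      then obtain d where d: "d > 0" "\<And>h. 0 < h \<Longrightarrow> t1 - h \<in> {0..T} \<Longrightarrow> h < d \<Longrightarrow> g t1 x1 < g (t1 - h) x1"
        using has_real_derivative_neg_dec_left[OF dt] by force
      define h where "h = min (d / 2) t1"
      have "0 < h" "h < d" "t1 - h \<in> {0..T}" using d(1) t1 t1' by (auto simp: h_def)
      thus False using d(2)[of h] mx[of "t1 - h" x1] x1 by auto
    qed
    moreover have "\<bar>v t1 x1 * fx t1 x1\<bar> \<le> M * \<epsilon>" unfolding abs_mult using v[OF t1] fxb M0 by (intro mult_mono) auto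
    \<comment> \<open>The chain reads \<epsilon> (M + 1) <= f_t - H' <= - v f_x <= M
      \<epsilon>.\<close>
    ultimately show False using le[OF t1, of x1] e by (simp add: algebra_simps)
  qed
  show ?thesis
  proof (rule field_le_epsilon)
    fix e :: real assume e: "e > 0"
    define k where "k = (M + 1) * t + sqrt (1 + x\<^sup>2)"
    have "0 \<le> (M + 1) * t" using M0 t by auto
    moreover have "0 < sqrt (1 + x\<^sup>2)" by (simp add: add_pos_nonneg)
    ultimately have "k > 0" unfolding k_def by linarith
    hence "f t x \<le> H t + e / k * k" using key[of "e / k"] e by (simp add: k_def)
    thus "f t x \<le> H t + e" using \<open>k > 0\<close> by simp
  qed
qed

text \<open>With the shift placed on f the majorant B |k| is the same at all points, so dominated
  convergence gives sequential continuity.\<close>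

lemma jointly_cont_convolution:
  fixes k :: "real \<Rightarrow> real"
  assumes f: "jointly_cont T f" and fB: "\<And>t x. t \<in> {0..T} \<Longrightarrow> \<bar>f t x\<bar> \<le> B" and k: "integrable lborel k"
  shows "jointly_cont T (\<lambda>t x. LINT y|lborel. k y * f t (x - y))"
  unfolding jointly_cont_def continuous_on_sequentially case_prod_unfold comp_def
proof (intro allI ballI impI, elim conjE)
  fix X :: "nat \<Rightarrow> real \<times> real" and p assume p: "p \<in> {0..T} \<times> UNIV" and X: "\<forall>n. X n \<in> {0..T} \<times> UNIV" "X \<longlonglongrightarrow> p"
  have [measurable]: "k \<in> borel_measurable borel" using k by auto
  have m: "(\<lambda>y. f t (x - y)) \<in> borel_measurable borel" if "t \<in> {0..T}" for t x
    by (intro borel_measurable_continuous_onI jointly_cont_compose[OF f]) (use that in \<open>auto intro!: continuous_intros\<close>)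
  show "(\<lambda>n. LINT y|lborel. k y * f (fst (X n)) (snd (X n) - y)) \<longlonglongrightarrow> (LINT y|lborel. k y * f (fst p) (snd p - y))"
  proof (rule integral_dominated_convergence[where w="\<lambda>y. B * \<bar>k y\<bar>"])
    have Xn: "fst (X n) \<in> {0..T}" for n using X(1) by (metis mem_Times_iff)
    show "(\<lambda>y. k y * f (fst p) (snd p - y)) \<in> borel_measurable lborel"
      using m[of "fst p" "snd p"] p by auto
    show "(\<lambda>y. k y * f (fst (X n)) (snd (X n) - y)) \<in> borel_measurable lborel" for n
      using m[OF Xn] by auto
    show "integrable lborel (\<lambda>y. B * \<bar>k y\<bar>)" using k by auto
    show "AE y in lborel. (\<lambda>n. k y * f (fst (X n)) (snd (X n) - y)) \<longlonglongrightarrow> k y * f (fst p) (snd p - y)"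
    proof (rule AE_I2)
      fix y
      have "continuous_on ({0..T} \<times> UNIV) (\<lambda>p. f (fst p) (snd p - y))"
        by (rule jointly_cont_compose[OF f]) (auto intro!: continuous_intros)
      hence "(\<lambda>n. f (fst (X n)) (snd (X n) - y)) \<longlonglongrightarrow> f (fst p) (snd p - y)"
        using X p unfolding continuous_on_sequentially comp_def by blast
      thus "(\<lambda>n. k y * f (fst (X n)) (snd (X n) - y)) \<longlonglongrightarrow> k y * f (fst p) (snd p - y)"
        by (intro tendsto_intros)
    qed
    show "AE y in lborel. norm (k y * f (fst (X n)) (snd (X n) - y)) \<le> B * \<bar>k y\<bar>" for n
    proof (rule AE_I2)
      fix y show "norm (k y * f (fst (X n)) (snd (X n) - y)) \<le> B * \<bar>k y\<bar>"
        using mult_left_mono[OF fB[OF Xn[of n], of "snd (X n) - y"] abs_ge_zero[of "k y"]]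
        by (simp add: abs_mult mult.commute)
    qed
  qed
qed

lemma jointly_cont_resolvents1:
  assumes f: "jointly_cont T f" and fB: "\<And>t x. t \<in> {0..T} \<Longrightarrow> \<bar>f t x\<bar> \<le> B" and c: "c > 0"
  shows "jointly_cont T (\<lambda>t. resolvent1 c (f t))" "jointly_cont T (\<lambda>t. resolvent_deriv1 c (f t))"
proof -
  have i: "integrable lborel (exp_decay c)"
    using lborel_integrable_real_affine_iff[of "- 1" "exp_decay c" 0] exp_decay_integrable[OF c, of 0] by simp
  have v: "resolvent1 c g x = (LINT y|lborel. exp_decay c y * g (x - y))" for g x
    unfolding resolvent1_eq by (subst lborel_integral_real_affine[of "- 1" _ x]) simp_all
  have d: "resolvent_deriv1 c g x = (LINT y|lborel. (c * (- sgn y * exp_decay c y)) * g (x - y))" for g x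
    unfolding resolvent_deriv_def weighted_integral_def exp_kernel_1
    by (subst lborel_integral_real_affine[of "- 1" _ x]) (simp_all add: exp_decay_def sgn_minus power2_eq_square mult_ac)
  have i2: "integrable lborel (\<lambda>y. c * (- sgn y * exp_decay c y))"
    by (intro integrable_mult_right Bochner_Integration.integrable_bound[OF i]) (auto simp: abs_mult sgn_if)
  show "jointly_cont T (\<lambda>t. resolvent1 c (f t))" "jointly_cont T (\<lambda>t. resolvent_deriv1 c (f t))"
    using jointly_cont_convolution[OF f fB i] jointly_cont_convolution[OF f fB i2] by (simp_all add: v[abs_def] d[abs_def])
qed

text \<open>A difference of squares costs 2 M e, and each resolvent a factor 4: this gives 8 and 32,
  and 40 for their difference. \<open>K\<close> is independent of the size M of the
  functions.\<close>

lemma forces_diff: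
  assumes ab: "a > 0" "b > 0"
  obtains K where "K > 0" and
    "\<And>U W U' W' M e z. continuous_on UNIV U \<Longrightarrow> continuous_on UNIV W \<Longrightarrow> continuous_on UNIV U' \<Longrightarrow> continuous_on UNIV W' \<Longrightarrow>
      (\<And>y. \<bar>U y\<bar> \<le> M) \<Longrightarrow> (\<And>y. \<bar>W y\<bar> \<le> M) \<Longrightarrow> (\<And>y. \<bar>U' y\<bar> \<le> M) \<Longrightarrow> (\<And>y. \<bar>W' y\<bar> \<le> M) \<Longrightarrow>
      (\<And>y. \<bar>U y - U' y\<bar> \<le> e) \<Longrightarrow> (\<And>y. \<bar>W y - W' y\<bar> \<le> e) \<Longrightarrow>
      \<bar>nonlocal_force a b p1 p2 p3 U W (\<lambda>_. 1) z - nonlocal_force a b p1 p2 p3 U' W' (\<lambda>_. 1) z\<bar> \<le> K * (M * e) \<and>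
      \<bar>force_slope a b p1 p2 p3 U W (\<lambda>_. 1) z - force_slope a b p1 p2 p3 U' W' (\<lambda>_. 1) z\<bar> \<le> K * (M * e)"
proof -
  define K where "K = 1 + (\<bar>p1\<bar> * (32 * a) + \<bar>p2\<bar> * (32 * a) + \<bar>p3\<bar> * (8 * b))
     + (\<bar>p1\<bar> * (a\<^sup>2 * 40) + \<bar>p2\<bar> * (a\<^sup>2 * 40) + \<bar>p3\<bar> * (b\<^sup>2 * 8))"
  have K0: "K > 0" unfolding K_def using ab by (intro add_pos_nonneg) auto
  show thesis
  proof (rule that[OF K0])
    fix U W U' W' :: "real \<Rightarrow> real" and M e z
    assume c: "continuous_on UNIV U" "continuous_on UNIV W" "continuous_on UNIV U'" "continuous_on UNIV W'"
      and B: "\<And>y. \<bar>U y\<bar> \<le> M" "\<And>y. \<bar>W y\<bar> \<le> M" "\<And>y. \<bar>U' y\<bar> \<le> M" "\<And>y. \<bar>W' y\<bar> \<le> M"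
      and e: "\<And>y. \<bar>U y - U' y\<bar> \<le> e" "\<And>y. \<bar>W y - W' y\<bar> \<le> e"
    define E where "E = M * e"
    have E0: "0 \<le> E" unfolding E_def using B(1)[of 0] e(1)[of 0] by auto
    have sq: "\<bar>(f y)\<^sup>2 - (g y)\<^sup>2\<bar> \<le> 2 * E" if "\<And>y. \<bar>f y\<bar> \<le> M" "\<And>y. \<bar>g y\<bar> \<le> M" "\<And>y. \<bar>f y - g y\<bar> \<le> e" for f g :: "real \<Rightarrow> real" and y
    proof -
      have "(f y)\<^sup>2 - (g y)\<^sup>2 = (f y + g y) * (f y - g y)" by (simp add: power2_eq_square algebra_simps)
      also have "\<bar>\<dots>\<bar> \<le> (2 * M) * e"
        unfolding abs_mult using that(1)[of y] that(2)[of y] that(3)[of y] by (intro mult_mono) auto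
      finally show ?thesis by (simp add: E_def)
    qed
    have op: "\<bar>resolvent1 b (\<lambda>y. (f y)\<^sup>2) z - resolvent1 b (\<lambda>y. (g y)\<^sup>2) z\<bar> \<le> 8 * E \<and>
        \<bar>resolvent_deriv1 b (\<lambda>y. (f y)\<^sup>2) z - resolvent_deriv1 b (\<lambda>y. (g y)\<^sup>2) z\<bar> \<le> 8 * b * E \<and>
        \<bar>resolvent1 a (resolvent1 b (\<lambda>y. (f y)\<^sup>2)) z - resolvent1 a (resolvent1 b (\<lambda>y. (g y)\<^sup>2)) z\<bar> \<le> 32 * E \<and>
        \<bar>resolvent_deriv1 a (resolvent1 b (\<lambda>y. (f y)\<^sup>2)) z - resolvent_deriv1 a (resolvent1 b (\<lambda>y. (g y)\<^sup>2)) z\<bar> \<le> 32 * a * E"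
      if f: "continuous_on UNIV f" "continuous_on UNIV g" "\<And>y. \<bar>f y\<bar> \<le> M" "\<And>y. \<bar>g y\<bar> \<le> M" "\<And>y. \<bar>f y - g y\<bar> \<le> e" for f g z
    proof -
      have c2: "continuous_on UNIV (\<lambda>y. (f y)\<^sup>2)" "continuous_on UNIV (\<lambda>y. (g y)\<^sup>2)" using f by (auto intro!: continuous_intros)
      have b2: "\<bar>(h y)\<^sup>2\<bar> \<le> M\<^sup>2" if "\<And>y. \<bar>h y\<bar> \<le> M" for h :: "real \<Rightarrow> real" and y
        by (rule abs_square_le[OF that])
      note m = c2[THEN borel_measurable_continuous_onI]
      note s = sq[OF f(3,4,5)]
      have l: "\<bar>resolvent1 b (\<lambda>y. (f y)\<^sup>2) z - resolvent1 b (\<lambda>y. (g y)\<^sup>2) z\<bar> \<le> 4 * (2 * E) + 10 * M\<^sup>2 * 0"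
        "\<bar>resolvent_deriv1 b (\<lambda>y. (f y)\<^sup>2) z - resolvent_deriv1 b (\<lambda>y. (g y)\<^sup>2) z\<bar> \<le> b * (4 * (2 * E) + 10 * M\<^sup>2 * 0)" for z
        by (rule resolvents_lipschitz[OF admissible_1 admissible_1 ab(2) m], rule b2[of f], rule f(3), simp, rule s)+
      have vc: "continuous_on UNIV (resolvent1 b (\<lambda>y. (f y)\<^sup>2))" "continuous_on UNIV (resolvent1 b (\<lambda>y. (g y)\<^sup>2))"
        using resolvent1_continuous(1)[OF ab(2) c2(1) b2[of f, OF f(3)]] resolvent1_continuous(1)[OF ab(2) c2(2) b2[of g, OF f(4)]] by auto
      note vm = vc[THEN borel_measurable_continuous_onI]
      note vb = resolvents_bound(1)[OF admissible_1 ab(2) m(1) b2[of f, OF f(3)]]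
      have l2: "\<bar>resolvent1 a (resolvent1 b (\<lambda>y. (f y)\<^sup>2)) z - resolvent1 a (resolvent1 b (\<lambda>y. (g y)\<^sup>2)) z\<bar> \<le> 4 * (4 * (2 * E) + 10 * M\<^sup>2 * 0) + 10 * (4 * M\<^sup>2) * 0"
        "\<bar>resolvent_deriv1 a (resolvent1 b (\<lambda>y. (f y)\<^sup>2)) z - resolvent_deriv1 a (resolvent1 b (\<lambda>y. (g y)\<^sup>2)) z\<bar> \<le> a * (4 * (4 * (2 * E) + 10 * M\<^sup>2 * 0) + 10 * (4 * M\<^sup>2) * 0)" for z
        by (rule resolvents_lipschitz[OF admissible_1 admissible_1 ab(1) vm], rule vb, simp, rule l)+
      show ?thesis using l[of z] l2[of z] by (simp add: mult_ac)
    qed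
    note oU = op[OF c(1,3) B(1,3) e(1), of z] and oW = op[OF c(2,4) B(2,4) e(2), of z]
    have m: "\<bar>p * x\<bar> \<le> \<bar>p\<bar> * X" if "\<bar>x\<bar> \<le> X" for p x X :: real unfolding abs_mult using that by (intro mult_left_mono) auto
    have "nonlocal_force a b p1 p2 p3 U W (\<lambda>_. 1) z - nonlocal_force a b p1 p2 p3 U' W' (\<lambda>_. 1) z =
      p1 * (resolvent_deriv1 a (resolvent1 b (\<lambda>y. (U y)\<^sup>2)) z - resolvent_deriv1 a (resolvent1 b (\<lambda>y. (U' y)\<^sup>2)) z)
      + p2 * (resolvent_deriv1 a (resolvent1 b (\<lambda>y. (W y)\<^sup>2)) z - resolvent_deriv1 a (resolvent1 b (\<lambda>y. (W' y)\<^sup>2)) z)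
      + p3 * (resolvent_deriv1 b (\<lambda>y. (W y)\<^sup>2) z - resolvent_deriv1 b (\<lambda>y. (W' y)\<^sup>2) z)"
      unfolding nonlocal_force_def by (simp add: algebra_simps)
    also have "\<bar>\<dots>\<bar> \<le> \<bar>p1\<bar> * (32 * a * E) + \<bar>p2\<bar> * (32 * a * E) + \<bar>p3\<bar> * (8 * b * E)"
      using oU oW by (intro order_trans[OF abs_triangle_ineq] add_mono order_trans[OF abs_triangle_ineq] m) auto
    also have "\<dots> \<le> K * E"
    proof -
      have "K * E = E + (\<bar>p1\<bar> * (32 * a * E) + \<bar>p2\<bar> * (32 * a * E) + \<bar>p3\<bar> * (8 * b * E))
        + (\<bar>p1\<bar> * (a\<^sup>2 * 40) + \<bar>p2\<bar> * (a\<^sup>2 * 40) + \<bar>p3\<bar> * (b\<^sup>2 * 8)) * E" by (simp add: K_def algebra_simps)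
      thus ?thesis using E0 by simp
    qed
    finally have F: "\<bar>nonlocal_force a b p1 p2 p3 U W (\<lambda>_. 1) z - nonlocal_force a b p1 p2 p3 U' W' (\<lambda>_. 1) z\<bar> \<le> K * (M * e)" by (simp add: E_def)
    have GGd: "force_slope a b p1 p2 p3 U W (\<lambda>_. 1) z - force_slope a b p1 p2 p3 U' W' (\<lambda>_. 1) z =
      p1 * (a\<^sup>2 * ((resolvent1 a (resolvent1 b (\<lambda>y. (U y)\<^sup>2)) z - resolvent1 a (resolvent1 b (\<lambda>y. (U' y)\<^sup>2)) z) - (resolvent1 b (\<lambda>y. (U y)\<^sup>2) z - resolvent1 b (\<lambda>y. (U' y)\<^sup>2) z)))
      + p2 * (a\<^sup>2 * ((resolvent1 a (resolvent1 b (\<lambda>y. (W y)\<^sup>2)) z - resolvent1 a (resolvent1 b (\<lambda>y. (W' y)\<^sup>2)) z) - (resolvent1 b (\<lambda>y. (W y)\<^sup>2) z - resolvent1 b (\<lambda>y. (W' y)\<^sup>2) z)))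
      + p3 * (b\<^sup>2 * (resolvent1 b (\<lambda>y. (W y)\<^sup>2) z - resolvent1 b (\<lambda>y. (W' y)\<^sup>2) z))"
      unfolding force_slope_def by (simp add: algebra_simps)
    have m2: "\<bar>p * (a\<^sup>2 * (x - y))\<bar> \<le> \<bar>p\<bar> * (a\<^sup>2 * (40 * E))" if "\<bar>x\<bar> \<le> 32 * E" "\<bar>y\<bar> \<le> 8 * E" for p x y
    proof -
      have "\<bar>x - y\<bar> \<le> 40 * E" using that by linarith
      hence "\<bar>a\<^sup>2 * (x - y)\<bar> \<le> a\<^sup>2 * (40 * E)" unfolding abs_mult by (simp add: mult_left_mono)
      thus ?thesis by (rule m)
    qed
    have m3: "\<bar>p * (b\<^sup>2 * x)\<bar> \<le> \<bar>p\<bar> * (b\<^sup>2 * (8 * E))" if "\<bar>x\<bar> \<le> 8 * E" for p x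
    proof -
      have "\<bar>b\<^sup>2 * x\<bar> \<le> b\<^sup>2 * (8 * E)" unfolding abs_mult using that by (simp add: mult_left_mono)
      thus ?thesis by (rule m)
    qed
    have "\<bar>force_slope a b p1 p2 p3 U W (\<lambda>_. 1) z - force_slope a b p1 p2 p3 U' W' (\<lambda>_. 1) z\<bar> \<le>
       \<bar>p1\<bar> * (a\<^sup>2 * (40 * E)) + \<bar>p2\<bar> * (a\<^sup>2 * (40 * E)) + \<bar>p3\<bar> * (b\<^sup>2 * (8 * E))"
      unfolding GGd using oU oW
      by (intro order_trans[OF abs_triangle_ineq] add_mono order_trans[OF abs_triangle_ineq] m2 m3) auto
    also have "\<dots> \<le> K * E"
    proof -
      have "K * E = E + (\<bar>p1\<bar> * (32 * a) + \<bar>p2\<bar> * (32 * a) + \<bar>p3\<bar> * (8 * b)) * E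
        + (\<bar>p1\<bar> * (a\<^sup>2 * (40 * E)) + \<bar>p2\<bar> * (a\<^sup>2 * (40 * E)) + \<bar>p3\<bar> * (b\<^sup>2 * (8 * E)))" by (simp add: K_def algebra_simps)
      moreover have "0 \<le> (\<bar>p1\<bar> * (32 * a) + \<bar>p2\<bar> * (32 * a) + \<bar>p3\<bar> * (8 * b)) * E" using ab E0 by simp
      ultimately show ?thesis using E0 by simp
    qed
    finally show "\<bar>nonlocal_force a b p1 p2 p3 U W (\<lambda>_. 1) z - nonlocal_force a b p1 p2 p3 U' W' (\<lambda>_. 1) z\<bar> \<le> K * (M * e) \<and>
      \<bar>force_slope a b p1 p2 p3 U W (\<lambda>_. 1) z - force_slope a b p1 p2 p3 U' W' (\<lambda>_. 1) z\<bar> \<le> K * (M * e)"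
      using F by (simp add: E_def)
  qed
qed

text \<open>A solution is only known to be differentiable in time at each x. Its equation is
  therefore integrated in time, differentiated in x under the integral, and then read as a statement
  about the time derivative of v_x.\<close>

lemma solution_facts:
  assumes \<alpha>: "\<alpha> \<noteq> 0" and \<beta>: "\<beta> \<noteq> 0" and T: "0 \<le> T" and s: "solution \<alpha> \<beta> (5 / 3) u0 T v"
    and bd: "\<forall>t\<in>{0..T}. \<forall>x. \<bar>v t x\<bar> \<le> M \<and> \<bar>deriv (v t) x\<bar> \<le> M"
  defines "a \<equiv> 1 / \<bar>\<alpha>\<bar>" and "b \<equiv> 1 / \<bar>\<beta>\<bar>" and "p1 \<equiv> 5 / 6" and "p2 \<equiv> 2 / 3 * (\<alpha>\<^sup>2 + \<beta>\<^sup>2) - 5 / 3 * \<beta>\<^sup>2" and "p3 \<equiv> 5 / 3 * \<beta>\<^sup>2"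
  shows "jointly_cont T v" "jointly_cont T (\<lambda>t. deriv (v t))"
    and "\<And>t x. t \<in> {0..T} \<Longrightarrow> (v t has_real_derivative deriv (v t) x) (at x)"
    and "\<And>t x. t \<in> {0..T} \<Longrightarrow> (deriv (v t) has_real_derivative deriv (deriv (v t)) x) (at x)"
    and "\<And>t x. t \<in> {0..T} \<Longrightarrow> ((\<lambda>s. v s x) has_real_derivative
      - (v t x * deriv (v t) x) - nonlocal_force a b p1 p2 p3 (v t) (deriv (v t)) (\<lambda>_. 1) x) (at t within {0..T})"
    and "\<And>t x. t \<in> {0..T} \<Longrightarrow> ((\<lambda>s. deriv (v s) x) has_real_derivative
      2 / 3 * (deriv (v t) x)\<^sup>2 - v t x * deriv (deriv (v t)) x - force_slope a b p1 p2 p3 (v t) (deriv (v t)) (\<lambda>_. 1) x) (at t within {0..T})"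
proof -
  have M: "\<bar>v t x\<bar> \<le> M" "\<bar>deriv (v t) x\<bar> \<le> M" if "t \<in> {0..T}" for t x
    using bd that by auto
  have ab: "a > 0" "b > 0" using \<alpha> \<beta> by (auto simp: a_def b_def)
  have p3b: "p3 * (b\<^sup>2 * y) = 5 / 3 * y" for y using \<beta> by (simp add: p3_def b_def power_divide)
  have c: "continuous_into_smooth T v" using s by (simp add: solution_def)
  have sm: "smooth (v t)" if "t \<in> {0..T}" for t using c that by (simp add: continuous_into_smooth_def)
  show jv: "jointly_cont T v" and jw: "jointly_cont T (\<lambda>t. deriv (v t))"
    using continuous_into_smooth_jointly_cont[OF c, of 0] continuous_into_smooth_jointly_cont[OF c, of 1] by auto
  have jx: "jointly_cont T (\<lambda>t. deriv (deriv (v t)))"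
    using continuous_into_smooth_jointly_cont[OF c, of 2] by (simp add: numeral_2_eq_2)
  show d1: "(v t has_real_derivative deriv (v t) x) (at x)" if "t \<in> {0..T}" for t x
    using smooth_deriv[OF sm[OF that], of 0] by simp
  show d2: "(deriv (v t) has_real_derivative deriv (deriv (v t)) x) (at x)" if "t \<in> {0..T}" for t x
    using smooth_deriv[OF sm[OF that], of 1] by simp
  have cv: "continuous_on UNIV (v t)" "continuous_on UNIV (deriv (v t))" if "t \<in> {0..T}" for t
    using jointly_cont_slices(2)[OF jv that] jointly_cont_slices(2)[OF jw that] by auto
  show vt: "((\<lambda>s. v s x) has_real_derivative
      - (v t x * deriv (v t) x) - nonlocal_force a b p1 p2 p3 (v t) (deriv (v t)) (\<lambda>_. 1) x) (at t within {0..T})" if t: "t \<in> {0..T}" for t x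
  proof -
    obtain ut where ut: "((\<lambda>s. v s x) has_real_derivative ut) (at t within {0..T})"
      "ut + v t x * deriv (v t) x + F \<alpha> \<beta> (5 / 3) (v t) x = 0"
      using s t unfolding solution_def by blast
    have "F \<alpha> \<beta> (5 / 3) (v t) x = nonlocal_force a b p1 p2 p3 (v t) (deriv (v t)) (\<lambda>_. 1) x"
      unfolding a_def b_def p1_def p2_def p3_def by (rule F_eq_nonlocal_force[OF \<alpha> \<beta> cv(1)[OF t] M(1)[OF t] cv(2)[OF t] M(2)[OF t]])
    hence "ut = - (v t x * deriv (v t) x) - nonlocal_force a b p1 p2 p3 (v t) (deriv (v t)) (\<lambda>_. 1) x" using ut(2) by linarith
    thus ?thesis using ut(1) by simp
  qed
  have sqB: "\<bar>(f t x)\<^sup>2\<bar> \<le> M\<^sup>2" if "\<And>t x. t \<in> {0..T} \<Longrightarrow> \<bar>f t x\<bar> \<le> M" "t \<in> {0..T}" for f :: "real \<Rightarrow> real \<Rightarrow> real" and t x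
    by (rule abs_square_le[OF that(1)[OF that(2)]])
  have op: "jointly_cont T (\<lambda>t. resolvent1 b (\<lambda>y. (f t y)\<^sup>2))" "jointly_cont T (\<lambda>t. resolvent_deriv1 b (\<lambda>y. (f t y)\<^sup>2))"
    "jointly_cont T (\<lambda>t. resolvent1 a (resolvent1 b (\<lambda>y. (f t y)\<^sup>2)))" "jointly_cont T (\<lambda>t. resolvent_deriv1 a (resolvent1 b (\<lambda>y. (f t y)\<^sup>2)))"
    if f: "jointly_cont T f" "\<And>t x. t \<in> {0..T} \<Longrightarrow> \<bar>f t x\<bar> \<le> M" for f
  proof -
    have j2: "jointly_cont T (\<lambda>t y. (f t y)\<^sup>2)" using space_diff_power2[of T 0 f] f(1) by simp
    note o = jointly_cont_resolvents1[OF j2 sqB[where f=f, OF f(2)] ab(2)]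
    show "jointly_cont T (\<lambda>t. resolvent1 b (\<lambda>y. (f t y)\<^sup>2))" "jointly_cont T (\<lambda>t. resolvent_deriv1 b (\<lambda>y. (f t y)\<^sup>2))" using o by auto
    have B: "\<bar>resolvent1 b (\<lambda>y. (f t y)\<^sup>2) x\<bar> \<le> 4 * M\<^sup>2" if t: "t \<in> {0..T}" for t x
      by (rule resolvents_bound(1)[OF admissible_1 ab(2) borel_measurable_continuous_onI[OF jointly_cont_slices(2)[OF j2 t]] sqB[where f=f, OF f(2) t]])
    show "jointly_cont T (\<lambda>t. resolvent1 a (resolvent1 b (\<lambda>y. (f t y)\<^sup>2)))" "jointly_cont T (\<lambda>t. resolvent_deriv1 a (resolvent1 b (\<lambda>y. (f t y)\<^sup>2)))"
      using jointly_cont_resolvents1[OF o(1) B ab(1)] by auto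
  qed
  define Ff where "Ff t = nonlocal_force a b p1 p2 p3 (v t) (deriv (v t)) (\<lambda>_. 1)" for t
  define Gf where "Gf t = force_slope a b p1 p2 p3 (v t) (deriv (v t)) (\<lambda>_. 1)" for t
  have jj: "space_diff T 0 v" "space_diff T 0 (\<lambda>t. deriv (v t))" "space_diff T 0 (\<lambda>t. deriv (deriv (v t)))" using jv jw jx by auto
  note op' = op[folded space_diff.simps(1)]
  have "space_diff T 0 Ff" unfolding Ff_def[abs_def] nonlocal_force_def[abs_def]
    by (intro space_diff_add space_diff_mult space_diff_const op' jj(1,2); rule M; assumption)
  moreover have "space_diff T 0 Gf" unfolding Gf_def[abs_def] force_slope_def[abs_def]
    by (intro space_diff_add space_diff_mult space_diff_diff space_diff_const op' jj(1,2); rule M; assumption)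
  ultimately have jFG: "space_diff T 0 Ff" "space_diff T 0 Gf" by auto
  define g g' where "g t x = - (v t x * deriv (v t) x) - Ff t x"
    and "g' t x = 2 / 3 * (deriv (v t) x)\<^sup>2 - v t x * deriv (deriv (v t)) x - Gf t x" for t x
  have "space_diff T 0 g" "space_diff T 0 g'"
    unfolding g_def[abs_def] g'_def[abs_def] by (intro space_diff_diff space_diff_mult space_diff_minus space_diff_const space_diff_power2 jj jFG)+
  hence jg: "jointly_cont T g" "jointly_cont T g'" by auto
  have gd: "(g t has_real_derivative g' t x) (at x)" if t: "t \<in> {0..T}" for t x
  proof -
    have "(Ff t has_real_derivative 1 * (Gf t x - p3 * (b\<^sup>2 * (deriv (v t) x)\<^sup>2))) (at x)"
      unfolding Ff_def Gf_def by (rule forces_deriv(1)[OF admissible_1 ab cv(1)[OF t] M(1)[OF t] cv(2)[OF t] M(2)[OF t]])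
    hence dF: "(Ff t has_real_derivative Gf t x - 5 / 3 * (deriv (v t) x)\<^sup>2) (at x)" by (simp add: p3b)
    show ?thesis unfolding g_def[abs_def]
      by (rule DERIV_cong[OF DERIV_diff[OF DERIV_minus[OF DERIV_mult[OF d1[OF t] d2[OF t]]] dF]])
        (simp add: g'_def power2_eq_square field_simps)
  qed
  have w: "deriv (v t) x = deriv (v 0) x + time_int g' t x" if t: "t \<in> {0..T}" for t x
  proof -
    have vt': "((\<lambda>s. v s y) has_real_derivative g s y) (at s within {0..T})" if "s \<in> {0..T}" for s y
      using vt[OF that, of y] by (simp add: g_def Ff_def)
    have "v t y = v 0 y + time_int g t y" for y
    proof -
      have "v t y - v 0 y = time_int g t y" by (rule time_int_eqI[OF t vt'])
      thus ?thesis by simp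
    qed
    hence e: "v t = (\<lambda>y. v 0 y + time_int g t y)" by auto
    have "((\<lambda>y. v 0 y + time_int g t y) has_real_derivative deriv (v 0) x + time_int g' t x) (at x)"
      by (intro DERIV_add d1 time_int_deriv_z[OF jg gd t]) (use T in auto)
    thus ?thesis unfolding e[symmetric] by (rule DERIV_imp_deriv)
  qed
  show "((\<lambda>s. deriv (v s) x) has_real_derivative
      2 / 3 * (deriv (v t) x)\<^sup>2 - v t x * deriv (deriv (v t)) x - force_slope a b p1 p2 p3 (v t) (deriv (v t)) (\<lambda>_. 1) x) (at t within {0..T})"
    if t: "t \<in> {0..T}" for t x
  proof -
    have "((\<lambda>s. deriv (v 0) x + time_int g' s x) has_real_derivative 0 + g' t x) (at t within {0..T})"
      by (intro DERIV_add DERIV_const time_int_deriv_t jg t)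
    hence "((\<lambda>s. deriv (v 0) x + time_int g' s x) has_real_derivative g' t x) (at t within {0..T})" by simp
    hence "((\<lambda>s. deriv (v s) x) has_real_derivative g' t x) (at t within {0..T})"
      by (rule has_field_derivative_transform_within[OF _ zero_less_one t]) (rule w[symmetric])
    thus ?thesis by (simp add: g'_def Gf_def)
  qed
qed

text \<open>
  The difference \<open>u - v\<close> and its space derivative are transported by \<open>v\<close>, and only second derivatives
  of \<open>u\<close> enter the right-hand side; those of \<open>v\<close> may be unbounded.
\<close>

theorem solution_unique:
  assumes \<alpha>: "\<alpha> \<noteq> 0" and \<beta>: "\<beta> \<noteq> 0" and T: "0 \<le> T"
    and su: "solution \<alpha> \<beta> (5 / 3) u0 T u" and sv: "solution \<alpha> \<beta> (5 / 3) u0 T v"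
    and Ku: "\<And>t x. t \<in> {0..T} \<Longrightarrow> \<bar>deriv (deriv (u t)) x\<bar> \<le> Ku"
    and t: "t \<in> {0..T}"
  shows "v t = u t"
proof -
  define a b p1 p2 p3 where "a = 1 / \<bar>\<alpha>\<bar>" and "b = 1 / \<bar>\<beta>\<bar>" and "p1 = (5 / 6 :: real)"
    and "p2 = 2 / 3 * (\<alpha>\<^sup>2 + \<beta>\<^sup>2) - 5 / 3 * \<beta>\<^sup>2" and "p3 = 5 / 3 * \<beta>\<^sup>2"
  have ab: "a > 0" "b > 0" using \<alpha> \<beta> by (auto simp: a_def b_def)
  obtain M1 M2 where M12: "\<And>t x. t \<in> {0..T} \<Longrightarrow> \<bar>u t x\<bar> \<le> M1 \<and> \<bar>deriv (u t) x\<bar> \<le> M1"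
    "\<And>t x. t \<in> {0..T} \<Longrightarrow> \<bar>v t x\<bar> \<le> M2 \<and> \<bar>deriv (v t) x\<bar> \<le> M2"
    using su sv unfolding solution_def bounded_with_deriv_def by metis
  define M where "M = max M1 M2"
  have Mu: "\<bar>u t x\<bar> \<le> M" "\<bar>deriv (u t) x\<bar> \<le> M" and Mv: "\<bar>v t x\<bar> \<le> M" "\<bar>deriv (v t) x\<bar> \<le> M" if "t \<in> {0..T}" for t x
    using M12(1)[OF that, of x] M12(2)[OF that, of x] by (auto simp: M_def)
  have T0: "0 \<in> {0..T}" using T by auto
  have M0: "0 \<le> M" using Mu(1)[OF T0, of 0] by linarith
  have Ku0: "0 \<le> Ku" using Ku[OF T0, of 0] by linarith
  have bu: "\<forall>t\<in>{0..T}. \<forall>x. \<bar>u t x\<bar> \<le> M \<and> \<bar>deriv (u t) x\<bar> \<le> M"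
    and bv: "\<forall>t\<in>{0..T}. \<forall>x. \<bar>v t x\<bar> \<le> M \<and> \<bar>deriv (v t) x\<bar> \<le> M"
    using Mu Mv by auto
  note fu = solution_facts[OF \<alpha> \<beta> T su bu, folded a_def b_def p1_def p2_def p3_def]
  note fv = solution_facts[OF \<alpha> \<beta> T sv bv, folded a_def b_def p1_def p2_def p3_def]
  obtain K where K: "K > 0" and Kd: "\<And>U W U' W' M e z. continuous_on UNIV U \<Longrightarrow> continuous_on UNIV W \<Longrightarrow> continuous_on UNIV U' \<Longrightarrow> continuous_on UNIV W' \<Longrightarrow>
      (\<And>y. \<bar>U y\<bar> \<le> M) \<Longrightarrow> (\<And>y. \<bar>W y\<bar> \<le> M) \<Longrightarrow> (\<And>y. \<bar>U' y\<bar> \<le> M) \<Longrightarrow> (\<And>y. \<bar>W' y\<bar> \<le> M) \<Longrightarrow>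
      (\<And>y. \<bar>U y - U' y\<bar> \<le> e) \<Longrightarrow> (\<And>y. \<bar>W y - W' y\<bar> \<le> e) \<Longrightarrow>
      \<bar>nonlocal_force a b p1 p2 p3 U W (\<lambda>_. 1) z - nonlocal_force a b p1 p2 p3 U' W' (\<lambda>_. 1) z\<bar> \<le> K * (M * e) \<and>
      \<bar>force_slope a b p1 p2 p3 U W (\<lambda>_. 1) z - force_slope a b p1 p2 p3 U' W' (\<lambda>_. 1) z\<bar> \<le> K * (M * e)"
    using forces_diff[OF ab, of p1 p2 p3] by metis
  \<comment> \<open>Bounds the zero-order terms in the two equations for the differences; doubling
    it in \<open>l\<close> makes the integral of k A exp (l s) over [0, t] equal to A / 2 (exp (l t)
    - 1), hence a factor 1 / 2 per round.\<close>
  define k where "k = 2 * M + Ku + K * M + 1"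
  have k0: "k > 0" unfolding k_def using M0 Ku0 K by (intro add_nonneg_pos add_nonneg_nonneg) auto
  define l where "l = 2 * k"
  define P where "P A \<longleftrightarrow> (\<forall>t\<in>{0..T}. \<forall>x. \<bar>u t x - v t x\<bar> \<le> A * exp (l * t) \<and> \<bar>deriv (u t) x - deriv (v t) x\<bar> \<le> A * exp (l * t))" for A
  have step: "P (A / 2)" if PA: "P A" for A
  proof -
    have A0: "0 \<le> A * exp (l * t)" if "t \<in> {0..T}" for t
    proof -
      have "\<bar>u t 0 - v t 0\<bar> \<le> A * exp (l * t)" using PA that unfolding P_def by blast
      thus ?thesis by linarith
    qed
    hence A0': "0 \<le> A" using A0[OF T0] by simp
    define H' where "H' t = k * (A * exp (l * t))" for t
    \<comment> \<open>For negative t the bracket is negative, but the maximum principle asks for a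
      barrier that is nonnegative everywhere; on [0, T] the modulus changes nothing.\<close>
    define h where "h t = A / 2 * \<bar>exp (l * t) - 1\<bar>" for t
    have hd: "(h has_real_derivative H' t) (at t within {0..T})" if t: "t \<in> {0..T}" for t
    proof -
      have "((\<lambda>t. A / 2 * (exp (l * t) - 1)) has_real_derivative H' t) (at t within {0..T})"
        unfolding H'_def l_def by (auto intro!: derivative_eq_intros)
      moreover have "A / 2 * (exp (l * s) - 1) = h s" if "s \<in> {0..T}" for s
        using that k0 by (auto simp: h_def l_def)
      ultimately show ?thesis by (rule has_field_derivative_transform_within[OF _ zero_less_one t])
    qed
    have h0: "0 \<le> h t" for t using A0' by (simp add: h_def)
    have hle: "h t \<le> A / 2 * exp (l * t)" if "t \<in> {0..T}" for t
      unfolding h_def using that k0 A0' by (intro mult_left_mono) (auto simp: l_def)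
    have cont: "continuous_on UNIV (u t)" "continuous_on UNIV (deriv (u t))" "continuous_on UNIV (v t)" "continuous_on UNIV (deriv (v t))" if "t \<in> {0..T}" for t
      using jointly_cont_slices(2)[OF fu(1) that] jointly_cont_slices(2)[OF fu(2) that] jointly_cont_slices(2)[OF fv(1) that] jointly_cont_slices(2)[OF fv(2) that] by auto
    define d d' where "d t x = u t x - v t x" and "d' t x = deriv (u t) x - deriv (v t) x" for t x
    define N1 N2 where "N1 t x = - (d t x * deriv (u t) x) - (nonlocal_force a b p1 p2 p3 (u t) (deriv (u t)) (\<lambda>_. 1) x - nonlocal_force a b p1 p2 p3 (v t) (deriv (v t)) (\<lambda>_. 1) x)"
      and "N2 t x = 2 / 3 * ((deriv (u t) x + deriv (v t) x) * d' t x) - d t x * deriv (deriv (u t)) x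
        - (force_slope a b p1 p2 p3 (u t) (deriv (u t)) (\<lambda>_. 1) x - force_slope a b p1 p2 p3 (v t) (deriv (v t)) (\<lambda>_. 1) x)" for t x
    have dA: "\<bar>d t x\<bar> \<le> A * exp (l * t)" "\<bar>d' t x\<bar> \<le> A * exp (l * t)" if "t \<in> {0..T}" for t x
      using PA that unfolding P_def d_def d'_def by blast+
    have N: "\<bar>N1 t x\<bar> \<le> H' t" "\<bar>N2 t x\<bar> \<le> H' t" if t: "t \<in> {0..T}" for t x
    proof -
      define e where "e = A * exp (l * t)"
      have e0: "0 \<le> e" using A0[OF t] by (simp add: e_def)
      note de = dA[OF t, folded e_def]
      have Fd: "\<bar>nonlocal_force a b p1 p2 p3 (u t) (deriv (u t)) (\<lambda>_. 1) x - nonlocal_force a b p1 p2 p3 (v t) (deriv (v t)) (\<lambda>_. 1) x\<bar> \<le> K * (M * e) \<and>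
        \<bar>force_slope a b p1 p2 p3 (u t) (deriv (u t)) (\<lambda>_. 1) x - force_slope a b p1 p2 p3 (v t) (deriv (v t)) (\<lambda>_. 1) x\<bar> \<le> K * (M * e)"
        by (rule Kd[OF cont[OF t] Mu[OF t] Mv[OF t]]) (use de in \<open>simp_all add: d_def d'_def\<close>)
      have 1: "\<bar>d t x * deriv (u t) x\<bar> \<le> M * e" unfolding abs_mult mult.commute[of M] using de Mu[OF t] e0 by (intro mult_mono) auto
      have 2: "\<bar>d t x * deriv (deriv (u t)) x\<bar> \<le> e * Ku" unfolding abs_mult using de Ku[OF t] e0 by (intro mult_mono) auto
      have "\<bar>deriv (u t) x + deriv (v t) x\<bar> \<le> 2 * M" using Mu(2)[OF t, of x] Mv(2)[OF t, of x] by linarith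
      hence 3: "\<bar>(deriv (u t) x + deriv (v t) x) * d' t x\<bar> \<le> 2 * M * e" unfolding abs_mult using de M0 by (intro mult_mono) auto
      have H'e: "H' t = 2 * M * e + e * Ku + K * (M * e) + e" by (simp add: H'_def e_def[symmetric] k_def algebra_simps)
      have n: "0 \<le> e * Ku" "0 \<le> M * e" using e0 M0 Ku0 by auto
      show "\<bar>N1 t x\<bar> \<le> H' t" using 1 conjunct1[OF Fd] n e0 unfolding N1_def H'e by linarith
      show "\<bar>N2 t x\<bar> \<le> H' t" using 2 3 Fd n e0 unfolding N2_def H'e by linarith
    qed
    have jd: "jointly_cont T d" "jointly_cont T d'" "jointly_cont T (\<lambda>t x. - d t x)" "jointly_cont T (\<lambda>t x. - d' t x)"
    proof -
 have j: "space_diff T 0 u" "space_diff T 0 v" "space_diff T 0 (\<lambda>t. deriv (u t))" "space_diff T 0 (\<lambda>t. deriv (v t))" using fu(1,2) fv(1,2) by auto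
      have "space_diff T 0 d" "space_diff T 0 d'" "space_diff T 0 (\<lambda>t x. - d t x)" "space_diff T 0 (\<lambda>t x. - d' t x)"
        unfolding d_def[abs_def] d'_def[abs_def] by (intro space_diff_diff space_diff_minus j)+
      thus "jointly_cont T d" "jointly_cont T d'" "jointly_cont T (\<lambda>t x. - d t x)" "jointly_cont T (\<lambda>t x. - d' t x)" by auto
    qed
    have tx: "((\<lambda>s. d s x) has_real_derivative N1 t x - v t x * d' t x) (at t within {0..T})"
      "(d t has_real_derivative d' t x) (at x)"
      "((\<lambda>s. d' s x) has_real_derivative N2 t x - v t x * (deriv (deriv (u t)) x - deriv (deriv (v t)) x)) (at t within {0..T})"
      "(d' t has_real_derivative deriv (deriv (u t)) x - deriv (deriv (v t)) x) (at x)" if t: "t \<in> {0..T}" for t x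
    proof -
      show "((\<lambda>s. d s x) has_real_derivative N1 t x - v t x * d' t x) (at t within {0..T})"
        unfolding d_def by (rule DERIV_cong[OF DERIV_diff[OF fu(5)[OF t] fv(5)[OF t]]]) (simp add: N1_def d_def d'_def algebra_simps)
      show "((\<lambda>s. d' s x) has_real_derivative N2 t x - v t x * (deriv (deriv (u t)) x - deriv (deriv (v t)) x)) (at t within {0..T})"
        unfolding d'_def by (rule DERIV_cong[OF DERIV_diff[OF fu(6)[OF t] fv(6)[OF t]]])
          (simp add: N2_def d_def d'_def field_simps power2_eq_square)
      show "(d t has_real_derivative d' t x) (at x)" "(d' t has_real_derivative deriv (deriv (u t)) x - deriv (deriv (v t)) x) (at x)"
        unfolding d_def[abs_def] d'_def[abs_def] by (intro DERIV_diff fu(3,4) fv(3,4) t)+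
    qed
    have init: "d 0 x = 0" "d' 0 x = 0" for x
      using su sv by (auto simp: solution_def d_def d'_def)
    have B: "\<bar>d t x\<bar> \<le> 2 * M" "\<bar>d' t x\<bar> \<le> 2 * M" if "t \<in> {0..T}" for t x
      using Mu[OF that, of x] Mv[OF that, of x] by (auto simp: d_def d'_def)
    \<comment> \<open>Applied to both differences with both signs, since the maximum principle is
      one-sided.\<close>
    have mp: "f t x \<le> h t" if t: "t \<in> {0..T}" and f: "jointly_cont T f"
      "\<And>t x. t \<in> {0..T} \<Longrightarrow> ((\<lambda>s. f s x) has_real_derivative n t x - v t x * f' t x) (at t within {0..T})"
      "\<And>t x. t \<in> {0..T} \<Longrightarrow> (f t has_real_derivative f' t x) (at x)"
      "\<And>t x. t \<in> {0..T} \<Longrightarrow> f t x \<le> 2 * M" "\<And>x. f 0 x \<le> 0" "\<And>t x. t \<in> {0..T} \<Longrightarrow> n t x \<le> H' t" for f f' n t x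
    proof (rule transport_max_principle[OF T f(1), where v=v and M=M and ft="\<lambda>t x. n t x - v t x * f' t x" and fx=f' and B="2 * M" and H'=H'])
      show "n t x - v t x * f' t x + v t x * f' t x \<le> H' t" if "t \<in> {0..T}" for t x
        using f(6)[OF that, of x] by simp
    qed (use f Mv hd h0 t in blast)+
    have fin: "\<bar>d t x\<bar> \<le> h t \<and> \<bar>d' t x\<bar> \<le> h t" if t: "t \<in> {0..T}" for t x
    proof -
      have "d t x \<le> h t"
        by (rule mp[OF t jd(1) tx(1,2)]) (use B init N in \<open>auto simp: abs_le_iff\<close>)
      moreover have "d' t x \<le> h t"
        by (rule mp[OF t jd(2) tx(3,4)]) (use B init N in \<open>auto simp: abs_le_iff\<close>)
      moreover have "- d t x \<le> h t"
      proof (rule mp[OF t jd(3), where n="\<lambda>t x. - N1 t x" and f'="\<lambda>t x. - d' t x"])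
        show "((\<lambda>s. - d s x) has_real_derivative - N1 t x - v t x * - d' t x) (at t within {0..T})" if "t \<in> {0..T}" for t x
          by (rule DERIV_cong[OF DERIV_minus[OF tx(1)[OF that]]]) simp
        show "((\<lambda>x. - d t x) has_real_derivative - d' t x) (at x)" if "t \<in> {0..T}" for t x
          by (rule DERIV_minus[OF tx(2)[OF that]])
      qed (use B init N in \<open>auto simp: abs_le_iff\<close>)
      moreover have "- d' t x \<le> h t"
      proof (rule mp[OF t jd(4), where n="\<lambda>t x. - N2 t x" and f'="\<lambda>t x. - (deriv (deriv (u t)) x - deriv (deriv (v t)) x)"])
        show "((\<lambda>s. - d' s x) has_real_derivative - N2 t x - v t x * - (deriv (deriv (u t)) x - deriv (deriv (v t)) x)) (at t within {0..T})" if "t \<in> {0..T}" for t x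
          by (rule DERIV_cong[OF DERIV_minus[OF tx(3)[OF that]]]) (simp add: algebra_simps)
        show "((\<lambda>x. - d' t x) has_real_derivative - (deriv (deriv (u t)) x - deriv (deriv (v t)) x)) (at x)" if "t \<in> {0..T}" for t x
          by (rule DERIV_minus[OF tx(4)[OF that]])
      qed (use B init N in \<open>auto simp: abs_le_iff\<close>)
      ultimately show ?thesis by linarith
    qed
    show ?thesis
      unfolding P_def
    proof (intro ballI allI)
      fix t x assume t: "t \<in> {0..T}"
      show "\<bar>u t x - v t x\<bar> \<le> A / 2 * exp (l * t) \<and> \<bar>deriv (u t) x - deriv (v t) x\<bar> \<le> A / 2 * exp (l * t)"
        using fin[OF t, of x] hle[OF t] unfolding d_def d'_def by linarith
    qed
  qed
  \<comment> \<open>The crude bound starts the iteration, which then tends to 0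
    geometrically.\<close>
  have "P (2 * M)"
    unfolding P_def
  proof (intro ballI allI)
    fix t x assume t: "t \<in> {0..T}"
    have "1 \<le> exp (l * t)" using t k0 by (auto simp: l_def)
    hence "2 * M * 1 \<le> 2 * M * exp (l * t)" using M0 by (intro mult_left_mono) auto
    thus "\<bar>u t x - v t x\<bar> \<le> 2 * M * exp (l * t) \<and> \<bar>deriv (u t) x - deriv (v t) x\<bar> \<le> 2 * M * exp (l * t)"
      using Mu[OF t, of x] Mv[OF t, of x] by linarith
  qed
  hence Pn: "P (2 * M / 2 ^ n)" for n
  proof (induction n)
    case (Suc n) from step[OF Suc.IH[OF Suc.prems]] show ?case by (simp add: field_simps)
  qed simp
  show "v t = u t"
  proof
    fix x
    have "\<bar>u t x - v t x\<bar> \<le> 2 * M / 2 ^ n * exp (l * t)" for n using Pn[of n] t unfolding P_def by blast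
    moreover have "(\<lambda>n. 2 * M / 2 ^ n * exp (l * t)) \<longlonglongrightarrow> 0" by real_asymp
    ultimately have "\<bar>u t x - v t x\<bar> \<le> 0" by (intro LIMSEQ_le_const) auto
    thus "v t x = u t x" by simp
  qed
qed

section \<open>Littlewood-Paley blocks\<close>

lemma smooth_continuous: "smooth f \<Longrightarrow> continuous_on A ((deriv ^^ n) f)"
  using smooth_deriv by (meson DERIV_isCont continuous_at_imp_continuous_on)

lemma deriv_iter_support:
  assumes "\<And>\<xi>. f \<xi> \<noteq> 0 \<Longrightarrow> \<bar>\<xi>\<bar> \<le> c" "\<bar>\<xi>\<bar> > c"
  shows "(deriv ^^ n) f \<xi> = (0 :: real)"
  using assms(2)
proof (induction n arbitrary: \<xi>)
  case 0 thus ?case using assms(1)[of \<xi>] by (auto simp: not_le)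
next
  case (Suc n)
  have "open {y. c < \<bar>y\<bar>}" by (intro open_Collect_less continuous_intros)
  hence "\<forall>\<^sub>F y in nhds \<xi>. (deriv ^^ n) f y = 0"
    using Suc eventually_nhds by (metis (mono_tags, lifting) mem_Collect_eq)
  hence "deriv ((deriv ^^ n) f) \<xi> = deriv (\<lambda>_. 0) \<xi>" by (intro deriv_cong_ev refl)
  thus ?case by simp
qed

text \<open>Instantiated by \<open>chi\<close> and \<open>phi\<close>; the dyadic scale is
  introduced by dilation.\<close>

locale freq_kernel =
  fixes f :: "real \<Rightarrow> real" and c :: real
  assumes sm: "smooth f" and supp: "\<And>\<xi>. f \<xi> \<noteq> 0 \<Longrightarrow> \<bar>\<xi>\<bar> \<le> c" and c0: "0 \<le> c"
begin

definition "block_kernel x = Re (inv_fourier f x)"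

text \<open>The interval is larger than the support, so all derivatives of f vanish at its ends and
  integration by parts leaves no boundary terms.\<close>

definition "J n x = integral {- (c + 1)..c + 1} (\<lambda>\<xi>. cis (x * \<xi>) * complex_of_real ((deriv ^^ n) f \<xi>))"

lemma fc: "continuous_on A f" using smooth_continuous[OF sm, of A 0] by simp

lemma lborel_eq_J:
  "integrable lborel (\<lambda>\<xi>. cis (x * \<xi>) * complex_of_real (f \<xi>))"
  "(LINT \<xi>|lborel. cis (x * \<xi>) * complex_of_real (f \<xi>)) = J 0 x"
proof -
  let ?g = "\<lambda>\<xi>. cis (x * \<xi>) * complex_of_real (f \<xi>)"
  have s: "set_integrable lborel {- (c + 1)..c + 1} ?g"
    by (rule borel_integrable_atLeastAtMost') (intro continuous_intros fc)
  have e: "(\<lambda>\<xi>. indicator {- (c + 1)..c + 1} \<xi> *\<^sub>R ?g \<xi>) = ?g"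
  proof
    fix \<xi> show "indicator {- (c + 1)..c + 1} \<xi> *\<^sub>R ?g \<xi> = ?g \<xi>"
      using supp[of \<xi>] by (cases "f \<xi> = 0") (auto simp: indicator_def)
  qed
  show "integrable lborel ?g" using s unfolding set_integrable_def e .
  show "(LINT \<xi>|lborel. ?g \<xi>) = J 0 x"
    using set_borel_integral_eq_integral(2)[OF s] unfolding set_lebesgue_integral_def e by (simp add: J_def)
qed

lemma inv_fourier_J: "inv_fourier f x = (1 / (2 * pi)) * J 0 x"
  unfolding inv_fourier_def lborel_eq_J(2) ..

lemma J_cont: "continuous_on UNIV (J n)"
proof -
  have "continuous_on UNIV (\<lambda>x. integral (cbox (- (c + 1)) (c + 1)) ((\<lambda>x \<xi>. cis (x * \<xi>) * complex_of_real ((deriv ^^ n) f \<xi>)) x))"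
  proof (rule integral_continuous_on_param)
    have "continuous_on (UNIV \<times> cbox (- (c + 1)) (c + 1)) (\<lambda>p. (deriv ^^ n) f (snd p))"
      by (rule continuous_on_compose2[OF smooth_continuous[OF sm, of UNIV n]]) (auto intro: continuous_on_snd)
    thus "continuous_on (UNIV \<times> cbox (- (c + 1)) (c + 1)) (\<lambda>(x, \<xi>). cis (x * \<xi>) * complex_of_real ((deriv ^^ n) f \<xi>))"
      unfolding case_prod_unfold by (intro continuous_intros)
  qed
  thus ?thesis by (simp add: J_def[abs_def])
qed

lemma J_step: "norm (J (Suc n) x) = \<bar>x\<bar> * norm (J n x)"
proof -
  let ?d = "\<lambda>n \<xi>. complex_of_real ((deriv ^^ n) f \<xi>)"
  have z: "(deriv ^^ n) f (c + 1) = 0" "(deriv ^^ n) f (- (c + 1)) = 0"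
    by (rule deriv_iter_support[where c=c, OF supp]; use c0 in auto)+
  have "((\<lambda>\<xi>. cis (x * \<xi>) * ?d (Suc n) \<xi> + (\<i> * complex_of_real x) * (cis (x * \<xi>) * ?d n \<xi>)) has_integral
     cis (x * (c + 1)) * ?d n (c + 1) - cis (x * (- (c + 1))) * ?d n (- (c + 1))) {- (c + 1)..c + 1}"
  proof (rule fundamental_theorem_of_calculus)
    fix \<xi>
    have "((\<lambda>\<xi>. cis (x * \<xi>)) has_vector_derivative \<i> * complex_of_real x * cis (x * \<xi>)) (at \<xi>)"
    proof -
      have "((\<lambda>w. exp (\<i> * complex_of_real x * w)) has_field_derivative \<i> * complex_of_real x * exp (\<i> * complex_of_real x * complex_of_real \<xi>)) (at (complex_of_real \<xi>))"
        by (auto intro!: derivative_eq_intros)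
      from has_vector_derivative_real_field[OF this] show ?thesis
        by (simp add: cis_conv_exp mult.assoc)
    qed
    moreover have "(?d n has_vector_derivative ?d (Suc n) \<xi>) (at \<xi>)"
      using smooth_deriv[OF sm, of n \<xi>] by (intro has_vector_derivative_of_real) (simp add: has_real_derivative_iff_has_vector_derivative)
    ultimately have "((\<lambda>\<xi>. cis (x * \<xi>) * ?d n \<xi>) has_vector_derivative
       cis (x * \<xi>) * ?d (Suc n) \<xi> + (\<i> * complex_of_real x * cis (x * \<xi>)) * ?d n \<xi>) (at \<xi>)"
      by (rule has_vector_derivative_mult)
    thus "((\<lambda>\<xi>. cis (x * \<xi>) * ?d n \<xi>) has_vector_derivative
       cis (x * \<xi>) * ?d (Suc n) \<xi> + (\<i> * complex_of_real x) * (cis (x * \<xi>) * ?d n \<xi>)) (at \<xi> within {- (c + 1)..c + 1})"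
      by (simp add: mult.assoc has_vector_derivative_at_within)
  qed (use c0 in auto)
  hence 0: "((\<lambda>\<xi>. cis (x * \<xi>) * ?d (Suc n) \<xi> + (\<i> * complex_of_real x) * (cis (x * \<xi>) * ?d n \<xi>)) has_integral 0) {- (c + 1)..c + 1}"
    by (simp only: z of_real_0 mult_zero_right diff_self)
  have i: "(\<lambda>\<xi>. cis (x * \<xi>) * ?d n \<xi>) integrable_on {- (c + 1)..c + 1}" for n
    by (intro integrable_continuous_real continuous_intros smooth_continuous[OF sm])
  have "integral {- (c + 1)..c + 1} (\<lambda>\<xi>. cis (x * \<xi>) * ?d (Suc n) \<xi> + (\<i> * complex_of_real x) * (cis (x * \<xi>) * ?d n \<xi>))
     = J (Suc n) x + (\<i> * complex_of_real x) * J n x"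
    unfolding J_def
    by (subst Henstock_Kurzweil_Integration.integral_add[OF i integrable_on_mult_right[OF i]]) (simp only: integral_mult_right)
  hence "J (Suc n) x = - ((\<i> * complex_of_real x) * J n x)"
    using integral_unique[OF 0] by (simp add: add_eq_0_iff2)
  thus ?thesis by (simp add: norm_mult)
qed

lemma J_bound: "\<exists>D. \<forall>x. norm (J n x) \<le> D"
proof -
  have "compact ((deriv ^^ n) f ` {- (c + 1)..c + 1})"
    by (intro compact_continuous_image smooth_continuous[OF sm]) auto
  then obtain B where B: "\<And>\<xi>. \<xi> \<in> {- (c + 1)..c + 1} \<Longrightarrow> \<bar>(deriv ^^ n) f \<xi>\<bar> \<le> B"
    using compact_imp_bounded bounded_real by (metis (no_types, lifting) bounded_iff image_eqI real_norm_def)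
  have "norm (J n x) \<le> B * (c + 1 - (- (c + 1)))" for x
    unfolding J_def
    by (rule integral_bound) (use c0 B in \<open>auto simp: norm_mult intro!: continuous_intros smooth_continuous[OF sm]\<close>)
  thus ?thesis by blast
qed

lemma J_pow: "norm (J n x) = \<bar>x\<bar> ^ n * norm (J 0 x)"
  by (induction n) (simp_all add: J_step)

lemma block_kernel_cont: "continuous_on A block_kernel"
proof -
  have "continuous_on UNIV block_kernel" unfolding block_kernel_def[abs_def] inv_fourier_J by (intro continuous_intros J_cont)
  thus ?thesis by (rule continuous_on_subset) simp
qed

lemma block_kernel_meas [measurable]: "block_kernel \<in> borel_measurable borel"
  by (rule borel_measurable_continuous_onI[OF block_kernel_cont])

text \<open>The transforms of the derivatives of order 0, 2 and 4 carry the weights 1, x^2 and x^4.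
  Decay of fourth order keeps second moments of the kernel integrable, which quadratic remainders
  require.\<close>

lemma inv_fourier_decay: "\<exists>D. \<forall>x. norm (inv_fourier f x) \<le> D / (1 + x\<^sup>2)\<^sup>2"
proof -
  obtain D0 D2 D4 where D: "\<And>x. norm (J 0 x) \<le> D0" "\<And>x. norm (J 2 x) \<le> D2" "\<And>x. norm (J 4 x) \<le> D4"
    using J_bound by metis
  have "norm (inv_fourier f x) \<le> (1 / (2 * pi) * (D0 + 2 * D2 + D4)) / (1 + x\<^sup>2)\<^sup>2" for x
  proof -
    have e: "\<bar>x\<bar> ^ 4 = (x\<^sup>2)\<^sup>2" by (simp add: power4_eq_xxxx power2_eq_square)
    have "(1 + x\<^sup>2)\<^sup>2 * norm (J 0 x) = norm (J 0 x) + 2 * norm (J 2 x) + norm (J 4 x)"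
      unfolding J_pow[of 2] J_pow[of 4] e by (simp add: power2_eq_square algebra_simps)
    also have "\<dots> \<le> D0 + 2 * D2 + D4" using D[of x] by simp
    finally have a: "(1 + x\<^sup>2)\<^sup>2 * norm (J 0 x) \<le> D0 + 2 * D2 + D4" .
    have "(1 + x\<^sup>2)\<^sup>2 > 0" by (simp add: add_nonneg_eq_0_iff)
    hence "norm (J 0 x) \<le> (D0 + 2 * D2 + D4) / (1 + x\<^sup>2)\<^sup>2" using a by (simp add: pos_le_divide_eq mult.commute)
    hence "1 / (2 * pi) * norm (J 0 x) \<le> 1 / (2 * pi) * ((D0 + 2 * D2 + D4) / (1 + x\<^sup>2)\<^sup>2)" by (intro mult_left_mono) auto
    thus ?thesis unfolding inv_fourier_J norm_mult by (simp add: norm_divide norm_mult)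
  qed
  thus ?thesis by blast
qed

lemma inv_fourier_integrable: "integrable lborel (\<lambda>x. (1 + x\<^sup>2) * norm (inv_fourier f x))"
proof -
  obtain D where D: "\<And>x. norm (inv_fourier f x) \<le> D / (1 + x\<^sup>2)\<^sup>2" using inv_fourier_decay by metis
  have c: "continuous_on UNIV (inv_fourier f)" unfolding inv_fourier_J[abs_def] by (intro continuous_intros J_cont)
  hence [measurable]: "inv_fourier f \<in> borel_measurable borel" by (rule borel_measurable_continuous_onI)
  show ?thesis
  proof (rule Bochner_Integration.integrable_bound)
    show "integrable lborel (\<lambda>x. D * (1 / (1 + x\<^sup>2)))" by (intro integrable_mult_right integrable_inverse_1_plus_square_UNIV)
    show "AE x in lborel. norm ((1 + x\<^sup>2) * norm (inv_fourier f x)) \<le> norm (D * (1 / (1 + x\<^sup>2)))"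
    proof (rule AE_I2)
      fix x :: real
      have p: "0 < 1 + x\<^sup>2" by (simp add: add_pos_nonneg)
      have "(1 + x\<^sup>2) * norm (inv_fourier f x) \<le> (1 + x\<^sup>2) * (D / (1 + x\<^sup>2)\<^sup>2)"
        using D[of x] p by (intro mult_left_mono) auto
      also have "\<dots> = D * (1 / (1 + x\<^sup>2))" using p by (simp add: power2_eq_square)
      also have "\<dots> \<le> \<bar>D * (1 / (1 + x\<^sup>2))\<bar>" by (rule abs_ge_self)
      finally show "norm ((1 + x\<^sup>2) * norm (inv_fourier f x)) \<le> norm (D * (1 / (1 + x\<^sup>2)))"
        using p by simp
    qed
  qed measurable
qed

lemma block_kernel_moment:
  assumes "g \<in> borel_measurable borel" "\<And>x. \<bar>g x\<bar> \<le> k * (1 + x\<^sup>2)"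
  shows "integrable lborel (\<lambda>x. block_kernel x * g x)"
    "\<bar>LINT x|lborel. block_kernel x * g x\<bar> \<le> k * (LINT x|lborel. (1 + x\<^sup>2) * norm (inv_fourier f x))"
proof -
  note [measurable] = assms(1)
  have b: "\<bar>block_kernel x * g x\<bar> \<le> k * ((1 + x\<^sup>2) * norm (inv_fourier f x))" for x
  proof -
    have "\<bar>block_kernel x\<bar> * \<bar>g x\<bar> \<le> norm (inv_fourier f x) * (k * (1 + x\<^sup>2))"
      unfolding block_kernel_def using assms(2) abs_Re_le_cmod by (intro mult_mono) auto
    thus ?thesis by (simp add: abs_mult mult_ac)
  qed
  have wi: "integrable lborel (\<lambda>x. k * ((1 + x\<^sup>2) * norm (inv_fourier f x)))"
    by (intro integrable_mult_right inv_fourier_integrable)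
  show i: "integrable lborel (\<lambda>x. block_kernel x * g x)"
    by (rule Bochner_Integration.integrable_bound[OF wi]) (auto intro!: AE_I2 order_trans[OF b abs_ge_self] simp del: abs_mult simp: abs_mult[symmetric])
  have "\<bar>LINT x|lborel. block_kernel x * g x\<bar> \<le> (LINT x|lborel. \<bar>block_kernel x * g x\<bar>)" by (rule integral_abs_bound)
  also have "\<dots> \<le> (LINT x|lborel. k * ((1 + x\<^sup>2) * norm (inv_fourier f x)))"
    by (intro integral_mono integrable_abs i wi b)
  finally show "\<bar>LINT x|lborel. block_kernel x * g x\<bar> \<le> k * (LINT x|lborel. (1 + x\<^sup>2) * norm (inv_fourier f x))" by simp
qed

text \<open>The single constant of all block estimates; the weight admits bounded functions as well
  as quadratic remainders.\<close>

definition "I0 = (LINT x|lborel. (1 + x\<^sup>2) * norm (inv_fourier f x))"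

lemma I0_nonneg: "0 \<le> I0" unfolding I0_def by (intro integral_nonneg_AE AE_I2) simp

lemma block_kernel_even: "block_kernel (- x) = block_kernel x"
proof -
  have "J 0 (- x) = cnj (J 0 x)"
    unfolding J_def integral_cnj by (simp add: cis_cnj)
  thus ?thesis by (simp add: block_kernel_def inv_fourier_J)
qed

text \<open>Inversion at the point 0, with the roles of symbol and kernel exchanged. For
  \<open>phi\<close> the mass is 0 because the symbol vanishes at 0; with the vanishing first moment
  of an even kernel, blocks annihilate affine functions.\<close>

lemma block_kernel_integral: "(LINT x|lborel. block_kernel x) = f 0"
proof -
  have fi: "integrable lborel f"
  proof -
    have "integrable lborel (\<lambda>\<xi>. complex_of_real (f \<xi>))" using lborel_eq_J(1)[of 0] by simp
    from integrable_Re[OF this] show ?thesis by simp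
  qed
  have "compact (f ` {- c..c})" by (intro compact_continuous_image fc) auto
  then obtain B where "\<And>\<xi>. \<xi> \<in> {- c..c} \<Longrightarrow> \<bar>f \<xi>\<bar> \<le> B"
    using compact_imp_bounded bounded_real by (metis (no_types, lifting) bounded_iff image_eqI real_norm_def)
  hence B: "\<bar>f \<xi>\<bar> \<le> max B 0" for \<xi>
  proof (cases "f \<xi> = 0")
    case False
    hence "\<xi> \<in> {- c..c}" using supp[of \<xi>] by auto
    thus ?thesis using \<open>\<And>\<xi>. \<xi> \<in> {- c..c} \<Longrightarrow> \<bar>f \<xi>\<bar> \<le> B\<close>[of \<xi>] by linarith
  qed simp
  define g where "g \<xi> = complex_of_real (2 * pi) * inv_fourier f (- \<xi>)" for \<xi>
  have g: "g \<xi> = (LINT y|lborel. cis (- (y * \<xi>)) * complex_of_real (f y))" for \<xi>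
    unfolding g_def inv_fourier_def by (simp add: mult.commute)
  have ii: "integrable lborel (inv_fourier f)"
  proof (rule Bochner_Integration.integrable_bound[OF inv_fourier_integrable])
    have "continuous_on UNIV (inv_fourier f)" unfolding inv_fourier_J[abs_def] by (intro continuous_intros J_cont)
    thus "inv_fourier f \<in> borel_measurable lborel" using borel_measurable_continuous_onI by auto
    show "AE x in lborel. norm (inv_fourier f x) \<le> norm ((1 + x\<^sup>2) * norm (inv_fourier f x))"
      by (intro AE_I2) (simp add: abs_mult mult_le_cancel_right1)
  qed
  hence im: "integrable lborel (\<lambda>\<xi>. inv_fourier f (0 + (- 1) * \<xi>))" by (intro lborel_integrable_real_affine) auto
  hence gi: "integrable lborel g" unfolding g_def by simp
  have "(LINT \<xi>|lborel. cis (0 * \<xi>) * g \<xi>) = complex_of_real (2 * pi * f 0)"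
    by (rule fourier_inversion[OF fi fc B g gi])
  hence "complex_of_real (2 * pi) * (LINT \<xi>|lborel. inv_fourier f (- \<xi>)) = complex_of_real (2 * pi) * complex_of_real (f 0)"
    by (simp add: g_def)
  hence "(LINT \<xi>|lborel. inv_fourier f (- \<xi>)) = complex_of_real (f 0)" by simp
  hence "(LINT \<xi>|lborel. block_kernel (- \<xi>)) = f 0"
    unfolding block_kernel_def using integral_Re[OF im] by simp
  thus ?thesis by (simp add: block_kernel_even)
qed

lemma block_kernel_first_moment: "(LINT x|lborel. block_kernel x * x) = 0"
proof -
  have "(LINT x|lborel. block_kernel x * x) = - (LINT x|lborel. block_kernel x * x)"
    by (subst lborel_integral_real_affine[of "- 1" _ 0]) (simp_all add: block_kernel_even)
  thus ?thesis by simp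
qed

text \<open>After rescaling, the kernel is the same for every block and the scale appears only in
  the argument of h.\<close>

lemma multiplier_eq:
  assumes s: "s > 0" shows "multiplier (\<lambda>\<xi>. f (\<xi> / s)) h x = (LINT y|lborel. block_kernel y * h (x - y / s))"
proof -
  have k: "Re (inv_fourier (\<lambda>\<xi>. f (\<xi> / s)) z) = s * block_kernel (s * z)" for z
  proof -
    have "(LINT \<xi>|lborel. cis (z * \<xi>) * complex_of_real (f (\<xi> / s))) = s *\<^sub>R (LINT \<xi>|lborel. cis (s * z * \<xi>) * complex_of_real (f \<xi>))"
      using s by (subst lborel_integral_real_affine[of s _ 0]) (auto simp: mult_ac)
    thus ?thesis using s by (simp add: inv_fourier_def block_kernel_def scaleR_conv_of_real)
  qed
  have "multiplier (\<lambda>\<xi>. f (\<xi> / s)) h x = (LINT y|lborel. s * block_kernel (s * (x - y)) * h y)"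
    unfolding multiplier_def k ..
  also have "\<dots> = (1 / s) * (LINT y|lborel. s * (block_kernel y * h (x - y / s)))"
    using s by (subst lborel_integral_real_affine[of "- 1 / s" _ x]) (auto simp: mult_ac)
  also have "\<dots> = (LINT y|lborel. block_kernel y * h (x - y / s))" using s by simp
  finally show ?thesis .
qed

lemma multiplier_bound0:
  assumes s: "s > 0" and h: "h \<in> borel_measurable borel" "\<And>x. \<bar>h x\<bar> \<le> m"
  shows "\<bar>multiplier (\<lambda>\<xi>. f (\<xi> / s)) h x\<bar> \<le> m * I0"
  unfolding multiplier_eq[OF s] I0_def
proof (rule block_kernel_moment(2))
  note [measurable] = h(1)
  show "(\<lambda>y. h (x - y / s)) \<in> borel_measurable borel" by measurable
  have m0: "0 \<le> m" using h(2)[of 0] by linarith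
  show "\<bar>h (x - y / s)\<bar> \<le> m * (1 + y\<^sup>2)" for y
  proof -
    have "m * 1 \<le> m * (1 + y\<^sup>2)" using m0 by (intro mult_left_mono) auto
    thus ?thesis using h(2)[of "x - y / s"] by simp
  qed
qed

text \<open>The constant and linear Taylor terms are annihilated, and the remainder at y / s is at
  most m (y / s)^2.\<close>

lemma multiplier_bound2:
  assumes f0: "f 0 = 0" and s: "s > 0" and h: "\<And>x. (h has_real_derivative h' x) (at x)" "\<And>x y. \<bar>h' x - h' y\<bar> \<le> m * \<bar>x - y\<bar>"
    and hB: "\<And>x. \<bar>h x\<bar> \<le> B"
  shows "\<bar>multiplier (\<lambda>\<xi>. f (\<xi> / s)) h x\<bar> \<le> m / s\<^sup>2 * I0"
proof -
  have hc: "continuous_on UNIV h" using h(1) by (meson DERIV_isCont continuous_at_imp_continuous_on)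
  hence [measurable]: "h \<in> borel_measurable borel" by (rule borel_measurable_continuous_onI)
  have m0: "0 \<le> m" using h(2)[of 1 0] by (simp add: order_trans[OF abs_ge_zero])
  have B0: "0 \<le> B" using hB[of 0] by linarith
  \<comment> \<open>The remainder of first order; a Lipschitz derivative replaces a second
    derivative.\<close>
  define e where "e y = h (x - y / s) - h x + h' x / s * y" for y
  have em [measurable]: "e \<in> borel_measurable borel" unfolding e_def[abs_def] by measurable
  have eb: "\<bar>e y\<bar> \<le> m / s\<^sup>2 * (1 + y\<^sup>2)" for y
  proof -
    define d where "d = y / s"
    have "\<exists>z. h (x - d) - h x = - d * h' z \<and> \<bar>z - x\<bar> \<le> \<bar>d\<bar>"
    proof (cases d "0 :: real" rule: linorder_cases)
      case less
      hence "x < x - d" by simp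
      from MVT2[OF this h(1)] obtain z where "x < z" "z < x - d" "h (x - d) - h x = (x - d - x) * h' z" by blast
      thus ?thesis by (intro exI[of _ z]) auto
    next
      case greater
      hence "x - d < x" by simp
      from MVT2[OF this h(1)] obtain z where "x - d < z" "z < x" "h x - h (x - d) = (x - (x - d)) * h' z" by blast
      thus ?thesis by (intro exI[of _ z]) auto
    qed auto
    then obtain z where z: "h (x - d) - h x = - d * h' z" "\<bar>z - x\<bar> \<le> \<bar>d\<bar>" by blast
    have "e y = - d * h' z + d * h' x" unfolding e_def d_def[symmetric] using z(1) by (simp add: d_def)
    also have "\<dots> = - d * (h' z - h' x)" by (simp add: algebra_simps)
    also have "\<bar>\<dots>\<bar> \<le> \<bar>d\<bar> * (m * \<bar>d\<bar>)"
      unfolding abs_mult abs_minus_cancel using h(2)[of z x] z(2) m0 by (intro mult_left_mono order_trans[OF h(2)] mult_left_mono) auto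
    also have "\<dots> = m / s\<^sup>2 * y\<^sup>2" by (simp add: d_def power2_eq_square abs_mult[symmetric] flip: abs_mult)
    also have "\<dots> \<le> m / s\<^sup>2 * (1 + y\<^sup>2)" using m0 by (intro mult_left_mono) auto
    finally show ?thesis .
  qed
  have i1: "integrable lborel (\<lambda>y. block_kernel y * y)" by (rule block_kernel_moment(1)[where k=1]) (use abs_le_1_plus_square in auto)
  have i0: "integrable lborel (\<lambda>y. block_kernel y * 1)" by (rule block_kernel_moment(1)[where k=1]) auto
  have ie: "integrable lborel (\<lambda>y. block_kernel y * e y)" by (rule block_kernel_moment(1)[OF em eb])
  have "multiplier (\<lambda>\<xi>. f (\<xi> / s)) h x = (LINT y|lborel. block_kernel y * e y + (h x * (block_kernel y * 1) - h' x / s * (block_kernel y * y)))"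
    unfolding multiplier_eq[OF s] by (intro Bochner_Integration.integral_cong refl) (simp add: e_def algebra_simps)
  also have "\<dots> = (LINT y|lborel. block_kernel y * e y) + (h x * (LINT y|lborel. block_kernel y * 1) - h' x / s * (LINT y|lborel. block_kernel y * y))"
    using i1 i0 ie by (subst Bochner_Integration.integral_add) (auto simp del: mult_1_right)
  also have "\<dots> = (LINT y|lborel. block_kernel y * e y)" using block_kernel_integral f0 block_kernel_first_moment by simp
  also have "\<bar>\<dots>\<bar> \<le> m / s\<^sup>2 * I0" unfolding I0_def by (rule block_kernel_moment(2)[OF em eb])
  finally show ?thesis .
qed

section \<open>Response of a block to a corner\<close>

definition "\<kappa> x = (LINT y|lborel. block_kernel y * max 0 (x - y))"

lemma kappa_integrable: "integrable lborel (\<lambda>y. block_kernel y * max 0 (x - y))"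
proof (rule block_kernel_moment(1)[where k="\<bar>x\<bar> + 1"])
  fix y :: real
  note y = abs_le_1_plus_square[of y]
  have "\<bar>max 0 (x - y)\<bar> \<le> \<bar>x\<bar> * 1 + \<bar>y\<bar>" by auto
  also have "\<dots> \<le> \<bar>x\<bar> * (1 + y\<^sup>2) + (1 + y\<^sup>2)" using y by (intro add_mono mult_left_mono) auto
  finally show "\<bar>max 0 (x - y)\<bar> \<le> (\<bar>x\<bar> + 1) * (1 + y\<^sup>2)" by (simp add: algebra_simps)
qed measurable

text \<open>A second difference of \<open>\<kappa>\<close> at \<open>0\<close> is the integral of \<open>block_kernel\<close> against a tent.\<close>

lemma kappa_nonzero:
  assumes "block_kernel 0 > 0" shows "\<exists>x. \<kappa> x \<noteq> 0"
proof (rule ccontr)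
  assume "\<not> ?thesis"
  hence z: "\<kappa> x = 0" for x by blast
  have "isCont block_kernel 0" using block_kernel_cont[of UNIV] by (simp add: continuous_on_eq_continuous_at)
  then obtain d where d: "d > 0" "\<And>y. dist y 0 < d \<Longrightarrow> dist (block_kernel y) (block_kernel 0) < block_kernel 0 / 2"
    using assms unfolding continuous_at_eps_delta dist_real_def by (metis half_gt_zero)
  define h where "h = d / 2"
  have h: "h > 0" "\<And>y. \<bar>y\<bar> \<le> h \<Longrightarrow> block_kernel y \<ge> block_kernel 0 / 2"
  proof -
    show "h > 0" using d(1) by (simp add: h_def)
    fix y assume "\<bar>y\<bar> \<le> h"
    hence "dist y 0 < d" using d(1) by (simp add: h_def)
    from d(2)[OF this] show "block_kernel y \<ge> block_kernel 0 / 2" unfolding dist_real_def by linarith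
  qed
  have tent: "max 0 (h - y) + max 0 (- h - y) - 2 * max 0 (0 - y) = max 0 (h - \<bar>y\<bar>)" for y
    using h(1) by (auto simp: max_def)
  have "\<kappa> h + \<kappa> (- h) - 2 * \<kappa> 0 = (LINT y|lborel. block_kernel y * max 0 (h - y) + block_kernel y * max 0 (- h - y) - 2 * (block_kernel y * max 0 (0 - y)))"
    unfolding \<kappa>_def using kappa_integrable[of h] kappa_integrable[of "- h"] kappa_integrable[of 0] by simp
  also have "\<dots> = (LINT y|lborel. block_kernel y * max 0 (h - \<bar>y\<bar>))"
    by (intro Bochner_Integration.integral_cong refl) (simp only: tent[symmetric] algebra_simps)
  finally have 0: "(LINT y|lborel. block_kernel y * max 0 (h - \<bar>y\<bar>)) = 0" by (simp add: z)
  have i: "integrable lborel (\<lambda>y. block_kernel y * max 0 (h - \<bar>y\<bar>))"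
  proof (rule block_kernel_moment(1)[where k=h])
    show "\<bar>max 0 (h - \<bar>y\<bar>)\<bar> \<le> h * (1 + y\<^sup>2)" for y
    proof -
      have "\<bar>max 0 (h - \<bar>y\<bar>)\<bar> \<le> h * 1" using h(1) by auto
      also have "\<dots> \<le> h * (1 + y\<^sup>2)" using h(1) by (intro mult_left_mono) auto
      finally show ?thesis .
    qed
  qed measurable
  \<comment> \<open>Near 0 the kernel is at least half its value there, and the tent is at least h /
    2 on the middle half of its support.\<close>
  have "(LINT y|lborel. (block_kernel 0 / 2 * (h / 2)) * indicator {- (h / 2)..h / 2} y) \<le> (LINT y|lborel. block_kernel y * max 0 (h - \<bar>y\<bar>))"
  proof (rule integral_mono[OF _ i])
    show "integrable lborel (\<lambda>y. (block_kernel 0 / 2 * (h / 2)) * indicator {- (h / 2)..h / 2} y)"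
      using h(1) by (intro integrable_mult_right integrable_real_indicator) (auto simp: emeasure_lborel_Icc_eq)
    fix y
    show "(block_kernel 0 / 2 * (h / 2)) * indicator {- (h / 2)..h / 2} y \<le> block_kernel y * max 0 (h - \<bar>y\<bar>)"
    proof (cases "\<bar>y\<bar> \<le> h")
      case True
      hence p: "block_kernel 0 / 2 \<le> block_kernel y" by (rule h(2))
      show ?thesis
      proof (cases "y \<in> {- (h / 2)..h / 2}")
        case True
        hence "h / 2 \<le> max 0 (h - \<bar>y\<bar>)" by auto
        hence "block_kernel 0 / 2 * (h / 2) \<le> block_kernel y * max 0 (h - \<bar>y\<bar>)"
          using p assms h(1) by (intro mult_mono) linarith+
        thus ?thesis using True by (simp only: indicator_simps mult_1_right)
      next
        case False
        have "0 \<le> block_kernel y * max 0 (h - \<bar>y\<bar>)" using p assms by auto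
        thus ?thesis unfolding indicator_simps(2)[OF False] by simp
      qed
    next
      case False
      hence y: "y \<notin> {- (h / 2)..h / 2}" using h(1) by auto
      have "max 0 (h - \<bar>y\<bar>) = 0" using False by simp
      thus ?thesis unfolding indicator_simps(2)[OF y] by simp
    qed
  qed
  also have "(LINT y|lborel. (block_kernel 0 / 2 * (h / 2)) * indicator {- (h / 2)..h / 2} y) = (block_kernel 0 / 2 * (h / 2)) * h"
    using h(1) by simp
  finally show False using 0 h(1) assms by (simp add: mult_le_0_iff)
qed

text \<open>At the origin the kernel is the integral of the nonnegative symbol divided by 2
  pi.\<close>

lemma block_kernel_0_pos:
  assumes nn: "\<And>\<xi>. 0 \<le> f \<xi>" and nz: "f \<xi>0 \<noteq> 0" shows "block_kernel 0 > 0"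
proof -
  have i: "f integrable_on {- (c + 1)..c + 1}" by (intro integrable_continuous_real fc)
  have "J 0 0 = complex_of_real (integral {- (c + 1)..c + 1} f)"
    unfolding J_def using has_integral_of_real[OF integrable_integral[OF i], where 'b=complex] by (simp add: integral_unique)
  hence e: "block_kernel 0 = 1 / (2 * pi) * integral {- (c + 1)..c + 1} f" by (simp add: block_kernel_def inv_fourier_J)
  have "integral {- (c + 1)..c + 1} f \<noteq> 0"
  proof
    assume "integral {- (c + 1)..c + 1} f = 0"
    hence "\<forall>\<xi>\<in>{- (c + 1)..c + 1}. f \<xi> = 0"
      using integral_eq_0_iff[of "- (c + 1)" "c + 1" f] fc c0 nn by auto
    moreover have "\<xi>0 \<in> {- (c + 1)..c + 1}" using supp[OF nz] by auto
    ultimately show False using nz by auto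
  qed
  moreover have "integral {- (c + 1)..c + 1} f \<ge> 0" by (intro integral_nonneg i nn)
  ultimately show ?thesis unfolding e by simp
qed

text \<open>The affine part is annihilated. The corner is homogeneous of degree one, so after
  multiplication by s its response is independent of s. The three errors scale differently:
  quadratic ones decay like 1 / s, linear ones persist in every block, constant ones grow like
  s.\<close>

lemma block_lower_bound:
  assumes u: "u \<in> borel_measurable borel" "\<And>x. \<bar>u x\<bar> \<le> M" and f0: "f 0 = 0" and s: "s \<ge> 1"
    and E: "E0 \<ge> 0" "E1 \<ge> 0" "E2 \<ge> 0"
    and app: "\<And>h. \<bar>u (x0 + h) - (k0 - c1 * h + B * max 0 h)\<bar> \<le> E2 * h\<^sup>2 + E1 * \<bar>h\<bar> + E0"
  shows "\<bar>s * multiplier (\<lambda>\<xi>. f (\<xi> / s)) u (x0 + x / s) - B * \<kappa> x\<bar> \<le> (E2 / s + E1 + s * E0) * ((2 + 2 * x\<^sup>2) * I0)"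
proof -
  note [measurable] = u(1)
  have s0: "s > 0" using s by simp
  define e where "e y = s * u (x0 + (x - y) / s) - s * (k0 - c1 * ((x - y) / s) + B * max 0 ((x - y) / s))" for y
  have em [measurable]: "e \<in> borel_measurable borel" unfolding e_def[abs_def] by measurable
  have eb: "\<bar>e y\<bar> \<le> (E2 / s + E1 + s * E0) * (2 + 2 * x\<^sup>2) * (1 + y\<^sup>2)" for y
  proof -
    define d where "d = x - y"
    define m where "m = (2 + 2 * x\<^sup>2) * (1 + y\<^sup>2)"
    have m2: "d\<^sup>2 + 1 \<le> m"
    proof -
      have "0 \<le> (x + y)\<^sup>2 + 1 + 2 * x\<^sup>2 * y\<^sup>2" by simp
      thus ?thesis by (simp add: m_def d_def power2_eq_square algebra_simps)
    qed
    note m1 = abs_le_1_plus_square[of d]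
    have "e y = s * (u (x0 + d / s) - (k0 - c1 * (d / s) + B * max 0 (d / s)))" by (simp add: e_def d_def algebra_simps)
    also have "\<bar>\<dots>\<bar> \<le> s * (E2 * (d / s)\<^sup>2 + E1 * \<bar>d / s\<bar> + E0)"
      unfolding abs_mult using app[of "d / s"] s0 by (simp add: mult_left_mono)
    also have "\<dots> = E2 / s * d\<^sup>2 + E1 * \<bar>d\<bar> + s * E0"
      using s0 by (simp add: power2_eq_square field_simps)
    also have "\<dots> \<le> E2 / s * m + E1 * m + s * E0 * m"
    proof (intro add_mono mult_left_mono)
      show "d\<^sup>2 \<le> m" "\<bar>d\<bar> \<le> m" using m1 m2 by linarith+
      have "1 \<le> m" using m2 zero_le_power2[of d] by linarith
      thus "s * E0 \<le> s * E0 * m" using s0 E mult_left_mono[of 1 m "s * E0"] by simp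
    qed (use E s0 in auto)
    also have "\<dots> = (E2 / s + E1 + s * E0) * m" by (simp add: algebra_simps)
    finally show ?thesis by (simp add: m_def mult.assoc)
  qed
  have i1: "integrable lborel (\<lambda>y. block_kernel y * y)" by (rule block_kernel_moment(1)[where k=1]) (use abs_le_1_plus_square in auto)
  have i0: "integrable lborel (\<lambda>y. block_kernel y * 1)" by (rule block_kernel_moment(1)[where k=1]) auto
  have ie: "integrable lborel (\<lambda>y. block_kernel y * e y)" by (rule block_kernel_moment(1)[OF em eb])
  have mx: "s * (B * max 0 (d / s)) = B * max 0 d" for d
    using s0 by (simp add: max_def zero_le_divide_iff)
  have "s * multiplier (\<lambda>\<xi>. f (\<xi> / s)) u (x0 + x / s) = (LINT y|lborel. s * (block_kernel y * u (x0 + (x - y) / s)))"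
    unfolding multiplier_eq[OF s0] by (simp add: diff_divide_distrib add_diff_eq)
  also have "\<dots> = (LINT y|lborel. block_kernel y * e y + (B * (block_kernel y * max 0 (x - y)) + ((s * k0 - c1 * x) * (block_kernel y * 1) + c1 * (block_kernel y * y))))"
  proof (intro Bochner_Integration.integral_cong refl)
    fix y
    have "s * U = (s * U - s * (k0 - c1 * d + B * m)) + (s * k0 - c1 * (s * d) + s * (B * m))" for U d m
      by (simp add: algebra_simps)
    from this[of "u (x0 + (x - y) / s)" "(x - y) / s" "max 0 ((x - y) / s)"]
    have "s * u (x0 + (x - y) / s) = e y + (s * k0 - c1 * (x - y) + s * (B * max 0 ((x - y) / s)))"
      using s0 by (simp add: e_def)
    also have "s * (B * max 0 ((x - y) / s)) = B * max 0 (x - y)" by (rule mx)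
    finally have "block_kernel y * (s * u (x0 + (x - y) / s)) = block_kernel y * (e y + (s * k0 - c1 * (x - y) + B * max 0 (x - y)))" by simp
    thus "s * (block_kernel y * u (x0 + (x - y) / s)) = block_kernel y * e y + (B * (block_kernel y * max 0 (x - y)) + ((s * k0 - c1 * x) * (block_kernel y * 1) + c1 * (block_kernel y * y)))"
      by (simp add: algebra_simps)
  qed
  also have "\<dots> = (LINT y|lborel. block_kernel y * e y) + (B * \<kappa> x + ((s * k0 - c1 * x) * (LINT y|lborel. block_kernel y * 1) + c1 * (LINT y|lborel. block_kernel y * y)))"
    unfolding \<kappa>_def
    by (subst Bochner_Integration.integral_add Bochner_Integration.integral_mult_right_zero |
        (intro Bochner_Integration.integrable_add integrable_mult_right ie i0 i1 kappa_integrable))+ (rule refl)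
  also have "\<dots> = (LINT y|lborel. block_kernel y * e y) + B * \<kappa> x" using block_kernel_integral f0 block_kernel_first_moment by simp
  finally have "s * multiplier (\<lambda>\<xi>. f (\<xi> / s)) u (x0 + x / s) - B * \<kappa> x = (LINT y|lborel. block_kernel y * e y)" by simp
  also have "\<bar>\<dots>\<bar> \<le> (E2 / s + E1 + s * E0) * (2 + 2 * x\<^sup>2) * I0" unfolding I0_def by (rule block_kernel_moment(2)[OF em eb])
  finally show ?thesis by (simp add: mult.assoc)
qed

end

section \<open>Bounds of the Besov norm\<close>

lemma sup_norm_le: "(\<And>x. \<bar>g x\<bar> \<le> m) \<Longrightarrow> sup_norm g \<le> ennreal m"
  unfolding sup_norm_def by (intro SUP_least ennreal_leI)

lemma slowly_increasing_bounded:
  assumes "continuous_on UNIV h" "\<And>x. \<bar>h x\<bar> \<le> B" shows "slowly_increasing h"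
  unfolding slowly_increasing_def
  using borel_measurable_continuous_onI[OF assms(1)] assms(2) by (auto intro!: exI[of _ B] exI[of _ "0 :: nat"])

lemma partition_kernels:
  assumes "dyadic_partition chi phi"
  shows "freq_kernel chi (4 / 3)" "freq_kernel phi (8 / 3)" "phi 0 = 0" "\<exists>\<xi>. phi \<xi> \<noteq> 0" "\<And>\<xi>. 0 \<le> phi \<xi>"
proof -
  note d = assms[unfolded dyadic_partition_def]
  show "freq_kernel chi (4 / 3)" by unfold_locales (use d in auto)
  show "freq_kernel phi (8 / 3)" by unfold_locales (use d in auto)
  have "\<forall>\<xi>. phi \<xi> \<noteq> 0 \<longrightarrow> 3 / 4 \<le> \<bar>\<xi>\<bar> \<and> \<bar>\<xi>\<bar> \<le> 8 / 3" using d by blast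
  thus "phi 0 = 0" by force
  show "0 \<le> phi \<xi>" for \<xi> using d by auto
  show "\<exists>\<xi>. phi \<xi> \<noteq> 0"
  proof (rule ccontr)
    assume "\<not> ?thesis"
    hence "\<And>\<xi>. phi \<xi> = 0" by blast
    \<comment> \<open>At frequency 2 the function \<open>chi\<close> vanishes, so the dyadic sum of
      \<open>phi\<close> must be 1 there.\<close>
    moreover have "(\<lambda>j. phi (2 / 2 ^ j)) sums (1 - chi 2)" using d by blast
    ultimately have "(\<lambda>j. 0 :: real) sums (1 - chi 2)" by simp
    hence "1 - chi 2 = 0" using sums_unique2 sums_zero by blast
    hence "chi 2 \<noteq> 0" by simp
    moreover have "\<forall>\<xi>. chi \<xi> \<noteq> 0 \<longrightarrow> \<bar>\<xi>\<bar> \<le> 4 / 3" using d by blast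
    ultimately have "\<bar>2 :: real\<bar> \<le> 4 / 3" by blast
    thus False by simp
  qed
qed

text \<open>Blocks below the frequency are bounded by the sup norm and those above it by the
  Lipschitz constant of the derivative. The first conclusion certifies finiteness of the final norm,
  the second smallness of the initial one.\<close>

theorem besov_upper:
  assumes dp: "dyadic_partition chi phi"
  obtains C where "C > 0" and
    "\<And>h h' m0 m2. (\<And>x. (h has_real_derivative h' x) (at x)) \<Longrightarrow> (\<And>x. \<bar>h x\<bar> \<le> m0) \<Longrightarrow>
        (\<And>x y. \<bar>h' x - h' y\<bar> \<le> m2 * \<bar>x - y\<bar>) \<Longrightarrow> besov_norm chi phi 1 h < \<infinity>"
    "\<And>h h' A n. (\<And>x. (h has_real_derivative h' x) (at x)) \<Longrightarrow> (\<And>x. \<bar>h x\<bar> \<le> A / 4 ^ n) \<Longrightarrow>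
        (\<And>x y. \<bar>h' x - h' y\<bar> \<le> A * 4 ^ n * \<bar>x - y\<bar>) \<Longrightarrow> besov_norm chi phi 1 h \<le> ennreal (C * A)"
proof -
  note pk = partition_kernels[OF dp]
  interpret ch: freq_kernel chi "4 / 3" by (rule pk(1))
  interpret ph: freq_kernel phi "8 / 3" by (rule pk(2))
  have cont: "continuous_on UNIV h" if "\<And>x. (h has_real_derivative h' x) (at x)" for h h' :: "real \<Rightarrow> real"
    using that by (meson DERIV_isCont continuous_at_imp_continuous_on)
  have eq: "besov_norm chi phi 1 h = ennreal (1 / 2) * sup_norm (multiplier chi h)
     + (\<Sum>j. ennreal (2 ^ j) * sup_norm (multiplier (\<lambda>\<xi>. phi (\<xi> / 2 ^ j)) h))"
    if "continuous_on UNIV h" "\<And>x. \<bar>h x\<bar> \<le> m0" for h m0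
    using slowly_increasing_bounded[OF that] by (simp add: besov_norm_def powr_minus powr_realpow inverse_eq_divide)
  have c1: "ennreal (1 / 2) * sup_norm (multiplier chi h) \<le> ennreal (m0 * ch.I0)"
    if h: "continuous_on UNIV h" "\<And>x. \<bar>h x\<bar> \<le> m0" for h m0
  proof -
    have "\<bar>multiplier chi h x\<bar> \<le> m0 * ch.I0" for x
      using ch.multiplier_bound0[of 1 h m0 x] borel_measurable_continuous_onI[OF h(1)] h(2) by simp
    hence "sup_norm (multiplier chi h) \<le> ennreal (m0 * ch.I0)" by (rule sup_norm_le)
    moreover have "ennreal (1 / 2) \<le> ennreal 1" by (rule ennreal_leI) simp
    ultimately have "ennreal (1 / 2) * sup_norm (multiplier chi h) \<le> 1 * ennreal (m0 * ch.I0)"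
      by (intro mult_mono) auto
    thus ?thesis by simp
  qed
  have c2: "ennreal (2 ^ j) * sup_norm (multiplier (\<lambda>\<xi>. phi (\<xi> / 2 ^ j)) h) \<le> ennreal (m0 * ph.I0 * 2 ^ j)"
    if h: "continuous_on UNIV h" "\<And>x. \<bar>h x\<bar> \<le> m0" for h m0 j
  proof -
    have m0: "0 \<le> m0" using h(2)[of 0] by linarith
    have "sup_norm (multiplier (\<lambda>\<xi>. phi (\<xi> / 2 ^ j)) h) \<le> ennreal (m0 * ph.I0)"
      by (rule sup_norm_le, rule ph.multiplier_bound0) (use borel_measurable_continuous_onI[OF h(1)] h(2) in auto)
    hence "ennreal (2 ^ j) * sup_norm (multiplier (\<lambda>\<xi>. phi (\<xi> / 2 ^ j)) h) \<le> ennreal (2 ^ j) * ennreal (m0 * ph.I0)"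
      by (rule mult_left_mono) simp
    also have "\<dots> = ennreal (m0 * ph.I0 * 2 ^ j)" using m0 ph.I0_nonneg by (simp add: mult_ac flip: ennreal_mult)
    finally show ?thesis .
  qed
  have c3: "ennreal (2 ^ j) * sup_norm (multiplier (\<lambda>\<xi>. phi (\<xi> / 2 ^ j)) h) \<le> ennreal (m2 * ph.I0 / 2 ^ j)"
    if h: "\<And>x. (h has_real_derivative h' x) (at x)" "\<And>x. \<bar>h x\<bar> \<le> m0" "\<And>x y. \<bar>h' x - h' y\<bar> \<le> m2 * \<bar>x - y\<bar>" for h h' m0 m2 j
  proof -
    have m2: "0 \<le> m2" using h(3)[of 1 0] by (simp add: order_trans[OF abs_ge_zero])
    have "sup_norm (multiplier (\<lambda>\<xi>. phi (\<xi> / 2 ^ j)) h) \<le> ennreal (m2 / (2 ^ j)\<^sup>2 * ph.I0)"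
      by (rule sup_norm_le, rule ph.multiplier_bound2[OF pk(3) _ h(1) h(3) h(2)]) auto
    hence "ennreal (2 ^ j) * sup_norm (multiplier (\<lambda>\<xi>. phi (\<xi> / 2 ^ j)) h) \<le> ennreal (2 ^ j) * ennreal (m2 / (2 ^ j)\<^sup>2 * ph.I0)"
      by (rule mult_left_mono) simp
    also have "\<dots> = ennreal (2 ^ j * (m2 / (2 ^ j)\<^sup>2 * ph.I0))" using m2 ph.I0_nonneg by (subst ennreal_mult) auto
    also have "2 ^ j * (m2 / (2 ^ j)\<^sup>2 * ph.I0) = m2 * ph.I0 / 2 ^ j" by (simp add: power2_eq_square)
    finally show ?thesis .
  qed
  have split: "(\<Sum>j<m + k. g j) = (\<Sum>j<m. g j) + (\<Sum>i<k. g (m + i))" for g :: "nat \<Rightarrow> real" and m k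
    by (induction k) (simp_all add: add.assoc)
  have p2: "(\<Sum>j<m. 2 ^ j) = (2 :: real) ^ m - 1" for m by (induction m) simp_all
  have geo: "(\<Sum>i<k. (1 / 2) ^ i) \<le> (2 :: real)" for k
    using sum_le_suminf[of "\<lambda>i. (1 / 2 :: real) ^ i" "{..<k}"] suminf_geometric[of "1 / 2 :: real"] by (simp add: summable_geometric)
  define C where "C = ch.I0 + 3 * ph.I0 + 1"
  have C: "C > 0" using ch.I0_nonneg ph.I0_nonneg by (simp add: C_def)
  show thesis
  proof (rule that[OF C])
    fix h h' :: "real \<Rightarrow> real" and m0 m2
    assume h: "\<And>x. (h has_real_derivative h' x) (at x)" "\<And>x. \<bar>h x\<bar> \<le> m0" "\<And>x y. \<bar>h' x - h' y\<bar> \<le> m2 * \<bar>x - y\<bar>"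
    have m2: "0 \<le> m2" using h(3)[of 1 0] by (simp add: order_trans[OF abs_ge_zero])
    note hc = cont[OF h(1)]
    have "(\<Sum>j. ennreal (2 ^ j) * sup_norm (multiplier (\<lambda>\<xi>. phi (\<xi> / 2 ^ j)) h)) \<le> (\<Sum>j. ennreal (m2 * ph.I0 * (1 / 2) ^ j))"
      using c3[OF h] by (intro suminf_le) (auto simp: power_divide)
    also have "\<dots> < \<infinity>"
      using m2 ph.I0_nonneg by (subst suminf_ennreal_eq[OF _ sums_mult[OF geometric_sums]]) auto
    finally show "besov_norm chi phi 1 h < \<infinity>"
      unfolding eq[OF hc h(2)] using c1[OF hc h(2)] by (auto simp: ennreal_add_less_top top_unique less_top[symmetric])
  next
    fix h h' :: "real \<Rightarrow> real" and A :: real and n :: nat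
    assume h: "\<And>x. (h has_real_derivative h' x) (at x)" "\<And>x. \<bar>h x\<bar> \<le> A / 4 ^ n" "\<And>x y. \<bar>h' x - h' y\<bar> \<le> A * 4 ^ n * \<bar>x - y\<bar>"
    note hc = cont[OF h(1)]
    have "0 \<le> A / 4 ^ n" using h(2)[of 0] by linarith
    hence A: "0 \<le> A" using mult_nonneg_nonneg[of "A / 4 ^ n" "4 ^ n"] by simp
    have AI: "0 \<le> A * ph.I0" using A ph.I0_nonneg by simp
    have "(\<Sum>j. ennreal (2 ^ j) * sup_norm (multiplier (\<lambda>\<xi>. phi (\<xi> / 2 ^ j)) h)) \<le> ennreal (3 * (A * ph.I0))"
    proof (rule suminf_le_const)
      fix k
      \<comment> \<open>Both bounds equal A times \<open>ph.I0\<close> at 2^j = 4^n and decay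
        geometrically away from it; the two sums are at most 1 and 2, whence the factor 3.\<close>
      define g where "g j = (if j < 2 * n then A * ph.I0 * (2 ^ j / 2 ^ (2 * n)) else A * ph.I0 * (1 / 2) ^ (j - 2 * n))" for j :: nat
      have 4: "(4 :: real) ^ n = 2 ^ (2 * n)" by (simp add: power_mult)
      have g0: "0 \<le> g j" for j using AI by (simp add: g_def)
      have "ennreal (2 ^ j) * sup_norm (multiplier (\<lambda>\<xi>. phi (\<xi> / 2 ^ j)) h) \<le> ennreal (g j)" for j
      proof (cases "j < 2 * n")
        case True
        thus ?thesis using c2[OF hc h(2), of j] by (simp add: g_def 4 mult_ac)
      next
        case False
        hence "2 ^ j = (2 :: real) ^ (j - 2 * n) * 2 ^ (2 * n)" by (simp flip: power_add)
        hence "A * 4 ^ n * ph.I0 / 2 ^ j = A * ph.I0 * (1 / 2) ^ (j - 2 * n)" by (simp add: 4 power_divide)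
        thus ?thesis using c3[OF h, of j] False by (simp add: g_def)
      qed
      hence "(\<Sum>j<k. ennreal (2 ^ j) * sup_norm (multiplier (\<lambda>\<xi>. phi (\<xi> / 2 ^ j)) h)) \<le> (\<Sum>j<k. ennreal (g j))"
        by (intro sum_mono)
      also have "\<dots> = ennreal (\<Sum>j<k. g j)" using g0 by (simp add: sum_ennreal)
      also have "(\<Sum>j<k. g j) \<le> (\<Sum>j<2 * n + k. g j)" using g0 by (intro sum_mono2) auto
      also have "(\<Sum>j<2 * n + k. g j) = (\<Sum>j<2 * n. g j) + (\<Sum>i<k. g (2 * n + i))"
        by (rule split)
      also have "(\<Sum>i<k. g (2 * n + i)) = A * ph.I0 * (\<Sum>i<k. (1 / 2) ^ i)" by (simp add: g_def sum_distrib_left)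
      also have "(\<Sum>j<2 * n. g j) = A * ph.I0 * ((\<Sum>j<2 * n. 2 ^ j) / 2 ^ (2 * n))"
        by (simp add: g_def sum_distrib_left sum_divide_distrib)
      also have "(\<Sum>j<2 * n. 2 ^ j) = (2 :: real) ^ (2 * n) - 1" by (rule p2)
      also have "A * ph.I0 * (((2 :: real) ^ (2 * n) - 1) / 2 ^ (2 * n)) + A * ph.I0 * (\<Sum>i<k. (1 / 2) ^ i) \<le> A * ph.I0 * 1 + A * ph.I0 * 2"
        using AI geo[of k] by (intro add_mono mult_left_mono) auto
      also have "\<dots> = 3 * (A * ph.I0)" by simp
      finally show "(\<Sum>j<k. ennreal (2 ^ j) * sup_norm (multiplier (\<lambda>\<xi>. phi (\<xi> / 2 ^ j)) h)) \<le> ennreal (3 * (A * ph.I0))"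
        by (simp add: ennreal_leI)
    qed simp
    moreover have "ennreal (1 / 2) * sup_norm (multiplier chi h) \<le> ennreal (A * ch.I0)"
    proof -
      have "A / 4 ^ n \<le> A" using A by (simp add: divide_le_eq mult_le_cancel_left1)
      hence "A / 4 ^ n * ch.I0 \<le> A * ch.I0" using ch.I0_nonneg by (rule mult_right_mono)
      thus ?thesis using c1[OF hc h(2)] by (meson ennreal_leI order_trans)
    qed
    ultimately have "besov_norm chi phi 1 h \<le> ennreal (A * ch.I0) + ennreal (3 * (A * ph.I0))"
      unfolding eq[OF hc h(2)] by (intro add_mono)
    also have "\<dots> = ennreal (A * ch.I0 + 3 * (A * ph.I0))" using A AI ch.I0_nonneg by (simp flip: ennreal_plus)
    also have "\<dots> \<le> ennreal (C * A)" using A by (intro ennreal_leI) (simp add: C_def algebra_simps)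
    finally show "besov_norm chi phi 1 h \<le> ennreal (C * A)" .
  qed
qed

text \<open>Each of finitely many blocks is estimated from below at one point of choice, which may
  differ from block to block.\<close>

lemma besov_lower:
  "ennreal (\<Sum>j<L. \<bar>2 ^ j * multiplier (\<lambda>\<xi>. phi (\<xi> / 2 ^ j)) u (x j)\<bar>) \<le> besov_norm chi phi 1 u"
proof (cases "slowly_increasing u")
  case True
  have "ennreal (\<Sum>j<L. \<bar>2 ^ j * multiplier (\<lambda>\<xi>. phi (\<xi> / 2 ^ j)) u (x j)\<bar>)
     = (\<Sum>j<L. ennreal (2 ^ j) * ennreal \<bar>multiplier (\<lambda>\<xi>. phi (\<xi> / 2 ^ j)) u (x j)\<bar>)"
    by (subst sum_ennreal[symmetric]) (auto simp: abs_mult ennreal_mult)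
  also have "\<dots> \<le> (\<Sum>j<L. ennreal (2 ^ j) * sup_norm (multiplier (\<lambda>\<xi>. phi (\<xi> / 2 ^ j)) u))"
    unfolding sup_norm_def by (intro sum_mono mult_left_mono SUP_upper) auto
  also have "\<dots> \<le> (\<Sum>j. ennreal (2 ^ j) * sup_norm (multiplier (\<lambda>\<xi>. phi (\<xi> / 2 ^ j)) u))"
    by (rule sum_le_suminf) auto
  also have "\<dots> \<le> besov_norm chi phi 1 u"
    using True by (simp add: besov_norm_def powr_realpow)
  finally show ?thesis .
qed (simp add: besov_norm_def)

section \<open>The initial data\<close>

text \<open>A smooth step whose derivatives are polynomials in itself and whose primitive, softplus,
  stays within distance 1 of max 0.\<close>

definition logistic :: "real \<Rightarrow> real" where "logistic x = 1 / (1 + exp (- x))"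

lemma logistic_bounds: "0 < logistic x" "logistic x < 1"
  by (simp_all add: logistic_def add_pos_pos)

lemma logistic_deriv: "(logistic has_real_derivative logistic x - (logistic x)\<^sup>2) (at x)"
proof -
  have p: "1 + exp (- x) \<noteq> 0" using exp_gt_zero[of "- x"] by linarith
  have "(logistic has_real_derivative exp (- x) / (1 + exp (- x))\<^sup>2) (at x)"
    unfolding logistic_def[abs_def] using p by (auto intro!: derivative_eq_intros simp: power2_eq_square)
  moreover have "(r - 1) / r\<^sup>2 = 1 / r - (1 / r)\<^sup>2" if "r \<noteq> 0" for r :: real
    using that by (simp add: power2_eq_square diff_divide_distrib)
  from this[OF p] have "exp (- x) / (1 + exp (- x))\<^sup>2 = logistic x - (logistic x)\<^sup>2" by (simp add: logistic_def)
  with \<open>(logistic has_real_derivative exp (- x) / (1 + exp (- x))\<^sup>2) (at x)\<close> show ?thesis by simp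
qed

lemma softplus_deriv: "((\<lambda>x. ln (1 + exp x)) has_real_derivative logistic x) (at x)"
proof -
  have p: "1 + exp x > 0" using exp_gt_zero[of x] by linarith
  have "((\<lambda>x. ln (1 + exp x)) has_real_derivative exp x / (1 + exp x)) (at x)"
    using p by (auto intro!: derivative_eq_intros)
  moreover have "exp x / (1 + exp x) = logistic x" using p by (simp add: logistic_def exp_minus field_simps)
  ultimately show ?thesis by simp
qed

lemma softplus_bounds: "max 0 y \<le> ln (1 + exp y)" "ln (1 + exp y) \<le> max 0 y + (1 :: real)"
proof -
  have l: "ln (1 + exp y) \<le> exp y" for y :: real by (rule ln_add_one_self_le_self) simp
  have s: "ln (1 + exp y) = y + ln (1 + exp (- y))" for y :: real
  proof -
    have "1 + exp y = exp y * (1 + exp (- y))" by (simp add: distrib_left exp_minus)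
    thus ?thesis using add_pos_pos[OF zero_less_one exp_gt_zero[of "- y"]] by (simp add: ln_mult)
  qed
  have 0: "0 \<le> ln (1 + exp y)" for y :: real by simp
  show "max 0 y \<le> ln (1 + exp y)" using 0[of y] 0[of "- y"] s[of y] by simp
  show "ln (1 + exp y) \<le> max 0 y + 1"
  proof (cases "y \<le> 0")
    case True thus ?thesis using l[of y] exp_le_one_iff[of y] by linarith
  next
    case False
    hence "exp (- y) \<le> 1" "max 0 y = y" by auto
    thus ?thesis using l[of "- y"] s[of y] by linarith
  qed
qed

text \<open>The primitive \<open>J\<close> of \<open>w\<^sup>2\<close>, up to \<open>O(2\<^sup>-\<^sup>n)\<close>, is explicit because \<open>logistic\<^sup>2 = logistic - logistic'\<close>.\<close>

lemma initial_data:
  fixes A :: real and n :: nat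
  assumes A: "0 < A" "A \<le> 1 / 2"
  obtains u0 w w' J J' :: "real \<Rightarrow> real" where "smooth u0"
    "\<And>x. (u0 has_real_derivative w x) (at x)" "\<And>x. (w has_real_derivative w' x) (at x)"
    "\<And>x. \<bar>u0 x\<bar> \<le> A / 4 ^ n" "\<And>x. \<bar>w x\<bar> \<le> 1" "\<And>x. \<bar>w' x\<bar> \<le> 4 * A * 4 ^ n"
    "\<And>x. (J has_real_derivative J' x) (at x)" "\<And>x. \<bar>J' x - (w x)\<^sup>2\<bar> \<le> 3 / 2 ^ n"
    "\<And>x. \<bar>J x - A\<^sup>2 / 2 * max 0 x\<bar> \<le> 2 / 2 ^ n"
proof -
  \<comment> \<open>The step has width 1 / k and the oscillation has frequency k^2. Each derivative
    that falls on the step instead of the oscillation thus gains 1 / k.\<close>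
  define k :: real where "k = 2 ^ n"
  have k: "1 \<le> k" "4 ^ n = k\<^sup>2" by (auto simp: k_def power2_eq_square simp flip: power_mult_distrib)
  have k0: "k > 0" using k by simp
  define s s1 s2 where "s x = logistic (k * x)" and "s1 x = s x - (s x)\<^sup>2" and "s2 x = s1 x - 2 * (s x * s1 x)" for x
  have sb: "0 \<le> s x" "s x \<le> 1" for x using logistic_bounds[of "k * x"] by (auto simp: s_def)
  have s1b: "0 \<le> s1 x" "s1 x \<le> 1" for x
  proof -
    have "s1 x = s x * (1 - s x)" by (simp add: s1_def power2_eq_square algebra_simps)
    thus "0 \<le> s1 x" "s1 x \<le> 1" using sb[of x] mult_le_one[of "s x" "1 - s x"] by auto
  qed
  have s2b: "\<bar>s2 x\<bar> \<le> 1" for x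
  proof -
    have "s2 x = s1 x * (1 - 2 * s x)" by (simp add: s2_def algebra_simps)
    thus ?thesis using s1b[of x] sb[of x] mult_mono[of "\<bar>s1 x\<bar>" 1 "\<bar>1 - 2 * s x\<bar>" 1] by (simp add: abs_mult)
  qed
  have kx: "((\<lambda>x. k * x) has_real_derivative k) (at x)" for x by (auto intro!: derivative_eq_intros)
  have ds: "(s has_real_derivative s1 x * k) (at x)" for x
    unfolding s_def[abs_def] s1_def by (rule DERIV_chain2[OF logistic_deriv kx])
  have ds1: "(s1 has_real_derivative s2 x * k) (at x)" for x
    unfolding s1_def[abs_def] by (auto intro!: derivative_eq_intros ds simp: s2_def s1_def algebra_simps power2_eq_square)
  define u0 w w' where "u0 x = A / k\<^sup>2 * (sin (k\<^sup>2 * x) * s x)"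
    and "w x = A * (cos (k\<^sup>2 * x) * s x) + A / k * (sin (k\<^sup>2 * x) * s1 x)"
    and "w' x = - A * k\<^sup>2 * (sin (k\<^sup>2 * x) * s x) + 2 * A * k * (cos (k\<^sup>2 * x) * s1 x) + A * (sin (k\<^sup>2 * x) * s2 x)" for x
  have dsin: "((\<lambda>x. sin (m * x)) has_real_derivative m * cos (m * x)) (at x)"
    "((\<lambda>x. cos (m * x)) has_real_derivative - (m * sin (m * x))) (at x)" for m x :: real
    by (auto intro!: derivative_eq_intros)
  have d1: "(u0 has_real_derivative w x) (at x)" for x
    unfolding u0_def[abs_def]
    by (rule DERIV_cong[OF DERIV_cmult[OF DERIV_mult[OF dsin(1) ds]]])
      (use k0 in \<open>simp add: w_def field_simps power2_eq_square\<close>)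
  have d2: "(w has_real_derivative w' x) (at x)" for x
    unfolding w_def[abs_def]
    by (rule DERIV_cong[OF DERIV_add[OF DERIV_cmult[OF DERIV_mult[OF dsin(2) ds]] DERIV_cmult[OF DERIV_mult[OF dsin(1) ds1]]]])
      (use k0 in \<open>simp add: w'_def field_simps power2_eq_square\<close>)
  have prod: "\<bar>p * r\<bar> \<le> 1" if "\<bar>p\<bar> \<le> 1" "\<bar>r\<bar> \<le> 1" for p r :: real
    unfolding abs_mult using that mult_mono[of "\<bar>p\<bar>" 1 "\<bar>r\<bar>" 1] by simp
  have m: "\<bar>c * p\<bar> \<le> c" if "\<bar>p\<bar> \<le> 1" "0 \<le> c" for c p :: real
    unfolding abs_mult using that mult_left_mono[of "\<bar>p\<bar>" 1 c] by simp
  have b: "\<bar>s x\<bar> \<le> 1" "\<bar>s1 x\<bar> \<le> 1" for x using sb[of x] s1b[of x] by auto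
  note pb = prod[OF abs_sin_le_one b(1)] prod[OF abs_cos_le_one b(1)] prod[OF abs_sin_le_one b(2)] prod[OF abs_cos_le_one b(2)] prod[OF abs_sin_le_one s2b]
  have ik: "1 / k \<le> 1" "0 \<le> 1 / k" using k by auto
  have kk: "k \<le> k\<^sup>2" "1 \<le> k\<^sup>2" using k by (auto simp: power2_eq_square mult_le_cancel_left1 intro: order_trans[of 1 k])
  have u0b: "\<bar>u0 x\<bar> \<le> A / 4 ^ n" for x
    unfolding u0_def k(2) by (rule m) (use A pb in auto)
  \<comment> \<open>The amplitude of w is at most 2 A; the bound 1 is the one required by the
    existence theorem.\<close>
  have wb: "\<bar>w x\<bar> \<le> 1" for x
  proof -
    have "\<bar>w x\<bar> \<le> A + A / k" unfolding w_def
      by (intro order_trans[OF abs_triangle_ineq] add_mono m pb) (use A k0 in auto)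
    also have "A / k \<le> A" using A k by (simp add: divide_le_eq)
    finally show ?thesis using A by linarith
  qed
  have w'b: "\<bar>w' x\<bar> \<le> 4 * A * 4 ^ n" for x
  proof -
    have "w' x = - (A * k\<^sup>2 * (sin (k\<^sup>2 * x) * s x)) + 2 * A * k * (cos (k\<^sup>2 * x) * s1 x) + A * (sin (k\<^sup>2 * x) * s2 x)"
      by (simp add: w'_def)
    also have "\<bar>\<dots>\<bar> \<le> A * k\<^sup>2 + 2 * A * k + A"
      by (intro order_trans[OF abs_triangle_ineq] add_mono, subst abs_minus_cancel) (intro m pb, use A k0 in auto)+
    also have "\<dots> \<le> A * k\<^sup>2 + 2 * A * k\<^sup>2 + A * k\<^sup>2"
      using kk A by (intro add_mono mult_left_mono) auto
    finally show ?thesis by (simp add: k)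
  qed
  \<comment> \<open>In w^2 the leading term A^2 cos^2 s^2 splits by the double angle. The mean part
    is integrated by s^2 = s - s1, the oscillating part by sin (2 k^2 x) / (4 k^2) with an error of
    lower order.\<close>
  define J J' where "J x = A\<^sup>2 / 2 * (1 / k * (ln (1 + exp (k * x)) - s x)) + A\<^sup>2 / (4 * k\<^sup>2) * (sin (2 * k\<^sup>2 * x) * (s x)\<^sup>2)"
    and "J' x = A\<^sup>2 / 2 * (s x)\<^sup>2 + A\<^sup>2 / 2 * (cos (2 * k\<^sup>2 * x) * (s x)\<^sup>2) + A\<^sup>2 / (2 * k) * (sin (2 * k\<^sup>2 * x) * (s x * s1 x))" for x
  have dl: "((\<lambda>x. ln (1 + exp (k * x))) has_real_derivative s x * k) (at x)" for x
    unfolding s_def by (rule DERIV_chain2[OF softplus_deriv kx])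
  have dsq: "((\<lambda>x. (s x)\<^sup>2) has_real_derivative 2 * (s x * s1 x) * k) (at x)" for x
    by (auto intro!: derivative_eq_intros ds)
  have dJ: "(J has_real_derivative J' x) (at x)" for x
    unfolding J_def[abs_def]
    by (rule DERIV_cong[OF DERIV_add[OF DERIV_cmult[OF DERIV_cmult[OF DERIV_diff[OF dl ds]]] DERIV_cmult[OF DERIV_mult[OF dsin(1) dsq]]]])
      (use k0 in \<open>simp add: J'_def s1_def field_simps power2_eq_square\<close>)
  have A2: "0 \<le> A\<^sup>2" "A\<^sup>2 \<le> 1" using A by (auto simp: power2_eq_square intro: mult_le_one)
  have J'b: "\<bar>J' x - (w x)\<^sup>2\<bar> \<le> 3 / 2 ^ n" for x
  proof -
    define S Cc where "S = sin (k\<^sup>2 * x)" and "Cc = cos (k\<^sup>2 * x)"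
    have tr: "sin (2 * k\<^sup>2 * x) = 2 * S * Cc" "cos (2 * k\<^sup>2 * x) = 2 * Cc\<^sup>2 - 1"
      using sin_double[of "k\<^sup>2 * x"] cos_double_cos[of "k\<^sup>2 * x"] by (simp_all add: S_def Cc_def mult.assoc)
    have "J' x - (w x)\<^sup>2 = - (A\<^sup>2 / k * ((S * s x) * (Cc * s1 x))) - A\<^sup>2 / k\<^sup>2 * ((S * s1 x) * (S * s1 x))"
      unfolding J'_def w_def tr S_def[symmetric] Cc_def[symmetric]
      using k0 by (simp add: field_simps power2_eq_square)
    also have "\<bar>\<dots>\<bar> \<le> A\<^sup>2 / k + A\<^sup>2 / k\<^sup>2"
    proof -
      have "\<bar>A\<^sup>2 / k * ((S * s x) * (Cc * s1 x))\<bar> \<le> A\<^sup>2 / k"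
        unfolding S_def Cc_def by (rule m[OF prod[OF pb(1) pb(4)]]) (use k0 in auto)
      moreover have "\<bar>A\<^sup>2 / k\<^sup>2 * ((S * s1 x) * (S * s1 x))\<bar> \<le> A\<^sup>2 / k\<^sup>2"
        unfolding S_def by (rule m[OF prod[OF pb(3) pb(3)]]) auto
      ultimately show ?thesis by linarith
    qed
    also have "\<dots> \<le> 1 / k + 1 / k"
    proof (intro add_mono)
      show "A\<^sup>2 / k \<le> 1 / k" using A2 k0 by (intro divide_right_mono) auto
      show "A\<^sup>2 / k\<^sup>2 \<le> 1 / k" using A2 kk k0 by (intro frac_le) auto
    qed
    finally show ?thesis using k0 by (simp add: k_def[symmetric])
  qed
  have Jb: "\<bar>J x - A\<^sup>2 / 2 * max 0 x\<bar> \<le> 2 / 2 ^ n" for x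
  proof -
    have mx: "1 / k * max 0 (k * x) = max 0 x" using k0 by (simp add: max_def zero_le_mult_iff)
    have "J x - A\<^sup>2 / 2 * max 0 x = A\<^sup>2 / 2 * (1 / k * (ln (1 + exp (k * x)) - max 0 (k * x) - s x)) + A\<^sup>2 / (4 * k\<^sup>2) * (sin (2 * k\<^sup>2 * x) * (s x)\<^sup>2)"
      unfolding J_def mx[symmetric] by (simp add: algebra_simps)
    also have "\<bar>\<dots>\<bar> \<le> A\<^sup>2 / 2 * (1 / k) + A\<^sup>2 / (4 * k\<^sup>2)"
    proof (intro order_trans[OF abs_triangle_ineq] add_mono)
      have "\<bar>ln (1 + exp (k * x)) - max 0 (k * x) - s x\<bar> \<le> 1"
        using softplus_bounds[of "k * x"] sb[of x] by linarith
      from m[OF this ik(2)] have "\<bar>1 / k * (ln (1 + exp (k * x)) - max 0 (k * x) - s x)\<bar> \<le> 1 / k" .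
      moreover have "\<bar>A\<^sup>2 / 2 * y\<bar> \<le> A\<^sup>2 / 2 * Y" if "\<bar>y\<bar> \<le> Y" for y Y
        unfolding abs_mult using that by (intro mult_mono) auto
      ultimately show "\<bar>A\<^sup>2 / 2 * (1 / k * (ln (1 + exp (k * x)) - max 0 (k * x) - s x))\<bar> \<le> A\<^sup>2 / 2 * (1 / k)"
        by blast
      have "\<bar>(s x)\<^sup>2\<bar> \<le> 1" unfolding power2_eq_square by (intro prod b)
      thus "\<bar>A\<^sup>2 / (4 * k\<^sup>2) * (sin (2 * k\<^sup>2 * x) * (s x)\<^sup>2)\<bar> \<le> A\<^sup>2 / (4 * k\<^sup>2)"
        by (intro m prod) auto
    qed
    also have "\<dots> \<le> 1 * (1 / k) + 1 / k"
    proof (intro add_mono mult_right_mono)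
      show "A\<^sup>2 / (4 * k\<^sup>2) \<le> 1 / k" using A2 kk k0 by (intro frac_le) auto
    qed (use A2 ik in auto)
    finally show ?thesis using k0 by (simp add: k_def[symmetric])
  qed
  have sm: "smooth u0"
  proof -
    \<comment> \<open>The closure properties are used for a function constant in time, on the
      degenerate time interval {0}.\<close>
    have j: "space_diff 0 m (\<lambda>t. u0)" for m
    proof -
      have "space_diff 0 m (\<lambda>t z. 1 / (1 + exp (- (k * z))))"
      proof (rule space_diff_divide)
        show "space_diff 0 m (\<lambda>t z. 1 + exp (- (k * z)))" by (intro space_diff_add space_diff_const space_diff_exp space_diff_minus space_diff_linear)
        show "1 + exp (- (k * z)) \<noteq> 0" for z :: real using exp_gt_zero[of "- (k * z)"] by linarith
      qed (rule space_diff_const)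
      hence s: "space_diff 0 m (\<lambda>t. s)" by (simp add: s_def[abs_def] logistic_def)
      show ?thesis unfolding u0_def[abs_def] by (intro space_diff_mult space_diff_const space_diff_sin_cos s)
    qed
    from space_diff_smooth[OF j, of 0] show ?thesis by simp
  qed
  show thesis by (rule that[OF sm d1 d2 u0b wb w'b dJ J'b Jb])
qed

section \<open>Norm inflation\<close>

lemma deriv_bound_diff:
  fixes f f' :: "real \<Rightarrow> real"
  assumes "\<And>x. (f has_real_derivative f' x) (at x)" "\<And>x. \<bar>x\<bar> \<le> \<bar>z\<bar> \<Longrightarrow> \<bar>f' x\<bar> \<le> B"
  shows "\<bar>f z - f 0\<bar> \<le> B * \<bar>z\<bar>"
proof (cases z "0 :: real" rule: linorder_cases)
  case less
  from MVT2[OF less assms(1)] obtain y where "z < y" "y < 0" "f 0 - f z = (0 - z) * f' y" by blast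
  hence "f z - f 0 = z * f' y" "\<bar>f' y\<bar> \<le> B" using assms(2)[of y] by auto
  thus ?thesis using mult_left_mono[of "\<bar>f' y\<bar>" B "\<bar>z\<bar>"] by (simp add: abs_mult mult.commute)
next
  case greater
  from MVT2[OF greater assms(1)] obtain y where "0 < y" "y < z" "f z - f 0 = (z - 0) * f' y" by blast
  hence "f z - f 0 = z * f' y" "\<bar>f' y\<bar> \<le> B" using assms(2)[of y] by auto
  thus ?thesis using mult_left_mono[of "\<bar>f' y\<bar>" B "\<bar>z\<bar>"] by (simp add: abs_mult mult.commute)
qed simp

lemma deriv_bound_lipschitz:
  fixes f f' :: "real \<Rightarrow> real"
  assumes "\<And>x. (f has_real_derivative f' x) (at x)" "\<And>x. \<bar>f' x\<bar> \<le> B"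
  shows "\<bar>f x - f y\<bar> \<le> B * \<bar>x - y\<bar>"
  using field_differentiable_bound[of UNIV f f' B x y] assms by simp

context lagr
begin

lemma zero_in: "0 \<in> {0..T}" and T_in: "T \<in> {0..T}" using T by auto

lemma lagr_solution:
  assumes "\<alpha> \<noteq> 0" "\<beta> \<noteq> 0" "a = 1 / \<bar>\<alpha>\<bar>" "b = 1 / \<bar>\<beta>\<bar>" "p1 = 5 / 6"
    "p2 = 2 / 3 * (\<alpha>\<^sup>2 + \<beta>\<^sup>2) - 5 / 3 * \<beta>\<^sup>2" "p3 = 5 / 3 * \<beta>\<^sup>2"
  shows "solution \<alpha> \<beta> (5 / 3) u0 T u"
  unfolding solution_def
proof (intro conjI ballI allI)
  show "continuous_into_smooth T u" by (rule space_diff_continuous_into_smooth[OF space_diff_u])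
  show "bounded_with_deriv T u" unfolding bounded_with_deriv_def using u_bounds(1,2) by blast
  show "u 0 = u0"
  proof
    fix x
    have "q 0 x = x" by (simp add: q_def)
    hence "\<zeta> 0 x = x" using zeta_q[OF zero_in, of x] by simp
    thus "u 0 x = u0 x" by (simp add: u_def init)
  qed
  fix t x assume t: "t \<in> {0..T}"
  have c: "continuous_on UNIV (u t)" "continuous_on UNIV (deriv (u t))"
    using smooth_continuous[OF space_diff_smooth[OF space_diff_u t], of UNIV 0] smooth_continuous[OF space_diff_smooth[OF space_diff_u t], of UNIV 1] by auto
  have "F \<alpha> \<beta> (5 / 3) (u t) x = nonlocal_force a b p1 p2 p3 (u t) (deriv (u t)) (\<lambda>_. 1) (q t (\<zeta> t x))"
    unfolding assms(3-7) q_zeta[OF t] by (rule F_eq_nonlocal_force[OF assms(1,2) c(1) u_bounds(1) c(2) u_bounds(2)[OF t]])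
  also have "\<dots> = nonlocal_force a b p1 p2 p3 (\<lambda>z. u t (q t z)) (\<lambda>z. deriv (u t) (q t z)) (R t) (\<zeta> t x)"
    by (rule nonlocal_force_transport[OF state_bounds(5) ab c(1) u_bounds(1) c(2) u_bounds(2)[OF t] q_deriv[OF t], symmetric])
  also have "(\<lambda>z. u t (q t z)) = U t" using zeta_q[OF t] by (auto simp: u_def)
  also have "(\<lambda>z. deriv (u t) (q t z)) = W t" using zeta_q[OF t] by (auto simp: deriv_u[OF t])
  finally have "F \<alpha> \<beta> (5 / 3) (u t) x = Fl t (\<zeta> t x)" by (simp add: Fl_def)
  thus "\<exists>ut. ((\<lambda>s. u s x) has_real_derivative ut) (at t within {0..T}) \<and> ut + u t x * deriv (u t) x + F \<alpha> \<beta> (5 / 3) (u t) x = 0"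
    using u_time[OF t, of x] by (intro exI[of _ "- (u t x * deriv (u t) x) - Fl t (\<zeta> t x)"]) simp
qed

section \<open>Expansion of the solution to first order in time\<close>

lemma time_lipschitz:
  assumes t: "t \<in> {0..T}"
  shows "\<bar>R t z - 1\<bar> \<le> 4 * t" "\<bar>W t z - deriv u0 z\<bar> \<le> (3 + C) * t"
proof -
  have "space_diff T 0 (\<lambda>t z. W t z * R t z)" by (intro space_diff_mult) (use jconts in simp_all)
  hence j: "jointly_cont T (\<lambda>t z. W t z * R t z)" by simp
  have "\<bar>time_int (\<lambda>t z. W t z * R t z) t z\<bar> \<le> 4 * t"
  proof (rule time_int_bound[OF j t])
    fix s
    have "\<bar>W s z * R s z\<bar> \<le> 2 * 2" unfolding abs_mult using state_bounds(2,3,4)[of s z] by (intro mult_mono) auto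
    thus "\<bar>W s z * R s z\<bar> \<le> 4" by simp
  qed
  thus "\<bar>R t z - 1\<bar> \<le> 4 * t" using R_eq[OF t, of z] by simp
  have "space_diff T 0 (\<lambda>t z. 2 / 3 * (W t z)\<^sup>2 - Gl t z)"
    by (intro space_diff_diff space_diff_mult space_diff_const space_diff_power2) (use jconts in simp_all)
  hence j: "jointly_cont T (\<lambda>t z. 2 / 3 * (W t z)\<^sup>2 - Gl t z)" by (simp only: space_diff.simps(1))
  have "\<bar>time_int (\<lambda>t z. 2 / 3 * (W t z)\<^sup>2 - Gl t z) t z\<bar> \<le> (3 + C) * t"
  proof (rule time_int_bound[OF j t])
    fix s
    have "\<bar>W s z * W s z\<bar> \<le> 2 * 2" unfolding abs_mult using state_bounds(2)[of s z] by (intro mult_mono) auto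
    moreover have "0 \<le> (W s z)\<^sup>2" by simp
    ultimately show "\<bar>2 / 3 * (W s z)\<^sup>2 - Gl s z\<bar> \<le> 3 + C"
      using state_bounds(7)[of s z] unfolding power2_eq_square by linarith
  qed
  moreover have "W t z - W 0 z = time_int (\<lambda>t z. 2 / 3 * (W t z)\<^sup>2 - Gl t z) t z" 
    by (rule time_int_eqI[where f=W and g="\<lambda>t z. 2 / 3 * (W t z)\<^sup>2 - Gl t z", OF t]) (rule time_derivs(2))
  ultimately show "\<bar>W t z - deriv u0 z\<bar> \<le> (3 + C) * t" by (simp add: init)
qed

definition "C1 = 5 / 3 * (16 + 3 * (3 + C)) + 4 * C"
definition "C2 = 2 * (C + 7)"

lemma CC: "0 \<le> C1" "0 \<le> C2" using C0 by (auto simp: C1_def C2_def)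

text \<open>To first order in time \<open>R\<close> is replaced by 1, \<open>W\<close> by u0' and
  \<open>Gl\<close> by its value at z = 0. The constants depend on \<open>C\<close> alone, hence are
  uniform in the frequency of the data.\<close>

lemma WR_expansion:
  assumes w1: "\<And>z. \<bar>deriv u0 z\<bar> \<le> 1"
  shows "\<bar>W T z * R T z - (deriv u0 z + 5 / 3 * T * (deriv u0 z)\<^sup>2 - time_int (\<lambda>t _. Gl t 0) T 0)\<bar> \<le> (C1 * T + 2 * C * \<bar>z\<bar>) * T"
proof -
  define w where "w = deriv u0 z"
  have jG0: "jointly_cont T (\<lambda>t _. Gl t 0)"
  proof -
    have "continuous_on ({0..T} \<times> (UNIV :: real set)) (\<lambda>p. Gl (fst p) 0)"
      by (rule jointly_cont_compose[OF jconts(5)]) (auto intro!: continuous_intros)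
    thus ?thesis by (simp add: jointly_cont_def case_prod_unfold)
  qed
  let ?k = "\<lambda>t z. R t z * (5 / 3 * (W t z)\<^sup>2 - Gl t z)"
  have "space_diff T 0 (\<lambda>t z'. ?k t z' - 5 / 3 * w\<^sup>2 + Gl t 0)"
    by (intro space_diff_add space_diff_diff space_diff_const) (use jointly_cont_WR jG0 in simp_all)
  hence j: "jointly_cont T (\<lambda>t z'. ?k t z' - 5 / 3 * w\<^sup>2 + Gl t 0)" by (simp only: space_diff.simps(1))
  have "\<bar>time_int (\<lambda>t z'. ?k t z' - 5 / 3 * w\<^sup>2 + Gl t 0) T z\<bar> \<le> (C1 * T + 2 * C * \<bar>z\<bar>) * T"
  proof (rule time_int_bound[OF j T_in])
    fix s assume s: "s \<in> {0..T}"
    have r: "\<bar>R s z - 1\<bar> \<le> 4 * s" and ww: "\<bar>W s z - w\<bar> \<le> (3 + C) * s"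
      using time_lipschitz[OF s] by (auto simp: w_def)
    \<comment> \<open>Every summand carries one factor that is small: R - 1, W - w, or the variation
      of \<open>Gl\<close> in z.\<close>
    have "?k s z - 5 / 3 * w\<^sup>2 + Gl s 0 =
      5 / 3 * ((R s z - 1) * (W s z * W s z) + (W s z - w) * (W s z + w)) - (R s z - 1) * Gl s z - (Gl s z - Gl s 0)"
      by (simp add: field_simps power2_eq_square)
    moreover have "\<bar>(R s z - 1) * (W s z * W s z)\<bar> \<le> 4 * s * (2 * 2)"
      unfolding abs_mult using r state_bounds(2)[of s z] by (intro mult_mono) auto
    moreover have "\<bar>(W s z - w) * (W s z + w)\<bar> \<le> (3 + C) * s * 3"
    proof -
      have "\<bar>W s z + w\<bar> \<le> 3" using state_bounds(2)[of s z] w1[of z] by (simp add: w_def)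
      thus ?thesis unfolding abs_mult using ww by (intro mult_mono) auto
    qed
    moreover have "\<bar>(R s z - 1) * Gl s z\<bar> \<le> 4 * s * C"
      unfolding abs_mult using r state_bounds(7)[of s z] by (intro mult_mono) auto
    moreover have "\<bar>Gl s z - Gl s 0\<bar> \<le> 2 * C * \<bar>z\<bar>"
      by (rule deriv_bound_diff[OF space_derivs(2)]) (rule state_bounds(8))
    moreover have "\<bar>5 / 3 * (p + r) - x - y\<bar> \<le> 5 / 3 * (p' + r') + x' + y'"
      if "\<bar>p\<bar> \<le> p'" "\<bar>r\<bar> \<le> r'" "\<bar>x\<bar> \<le> x'" "\<bar>y\<bar> \<le> y'" for p p' r r' x x' y y' :: real
    proof -
      have "\<bar>p + r\<bar> \<le> p' + r'" using that(1,2) by linarith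
      hence "\<bar>5 / 3 * (p + r)\<bar> \<le> 5 / 3 * (p' + r')" by (simp only: abs_mult, simp)
      thus ?thesis using that(3,4) by linarith
    qed
    ultimately have "\<bar>?k s z - 5 / 3 * w\<^sup>2 + Gl s 0\<bar> \<le> 5 / 3 * (4 * s * (2 * 2) + (3 + C) * s * 3) + 4 * s * C + 2 * C * \<bar>z\<bar>"
      by (simp only:)
    also have "\<dots> = C1 * s + 2 * C * \<bar>z\<bar>" by (simp add: C1_def algebra_simps)
    also have "\<dots> \<le> C1 * T + 2 * C * \<bar>z\<bar>" using s CC C0 by (intro add_mono mult_left_mono) auto
    finally show "\<bar>?k s z - 5 / 3 * w\<^sup>2 + Gl s 0\<bar> \<le> C1 * T + 2 * C * \<bar>z\<bar>" .
  qed
  moreover have "time_int (\<lambda>t z'. ?k t z' - 5 / 3 * w\<^sup>2 + Gl t 0) T z = time_int ?k T z - 5 / 3 * T * w\<^sup>2 + time_int (\<lambda>t _. Gl t 0) T 0"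
  proof -
    have i1: "(\<lambda>s. ?k s z) integrable_on {0..T}"
      by (intro integrable_continuous_real) (rule jointly_cont_slices(1)[OF jointly_cont_WR], simp)
    have i2: "(\<lambda>s. Gl s 0) integrable_on {0..T}"
      by (intro integrable_continuous_real) (rule jointly_cont_slices(1)[OF jconts(5)], simp)
    have i3: "(\<lambda>s. 5 / 3 * w\<^sup>2) integrable_on {0..T}" by (rule integrable_const_ivl)
    have "((\<lambda>s. ?k s z - 5 / 3 * w\<^sup>2 + Gl s 0) has_integral
        integral {0..T} (\<lambda>s. ?k s z) - integral {0..T} (\<lambda>s. 5 / 3 * w\<^sup>2) + integral {0..T} (\<lambda>s. Gl s 0)) {0..T}"
      by (intro has_integral_add has_integral_diff integrable_integral i1 i2 i3)
    thus ?thesis unfolding time_int_def using T by (simp add: integral_unique mult.commute)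
  qed
  ultimately show ?thesis unfolding WR[OF T_in] w_def by (simp add: algebra_simps)
qed

text \<open>The expansion is centred at q T 0, where the flow has carried the corner. The slope from
  \<open>Gl\<close> at 0 stays explicit because blocks annihilate it. Errors linear in h are O(T^2)
  or proportional to \<epsilon>; all other errors are quadratic in h or a multiple of
  \<epsilon>.\<close>

lemma u_expansion:
  assumes w1: "\<And>z. \<bar>deriv u0 z\<bar> \<le> 1" and m: "\<And>z. \<bar>u0 z\<bar> \<le> \<epsilon>"
    and J: "\<And>z. (J has_real_derivative J' z) (at z)" "\<And>z. \<bar>J' z - (deriv u0 z)\<^sup>2\<bar> \<le> 3 * \<epsilon>"
      "\<And>z. \<bar>J z - A\<^sup>2 / 2 * max 0 z\<bar> \<le> 2 * \<epsilon>"
    and A: "A\<^sup>2 \<le> 1"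
  shows "\<bar>u T (q T 0 + h) - (U T 0 - time_int (\<lambda>t _. Gl t 0) T 0 * h + 5 / 6 * T * A\<^sup>2 * max 0 h)\<bar>
    \<le> 8 * C * T * h\<^sup>2 + ((2 * C1 + 2 * (C + 1) * C2) * T\<^sup>2 + 12 * \<epsilon>) * \<bar>h\<bar> + (11 + 2 * C) * \<epsilon>"
proof -
  define z where "z = \<zeta> T (q T 0 + h)"
  define c where "c = time_int (\<lambda>t _. Gl t 0) T 0"
  have qz: "q T z = q T 0 + h" unfolding z_def by (rule q_zeta[OF T_in])
  have zh: "\<bar>z\<bar> \<le> 2 * \<bar>h\<bar>" using q_lower[OF T_in, of z 0] qz by simp
  have e0: "0 \<le> \<epsilon>" using m[of 0] by linarith
  have cb: "\<bar>c\<bar> \<le> C * T"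
  proof -
    have "continuous_on ({0..T} \<times> (UNIV :: real set)) (\<lambda>p. Gl (fst p) 0)"
      by (rule jointly_cont_compose[OF jconts(5)]) (auto intro!: continuous_intros)
    hence "jointly_cont T (\<lambda>t _. Gl t 0)" by (simp add: jointly_cont_def case_prod_unfold)
    thus ?thesis unfolding c_def by (rule time_int_bound[OF _ T_in]) (rule state_bounds(7))
  qed
  \<comment> \<open>\<open>J\<close> replaces the primitive of u0'^2. The oscillating u0 itself is
    never differentiated a second time; it is small in the sup norm and joins the constant
    error.\<close>
  define D where "D y = U T y - (u0 y + 5 / 3 * T * J y - c * y)" for y
  have Dd: "(D has_real_derivative W T y * R T y - (deriv u0 y + 5 / 3 * T * J' y - c)) (at y)" for y
    unfolding D_def[abs_def] by (auto intro!: derivative_eq_intros U_deriv[OF T_in] u0_deriv(1) J(1))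
  have Db: "\<bar>D z - D 0\<bar> \<le> ((C1 * T + 2 * C * \<bar>z\<bar>) * T + 5 / 3 * T * (3 * \<epsilon>)) * \<bar>z\<bar>"
  proof (rule deriv_bound_diff[OF Dd])
    fix y assume y: "\<bar>y\<bar> \<le> \<bar>z\<bar>"
    have 1: "\<bar>W T y * R T y - (deriv u0 y + 5 / 3 * T * (deriv u0 y)\<^sup>2 - c)\<bar> \<le> (C1 * T + 2 * C * \<bar>y\<bar>) * T"
      using WR_expansion[OF w1, of y] by (simp add: c_def)
    also have "\<dots> \<le> (C1 * T + 2 * C * \<bar>z\<bar>) * T" using y T C0 by (intro mult_right_mono add_left_mono mult_left_mono) auto
    finally have "\<bar>W T y * R T y - (deriv u0 y + 5 / 3 * T * (deriv u0 y)\<^sup>2 - c)\<bar> \<le> (C1 * T + 2 * C * \<bar>z\<bar>) * T" .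
    moreover have "\<bar>5 / 3 * T * (J' y - (deriv u0 y)\<^sup>2)\<bar> \<le> 5 / 3 * T * (3 * \<epsilon>)"
      unfolding abs_mult using J(2)[of y] T by (simp add: mult_left_mono)
    moreover have "W T y * R T y - (deriv u0 y + 5 / 3 * T * J' y - c) =
      (W T y * R T y - (deriv u0 y + 5 / 3 * T * (deriv u0 y)\<^sup>2 - c)) - 5 / 3 * T * (J' y - (deriv u0 y)\<^sup>2)"
      by (simp add: right_diff_distrib)
    ultimately show "\<bar>W T y * R T y - (deriv u0 y + 5 / 3 * T * J' y - c)\<bar> \<le> (C1 * T + 2 * C * \<bar>z\<bar>) * T + 5 / 3 * T * (3 * \<epsilon>)"
      by linarith
  qed
  \<comment> \<open>Passing from the label z to the position h costs O(T) relative to |z|. It is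
    multiplied by a slope or corner coefficient that is itself O(T), so the effect is
    O(T^2).\<close>
  have hz: "\<bar>h - z\<bar> \<le> (2 * \<epsilon> + C2 * \<bar>z\<bar>) * T"
  proof -
    have "space_diff T 0 (\<lambda>s y. U s y - U s 0)"
    proof (rule space_diff_diff)
      have "continuous_on ({0..T} \<times> (UNIV :: real set)) (\<lambda>p. U (fst p) 0)"
        by (rule jointly_cont_compose[OF jconts(1)]) (auto intro!: continuous_intros)
      thus "space_diff T 0 (\<lambda>s y. U s 0)" by (simp add: jointly_cont_def case_prod_unfold)
    qed (use jconts in simp)
    hence j: "jointly_cont T (\<lambda>s y. U s y - U s 0)" by simp
    have "\<bar>time_int (\<lambda>s y. U s y - U s 0) T z\<bar> \<le> (2 * \<epsilon> + C2 * \<bar>z\<bar>) * T"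
    proof (rule time_int_bound[OF j T_in])
      fix s assume s: "s \<in> {0..T}"
      have mF: "jointly_cont T (\<lambda>t z. - Fl t z)" using space_diff_minus[of T 0 Fl] jconts(4) by simp
      have ut: "U s y = u0 y + time_int (\<lambda>t z. - Fl t z) s y" for y
      proof -
        have "U s y - U 0 y = time_int (\<lambda>t z. - Fl t z) s y"
          by (rule time_int_eqI[where f=U and g="\<lambda>t z. - Fl t z", OF s]) (rule time_derivs(1))
        thus ?thesis by (simp add: init)
      qed
      have "\<bar>time_int (\<lambda>t z. - Fl t z) s z - time_int (\<lambda>t z. - Fl t z) s 0\<bar> \<le> C2 * \<bar>z\<bar>"
      proof (rule deriv_bound_diff[OF time_int_deriv_z[OF mF jointly_cont_WR _ s]])
        show "((\<lambda>z. - Fl t z) has_real_derivative R t y * (5 / 3 * (W t y)\<^sup>2 - Gl t y)) (at y)" for t y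
          by (rule DERIV_cong[OF DERIV_minus[OF space_derivs(1)]]) (simp add: algebra_simps)
        fix y
        have "\<bar>time_int (\<lambda>t z. R t z * (5 / 3 * (W t z)\<^sup>2 - Gl t z)) s y\<bar> \<le> C2 * s"
        proof (rule time_int_bound[OF jointly_cont_WR s])
          fix r
          have "\<bar>W r y * W r y\<bar> \<le> 2 * 2" unfolding abs_mult using state_bounds(2)[of r y] by (intro mult_mono) auto
          moreover have "0 \<le> W r y * W r y" by simp
          ultimately have "\<bar>5 / 3 * (W r y)\<^sup>2 - Gl r y\<bar> \<le> C + 7" using state_bounds(7)[of r y] unfolding power2_eq_square by linarith
          moreover have "\<bar>R r y\<bar> \<le> 2" using state_bounds(3,4)[of r y] by linarith
          ultimately show "\<bar>R r y * (5 / 3 * (W r y)\<^sup>2 - Gl r y)\<bar> \<le> C2"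
            unfolding abs_mult C2_def by (intro mult_mono) auto
        qed
        also have "C2 * s \<le> C2 * 1" using s T CC by (intro mult_left_mono) auto
        finally show "\<bar>time_int (\<lambda>t z. R t z * (5 / 3 * (W t z)\<^sup>2 - Gl t z)) s y\<bar> \<le> C2" by simp
      qed
      thus "\<bar>U s z - U s 0\<bar> \<le> 2 * \<epsilon> + C2 * \<bar>z\<bar>"
        unfolding ut[of z] ut[of 0] using m[of z] m[of 0] by linarith
    qed
    moreover have "h - z = time_int (\<lambda>s y. U s y - U s 0) T z"
    proof -
      have i: "(\<lambda>s. U s y) integrable_on {0..T}" for y
        by (intro integrable_continuous_real) (rule jointly_cont_slices(1)[OF jconts(1)], simp)
      have "time_int (\<lambda>s y. U s y - U s 0) T z = time_int U T z - time_int U T 0"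
        unfolding time_int_def by (rule Henstock_Kurzweil_Integration.integral_diff[OF i i])
      thus ?thesis using qz by (simp add: q_def)
    qed
    ultimately show ?thesis by simp
  qed
  have B: "0 \<le> 5 / 6 * T * A\<^sup>2" "5 / 6 * T * A\<^sup>2 \<le> T"
  proof -
    show "0 \<le> 5 / 6 * T * A\<^sup>2" using T by simp
    have "5 / 6 * T * A\<^sup>2 \<le> 5 / 6 * T * 1" using T A by (intro mult_left_mono) auto
    thus "5 / 6 * T * A\<^sup>2 \<le> T" using T by linarith
  qed
  have uz: "u T (q T 0 + h) = U T z" by (simp add: u_def z_def)
  have dec: "u T (q T 0 + h) - (U T 0 - c * h + 5 / 6 * T * A\<^sup>2 * max 0 h) =
    (D z - D 0) + (u0 z - u0 0) + 5 / 3 * T * ((J z - A\<^sup>2 / 2 * max 0 z) - (J 0 - A\<^sup>2 / 2 * max 0 0)) + c * (h - z)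
     + 5 / 6 * T * A\<^sup>2 * (max 0 z - max 0 h)"
    unfolding uz D_def by (simp add: field_simps)
  have t1: "\<bar>5 / 3 * T * ((J z - A\<^sup>2 / 2 * max 0 z) - (J 0 - A\<^sup>2 / 2 * max 0 0))\<bar> \<le> 5 / 3 * T * (4 * \<epsilon>)"
  proof -
    have "\<bar>(J z - A\<^sup>2 / 2 * max 0 z) - (J 0 - A\<^sup>2 / 2 * max 0 0)\<bar> \<le> 4 * \<epsilon>"
      using J(3)[of z] J(3)[of 0] by linarith
    thus ?thesis unfolding abs_mult using T by (simp add: mult_left_mono)
  qed
  have t2: "\<bar>c * (h - z)\<bar> \<le> C * T * \<bar>h - z\<bar>" unfolding abs_mult using cb by (intro mult_right_mono) auto
  have t3: "\<bar>5 / 6 * T * A\<^sup>2 * (max 0 z - max 0 h)\<bar> \<le> T * \<bar>h - z\<bar>"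
  proof -
    have "\<bar>max 0 z - max 0 h\<bar> \<le> \<bar>h - z\<bar>" by (auto simp: max_def)
    moreover have "\<bar>5 / 6 * T * A\<^sup>2\<bar> \<le> T" using B by linarith
    ultimately show ?thesis unfolding abs_mult[of "5 / 6 * T * A\<^sup>2"] using T by (intro mult_mono) auto
  qed
  have t4: "(C * T + T) * \<bar>h - z\<bar> \<le> (C * T + T) * ((2 * \<epsilon> + C2 * \<bar>z\<bar>) * T)"
    using hz C0 T by (intro mult_left_mono) auto
  have "\<bar>u T (q T 0 + h) - (U T 0 - c * h + 5 / 6 * T * A\<^sup>2 * max 0 h)\<bar> \<le>
     ((C1 * T + 2 * C * \<bar>z\<bar>) * T + 5 / 3 * T * (3 * \<epsilon>)) * \<bar>z\<bar> + 2 * \<epsilon> + 5 / 3 * T * (4 * \<epsilon>) + (C * T + T) * ((2 * \<epsilon> + C2 * \<bar>z\<bar>) * T)"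
  proof -
    have "\<bar>d + (x - y) + p + r + v\<bar> \<le> d' + 2 * e + p' + (k + l)"
      if "\<bar>d\<bar> \<le> d'" "\<bar>x\<bar> \<le> e" "\<bar>y\<bar> \<le> e" "\<bar>p\<bar> \<le> p'" "\<bar>r\<bar> \<le> k" "\<bar>v\<bar> \<le> l" for d d' x y e p p' r v k l :: real
      by (intro abs_leI) (use that[THEN abs_le_D1] that[THEN abs_le_D2] in linarith)+
    from this[OF Db m[of z] m[of 0] t1 t2 t3]
    have "\<bar>u T (q T 0 + h) - (U T 0 - c * h + 5 / 6 * T * A\<^sup>2 * max 0 h)\<bar> \<le>
       ((C1 * T + 2 * C * \<bar>z\<bar>) * T + 5 / 3 * T * (3 * \<epsilon>)) * \<bar>z\<bar> + 2 * \<epsilon> + 5 / 3 * T * (4 * \<epsilon>) + (C * T + T) * \<bar>h - z\<bar>"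
      unfolding dec distrib_right[of "C * T"] .
    thus ?thesis using t4 by linarith
  qed
  also have "\<dots> = C1 * T\<^sup>2 * \<bar>z\<bar> + 2 * C * T * (\<bar>z\<bar> * \<bar>z\<bar>) + 5 * (T * \<epsilon> * \<bar>z\<bar>) + 2 * \<epsilon> + 20 / 3 * (T * \<epsilon>) + 2 * (C + 1) * (T * T * \<epsilon>) + (C + 1) * C2 * T\<^sup>2 * \<bar>z\<bar>"
    by (simp add: field_simps power2_eq_square)
  \<comment> \<open>Here T <= 1 is used in the \<epsilon> terms, and |z| <= 2 |h| from the expansion
    rate of the flow.\<close>
  also have "\<dots> \<le> C1 * T\<^sup>2 * (2 * \<bar>h\<bar>) + 2 * C * T * ((2 * \<bar>h\<bar>) * (2 * \<bar>h\<bar>)) + 5 * (1 * \<epsilon> * (2 * \<bar>h\<bar>)) + 2 * \<epsilon> + 20 / 3 * (1 * \<epsilon>) + 2 * (C + 1) * (1 * 1 * \<epsilon>) + (C + 1) * C2 * T\<^sup>2 * (2 * \<bar>h\<bar>)"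
    using zh T C0 CC e0 by (intro add_mono mult_mono mult_left_mono mult_nonneg_nonneg order_refl) auto
  also have "\<dots> \<le> 8 * C * T * h\<^sup>2 + ((2 * C1 + 2 * (C + 1) * C2) * T\<^sup>2 + 12 * \<epsilon>) * \<bar>h\<bar> + (11 + 2 * C) * \<epsilon>"
  proof -
    have q: "(2 * \<bar>h\<bar>) * (2 * \<bar>h\<bar>) = 4 * h\<^sup>2" by (simp add: power2_eq_square)
    have "0 \<le> \<epsilon> * \<bar>h\<bar>" using e0 by simp
    thus ?thesis unfolding q using e0 by (simp add: algebra_simps)
  qed
  finally show ?thesis unfolding c_def .
qed

end

theorem theorem5p3:
  fixes \<alpha> \<beta> :: real and chi phi :: "real \<Rightarrow> real"
  assumes "\<alpha> * \<beta> \<noteq> 0"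
    and "dyadic_partition chi phi"
  shows "\<exists>C>0. \<exists>N0. \<forall>N::nat. N0 \<le> N \<and> 10 < N \<longrightarrow>
    (\<exists>u0. smooth u0 \<and>
      besov_norm chi phi 1 u0 \<le> ennreal (C * real N powr (- 1 / 10)) \<and>
      (\<exists>T. 0 < T \<and> T \<le> 2 * real N powr (- 1 / 2) \<and>
        (\<exists>u. solution \<alpha> \<beta> (5 / 3) u0 T u \<and>
          (\<forall>v. solution \<alpha> \<beta> (5 / 3) u0 T v \<longrightarrow> (\<forall>t\<in>{0..T}. v t = u t)) \<and>
          (\<exists>t0\<in>{0..T}. ennreal (ln (real N)) \<le> besov_norm chi phi 1 (u t0) \<and>
             besov_norm chi phi 1 (u t0) < \<infinity>))))"
proof -
  have \<alpha>: "\<alpha> \<noteq> 0" and \<beta>: "\<beta> \<noteq> 0" using assms(1) by auto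
  define a b p1 p2 p3 where "a = 1 / \<bar>\<alpha>\<bar>" and "b = 1 / \<bar>\<beta>\<bar>" and "p1 = (5 / 6 :: real)"
    and "p2 = 2 / 3 * (\<alpha>\<^sup>2 + \<beta>\<^sup>2) - 5 / 3 * \<beta>\<^sup>2" and "p3 = 5 / 3 * \<beta>\<^sup>2"
  have ab: "a > 0" "b > 0" using \<alpha> \<beta> by (auto simp: a_def b_def)
  have p3b: "p3 * b\<^sup>2 = 5 / 3" using \<beta> by (simp add: p3_def b_def power_divide)
  obtain T0 where T0: "T0 > 0" and ex:
    "\<And>T u0 w0. 0 < T \<Longrightarrow> T \<le> T0 \<Longrightarrow> continuous_on UNIV u0 \<Longrightarrow> continuous_on UNIV w0 \<Longrightarrow>
      (\<And>z. \<bar>u0 z\<bar> \<le> 1) \<Longrightarrow> (\<And>z. \<bar>w0 z\<bar> \<le> 1) \<Longrightarrow>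
      \<exists>X. continuous_on {0..T} X \<and> (\<forall>t. X t \<in> states) \<and> (\<forall>z. cU (X 0) z = u0 z \<and> cW (X 0) z = w0 z \<and> cR (X 0) z = 1) \<and>
        (\<forall>t\<in>{0..T}. \<forall>z.
          ((\<lambda>t. cU (X t) z) has_real_derivative - nonlocal_force a b p1 p2 p3 (cU (X t)) (cW (X t)) (cR (X t)) z) (at t within {0..T}) \<and>
          ((\<lambda>t. cW (X t) z) has_real_derivative 2 / 3 * (cW (X t) z)\<^sup>2 - force_slope a b p1 p2 p3 (cU (X t)) (cW (X t)) (cR (X t)) z) (at t within {0..T}) \<and>
          ((\<lambda>t. cR (X t) z) has_real_derivative cW (X t) z * cR (X t) z) (at t within {0..T}))"
    using lagrangian_existence[OF ab, of p1 p2 p3] by blast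
  have tb: "\<exists>B. \<forall>X\<in>states. \<forall>z. \<bar>\<Psi> X z\<bar> \<le> B" if "tame \<Psi>" for \<Psi>
    using that unfolding tame_def by blast
  obtain B1 B2 B3 where B123:
    "\<And>X z. X \<in> states \<Longrightarrow> \<bar>nonlocal_force a b p1 p2 p3 (cU X) (cW X) (cR X) z\<bar> \<le> B1"
    "\<And>X z. X \<in> states \<Longrightarrow> \<bar>force_slope a b p1 p2 p3 (cU X) (cW X) (cR X) z\<bar> \<le> B2"
    "\<And>X z. X \<in> states \<Longrightarrow> \<bar>force_curv a b p1 p2 p3 (cU X) (cW X) (cR X) z\<bar> \<le> B3"
    using tb[OF tame_nonlocal_force(1)[OF ab, of p1 p2 p3]] tb[OF tame_nonlocal_force(2)[OF ab, of p1 p2 p3]] tb[OF tame_nonlocal_force(3)[OF ab, of p1 p2 p3]]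
    by blast
  define C where "C = max 0 (max B1 (max B2 B3))"
  have C0: "0 \<le> C" by (simp add: C_def)
  have CB: "\<bar>nonlocal_force a b p1 p2 p3 (cU X) (cW X) (cR X) z\<bar> \<le> C" "\<bar>force_slope a b p1 p2 p3 (cU X) (cW X) (cR X) z\<bar> \<le> C"
    "\<bar>force_curv a b p1 p2 p3 (cU X) (cW X) (cR X) z\<bar> \<le> C" if "X \<in> states" for X z
    using B123(1)[OF that, of z] B123(2)[OF that, of z] B123(3)[OF that, of z] unfolding C_def by linarith+
  obtain Cb where Cb: "Cb > 0" and
    fin: "\<And>h h' m0 m2. (\<And>x. (h has_real_derivative h' x) (at x)) \<Longrightarrow> (\<And>x. \<bar>h x\<bar> \<le> m0) \<Longrightarrow>
        (\<And>x y. \<bar>h' x - h' y\<bar> \<le> m2 * \<bar>x - y\<bar>) \<Longrightarrow> besov_norm chi phi 1 h < \<infinity>" and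
    small: "\<And>h h' A n. (\<And>x. (h has_real_derivative h' x) (at x)) \<Longrightarrow> (\<And>x. \<bar>h x\<bar> \<le> A / 4 ^ n) \<Longrightarrow>
        (\<And>x y. \<bar>h' x - h' y\<bar> \<le> A * 4 ^ n * \<bar>x - y\<bar>) \<Longrightarrow> besov_norm chi phi 1 h \<le> ennreal (Cb * A)"
    using besov_upper[OF assms(2)] by blast
  note pk = partition_kernels[OF assms(2)]
  interpret ph: freq_kernel phi "8 / 3" by (rule pk(2))
  obtain xs where xs: "ph.\<kappa> xs \<noteq> 0"
    using ph.kappa_nonzero ph.block_kernel_0_pos pk(4,5) by blast
  define k where "k = \<bar>ph.\<kappa> xs\<bar>"
  have k0: "k > 0" using xs by (simp add: k_def)
  define Q where "Q = (2 + 2 * xs\<^sup>2) * ph.I0"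
  have Q0: "0 \<le> Q" using ph.I0_nonneg by (simp add: Q_def)
  \<comment> \<open>This is 2 C1 + 2 (C + 1) C2 from the expansion, written out because it must be
    available before the flow is constructed.\<close>
  define K1 where "K1 = 2 * (5 / 3 * (16 + 3 * (3 + C)) + 4 * C) + 2 * (C + 1) * (2 * (C + 7))"
  have K10: "0 \<le> K1" using C0 by (simp add: K1_def)
  have main: "\<exists>u0. smooth u0 \<and>
      besov_norm chi phi 1 u0 \<le> ennreal (2 * Cb * real N powr (- 1 / 10)) \<and>
      (\<exists>T. 0 < T \<and> T \<le> 2 * real N powr (- 1 / 2) \<and>
        (\<exists>u. solution \<alpha> \<beta> (5 / 3) u0 T u \<and>
          (\<forall>v. solution \<alpha> \<beta> (5 / 3) u0 T v \<longrightarrow> (\<forall>t\<in>{0..T}. v t = u t)) \<and>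
          (\<exists>t0\<in>{0..T}. ennreal (ln (real N)) \<le> besov_norm chi phi 1 (u t0) \<and>
             besov_norm chi phi 1 (u t0) < \<infinity>)))" if N: "10 < N" for N :: nat
  proof -
    \<comment> \<open>The factor 1 / 2 meets the condition A <= 1 / 2 of the initial data.\<close>
    define A where "A = real N powr (- 1 / 10) / 2"
    have "real N powr (- 1 / 10) \<le> real N powr 0" using N by (intro powr_mono) auto
    hence A: "0 < A" "A \<le> 1 / 2" using N by (auto simp: A_def)
    have A2: "0 < A\<^sup>2" "A\<^sup>2 \<le> 1" using A by (auto simp: power2_eq_square intro: mult_le_one)
    \<comment> \<open>The last entry makes the error Q K1 T^2 per block at most half of the gain 5/6
      T A^2 k.\<close>
    define T where "T = min (min T0 1) (min (real N powr (- 1 / 2)) (5 / 12 * A\<^sup>2 * k / (Q * K1 + 1)))"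
    have QK: "0 < Q * K1 + 1" using mult_nonneg_nonneg[OF Q0 K10] by linarith
    have T: "0 < T" "T \<le> T0" "T \<le> 1" "T \<le> real N powr (- 1 / 2)" "T \<le> 5 / 12 * A\<^sup>2 * k / (Q * K1 + 1)"
      using T0 N A2 k0 QK by (auto simp: T_def)
    have TQ: "Q * K1 * T\<^sup>2 \<le> 5 / 12 * T * A\<^sup>2 * k"
    proof -
      have "(Q * K1 + 1) * T \<le> 5 / 12 * A\<^sup>2 * k" using T(5)[unfolded pos_le_divide_eq[OF QK]] by (simp only: mult.commute)
      hence "Q * K1 * T \<le> 5 / 12 * A\<^sup>2 * k" using T(1) by (simp add: distrib_right)
      from mult_right_mono[OF this, of T] show ?thesis using T(1) by (simp add: power2_eq_square mult_ac)
    qed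
    define g where "g = 5 / 12 * T * A\<^sup>2 * k"
    have g0: "g > 0" using T A2 k0 by (simp add: g_def)
    \<comment> \<open>After the persistent errors each block retains g. The sum must also cover 16 Q
      C, the total of the quadratic errors, and 1 for all terms with \<epsilon>.\<close>
    obtain L :: nat where L: "ln (real N) + 16 * Q * C + 1 < real L * g"
      using reals_Archimedean3[OF g0] by blast
    \<comment> \<open>The constant errors grow like 2^j, so n has to be chosen after the number L of
      blocks.\<close>
    obtain n where n: "(12 * real L + 2 ^ L * (11 + 2 * C)) * Q < 2 ^ n"
      using real_arch_pow[of 2] by (metis one_less_numeral_iff semiring_norm(76))
    define \<epsilon> :: real where "\<epsilon> = 1 / 2 ^ n"
    have e0: "\<epsilon> > 0" by (simp add: \<epsilon>_def)
    have ne: "(12 * real L + 2 ^ L * (11 + 2 * C)) * Q * \<epsilon> \<le> 1" using n by (simp add: \<epsilon>_def)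
    obtain u0 w w' J J' :: "real \<Rightarrow> real" where d: "smooth u0"
      "\<And>x. (u0 has_real_derivative w x) (at x)" "\<And>x. (w has_real_derivative w' x) (at x)"
      "\<And>x. \<bar>u0 x\<bar> \<le> A / 4 ^ n" "\<And>x. \<bar>w x\<bar> \<le> 1" "\<And>x. \<bar>w' x\<bar> \<le> 4 * A * 4 ^ n"
      "\<And>x. (J has_real_derivative J' x) (at x)" "\<And>x. \<bar>J' x - (w x)\<^sup>2\<bar> \<le> 3 / 2 ^ n"
      "\<And>x. \<bar>J x - A\<^sup>2 / 2 * max 0 x\<bar> \<le> 2 / 2 ^ n"
      using initial_data[OF A, of n] by blast
    have du: "deriv u0 = w" and dw: "deriv w = w'"
      using d(2,3) by (auto intro!: DERIV_imp_deriv)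
    have u0e: "\<bar>u0 x\<bar> \<le> \<epsilon>" for x
    proof -
      have "A / 4 ^ n \<le> 1 / 2 ^ n" using A by (intro frac_le power_mono) auto
      thus ?thesis using d(4)[of x] by (simp add: \<epsilon>_def)
    qed
    have e1: "\<epsilon> \<le> 1" by (simp add: \<epsilon>_def)
    have cu: "continuous_on UNIV u0" "continuous_on UNIV w"
      using d(2,3) by (meson DERIV_isCont continuous_at_imp_continuous_on)+
    obtain X where X: "continuous_on {0..T} X" "\<And>t. X t \<in> states" "\<And>z. cU (X 0) z = u0 z" "\<And>z. cW (X 0) z = w z" "\<And>z. cR (X 0) z = 1"
      "\<And>t z. t \<in> {0..T} \<Longrightarrow> ((\<lambda>t. cU (X t) z) has_real_derivative - nonlocal_force a b p1 p2 p3 (cU (X t)) (cW (X t)) (cR (X t)) z) (at t within {0..T})"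
      "\<And>t z. t \<in> {0..T} \<Longrightarrow> ((\<lambda>t. cW (X t) z) has_real_derivative 2 / 3 * (cW (X t) z)\<^sup>2 - force_slope a b p1 p2 p3 (cU (X t)) (cW (X t)) (cR (X t)) z) (at t within {0..T})"
      "\<And>t z. t \<in> {0..T} \<Longrightarrow> ((\<lambda>t. cR (X t) z) has_real_derivative cW (X t) z * cR (X t) z) (at t within {0..T})"
      using ex[OF T(1,2) cu order_trans[OF u0e e1] d(5)] by blast
    interpret S: lagr a b p1 p2 p3 T C "4 * A * 4 ^ n" u0 X
      by unfold_locales (use ab p3b T d(1,6) X CB in \<open>simp_all add: du dw\<close>)
    have sol: "solution \<alpha> \<beta> (5 / 3) u0 T S.u"
      by (rule S.lagr_solution[OF \<alpha> \<beta>]) (simp_all add: a_def b_def p1_def p2_def p3_def)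
    have uniq: "v t = S.u t" if "solution \<alpha> \<beta> (5 / 3) u0 T v" "t \<in> {0..T}" for v t
      by (rule solution_unique[OF \<alpha> \<beta> _ sol that(1) S.u_bounds(3) that(2)]) (use T in auto)
    have b0: "besov_norm chi phi 1 u0 \<le> ennreal (2 * Cb * real N powr (- 1 / 10))"
    proof -
      \<comment> \<open>The norm estimate is applied with 4 A in place of A to absorb the factor 4
        in the bound of w'.\<close>
      have "\<bar>u0 x\<bar> \<le> 4 * A / 4 ^ n" for x
        using order_trans[OF d(4) divide_right_mono[of A "4 * A" "4 ^ n"]] A by simp
      from small[OF d(2) this deriv_bound_lipschitz[OF d(3) d(6)]]
      show ?thesis by (simp add: A_def mult_ac)
    qed
    note Tin = S.T_in
    have dT: "(S.u T has_real_derivative deriv (S.u T) x) (at x)" "(deriv (S.u T) has_real_derivative deriv (deriv (S.u T)) x) (at x)" for x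
      using smooth_deriv[OF space_diff_smooth[OF S.space_diff_u Tin], of 0 x] smooth_deriv[OF space_diff_smooth[OF S.space_diff_u Tin], of 1 x] by auto
    have finT: "besov_norm chi phi 1 (S.u T) < \<infinity>"
      by (rule fin[OF dT(1) S.u_bounds(1) deriv_bound_lipschitz[OF dT(2) S.u_bounds(3)[OF Tin]]])
    have cT: "continuous_on UNIV (S.u T)" using dT(1) by (meson DERIV_isCont continuous_at_imp_continuous_on)
    define B where "B = 5 / 6 * T * A\<^sup>2"
    define E where "E = K1 * T\<^sup>2 + 12 * \<epsilon>"
    have E0: "0 \<le> E" using K10 e0 by (simp add: E_def)
    \<comment> \<open>Block j is tested at the transported corner shifted by xs / 2^j, the same
      point xs in the variable of each block.\<close>
    have blk: "\<bar>2 ^ j * multiplier (\<lambda>\<xi>. phi (\<xi> / 2 ^ j)) (S.u T) (S.q T 0 + xs / 2 ^ j) - B * ph.\<kappa> xs\<bar>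
      \<le> (8 * C * T / 2 ^ j + E + 2 ^ j * ((11 + 2 * C) * \<epsilon>)) * Q" for j
      unfolding Q_def
    proof (rule ph.block_lower_bound[OF borel_measurable_continuous_onI[OF cT] S.u_bounds(1) pk(3)])
      fix h
      show "\<bar>S.u T (S.q T 0 + h) - (S.U T 0 - time_int (\<lambda>t _. S.Gl t 0) T 0 * h + B * max 0 h)\<bar> \<le> 8 * C * T * h\<^sup>2 + E * \<bar>h\<bar> + (11 + 2 * C) * \<epsilon>"
        unfolding B_def E_def K1_def S.C1_def[symmetric] S.C2_def[symmetric]
        by (rule S.u_expansion[OF _ u0e d(7) _ _ A2(2)]) (use d(5,8,9) in \<open>simp_all add: du \<epsilon>_def\<close>)
    qed (use C0 T E0 e0 in auto)
    have blk': "2 * g - (8 * C * (1 / 2) ^ j + E + 2 ^ j * ((11 + 2 * C) * \<epsilon>)) * Q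
      \<le> \<bar>2 ^ j * multiplier (\<lambda>\<xi>. phi (\<xi> / 2 ^ j)) (S.u T) (S.q T 0 + xs / 2 ^ j)\<bar>" for j
    proof -
      have "\<bar>B * ph.\<kappa> xs\<bar> = 2 * g" using T A2 by (simp add: abs_mult B_def g_def k_def)
      moreover have "8 * C * T / 2 ^ j \<le> 8 * C * (1 / 2) ^ j"
        using T C0 by (simp add: power_divide divide_right_mono mult_left_le)
      hence "(8 * C * T / 2 ^ j + E + 2 ^ j * ((11 + 2 * C) * \<epsilon>)) * Q \<le> (8 * C * (1 / 2) ^ j + E + 2 ^ j * ((11 + 2 * C) * \<epsilon>)) * Q"
        using Q0 by (intro mult_right_mono) auto
      ultimately show ?thesis using blk[of j] by linarith
    qed
    have geo: "(\<Sum>j<L. (1 / 2) ^ j) \<le> (2 :: real)"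
      using sum_le_suminf[of "\<lambda>i. (1 / 2 :: real) ^ i" "{..<L}"] suminf_geometric[of "1 / 2 :: real"] by (simp add: summable_geometric)
    have pow: "(\<Sum>j<L. 2 ^ j) \<le> (2 :: real) ^ L" by (induction L) auto
    have "(\<Sum>j<L. 2 * g - (8 * C * (1 / 2) ^ j + E + 2 ^ j * ((11 + 2 * C) * \<epsilon>)) * Q) =
      real L * (2 * g) - (8 * C * (\<Sum>j<L. (1 / 2) ^ j) + real L * E + (\<Sum>j<L. 2 ^ j) * ((11 + 2 * C) * \<epsilon>)) * Q"
      by (simp add: sum_subtractf sum.distrib sum_distrib_left sum_distrib_right distrib_right)
    also have "\<dots> \<ge> real L * (2 * g) - (8 * C * 2 + real L * E + 2 ^ L * ((11 + 2 * C) * \<epsilon>)) * Q"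
      using C0 e0 Q0 geo pow by (intro diff_left_mono mult_right_mono add_mono mult_left_mono order_refl) auto
    also have "real L * (2 * g) - (8 * C * 2 + real L * E + 2 ^ L * ((11 + 2 * C) * \<epsilon>)) * Q =
      real L * (2 * g) - 16 * Q * C - real L * (Q * K1 * T\<^sup>2) - (12 * real L + 2 ^ L * (11 + 2 * C)) * Q * \<epsilon>"
      by (simp add: E_def algebra_simps)
    finally have s1: "real L * (2 * g) - 16 * Q * C - real L * (Q * K1 * T\<^sup>2) - (12 * real L + 2 ^ L * (11 + 2 * C)) * Q * \<epsilon>
       \<le> (\<Sum>j<L. 2 * g - (8 * C * (1 / 2) ^ j + E + 2 ^ j * ((11 + 2 * C) * \<epsilon>)) * Q)" .
    \<comment> \<open>Half of the total gain 2 g L pays for the O(T^2) errors; the rest is covered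
      by the choice of L and n.\<close>
    have "real L * (Q * K1 * T\<^sup>2) \<le> real L * g" using TQ unfolding g_def by (intro mult_left_mono) auto
    hence "ln (real N) \<le> (\<Sum>j<L. 2 * g - (8 * C * (1 / 2) ^ j + E + 2 ^ j * ((11 + 2 * C) * \<epsilon>)) * Q)"
      using s1 L ne by linarith
    also have "\<dots> \<le> (\<Sum>j<L. \<bar>2 ^ j * multiplier (\<lambda>\<xi>. phi (\<xi> / 2 ^ j)) (S.u T) (S.q T 0 + xs / 2 ^ j)\<bar>)"
      by (intro sum_mono blk')
    finally have "ennreal (ln (real N)) \<le> ennreal (\<Sum>j<L. \<bar>2 ^ j * multiplier (\<lambda>\<xi>. phi (\<xi> / 2 ^ j)) (S.u T) (S.q T 0 + xs / 2 ^ j)\<bar>)"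
      by (rule ennreal_leI)
    also have "\<dots> \<le> besov_norm chi phi 1 (S.u T)" by (rule besov_lower)
    finally have big: "ennreal (ln (real N)) \<le> besov_norm chi phi 1 (S.u T)" .
    have "T \<le> 2 * real N powr (- 1 / 2)" using T(1,4) by linarith
    thus ?thesis using d(1) b0 T(1) sol uniq big finT Tin by blast
  qed
  show ?thesis
    \<comment> \<open>Cb times 4 A is 2 Cb N^(-1/10). The construction works for each N > 10, so the
      threshold is 0.\<close>
    by (intro exI[of _ "2 * Cb"] conjI exI[of _ 0] allI impI main) (use Cb in auto)
qed

end
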